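(* Let $\ell\le k$ be fixed positive integers. The problem $[\ell,k]$-CH in bipartite graphs is: (1) trivial if $2\leq k<2\ell-1$, in the sense that every bipartite graph is $[\ell,k]$-choosable; (2) solvable in polynomial time for $\ell=2$ and $k\geq 3$; (3) $\Pi_2^p$-complete for $\ell\geq 3$ and $k\geq 2\ell-1$; this holds in particular for $[3,5]$-CH.
   Context: All graphs are finite and simple. A graph $G=(V,E)$ is $[\ell,k]$-choosable (with $k\ge \ell$) if for every assignment of lists $L(v)\subseteq\{1,\dots,k\}$ with $|L(v)|=\ell$ for all $v\in V$, there is a proper coloring $c$ of $G$ with $c(v)\in L(v)$ for all $v\in V$. $[\ell,k]$-CH is the decision problem: given a graph $G$, decide whether $G$ is $[\ell,k]$-choosable. $\Pi_2^p$ is the usual class of the polynomial hierarchy; completeness is with respect to polynomial-time many-one reductions. *)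

theory Defs
  imports "Graph_Theory.Pair_Digraph"
begin

section \<open>Turing machines and polynomial time\<close>

text \<open>
  Deterministic multi-tape Turing machines with two-way infinite tapes. Tape symbols are the
  numbers below \<open>symbols M\<close>: \<open>0\<close> is the blank, \<open>1\<close> and \<open>2\<close> encode the bits, the others are
  auxiliary. The non-halting states are the numbers below \<open>states M\<close>; \<open>states M\<close> itself is the
  halting state, and the initial state is \<open>0\<close>.
\<close>

datatype move = Move_Left | Stay | Move_Right

record tm =
  tapes :: nat
  symbols :: nat
  states :: nat
  trans :: "nat \<Rightarrow> nat list \<Rightarrow> nat \<times> (nat \<times> move) list"

text \<open>Only finitely many values of \<open>trans\<close> are relevant: those constrained here.\<close>

definition wf_tm :: "tm \<Rightarrow> bool" where
  "wf_tm M \<longleftrightarrow> tapes M \<ge> 1 \<and> symbols M \<ge> 3 \<and>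
     (\<forall>q ss q' acts. q < states M \<longrightarrow> length ss = tapes M \<longrightarrow> set ss \<subseteq> {..<symbols M} \<longrightarrow>
        trans M q ss = (q', acts) \<longrightarrow>
        q' \<le> states M \<and> length acts = tapes M \<and> fst ` set acts \<subseteq> {..<symbols M})"

text \<open>A tape is its content together with the head position.\<close>

type_synonym tape = "(int \<Rightarrow> nat) \<times> int"
type_synonym config = "nat \<times> tape list"

fun shift :: "move \<Rightarrow> int \<Rightarrow> int" where
  "shift Move_Left p = p - 1"
| "shift Stay p = p"
| "shift Move_Right p = p + 1"

fun read :: "tape \<Rightarrow> nat" where
  "read (f, p) = f p"

fun act :: "tape \<Rightarrow> nat \<times> move \<Rightarrow> tape" where
  "act (f, p) (s, m) = (f(p := s), shift m p)"

fun step :: "tm \<Rightarrow> config \<Rightarrow> config" where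
  "step M (q, ts) =
     (if q = states M then (q, ts)
      else case trans M q (map read ts) of (q', acts) \<Rightarrow> (q', map2 act ts acts))"

definition bit_symbol :: "bool \<Rightarrow> nat" where
  "bit_symbol b = (if b then 2 else 1)"

definition input_tape :: "bool list \<Rightarrow> tape" where
  "input_tape x =
     (\<lambda>i. if 0 \<le> i \<and> i < int (length x) then bit_symbol (x ! nat i) else 0, 0)"

definition init :: "tm \<Rightarrow> bool list \<Rightarrow> config" where
  "init M x = (0, input_tape x # replicate (tapes M - 1) (\<lambda>_. 0, 0))"

text \<open>
  The output is the bit string that starts in cell \<open>0\<close> of the first tape and ends in front of the
  first blank; the other cells and tapes and the head positions do not matter.
\<close>

fun has_output :: "config \<Rightarrow> bool list \<Rightarrow> bool" where
  "has_output (q, ts) y \<longleftrightarrow>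
     (\<forall>i<length y. fst (hd ts) (int i) = bit_symbol (y ! i)) \<and> fst (hd ts) (int (length y)) = 0"

definition computes_in_time :: "tm \<Rightarrow> (bool list \<Rightarrow> bool list) \<Rightarrow> (nat \<Rightarrow> nat) \<Rightarrow> bool" where
  "computes_in_time M f T \<longleftrightarrow> wf_tm M \<and>
     (\<forall>x. \<exists>t \<le> T (length x).
        fst ((step M ^^ t) (init M x)) = states M \<and> has_output ((step M ^^ t) (init M x)) (f x))"

definition poly_time_computable :: "(bool list \<Rightarrow> bool list) \<Rightarrow> bool" where
  "poly_time_computable f \<longleftrightarrow> (\<exists>M c d. computes_in_time M f (\<lambda>n. c * n ^ d + c))"


section \<open>Complexity classes\<close>

type_synonym language = "bool list set"

definition class_P :: "language set" where
  "class_P = {A. poly_time_computable (\<lambda>x. [x \<in> A])}"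

text \<open>Self-delimiting pairing: the bits of the first component are doubled.\<close>

definition pair :: "bool list \<Rightarrow> bool list \<Rightarrow> bool list" where
  "pair x y = concat (map (\<lambda>b. [b, b]) x) @ [True, False] @ y"

definition poly_exists :: "language set \<Rightarrow> language set" where
  "poly_exists C = {A. \<exists>R\<in>C. \<exists>c d. \<forall>x.
     x \<in> A \<longleftrightarrow> (\<exists>u. length u \<le> c * length x ^ d + c \<and> pair x u \<in> R)}"

definition poly_forall :: "language set \<Rightarrow> language set" where
  "poly_forall C = {A. \<exists>R\<in>C. \<exists>c d. \<forall>x.
     x \<in> A \<longleftrightarrow> (\<forall>u. length u \<le> c * length x ^ d + c \<longrightarrow> pair x u \<in> R)}"

text \<open>\<open>\<Sigma>\<^sub>i\<^sub>+\<^sub>1\<close> and \<open>\<Pi>\<^sub>i\<^sub>+\<^sub>1\<close> of the polynomial hierarchy are \<open>poly_exists \<Pi>\<^sub>i\<close> and \<open>poly_forall \<Sigma>\<^sub>i\<close>,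
  where \<open>\<Sigma>\<^sub>0 = \<Pi>\<^sub>0 = P\<close>.\<close>

definition class_NP :: "language set" where
  "class_NP = poly_exists class_P"

definition class_Pi2 :: "language set" where
  "class_Pi2 = poly_forall class_NP"

definition poly_reducible :: "language \<Rightarrow> language \<Rightarrow> bool" where
  "poly_reducible A B \<longleftrightarrow> (\<exists>f. poly_time_computable f \<and> (\<forall>x. x \<in> A \<longleftrightarrow> f x \<in> B))"

definition complete_for :: "language set \<Rightarrow> language \<Rightarrow> bool" where
  "complete_for C B \<longleftrightarrow> B \<in> C \<and> (\<forall>A\<in>C. poly_reducible A B)"


section \<open>Choosability\<close>

text \<open>
  Finite simple graphs are the library's \<^const>\<open>pair_graph\<close>s: finite, loop-free and symmetric, so
  that an edge \<open>uv\<close> is represented by the two arcs \<open>(u, v)\<close> and \<open>(v, u)\<close>.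
\<close>

definition bipartite :: "'a pair_pre_digraph \<Rightarrow> bool" where
  "bipartite G \<longleftrightarrow> (\<exists>A B. A \<union> B = pverts G \<and> A \<inter> B = {} \<and>
     (\<forall>(u, v) \<in> parcs G. u \<in> A \<and> v \<in> B \<or> u \<in> B \<and> v \<in> A))"

definition proper_coloring :: "'a pair_pre_digraph \<Rightarrow> ('a \<Rightarrow> nat) \<Rightarrow> bool" where
  "proper_coloring G c \<longleftrightarrow> (\<forall>(u, v) \<in> parcs G. c u \<noteq> c v)"

definition choosable :: "nat \<Rightarrow> nat \<Rightarrow> 'a pair_pre_digraph \<Rightarrow> bool" where
  "choosable l k G \<longleftrightarrow>
     (\<forall>L :: 'a \<Rightarrow> nat set. (\<forall>v \<in> pverts G. L v \<subseteq> {1..k} \<and> card (L v) = l) \<longrightarrow>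
        (\<exists>c. proper_coloring G c \<and> (\<forall>v \<in> pverts G. c v \<in> L v)))"

text \<open>
  As an input, a graph on the vertices \<open>0, \<dots>, n - 1\<close> is its number \<open>n\<close> of vertices in unary
  followed by its adjacency matrix, row by row.
\<close>

definition encode_graph :: "nat pair_pre_digraph \<Rightarrow> bool list" where
  "encode_graph G = (let n = card (pverts G) in
     replicate n True @ [False] @
     map (\<lambda>(i, j). (i, j) \<in> parcs G) (List.product [0..<n] [0..<n]))"

definition bipartite_CH :: "nat \<Rightarrow> nat \<Rightarrow> language" where
  "bipartite_CH l k = {encode_graph G | G n.
     pair_graph G \<and> pverts G = {..<n} \<and> bipartite G \<and> choosable l k G}"

end

theory Submission
  imports Defs
begin

text \<open>
  For \<open>k < 2l - 1\<close>, every list meets both \<open>{1..l-1}\<close> and \<open>{l..k}\<close>, and one side of the graph is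
  colored from each of them.

  Lists of size 2: repeatedly deleting vertices of degree 1 changes nothing. A path of vertices with
  lists of size 2 rules out at most two combinations of colors of its ends; conversely every single
  combination is ruled out by suitable lists of an interior of at least two vertices. Hence two cycles
  with at most one common vertex in one component, and two vertices joined by three paths of which two
  have at least two interior vertices, are not choosable. A choosable component of the core
  is a cycle, \<open>K\<^sub>2\<^sub>,\<^sub>n\<close> (where \<open>n \<le> 3\<close> unless \<open>k = 3\<close>), or consists of two vertices joined by two paths of length 2 and one further path.

  Hardness: a computation of the verifier on an input \<open>pair (pair x u) w\<close> is described by clauses with
  at most three literals, with universal variables for \<open>u\<close>. For every literal there is a chain of
  copies of a graph with the following property: from suitable lists, choosing the bad color at its root
  forces the bad color at all its leaves, while from arbitrary lists the leaves can avoid any given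
  colors. Clause vertices see the leaves of their literals. Vertices with lists of size less than
  \<open>l\<close> are replaced by vertices with lists of size \<open>l\<close> next to copies of a graph with a vertex whose color
  can be forced; the latter exists because \<open>K\<^sub>m\<^sub>,\<^sub>m\<close> is not choosable for large \<open>m\<close>.

  All string transformations and verifiers are given by arithmetic formulas with
  quantifiers bounded by polynomials, which Turing machines evaluate in polynomial time.
\<close>

text \<open>The threshold stems from the family of all l-subsets of {1..2l-1}: colors that meet each
  of them number at least l, hence contain one of them. The obstacle in the reduction is that its
  universal quantifier ranges over all list assignments, most of which have nothing to do with the
  formula. So every building block needs two properties: for suitable lists it transmits a color,
  and for arbitrary lists enough freedom remains. From arbitrary lists a value of each universal
  variable is read off, according to which of two opposite vertices of its 4-cycle is not forced.
  The freedom rests on one count. Between two vertices with two candidate colors each, a path with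
  lists of size 2 usually excludes only one of the four pairs, so three paths leave one. The same
  count yields colorings in the case l = 2. A graph that forces one color is not obtained at once,
  because minimality only gives that the number j of colors lost at a vertex is below l. Copies of
  such a gadget lower the size of lists from l to some m >= 1, where a forcing graph is known by
  induction.\<close>

abbreviation (input) biimp :: "bool => bool => bool" (infixr "<->" 25) where
  "A <-> B \<equiv> A = B"

section \<open>Structured programs over tapes\<close>

datatype com =
    Op nat "nat => nat" move
  | Seq com com
  | If nat "nat => bool" com com
  | While nat "nat => bool" com

type_synonym tstore = "nat => tape"

inductive exec :: "com => tstore => nat => tstore => bool" where
  Op: "exec (Op r g m) sg 1 (sg(r := act (sg r) (g (read (sg r)), m)))"
| Seq: "exec c1 sg t1 sg1 ==> exec c2 sg1 t2 sg2 ==> exec (Seq c1 c2) sg (Suc (t1 + t2)) sg2"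
| IfT: "p (read (sg r)) ==> exec c1 sg t sg1 ==> exec (If r p c1 c2) sg (Suc t) sg1"
| IfF: "~ p (read (sg r)) ==> exec c2 sg t sg1 ==> exec (If r p c1 c2) sg (Suc t) sg1"
| WhileF: "~ p (read (sg r)) ==> exec (While r p c) sg 1 sg"
| WhileT: "p (read (sg r)) ==> exec c sg t1 sg1 ==> exec (While r p c) sg1 t2 sg2 ==>
    exec (While r p c) sg (Suc (t1 + t2)) sg2"

section \<open>Small steps on continuation stacks and their compilation into Turing machines\<close>

fun next_conts :: "com list => (nat => nat) => com list" where
  "next_conts [] _ = []"
| "next_conts (Op r g m # ka) _ = ka"
| "next_conts (Seq c1 c2 # ka) _ = c1 # c2 # ka"
| "next_conts (If r p c1 c2 # ka) rd = (if p (rd r) then c1 # ka else c2 # ka)"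
| "next_conts (While r p c # ka) rd = (if p (rd r) then c # While r p c # ka else ka)"

fun next_act :: "com list => (nat => nat) => nat => nat \<times> move" where
  "next_act (Op r g m # ka) rd i = (if i = r then (g (rd i), m) else (rd i, Stay))"
| "next_act _ rd i = (rd i, Stay)"

definition small_step :: "com list \<times> tstore => com list \<times> tstore" where
  "small_step = (%(ka, sg).
     (next_conts ka (%i. read (sg i)), %i. act (sg i) (next_act ka (%i. read (sg i)) i)))"

lemma act_read_Stay [simp]: "act a (read a, Stay) = a"
  by (cases a) auto

lemma funpow_step: "f x = y ==> (f ^^ t) y = z ==> (f ^^ Suc t) x = z"
  by (simp add: funpow_swap1)

lemma funpow_trans: "(f ^^ a) x = y ==> (f ^^ b) y = z ==> (f ^^ (a + b)) x = z"
  by (subst add.commute) (simp add: funpow_add)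

text \<open>Unfolding a constructor costs one small step, which the \<open>Suc\<close> in the rules
  of \<open>exec\<close> pays for; hence the two times agree exactly.\<close>

lemma exec_small_step:
  "exec c sg t sg' ==> (small_step ^^ t) (c # ka, sg) = (ka, sg')"
proof (induction arbitrary: ka rule: exec.induct)
  case (Op r g m sg)
  have "small_step (Op r g m # ka, sg) = (ka, sg(r := act (sg r) (g (read (sg r)), m)))"
    by (auto simp: small_step_def)
  from funpow_step[where f = small_step and t = 0, OF this] show ?case
    by (simp add: fun_upd_def)
next
  case (Seq c1 sg t1 sg1 c2 t2 sg2)
  show ?case
    by (rule funpow_step[OF _ funpow_trans[OF Seq.IH]]) (simp add: small_step_def)
next
  case (IfT p sg r c1 t sg1 c2)
  show ?case
    by (rule funpow_step[OF _ IfT.IH]) (use IfT.hyps in "simp add: small_step_def")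
next
  case (IfF p sg r c2 t sg1 c1)
  show ?case
    by (rule funpow_step[OF _ IfF.IH]) (use IfF.hyps in "simp add: small_step_def")
next
  case (WhileF p sg r c)
  then have "small_step (While r p c # ka, sg) = (ka, sg)"
    by (simp add: small_step_def)
  then show ?case by simp
next
  case (WhileT p sg r c t1 sg1 t2 sg2)
  show ?case
    by (rule funpow_step[OF _ funpow_trans[OF WhileT.IH]])
      (use WhileT.hyps in "simp add: small_step_def")
qed

fun wf_com :: "nat => com => bool" where
  "wf_com K (Op r g m) <-> r < K & (\<forall>s<3. g s < 3)"
| "wf_com K (Seq c1 c2) <-> wf_com K c1 & wf_com K c2"
| "wf_com K (If r p c1 c2) <-> r < K & wf_com K c1 & wf_com K c2"
| "wf_com K (While r p c) <-> r < K & wf_com K c"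

text \<open>The program points: all continuations that a run can pass through.\<close>

fun conts :: "com => com list => com list set" where
  "conts (Op r g m) ka = {Op r g m # ka}"
| "conts (Seq c1 c2) ka = insert (Seq c1 c2 # ka) (conts c1 (c2 # ka) \<union> conts c2 ka)"
| "conts (If r p c1 c2) ka = insert (If r p c1 c2 # ka) (conts c1 ka \<union> conts c2 ka)"
| "conts (While r p c) ka = insert (While r p c # ka) (conts c (While r p c # ka))"

lemma finite_conts: "finite (conts c ka)"
  by (induction c arbitrary: ka) auto

lemma conts_start: "c # ka \<in> conts c ka"
  by (cases c) auto

lemma conts_not_Nil: "[] ~: conts c ka"
  by (induction c arbitrary: ka) auto

lemma conts_closed: "ka' \<in> conts c ka ==> next_conts ka' rd \<in> insert ka (conts c ka)"
proof (induction c arbitrary: ka)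
  case (Seq c1 c2)
  then show ?case using conts_start[of c1 "c2 # ka"] conts_start[of c2 ka]
    by (auto dest: Seq.IH)
next
  case (If r p c1 c2)
  then show ?case using conts_start[of c1 ka] conts_start[of c2 ka] by auto
next
  case (While r p c)
  then show ?case using conts_start[of c "While r p c # ka"] by (auto dest: While.IH split: if_splits)
qed auto

lemma conts_wf:
  "ka' \<in> conts c ka ==> wf_com K c ==> list_all (wf_com K) ka ==> list_all (wf_com K) ka'"
proof (induction c arbitrary: ka)
  case (Seq c1 c2)
  from Seq.prems(1) consider "ka' = Seq c1 c2 # ka" | "ka' \<in> conts c1 (c2 # ka)" | "ka' \<in> conts c2 ka"
    by auto
  then show ?case
    by cases (use Seq.prems(2,3) Seq.IH(1)[of "c2 # ka"] Seq.IH(2)[of ka] in simp_all)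
next
  case (If r p c1 c2)
  from If.prems(1) consider "ka' = If r p c1 c2 # ka" | "ka' \<in> conts c1 ka" | "ka' \<in> conts c2 ka"
    by auto
  then show ?case
    by cases (use If.prems(2,3) If.IH(1)[of ka] If.IH(2)[of ka] in simp_all)
next
  case (While r p c)
  from While.prems(1) consider "ka' = While r p c # ka" | "ka' \<in> conts c (While r p c # ka)"
    by auto
  then show ?case
    by cases (use While.prems(2,3) While.IH[of "While r p c # ka"] in simp_all)
qed auto

lemma next_act_less:
  assumes "list_all (wf_com K) ka" "\<forall>i<K. rd i < 3" "i < K"
  shows "fst (next_act ka rd i) < 3"
proof (cases ka)
  case Nil
  then show ?thesis using assms by simp
next
  case (Cons c ka')
  then show ?thesis using assms by (cases c) simp_all
qed

lemma next_conts_cong: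
  assumes "list_all (wf_com K) ka" "!!i. i < K ==> rd i = rd' i"
  shows "next_conts ka rd = next_conts ka rd'"
proof (cases ka)
  case (Cons c ka')
  then show ?thesis using assms by (cases c) simp_all
qed simp

lemma next_act_cong:
  assumes "rd i = rd' i"
  shows "next_act ka rd i = next_act ka rd' i"
proof (cases ka)
  case Nil
  then show ?thesis using assms by simp
next
  case (Cons c ka')
  then show ?thesis using assms by (cases c) auto
qed

text \<open>The machine model fixes 0 as initial state and the number of states as halting state, so
  the program points must be numbered with the start at 0 and the empty continuation at
  \<open>card P\<close>.\<close>

lemma obtain_numbering:
  assumes "finite P" "a \<in> P" "b ~: P"
  obtains h :: "'a => nat" where "inj_on h (insert b P)" "h ` P = {..<card P}" "h a = 0" "h b = card P"
proof -
  obtain N h0 where h0: "bij_betw h0 (P - {a}) {0..<N}" and c: "card P = Suc N"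
    using ex_bij_betw_finite_nat[of "P - {a}"] assms by (metis card_Suc_Diff1 finite_Diff)
  define h where "h x = (if x = a then 0 else if x = b then card P else Suc (h0 x))" for x
  have lt: "h0 x < N" if "x \<in> P" "x ~= a" for x
    using h0 that by (auto simp: bij_betw_def)
  have "h ` P = insert 0 (Suc ` h0 ` (P - {a}))"
    using assms by (auto simp: h_def image_iff)
  also have "\<dots> = {..<card P}"
    using h0 by (simp add: bij_betw_def c lessThan_Suc_eq_insert_0 atLeast0LessThan)
  finally have img: "h ` P = {..<card P}" .
  have "inj_on h0 (P - {a})" using h0 by (simp add: bij_betw_def)
  then have inj: "inj_on h (insert b P)"
    using assms lt by (force simp: inj_on_def h_def c)
  show ?thesis by (rule that[OF inj img]) (use assms in "auto simp: h_def")
qed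

text \<open>Loops are not unrolled in \<open>conts\<close>, so a program has finitely many
  continuations, and these serve as states. One small step is one machine step, hence the running
  time is preserved exactly.\<close>

theorem compile_com:
  assumes wf: "wf_com K c" and K: "K \<ge> 1"
  obtains M where "wf_tm M" "tapes M = K"
    "!!sg t sg'. exec c sg t sg' ==>
       (step M ^^ t) (0, map sg [0..<K]) = (states M, map sg' [0..<K])"
proof -
  define P where "P = conts c []"
  have "finite P" "[c] \<in> P" "[] ~: P"
    unfolding P_def by (rule finite_conts, rule conts_start, rule conts_not_Nil)
  from obtain_numbering[OF this] obtain h
    where h: "inj_on h (insert [] P)" "h ` P = {..<card P}" "h [c] = 0" "h [] = card P" .
  define dec where "dec q = inv_into (insert [] P) h q" for q
  define M where "M = \<lparr>tapes = K, symbols = 3, states = card P,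
    trans = (%q ss. (h (next_conts (dec q) ((!) ss)),
               map (next_act (dec q) ((!) ss)) [0..<K]))\<rparr>"
  have dec: "dec (h ka) = ka" if "ka \<in> insert [] P" for ka
    using that h(1) unfolding dec_def by (rule inv_into_f_f[rotated])
  have closed: "next_conts ka rd \<in> insert [] P" if "ka \<in> insert [] P" for ka rd
    using that conts_closed[of ka c "[]"] unfolding P_def by auto
  have hle: "h ka \<le> card P" if "ka \<in> insert [] P" for ka
    using that h(2,4) by (metis imageI insertE lessThan_iff less_imp_le order_refl)
  have decP: "dec q \<in> P" if "q < card P" for q
  proof -
    have "q \<in> h ` P" using that h(2) by simp
    then obtain ka where "q = h ka" "ka \<in> P" by blast
    then show ?thesis using dec[of ka] by simp
  qed
  have "wf_tm M"
    unfolding wf_tm_def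
  proof (intro conjI allI impI)
    fix q ss q' acts
    assume q: "q < states M" and ss: "length ss = tapes M" "set ss \<subseteq> {..<symbols M}"
      and tr: "trans M q ss = (q', acts)"
    have "dec q \<in> P" using q decP by (simp add: M_def)
    then have wf: "list_all (wf_com K) (dec q)"
      using conts_wf[of _ c "[]"] assms by (auto simp: P_def)
    show "q' \<le> states M"
      using tr hle closed \<open>dec q \<in> P\<close> by (auto simp: M_def)
    show "length acts = tapes M" using tr by (auto simp: M_def)
    have "\<forall>i<K. ss ! i < 3" using ss by (auto simp: M_def subset_iff)
    moreover have "acts = map (next_act (dec q) ((!) ss)) [0..<K]" using tr by (auto simp: M_def)
    ultimately show "fst ` set acts \<subseteq> {..<symbols M}"
      using next_act_less[OF wf, of "(!) ss"] by (simp add: M_def image_subset_iff)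
  qed (use K in "simp_all add: M_def")
  moreover have "tapes M = K" by (simp add: M_def)
  moreover have small: "step M (h ka, map sg [0..<K]) =
      (%(ka', sg'). (h ka', map sg' [0..<K])) (small_step (ka, sg))" if "ka \<in> insert [] P" for ka sg
  proof (cases "ka = []")
    case True
    then show ?thesis by (simp add: M_def h small_step_def)
  next
    case False
    then have "ka \<in> P" using that by simp
    then have "h ka \<in> {..<card P}" using h(2) by blast
    then have ne: "h ka ~= card P" by simp
    have wf': "list_all (wf_com K) ka"
      using conts_wf[of ka c "[]"] assms \<open>ka \<in> P\<close> by (auto simp: P_def)
    let ?rd = "(!) (map (read \<circ> sg) [0..<K])"
    have rd: "?rd i = read (sg i)" if "i < K" for i using that by simp
    have nc: "next_conts ka ?rd = next_conts ka (%i. read (sg i))"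
      using wf' rd by (rule next_conts_cong)
    have na: "next_act ka ?rd i = next_act ka (%i. read (sg i)) i" if "i < K" for i
      using rd[OF that] by (rule next_act_cong)
    show ?thesis
      using ne nc na by (auto simp: M_def small_step_def dec[OF that] map2_map_map comp_def)
  qed
  have steps: "(step M ^^ t) (h ka, map sg [0..<K]) =
      (%(ka', sg'). (h ka', map sg' [0..<K])) ((small_step ^^ t) (ka, sg))
      & fst ((small_step ^^ t) (ka, sg)) \<in> insert [] P" if "ka \<in> insert [] P" for t ka sg
  proof (induction t)
    case 0
    then show ?case using that by simp
  next
    case (Suc t)
    obtain ka' sg' where e: "(small_step ^^ t) (ka, sg) = (ka', sg')"
      by (meson surj_pair)
    obtain ka'' sg'' where e': "small_step (ka', sg') = (ka'', sg'')" by (meson surj_pair)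
    have in': "ka' \<in> insert [] P" using Suc e by simp
    have "ka'' = next_conts ka' (%i. read (sg' i))" using e' by (simp add: small_step_def)
    then have in'': "ka'' \<in> insert [] P" using closed[OF in'] by blast
    have "(step M ^^ t) (h ka, map sg [0..<K]) = (h ka', map sg' [0..<K])" using Suc e by simp
    then show ?case using in'' small[OF in', of sg'] e e' by simp
  qed
  have "(step M ^^ t) (0, map sg [0..<K]) = (states M, map sg' [0..<K])" if "exec c sg t sg'" for sg t sg'
  proof -
    have "[c] \<in> insert [] P" using conts_start[of c "[]"] by (simp add: P_def)
    then show ?thesis using steps[of "[c]" t sg] exec_small_step[OF that, of "[]"] h
      by (simp add: M_def)
  qed
  ultimately show ?thesis using that by blast
qed

section \<open>Stack programs\<close>

definition pbound :: "(nat => nat) => bool" where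
  "pbound p <-> (\<exists>c d. \<forall>n. p n \<le> c * n ^ d + c)"

lemma pboundI: "(!!n. p n \<le> c * n ^ d + c) ==> pbound p"
  unfolding pbound_def by blast

lemma pbound_const: "pbound (%n. a)"
  by (rule pboundI[of _ a 0]) simp

lemma pbound_id: "pbound (%n. n)"
  by (rule pboundI[of _ 1 1]) simp

lemma pbound_le: "pbound q ==> (!!n. p n \<le> q n) ==> pbound p"
  unfolding pbound_def by (meson order_trans)

text \<open>The summand 1 is there for n = 0 and a = 0, where the left side is 1.\<close>

lemma power_le_power_add1: "(n::nat) ^ a \<le> n ^ (a + b) + 1"
proof (cases "n = 0")
  case False
  then have "n ^ a * 1 \<le> n ^ a * n ^ b" by (intro mult_le_mono2) (simp add: Suc_leI)
  then show ?thesis unfolding power_add by linarith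
qed (simp add: power_0_left)

lemma pbound_mult: assumes "pbound p" "pbound q" shows "pbound (%n. p n * q n)"
proof -
  obtain a d where p: "!!n. p n \<le> a * n ^ d + a" using assms by (auto simp: pbound_def)
  obtain b e where q: "!!n. q n \<le> b * n ^ e + b" using assms by (auto simp: pbound_def)
  have "p n * q n \<le> (3 * (a * b)) * n ^ (d + e) + 3 * (a * b)" for n
  proof -
    have "p n * q n \<le> (a * n ^ d + a) * (b * n ^ e + b)" using p q by (rule mult_le_mono)
    also have "\<dots> = a * b * (n ^ (d + e) + n ^ d + n ^ e + 1)"
      by (simp add: power_add algebra_simps)
    also have "\<dots> \<le> a * b * (n ^ (d + e) + (n ^ (d + e) + 1) + (n ^ (d + e) + 1) + 1)"
      using power_le_power_add1[of n d e] power_le_power_add1[of n e d]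
      by (intro mult_le_mono2) (simp add: add.commute)
    finally show ?thesis by (simp add: algebra_simps)
  qed
  then show ?thesis by (rule pboundI)
qed

text \<open>The sum is at most (1 + p) * (1 + q), so closure under products suffices; the added 1 is
  absorbed by a larger constant.\<close>

lemma pbound_add: assumes "pbound p" "pbound q" shows "pbound (%n. p n + q n)"
proof -
  have "pbound (%n. 1 + p n)" "pbound (%n. 1 + q n)"
  proof -
    have "pbound (%n. 1 + f n)" if f: "pbound f" for f
    proof -
      obtain a d where "!!n. f n \<le> a * n ^ d + a" using f by (auto simp: pbound_def)
      then have "1 + f n \<le> 1 + (a * n ^ d + a)" for n by simp
      also have "1 + (a * n ^ d + a) \<le> Suc a * n ^ d + Suc a" for n by simp
      finally show ?thesis by (rule pboundI)
    qed
    then show "pbound (%n. 1 + p n)" "pbound (%n. 1 + q n)" using assms by blast+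
  qed
  from pbound_mult[OF this] show ?thesis by (rule pbound_le) simp
qed

lemma pbound_power: "pbound p ==> pbound (%n. p n ^ d)"
  by (induction d) (simp_all add: pbound_const pbound_mult)

lemma pbound_comp: assumes "pbound p" "pbound q" shows "pbound (%n. p (q n))"
proof -
  obtain a d where "!!n. p n \<le> a * n ^ d + a" using assms by (auto simp: pbound_def)
  then have le: "p (q n) \<le> a * q n ^ d + a" for n by blast
  have "pbound (%n. a * q n ^ d + a)"
    by (intro pbound_add pbound_mult pbound_const pbound_power assms)
  then show ?thesis using le by (rule pbound_le)
qed

lemmas pbound_intros = pbound_const pbound_id pbound_add pbound_mult

type_synonym store = "nat => bool list"

text \<open>Nothing is required of the cells to the left of the head, because \<open>Push\<close>
  moves there before it writes.\<close>

definition stk :: "tape => bool list => bool" where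
  "stk a xs <-> (\<forall>i. fst a (snd a + int i) = (if i < length xs then bit_symbol (xs ! i) else 0))"

text \<open>Tape \<open>0\<close> carries the input and the output and is tracked literally; the other tapes are used
  as stacks whose top is under the head.\<close>

definition runs :: "com => tape => store => nat => tape => store => bool" where
  "runs c a s T a' s' <-> (\<forall>sg. sg 0 = a & (\<forall>r\<ge>1. stk (sg r) (s r)) -->
     (\<exists>t\<le>T. \<exists>sg'. exec c sg t sg' & sg' 0 = a' & (\<forall>r\<ge>1. stk (sg' r) (s' r))))"

lemma runs_weaken: "runs c a s T a' s' ==> T \<le> T' ==> runs c a s T' a' s'"
  unfolding runs_def
proof (intro allI impI)
  fix sg assume "\<forall>sg. sg 0 = a & (\<forall>r\<ge>1. stk (sg r) (s r)) -->
     (\<exists>t\<le>T. \<exists>sg'. exec c sg t sg' & sg' 0 = a' & (\<forall>r\<ge>1. stk (sg' r) (s' r)))"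
    and "T \<le> T'" "sg 0 = a & (\<forall>r\<ge>1. stk (sg r) (s r))"
  then obtain t sg' where "t \<le> T" "exec c sg t sg'" "sg' 0 = a'" "\<forall>r\<ge>1. stk (sg' r) (s' r)" by blast
  moreover have "t \<le> T'" using \<open>t \<le> T\<close> \<open>T \<le> T'\<close> by simp
  ultimately show "\<exists>t\<le>T'. \<exists>sg'. exec c sg t sg' & sg' 0 = a' & (\<forall>r\<ge>1. stk (sg' r) (s' r))" by blast
qed

lemma runs_eq: "runs c a s T a' s1 ==> s1 = s' ==> T \<le> T' ==> runs c a s T' a' s'"
  using runs_weaken by blast

lemma runs_Seq:
  assumes "runs c1 a s T1 a1 s1" "runs c2 a1 s1 T2 a2 s2"
  shows "runs (Seq c1 c2) a s (T1 + T2 + 1) a2 s2"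
  unfolding runs_def
proof (intro allI impI)
  fix sg assume "sg 0 = a & (\<forall>r\<ge>1. stk (sg r) (s r))"
  then obtain t1 sg1 where 1: "t1 \<le> T1" "exec c1 sg t1 sg1" "sg1 0 = a1" "\<forall>r\<ge>1. stk (sg1 r) (s1 r)"
    using assms(1) unfolding runs_def by blast
  then obtain t2 sg2 where 2: "t2 \<le> T2" "exec c2 sg1 t2 sg2" "sg2 0 = a2" "\<forall>r\<ge>1. stk (sg2 r) (s2 r)"
    using assms(2) unfolding runs_def by blast
  show "\<exists>t\<le>T1 + T2 + 1. \<exists>sg'. exec (Seq c1 c2) sg t sg' & sg' 0 = a2 & (\<forall>r\<ge>1. stk (sg' r) (s2 r))"
  proof (intro exI conjI)
    show "exec (Seq c1 c2) sg (Suc (t1 + t2)) sg2" using 1(2) 2(2) by (rule exec.Seq)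
  qed (use 1 2 in simp_all)
qed

lemma stk_read: "stk a xs ==> read a = (if xs = [] then 0 else bit_symbol (hd xs))"
proof -
  assume "stk a xs"
  then have "fst a (snd a + int 0) = (if 0 < length xs then bit_symbol (xs ! 0) else 0)"
    unfolding stk_def by blast
  then show ?thesis by (cases a) (simp add: hd_conv_nth)
qed

lemma runs_If0:
  assumes "p (read a) ==> runs c1 a s T a' s'" "~ p (read a) ==> runs c2 a s T a' s'"
  shows "runs (If 0 p c1 c2) a s (T + 1) a' s'"
  unfolding runs_def
proof (intro allI impI)
  fix sg assume sg: "sg 0 = a & (\<forall>r\<ge>1. stk (sg r) (s r))"
  obtain t sg' where "t \<le> T" "exec (if p (read (sg 0)) then c1 else c2) sg t sg'" "sg' 0 = a'"
      "\<forall>r\<ge>1. stk (sg' r) (s' r)"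
    using assms sg unfolding runs_def by (cases "p (read (sg 0))") auto
  then show "\<exists>t\<le>T + 1. \<exists>sg'. exec (If 0 p c1 c2) sg t sg' & sg' 0 = a' & (\<forall>r\<ge>1. stk (sg' r) (s' r))"
    by (intro exI[of _ "Suc t"] conjI exI[of _ sg'])
      (auto intro: exec.IfT exec.IfF split: if_splits)
qed

lemma runs_If:
  assumes r: "r \<ge> 1" and "p (if s r = [] then 0 else bit_symbol (hd (s r))) ==> runs c1 a s T a' s'"
    "~ p (if s r = [] then 0 else bit_symbol (hd (s r))) ==> runs c2 a s T a' s'"
  shows "runs (If r p c1 c2) a s (T + 1) a' s'"
  unfolding runs_def
proof (intro allI impI)
  fix sg assume sg: "sg 0 = a & (\<forall>r\<ge>1. stk (sg r) (s r))"
  then have rd: "read (sg r) = (if s r = [] then 0 else bit_symbol (hd (s r)))"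
    using r stk_read by blast
  obtain t sg' where "t \<le> T" "exec (if p (read (sg r)) then c1 else c2) sg t sg'" "sg' 0 = a'"
      "\<forall>r\<ge>1. stk (sg' r) (s' r)"
    using assms(2,3) sg unfolding runs_def rd[symmetric] by (cases "p (read (sg r))") auto
  then show "\<exists>t\<le>T + 1. \<exists>sg'. exec (If r p c1 c2) sg t sg' & sg' 0 = a' & (\<forall>r\<ge>1. stk (sg' r) (s' r))"
    by (intro exI[of _ "Suc t"] conjI exI[of _ sg'])
      (auto intro: exec.IfT exec.IfF split: if_splits)
qed

definition "nonblank x <-> x ~= (0::nat)"
definition "truesym x <-> x = (2::nat)"

abbreviation "IfTop r \<equiv> If r truesym"
abbreviation "IfNE r \<equiv> If r nonblank"
abbreviation "WhileNE r \<equiv> While r nonblank"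

lemma runs_IfTop:
  assumes "r \<ge> 1" "s r ~= [] ==> hd (s r) ==> runs c1 a s T a' s'"
    "s r = [] | ~ hd (s r) ==> runs c2 a s T a' s'"
  shows "runs (IfTop r c1 c2) a s (T + 1) a' s'"
  by (rule runs_If) (use assms in "auto simp: bit_symbol_def nonblank_def truesym_def split: if_splits")

lemma runs_IfNE:
  assumes "r \<ge> 1" "s r ~= [] ==> runs c1 a s T a' s'" "s r = [] ==> runs c2 a s T a' s'"
  shows "runs (IfNE r c1 c2) a s (T + 1) a' s'"
  by (rule runs_If) (use assms in "auto simp: bit_symbol_def nonblank_def truesym_def split: if_splits")

lemma runs_While0_done: "~ p (read a) ==> runs (While 0 p c) a s 1 a s"
  unfolding runs_def
proof (intro allI impI)
  fix sg assume "~ p (read a)" and sg: "sg 0 = a & (\<forall>r\<ge>1. stk (sg r) (s r))"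
  then have "exec (While 0 p c) sg 1 sg" by (intro exec.WhileF) simp
  then show "\<exists>t\<le>1. \<exists>sg'. exec (While 0 p c) sg t sg' & sg' 0 = a & (\<forall>r\<ge>1. stk (sg' r) (s r))"
    using sg by blast
qed

lemma runs_While_done: "r \<ge> 1 ==> s r = [] ==> runs (WhileNE r c) a s 1 a s"
  unfolding runs_def
proof (intro allI impI)
  fix sg assume "r \<ge> 1" "s r = []" and sg: "sg 0 = a & (\<forall>r\<ge>1. stk (sg r) (s r))"
  then have "read (sg r) = 0" using stk_read[of "sg r" "s r"] by auto
  then have "exec (WhileNE r c) sg 1 sg" by (intro exec.WhileF) (simp add: nonblank_def)
  then show "\<exists>t\<le>1. \<exists>sg'. exec (WhileNE r c) sg t sg' & sg' 0 = a & (\<forall>r\<ge>1. stk (sg' r) (s r))"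
    using sg by blast
qed

lemma runs_While_aux:
  assumes "!!sg. sg 0 = a ==> (\<forall>r\<ge>1. stk (sg r) (s r)) ==> p (read (sg r))"
    and 1: "runs c a s T1 a1 s1" and 2: "runs (While r p c) a1 s1 T2 a2 s2"
  shows "runs (While r p c) a s (T1 + T2 + 1) a2 s2"
  unfolding runs_def
proof (intro allI impI)
  fix sg assume sg: "sg 0 = a & (\<forall>r\<ge>1. stk (sg r) (s r))"
  then have p: "p (read (sg r))" using assms(1) by blast
  obtain t1 sg1 where 3: "t1 \<le> T1" "exec c sg t1 sg1" "sg1 0 = a1" "\<forall>r\<ge>1. stk (sg1 r) (s1 r)"
    using 1 sg unfolding runs_def by blast
  then obtain t2 sg2 where 4: "t2 \<le> T2" "exec (While r p c) sg1 t2 sg2" "sg2 0 = a2" "\<forall>r\<ge>1. stk (sg2 r) (s2 r)"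
    using 2 unfolding runs_def by blast
  have "exec (While r p c) sg (Suc (t1 + t2)) sg2" using p 3(2) 4(2) by (rule exec.WhileT)
  moreover have "Suc (t1 + t2) \<le> T1 + T2 + 1" using 3 4 by simp
  ultimately show "\<exists>t\<le>T1 + T2 + 1. \<exists>sg'. exec (While r p c) sg t sg' & sg' 0 = a2 & (\<forall>r\<ge>1. stk (sg' r) (s2 r))"
    using 4 by blast
qed

lemma runs_While0_step:
  assumes "p (read a)" "runs c a s T1 a1 s1" "runs (While 0 p c) a1 s1 T2 a2 s2"
  shows "runs (While 0 p c) a s (T1 + T2 + 1) a2 s2"
  by (rule runs_While_aux[OF _ assms(2,3)]) (use assms(1) in simp)

lemma runs_While_step:
  assumes "r \<ge> 1" "s r ~= []" "runs c a s T1 a1 s1" "runs (WhileNE r c) a1 s1 T2 a2 s2"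
  shows "runs (WhileNE r c) a s (T1 + T2 + 1) a2 s2"
proof (rule runs_While_aux[OF _ assms(3,4)])
  fix sg assume "\<forall>r\<ge>1. stk (sg r) (s r)"
  then have "read (sg r) = bit_symbol (hd (s r))" using assms(1,2) stk_read[of "sg r" "s r"] by simp
  then show "nonblank (read (sg r))" by (simp add: bit_symbol_def nonblank_def)
qed

lemma runs_Op0: "runs (Op 0 g m) a s 1 (act a (g (read a), m)) s"
  unfolding runs_def
proof (intro allI impI)
  fix sg assume sg: "sg 0 = a & (\<forall>r\<ge>1. stk (sg r) (s r))"
  show "\<exists>t\<le>1. \<exists>sg'. exec (Op 0 g m) sg t sg' & sg' 0 = act a (g (read a), m) & (\<forall>r\<ge>1. stk (sg' r) (s r))"
    by (intro exI[of _ 1] conjI exI[of _ "sg(0 := act (sg 0) (g (read (sg 0)), m))"] exec.Op)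
      (use sg in auto)
qed

lemma runs_Op:
  assumes "r \<ge> 1" "!!b. stk b (s r) ==> stk (act b (g (read b), m)) xs"
  shows "runs (Op r g m) a s 1 a (s(r := xs))"
  unfolding runs_def
proof (intro allI impI)
  fix sg assume "sg 0 = a & (\<forall>r\<ge>1. stk (sg r) (s r))"
  then show "\<exists>t\<le>1. \<exists>sg'. exec (Op r g m) sg t sg' & sg' 0 = a & (\<forall>ra\<ge>1. stk (sg' ra) ((s(r := xs)) ra))"
    using assms by (intro exI[of _ 1] conjI exI[of _ "sg(r := act (sg r) (g (read (sg r)), m))"] exec.Op) auto
qed

definition "Skip = Op 1 (%x. x) Stay"
definition "Pop r = Op r (%x. 0) Move_Right"
definition "Push r b = Seq (Op r (%x. x) Move_Left) (Op r (%x. bit_symbol b) Stay)"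

lemma runs_Skip: "runs Skip a s 1 a s"
  using runs_Op[of 1 s "%x. x" Stay "s 1" a] by (simp add: Skip_def)

lemma runs_Pop: "r \<ge> 1 ==> runs (Pop r) a s 1 a (s(r := tl (s r)))"
  unfolding Pop_def
proof (rule runs_Op)
  fix b assume b: "stk b (s r)"
  have "fst b (snd b + int (Suc i)) = (if i < length (tl (s r)) then bit_symbol (tl (s r) ! i) else 0)" for i
    using b[unfolded stk_def, rule_format, of "Suc i"] by (cases "s r") auto
  then show "stk (act b (0, Move_Right)) (tl (s r))"
    by (cases b) (auto simp: stk_def algebra_simps)
qed simp

lemma runs_Push: assumes "r \<ge> 1" shows "runs (Push r b) a s 3 a (s(r := b # s r))"
  unfolding Push_def runs_def
proof (intro allI impI)
  fix sg assume sg: "sg 0 = a & (\<forall>r\<ge>1. stk (sg r) (s r))"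
  obtain f p where fp: "sg r = (f, p)" by fastforce
  let ?sg1 = "sg(r := act (sg r) (read (sg r), Move_Left))"
  let ?sg2 = "?sg1(r := act (?sg1 r) (bit_symbol b, Stay))"
  have "stk (sg r) (s r)" using sg assms by blast
  then have st: "f (p + int i) = (if i < length (s r) then bit_symbol (s r ! i) else 0)" for i
    using fp by (auto simp: stk_def)
  have "stk (f(p - 1 := bit_symbol b), p - 1) (b # s r)"
    unfolding stk_def
  proof
    fix i
    show "fst (f(p - 1 := bit_symbol b), p - 1) (snd (f(p - 1 := bit_symbol b), p - 1) + int i)
      = (if i < length (b # s r) then bit_symbol ((b # s r) ! i) else 0)"
    proof (cases i)
      case (Suc j)
      have "p - 1 + int i = p + int j" using Suc by simp
      then show ?thesis using st[of j] Suc by simp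
    qed simp
  qed
  then have "stk (?sg2 r) (b # s r)" using fp by simp
  then have "\<forall>r'\<ge>1. stk (?sg2 r') ((s(r := b # s r)) r')" using sg by auto
  moreover have "exec (Seq (Op r (%x. x) Move_Left) (Op r (%x. bit_symbol b) Stay)) sg (Suc (1 + 1)) ?sg2"
    using exec.Seq[OF exec.Op[of r "%x. x" Move_Left sg] exec.Op[of r "%x. bit_symbol b" Stay]] .
  ultimately show "\<exists>t\<le>3. \<exists>sg'. exec (Seq (Op r (%x. x) Move_Left) (Op r (%x. bit_symbol b) Stay)) sg t sg'
      & sg' 0 = a & (\<forall>ra\<ge>1. stk (sg' ra) ((s(r := b # s r)) ra))"
    using sg assms by (intro exI[of _ "Suc (1 + 1)"] conjI exI[of _ ?sg2]) auto
qed

fun good :: "com => bool" where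
  "good (Op r g m) <-> (\<forall>s<3. g s < 3)"
| "good (Seq c1 c2) <-> good c1 & good c2"
| "good (If r p c1 c2) <-> good c1 & good c2"
| "good (While r p c) <-> good c"

lemma wf_com_mono: "wf_com K c ==> K \<le> K' ==> wf_com K' c"
  by (induction c) auto

lemma good_wf_com: "good c ==> \<exists>K\<ge>1. wf_com K c"
proof (induction c)
  case (Op r g m)
  then show ?case by (intro exI[of _ "Suc r"]) simp
next
  case (Seq c1 c2)
  then obtain K1 K2 where "wf_com K1 c1" "wf_com K2 c2" "K1 \<ge> 1" by auto
  then show ?case by (intro exI[of _ "K1 + K2"]) (auto intro: wf_com_mono)
next
  case (If r p c1 c2)
  then obtain K1 K2 where "wf_com K1 c1" "wf_com K2 c2" "K1 \<ge> 1" by auto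
  then show ?case by (intro exI[of _ "Suc r + K1 + K2"]) (auto intro: wf_com_mono)
next
  case (While r p c)
  then obtain K1 where "wf_com K1 c" "K1 \<ge> 1" by auto
  then show ?case by (intro exI[of _ "Suc r + K1"]) (auto intro: wf_com_mono)
qed

lemma good_prims [simp]: "good Skip" "good (Pop r)" "good (Push r b)"
  by (auto simp: Skip_def Pop_def Push_def bit_symbol_def)

section \<open>Moving, copying and counting the contents of registers\<close>

definition "mv a b = Seq (IfTop a (Push b True) (Push b False)) (Pop a)"

lemma runs_mv:
  assumes "a \<ge> 1" "b \<ge> 1" "a ~= b" "s a = x # xs"
  shows "runs (mv a b) z s 6 z (s(b := x # s b, a := xs))"
proof -
  have "runs (IfTop a (Push b True) (Push b False)) z s (3 + 1) z (s(b := x # s b))"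
    by (rule runs_IfTop) (use assms in \<open>auto intro: runs_Push[of b, THEN back_subst[of "runs _ _ _ _ _"]]\<close>)
  from runs_Seq[OF this runs_Pop[of a]] show ?thesis
    using assms by (simp add: mv_def)
qed

lemma good_mv [simp]: "good (mv a b)" by (simp add: mv_def)

definition "mvall a b = WhileNE a (mv a b)"

lemma runs_mvall:
  assumes "a \<ge> 1" "b \<ge> 1" "a ~= b"
  shows "runs (mvall a b) z s (7 * length (s a) + 1) z (s(a := [], b := rev (s a) @ s b))"
  unfolding mvall_def
proof (induction "s a" arbitrary: s)
  case Nil
  show ?case by (rule runs_eq[OF runs_While_done]) (use Nil assms in "auto simp: fun_eq_iff")
next
  case (Cons x xs)
  let ?s1 = "s(b := x # s b, a := xs)"
  have xs: "xs = ?s1 a" using assms by simp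
  show ?case
    by (rule runs_eq[OF runs_While_step[OF assms(1) _ runs_mv Cons(1)[of ?s1, OF xs]]])
      (use Cons(2)[symmetric] assms in "auto simp: fun_eq_iff")
qed

lemma good_mvall [simp]: "good (mvall a b)" by (simp add: mvall_def)

definition "mvcount a b d = WhileNE a (Seq (mv a b) (Push d True))"

lemma runs_mvcount:
  assumes "a \<ge> 1" "b \<ge> 1" "d \<ge> 1" "a ~= b" "d ~= a" "d ~= b"
  shows "runs (mvcount a b d) z s (11 * length (s a) + 1) z
    (s(a := [], b := rev (s a) @ s b, d := replicate (length (s a)) True @ s d))"
  unfolding mvcount_def
proof (induction "s a" arbitrary: s)
  case Nil
  show ?case by (rule runs_eq[OF runs_While_done]) (use Nil assms in "auto simp: fun_eq_iff")
next
  case (Cons x xs)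
  let ?s0 = "s(b := x # s b, a := xs)"
  let ?s1 = "?s0(d := True # ?s0 d)"
  have xs: "xs = ?s1 a" using assms by simp
  show ?case
    by (rule runs_eq[OF runs_While_step[OF assms(1) _ runs_Seq[OF runs_mv runs_Push] Cons(1)[of ?s1, OF xs]]])
      (use Cons(2)[symmetric] assms in "auto simp: fun_eq_iff replicate_app_Cons_same")
qed

lemma good_mvcount [simp]: "good (mvcount a b d)" by (simp add: mvcount_def)

text \<open>A stack can be traversed only by emptying it, so the contents pass to register 3 and
  return, and the copy is produced on the way back.\<close>

definition "copy r d = Seq (mvall r 3) (mvcount 3 r d)"

lemma runs_copy:
  assumes "r > 3" "d > 3" "r ~= d" "s r = replicate n True" "s 3 = []"
  shows "runs (copy r d) z s (18 * n + 3) z (s(d := replicate n True @ s d))"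
  unfolding copy_def
  by (rule runs_eq[OF runs_Seq[OF runs_mvall runs_mvcount]]) (use assms in "auto simp: fun_eq_iff")

definition "lencount d = Seq (mvcount 1 2 d) (mvall 2 1)"

lemma runs_lencount:
  assumes "d > 3" "s 2 = []"
  shows "runs (lencount d) z s (18 * length (s 1) + 3) z (s(d := replicate (length (s 1)) True @ s d))"
  unfolding lencount_def
  by (rule runs_eq[OF runs_Seq[OF runs_mvcount runs_mvall]]) (use assms in "auto simp: fun_eq_iff")

lemma good_copy [simp]: "good (copy r d)" "good (lencount d)"
  by (simp_all add: copy_def lencount_def)

section \<open>Bounded arithmetic formulas over bit strings\<close>

text \<open>Variables are de Bruijn indices; \<open>FEx t f\<close> bounds its variable strictly by \<open>t\<close>.\<close>

datatype trm = TVar nat | TConst nat | TLen | TAdd trm trm | TMul trm trm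
datatype fml = FEq trm trm | FBit trm | FNeg fml | FAnd fml fml | FEx trm fml

fun tval :: "bool list => (nat => nat) => trm => nat" where
  "tval X e (TVar i) = e i"
| "tval X e (TConst n) = n"
| "tval X e TLen = length X"
| "tval X e (TAdd a b) = tval X e a + tval X e b"
| "tval X e (TMul a b) = tval X e a * tval X e b"

fun fval :: "bool list => (nat => nat) => fml => bool" where
  "fval X e (FEq a b) <-> tval X e a = tval X e b"
| "fval X e (FBit a) <-> tval X e a < length X & X ! tval X e a"
| "fval X e (FNeg f) <-> ~ fval X e f"
| "fval X e (FAnd f g) <-> fval X e f & fval X e g"
| "fval X e (FEx t f) <-> (\<exists>j<tval X e t. fval X (case_nat j e) f)"

text \<open>Register use: \<open>1\<close> holds the string, \<open>2\<close> and \<open>3\<close> are scratch, \<open>4\<close> is left alone, truth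
  values are pushed onto \<open>5\<close>, and the registers from \<open>6\<close> on hold variables in unary; \<open>rh\<close> maps
  indices to registers and the registers from \<open>k\<close> on are free.\<close>

fun ct :: "trm => nat => (nat => nat) => nat => com" where
  "ct (TVar i) d rh k = copy (rh i) d"
| "ct (TConst n) d rh k = ((%c. Seq c (Push d True)) ^^ n) Skip"
| "ct TLen d rh k = lencount d"
| "ct (TAdd a b) d rh k = Seq (ct a d rh k) (ct b d rh k)"
| "ct (TMul a b) d rh k = Seq (ct a k rh (Suc k)) (WhileNE k (Seq (Pop k) (ct b d rh (Suc k))))"

definition "set_false = Seq (Pop 5) (Push 5 False)"

definition "fail_if r = WhileNE r (Seq (Pop r) set_false)"

text \<open>Both registers are emptied in step. A surplus of the first is collected in register 3, a
  surplus of the second stays where it is; the numbers agree iff neither is left over.\<close>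

definition "compare a b = Seq (WhileNE a (Seq (Pop a) (IfNE b (Pop b) (Push 3 True))))
   (Seq (Push 5 True) (Seq (fail_if 3) (fail_if b)))"

definition "lookup a = Seq (WhileNE a (Seq (Pop a) (IfNE 1 (mv 1 2) Skip)))
   (Seq (IfTop 1 (Push 5 True) (Push 5 False)) (mvall 2 1))"

text \<open>In the case of \<open>FEx\<close> the loop counter in register k is, after each
  \<open>Pop\<close>, the value of the bound variable itself, so the loop tries all values below the
  bound, the largest first.\<close>

fun cf :: "fml => (nat => nat) => nat => com" where
  "cf (FEq a b) rh k = Seq (ct a k rh (k + 2)) (Seq (ct b (Suc k) rh (k + 2)) (compare k (Suc k)))"
| "cf (FBit a) rh k = Seq (ct a k rh (Suc k)) (lookup k)"
| "cf (FNeg f) rh k = Seq (cf f rh k) (IfTop 5 set_false (Seq (Pop 5) (Push 5 True)))"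
| "cf (FAnd f g) rh k = Seq (cf f rh k) (Seq (cf g rh k) (IfTop 5 (Pop 5) (Seq (Pop 5) set_false)))"
| "cf (FEx t f) rh k = Seq (ct t k rh (Suc k)) (Seq (Push 5 False) (WhileNE k (Seq (Pop k)
     (Seq (cf f (case_nat k rh) (Suc k)) (IfTop 5 (Seq (Pop 5) (Seq (Pop 5) (Push 5 True))) (Pop 5))))))"

lemma good_ct [simp]: "good (ct t d rh k)"
proof (induction t arbitrary: d k)
  case (TConst n)
  show ?case by (induction n) auto
qed auto

lemma good_cf [simp]: "good (cf f rh k)"
  by (induction f arbitrary: rh k) (auto simp: compare_def lookup_def fail_if_def set_false_def)

text \<open>All of the infinitely many indices have registers below k, so \<open>rh\<close> cannot
  be injective: initially every index is mapped to the empty register 6, that is, has the value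
  0.\<close>

definition env_ok :: "store => bool list => (nat => nat) => (nat => nat) => nat => bool" where
  "env_ok s X e rh k <-> s 1 = X & s 2 = [] & s 3 = [] &
     (\<forall>i. s (rh i) = replicate (e i) True & 6 \<le> rh i & rh i < k) & (\<forall>r\<ge>k. s r = [])"

text \<open>A single number m bounds the length of the string and all variables, so that costs
  become functions of one argument.\<close>

lemma pbound_tval: "\<exists>q. pbound q & (\<forall>X e m. length X \<le> m --> (\<forall>i. e i \<le> m) --> tval X e t \<le> q m)"
proof (induction t)
  case (TAdd a b)
  then obtain p q where "pbound p" "pbound q"
    "!!X e m. length X \<le> m ==> (\<forall>i. e i \<le> m) ==> tval X e a \<le> p m"
    "!!X e m. length X \<le> m ==> (\<forall>i. e i \<le> m) ==> tval X e b \<le> q m" by blast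
  then show ?case
    by (intro exI[of _ "%m. p m + q m"]) (simp add: pbound_add add_mono)
next
  case (TMul a b)
  then obtain p q where "pbound p" "pbound q"
    "!!X e m. length X \<le> m ==> (\<forall>i. e i \<le> m) ==> tval X e a \<le> p m"
    "!!X e m. length X \<le> m ==> (\<forall>i. e i \<le> m) ==> tval X e b \<le> q m" by blast
  then show ?case
    by (intro exI[of _ "%m. p m * q m"]) (simp add: pbound_mult mult_le_mono)
qed (auto intro: pbound_const pbound_id exI[of _ "%m. m"])

definition trm_cost :: "trm => (nat => nat) => bool" where
  "trm_cost t p <-> pbound p & (\<forall>X e rh k s d m z. env_ok s X e rh k --> 4 \<le> d --> d < k -->
     d ~: range rh --> length X \<le> m --> (\<forall>i. e i \<le> m) -->
     runs (ct t d rh k) z s (p m) z (s(d := replicate (tval X e t) True @ s d)))"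

lemma trm_costD:
  "trm_cost t p ==> env_ok s X e rh k ==> 4 \<le> d ==> d < k ==> d ~: range rh ==> length X \<le> m ==>
   (!!i. e i \<le> m) ==> runs (ct t d rh k) z s (p m) z (s(d := replicate (tval X e t) True @ s d))"
  unfolding trm_cost_def by blast

lemma env_ok_fresh:
  "env_ok s X e rh k ==> d \<ge> 4 ==> d < k' ==> k \<le> k' ==> d ~: range rh ==> env_ok (s(d := xs)) X e rh k'"
  unfolding env_ok_def by (auto intro: less_le_trans)

lemma env_ok_not_range: "env_ok s X e rh k ==> k \<le> d | d < 6 ==> d ~: range rh"
  unfolding env_ok_def by (metis imageE leD)

lemma env_ok_Suc: "env_ok s X e rh k ==> k \<le> k' ==> env_ok s X e rh k'"
  unfolding env_ok_def by (meson le_trans less_le_trans)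

lemma env_ok_k: "env_ok s X e rh k ==> 6 < k"
  unfolding env_ok_def by (metis le_less_trans)

lemma replicate_append_replicate: "replicate a x @ replicate b x @ ys = replicate (a + b) x @ ys"
  by (simp add: replicate_add)

lemma trm_cost_ex: "\<exists>p. trm_cost t p"
proof (induction t)
  case (TVar i)
  have "trm_cost (TVar i) (%m. 18 * m + 3)"
    unfolding trm_cost_def
  proof (intro conjI allI impI)
    fix X e rh k s d m z
    assume *: "env_ok s X e rh k" "4 \<le> d" "d < k" "d ~: range rh" "length X \<le> m" "\<forall>i. e i \<le> m"
    then have "6 \<le> rh i" "s (rh i) = replicate (e i) True" "s 3 = []" "e i \<le> m"
      by (auto simp: env_ok_def)
    then show "runs (ct (TVar i) d rh k) z s (18 * m + 3) z (s(d := replicate (tval X e (TVar i)) True @ s d))"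
      unfolding ct.simps tval.simps by (intro runs_weaken[OF runs_copy]) (use * in auto)
  qed (intro pbound_intros)
  then show ?case by blast
next
  case (TConst n)
  have "runs (((%c. Seq c (Push d True)) ^^ n) Skip) z s (4 * n + 1) z (s(d := replicate n True @ s d))"
    if "d \<ge> 4" for d s z
  proof (induction n)
    case 0
    then show ?case using runs_Skip by simp
  next
    case (Suc n)
    show ?case unfolding funpow.simps comp_apply
      by (rule runs_eq[OF runs_Seq[OF Suc runs_Push]]) (use that in auto)
  qed
  then have "trm_cost (TConst n) (%m. 4 * n + 1)"
    unfolding trm_cost_def by (auto intro: pbound_const)
  then show ?case by blast
next
  case TLen
  have "trm_cost TLen (%m. 18 * m + 3)"
    unfolding trm_cost_def
  proof (intro conjI allI impI)
    fix X e rh k s d m z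
    assume *: "env_ok s X e rh k" "4 \<le> d" "d < k" "d ~: range rh" "length X \<le> m" "\<forall>i. e i \<le> m"
    show "runs (ct TLen d rh k) z s (18 * m + 3) z (s(d := replicate (tval X e TLen) True @ s d))"
      unfolding ct.simps tval.simps
      by (rule runs_eq[OF runs_lencount]) (use * in "auto simp: env_ok_def")
  qed (intro pbound_intros)
  then show ?case by blast
next
  case (TAdd a b)
  then obtain p q where p: "trm_cost a p" and q: "trm_cost b q" by blast
  have "trm_cost (TAdd a b) (%m. p m + q m + 1)"
    unfolding trm_cost_def
  proof (intro conjI allI impI)
    show "pbound (%m. p m + q m + 1)"
      using p q by (intro pbound_intros) (auto simp: trm_cost_def)
    fix X e rh k s d m z
    assume *: "env_ok s X e rh k" "4 \<le> d" "d < k" "d ~: range rh" "length X \<le> m" "\<forall>i. e i \<le> m"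
    show "runs (ct (TAdd a b) d rh k) z s (p m + q m + 1) z (s(d := replicate (tval X e (TAdd a b)) True @ s d))"
      unfolding ct.simps tval.simps
      by (rule runs_eq[OF runs_Seq[OF trm_costD[OF p *(1-5)] trm_costD[OF q env_ok_fresh[OF *(1)] *(2-5)]]])
        (use * in "auto simp: replicate_append_replicate add.commute")
  qed
  then show ?case by blast
next
  case (TMul a b)
  then obtain p q where p: "trm_cost a p" and q: "trm_cost b q" by blast
  obtain v where v: "pbound v" "!!X e m. length X \<le> m ==> (\<forall>i. e i \<le> m) ==> tval X e a \<le> v m"
    using pbound_tval by blast
  have "trm_cost (TMul a b) (%m. p m + (v m * (q m + 3) + 1) + 1)"
    unfolding trm_cost_def
  proof (intro conjI allI impI)
    show "pbound (%m. p m + (v m * (q m + 3) + 1) + 1)"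
      using p q v by (intro pbound_intros) (auto simp: trm_cost_def)
    fix X e rh k s d m z
    assume *: "env_ok s X e rh k" "4 \<le> d" "d < k" "d ~: range rh" "length X \<le> m" "\<forall>i. e i \<le> m"
    have k: "k ~: range rh" "4 \<le> k" "k ~= d" using env_ok_not_range[OF *(1)] * by auto
    have sk: "s k = []" using *(1) by (auto simp: env_ok_def)
    let ?b = "tval X e b"
    have loop: "runs (WhileNE k (Seq (Pop k) (ct b d rh (Suc k)))) z
        (s(k := replicate n True, d := D)) (n * (q m + 3) + 1) z (s(d := replicate (n * ?b) True @ D))" for n D
    proof (induction n arbitrary: D)
      case 0
      show ?case by (rule runs_eq[OF runs_While_done]) (use k sk in "auto simp: fun_eq_iff")
    next
      case (Suc n)
      have ok: "env_ok (s(k := replicate n True, d := D)) X e rh (Suc k)"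
        using * k by (intro env_ok_fresh[of _ _ _ _ "Suc k"] env_ok_fresh[OF *(1)]) auto
      have 1: "runs (Pop k) z (s(k := replicate (Suc n) True, d := D)) 1 z (s(k := replicate n True, d := D))"
        by (rule runs_eq[OF runs_Pop]) (use k in "auto simp: fun_eq_iff")
      have 2: "runs (ct b d rh (Suc k)) z (s(k := replicate n True, d := D)) (q m) z
          (s(k := replicate n True, d := replicate ?b True @ D))"
        by (rule runs_eq[OF trm_costD[OF q ok]]) (use * k in "auto simp: fun_eq_iff")
      show ?case
        by (rule runs_eq[OF runs_While_step[OF _ _ runs_Seq[OF 1 2] Suc]])
          (use k in "auto simp: replicate_append_replicate algebra_simps")
    qed
    have 1: "runs (ct a k rh (Suc k)) z s (p m) z (s(k := replicate (tval X e a) True))"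
      by (rule runs_eq[OF trm_costD[OF p env_ok_Suc[OF *(1)]]]) (use * k sk in "auto simp: fun_eq_iff")
    have 2: "runs (WhileNE k (Seq (Pop k) (ct b d rh (Suc k)))) z (s(k := replicate (tval X e a) True))
        (v m * (q m + 3) + 1) z (s(d := replicate (tval X e a * ?b) True @ s d))"
    proof (rule runs_weaken)
      have "s(k := replicate (tval X e a) True) = s(k := replicate (tval X e a) True, d := s d)"
        using k by (auto simp: fun_eq_iff)
      then show "runs (WhileNE k (Seq (Pop k) (ct b d rh (Suc k)))) z (s(k := replicate (tval X e a) True))
        (tval X e a * (q m + 3) + 1) z (s(d := replicate (tval X e a * ?b) True @ s d))"
        using loop[of "tval X e a" "s d"] by simp
      show "tval X e a * (q m + 3) + 1 \<le> v m * (q m + 3) + 1"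
        using v(2)[of X m e] * by simp
    qed
    show "runs (ct (TMul a b) d rh k) z s (p m + (v m * (q m + 3) + 1) + 1) z
        (s(d := replicate (tval X e (TMul a b)) True @ s d))"
      unfolding ct.simps tval.simps by (rule runs_Seq[OF 1 2])
  qed
  then show ?case by blast
qed

lemma good_aux [simp]: "good (fail_if r)" "good (compare a b)" "good (lookup a)"
  by (auto simp: compare_def lookup_def fail_if_def set_false_def)

lemma runs_set_false: "runs set_false z s 5 z (s(5 := False # tl (s 5)))"
  unfolding set_false_def by (rule runs_eq[OF runs_Seq[OF runs_Pop runs_Push]]) auto

lemma runs_fail_if:
  assumes "r \<ge> 1" "r ~= 5" "s 5 = b # R"
  shows "runs (fail_if r) z s (8 * length (s r) + 1) z (s(r := [], 5 := (b & s r = []) # R))"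
  using assms(3) unfolding fail_if_def
proof (induction "s r" arbitrary: s b)
  case Nil
  show ?case by (rule runs_eq[OF runs_While_done]) (use Nil assms in "auto simp: fun_eq_iff")
next
  case (Cons x xs)
  let ?s1 = "s(r := xs, 5 := False # R)"
  have xs: "xs = ?s1 r" "?s1 5 = False # R" using assms by simp_all
  have 1: "runs (Seq (Pop r) set_false) z s 7 z ?s1"
    by (rule runs_eq[OF runs_Seq[OF runs_Pop runs_set_false]])
      (use Cons(2)[symmetric] Cons(3) assms in "auto simp: fun_eq_iff")
  show ?case
    by (rule runs_eq[OF runs_While_step[OF assms(1) _ 1 Cons(1)[of ?s1, OF xs]]])
      (use Cons(2)[symmetric] assms in "auto simp: fun_eq_iff")
qed

lemma runs_compare:
  assumes "a > 5" "b > 5" "a ~= b" "s a = replicate x True" "s b = replicate y True" "s 3 = []"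
    "x \<le> m" "y \<le> m"
  shows "runs (compare a b) z s (30 * m + 12) z (s(a := [], b := [], 5 := (x = y) # s 5))"
proof -
  have loop: "runs (WhileNE a (Seq (Pop a) (IfNE b (Pop b) (Push 3 True)))) z
      (s(a := replicate x True, b := replicate y True, 3 := replicate w True)) (7 * x + 1) z
      (s(a := [], b := replicate (y - x) True, 3 := replicate (w + (x - y)) True))" for x y w
  proof (induction x arbitrary: y w)
    case 0
    show ?case by (rule runs_eq[OF runs_While_done]) (use assms in "auto simp: fun_eq_iff")
  next
    case (Suc x)
    let ?w = "if y = 0 then Suc w else w"
    have 1: "runs (Pop a) z (s(a := replicate (Suc x) True, b := replicate y True, 3 := replicate w True)) 1 z
      (s(a := replicate x True, b := replicate y True, 3 := replicate w True))"
      by (rule runs_eq[OF runs_Pop]) (use assms in "auto simp: fun_eq_iff")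
    have 2: "runs (IfNE b (Pop b) (Push 3 True)) z (s(a := replicate x True, b := replicate y True, 3 := replicate w True)) 4 z
      (s(a := replicate x True, b := replicate (y - 1) True, 3 := replicate ?w True))"
    proof (rule runs_weaken[OF runs_IfNE[where T = 3]])
      assume "(s(a := replicate x True, b := replicate y True, 3 := replicate w True)) b ~= []"
      then have "y > 0" using assms by auto
      then show "runs (Pop b) z (s(a := replicate x True, b := replicate y True, 3 := replicate w True)) 3 z
      (s(a := replicate x True, b := replicate (y - 1) True, 3 := replicate ?w True))"
        by (intro runs_eq[OF runs_Pop]) (use assms in "auto simp: fun_eq_iff")
    next
      assume "(s(a := replicate x True, b := replicate y True, 3 := replicate w True)) b = []"
      then have "y = 0" using assms by auto
      then show "runs (Push 3 True) z (s(a := replicate x True, b := replicate y True, 3 := replicate w True)) 3 z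
      (s(a := replicate x True, b := replicate (y - 1) True, 3 := replicate ?w True))"
        by (intro runs_eq[OF runs_Push]) (use assms in "auto simp: fun_eq_iff")
    qed (use assms in auto)
    show ?case
      by (rule runs_eq[OF runs_While_step[OF _ _ runs_Seq[OF 1 2] Suc]])
        (use assms in "auto simp: fun_eq_iff")
  qed
  have s: "s = s(a := replicate x True, b := replicate y True, 3 := replicate 0 True)"
    using assms by (auto simp: fun_eq_iff)
  let ?s1 = "s(a := [], b := replicate (y - x) True, 3 := replicate (0 + (x - y)) True)"
  have 1: "runs (WhileNE a (Seq (Pop a) (IfNE b (Pop b) (Push 3 True)))) z s (7 * x + 1) z ?s1"
    using loop[of x y 0] s by simp
  have 2: "runs (Push 5 True) z ?s1 3 z (?s1(5 := True # s 5))"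
    by (rule runs_eq[OF runs_Push]) (use assms in "auto simp: fun_eq_iff")
  let ?s2 = "s(a := [], b := replicate (y - x) True, 5 := (x \<le> y) # s 5)"
  have 3: "runs (fail_if 3) z (?s1(5 := True # s 5)) (8 * x + 1) z ?s2"
    by (rule runs_eq[OF runs_fail_if]) (use assms in "auto simp: fun_eq_iff")
  have 4: "runs (fail_if b) z ?s2 (8 * y + 1) z (s(a := [], b := [], 5 := (x = y) # s 5))"
    by (rule runs_eq[OF runs_fail_if]) (use assms in "auto simp: fun_eq_iff")
  show ?thesis unfolding compare_def
    by (rule runs_weaken[OF runs_Seq[OF 1 runs_Seq[OF 2 runs_Seq[OF 3 4]]]]) (use assms in auto)
qed

lemma runs_lookup:
  assumes "a > 5" "s a = replicate n True" "s 2 = []"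
  shows "runs (lookup a) z s (10 * n + 7 * length (s 1) + 9) z
    (s(a := [], 5 := (n < length (s 1) & s 1 ! n) # s 5))"
proof -
  let ?loop = "WhileNE a (Seq (Pop a) (IfNE 1 (mv 1 2) Skip))"
  have loop: "runs ?loop z (s(a := replicate n True, 1 := Y, 2 := Z)) (10 * n + 1) z
      (s(a := [], 1 := drop n Y, 2 := rev (take n Y) @ Z))" for n Y Z
  proof (induction n arbitrary: Y Z)
    case 0
    show ?case by (rule runs_eq[OF runs_While_done]) (use assms in "auto simp: fun_eq_iff")
  next
    case (Suc n)
    have 1: "runs (Pop a) z (s(a := replicate (Suc n) True, 1 := Y, 2 := Z)) 1 z
      (s(a := replicate n True, 1 := Y, 2 := Z))"
      by (rule runs_eq[OF runs_Pop]) (use assms in "auto simp: fun_eq_iff")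
    have 2: "runs (IfNE 1 (mv 1 2) Skip) z (s(a := replicate n True, 1 := Y, 2 := Z)) 7 z
      (s(a := replicate n True, 1 := drop 1 Y, 2 := rev (take 1 Y) @ Z))"
    proof (rule runs_weaken[OF runs_IfNE[where T = 6]])
      assume "(s(a := replicate n True, 1 := Y, 2 := Z)) 1 ~= []"
      then obtain y ys where "Y = y # ys" by (auto simp: neq_Nil_conv)
      then show "runs (mv 1 2) z (s(a := replicate n True, 1 := Y, 2 := Z)) 6 z
        (s(a := replicate n True, 1 := drop 1 Y, 2 := rev (take 1 Y) @ Z))"
        by (intro runs_eq[OF runs_mv]) (use assms in "auto simp: fun_eq_iff")
    next
      assume "(s(a := replicate n True, 1 := Y, 2 := Z)) 1 = []"
      then have "Y = []" by simp
      then show "runs Skip z (s(a := replicate n True, 1 := Y, 2 := Z)) 6 z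
        (s(a := replicate n True, 1 := drop 1 Y, 2 := rev (take 1 Y) @ Z))"
        by (intro runs_eq[OF runs_Skip]) (auto simp: fun_eq_iff)
    qed auto
    have e: "drop n (drop 1 Y) = drop (Suc n) Y"
      "rev (take n (drop 1 Y)) @ rev (take 1 Y) @ Z = rev (take (Suc n) Y) @ Z"
      by (cases Y; simp)+
    have a: "a ~= 1" "a ~= 2" using assms by auto
    show ?case
      by (rule runs_eq[OF runs_While_step[OF _ _ runs_Seq[OF 1 2] Suc]])
        (use assms a in "simp_all add: e del: drop_drop One_nat_def")
  qed
  let ?X = "s 1"
  let ?s1 = "s(a := [], 1 := drop n ?X, 2 := rev (take n ?X))"
  have 1: "runs ?loop z s (10 * n + 1) z ?s1"
    using loop[of n ?X "[]"] assms by (metis append_Nil2 fun_upd_triv)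
  let ?b = "n < length ?X & ?X ! n"
  have hd: "drop n ?X ~= [] & hd (drop n ?X) <-> ?b"
    by (auto simp: hd_drop_conv_nth)
  have 2: "runs (IfTop 1 (Push 5 True) (Push 5 False)) z ?s1 4 z (?s1(5 := ?b # s 5))"
  proof (rule runs_weaken[OF runs_IfTop[where T = 3]])
    assume "?s1 1 ~= []" "hd (?s1 1)"
    then have "?b" using hd by (auto split: if_splits)
    then show "runs (Push 5 True) z ?s1 3 z (?s1(5 := ?b # s 5))"
      by (intro runs_eq[OF runs_Push]) (use assms in "auto simp: fun_eq_iff")
  next
    assume "?s1 1 = [] | ~ hd (?s1 1)"
    then have "~ ?b" using hd assms by auto
    then show "runs (Push 5 False) z ?s1 3 z (?s1(5 := ?b # s 5))"
      by (intro runs_eq[OF runs_Push]) (use assms in "auto simp: fun_eq_iff")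
  qed auto
  have 3: "runs (mvall 2 1) z (?s1(5 := ?b # s 5)) (7 * length (s 1) + 1) z (s(a := [], 5 := ?b # s 5))"
    by (rule runs_eq[OF runs_mvall]) (use assms in "auto simp: fun_eq_iff")
  show ?thesis unfolding lookup_def
    by (rule runs_weaken[OF runs_Seq[OF 1 runs_Seq[OF 2 3]]]) simp
qed

definition fml_cost :: "fml => (nat => nat) => bool" where
  "fml_cost f p <-> pbound p & (\<forall>X e rh k s m z. env_ok s X e rh k --> length X \<le> m --> (\<forall>i. e i \<le> m) -->
     runs (cf f rh k) z s (p m) z (s(5 := fval X e f # s 5)))"

lemma fml_costD:
  "fml_cost f p ==> env_ok s X e rh k ==> length X \<le> m ==> (!!i. e i \<le> m) ==>
   runs (cf f rh k) z s (p m) z (s(5 := fval X e f # s 5))"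
  unfolding fml_cost_def by blast

lemma trm_cost_pbound: "trm_cost t p ==> pbound p" and fml_cost_pbound: "fml_cost f p ==> pbound p"
  by (auto simp: trm_cost_def fml_cost_def)

lemma runs_eval_fresh:
  assumes "trm_cost t p" "env_ok s X e rh k" "k \<le> d" "d < k'" "length X \<le> m" "!!i. e i \<le> m"
    "!!r. r \<ge> k' ==> s' r = []" "!!r. r < k ==> s' r = s r" "s' d = []"
  shows "runs (ct t d rh k') z s' (p m) z (s'(d := replicate (tval X e t) True))"
proof -
  have k: "6 < k" using env_ok_k[OF assms(2)] .
  have "env_ok s' X e rh k'"
    using assms(2,3,4,7,8) k unfolding env_ok_def by (auto intro: less_le_trans)
  from trm_costD[OF assms(1) this, of d m z] show ?thesis
    using assms k env_ok_not_range[OF assms(2), of d] by simp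
qed

text \<open>The quantifier is the critical case: its body runs at most \<open>u m\<close> times, in
  environments bounded by \<open>m + u m\<close>. The bound grows with each nested quantifier, but
  the formula is fixed, so only finitely many polynomials are composed.\<close>

lemma fml_cost_ex: "\<exists>p. fml_cost f p"
proof (induction f)
  case (FEq a b)
  obtain p q u v where p: "trm_cost a p" and q: "trm_cost b q"
    and v: "pbound u" "pbound v" "!!X e m. length X \<le> m ==> (\<forall>i. e i \<le> m) ==> tval X e a \<le> u m"
    "!!X e m. length X \<le> m ==> (\<forall>i. e i \<le> m) ==> tval X e b \<le> v m"
    using trm_cost_ex pbound_tval by metis
  have "fml_cost (FEq a b) (%m. p m + (q m + (30 * (u m + v m) + 12) + 1) + 1)"
    unfolding fml_cost_def
  proof (intro conjI allI impI)
    show "pbound (%m. p m + (q m + (30 * (u m + v m) + 12) + 1) + 1)"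
      by (intro pbound_intros trm_cost_pbound[OF p] trm_cost_pbound[OF q] v)
    fix X e rh k s m z
    assume *: "env_ok s X e rh k" "length X \<le> m" "\<forall>i. e i \<le> m"
    have k: "6 < k" using env_ok_k[OF *(1)] .
    have fr: "s r = []" if "r \<ge> k" for r using *(1) that by (auto simp: env_ok_def)
    have s3: "s 3 = []" using *(1) by (auto simp: env_ok_def)
    let ?x = "tval X e a" and ?y = "tval X e b"
    have 1: "runs (ct a k rh (k + 2)) z s (p m) z (s(k := replicate ?x True))"
      by (rule runs_eval_fresh[OF p *(1)]) (use * fr in auto)
    have 2: "runs (ct b (Suc k) rh (k + 2)) z (s(k := replicate ?x True)) (q m) z
        (s(k := replicate ?x True, Suc k := replicate ?y True))"
      by (rule runs_eval_fresh[OF q *(1)]) (use * fr in auto)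
    have 3: "runs (compare k (Suc k)) z (s(k := replicate ?x True, Suc k := replicate ?y True))
        (30 * (u m + v m) + 12) z (s(5 := fval X e (FEq a b) # s 5))"
      by (rule runs_eq[OF runs_compare[where m = "u m + v m"]])
        (use k s3 fr v(3)[OF *(2,3)] v(4)[OF *(2,3)] in "auto simp: fun_eq_iff")
    show "runs (cf (FEq a b) rh k) z s (p m + (q m + (30 * (u m + v m) + 12) + 1) + 1) z
        (s(5 := fval X e (FEq a b) # s 5))"
      unfolding cf.simps by (rule runs_Seq[OF 1 runs_Seq[OF 2 3]])
  qed
  then show ?case by blast
next
  case (FBit a)
  obtain p u where p: "trm_cost a p"
    and v: "pbound u" "!!X e m. length X \<le> m ==> (\<forall>i. e i \<le> m) ==> tval X e a \<le> u m"
    using trm_cost_ex pbound_tval by metis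
  have "fml_cost (FBit a) (%m. p m + (10 * u m + 7 * m + 9) + 1)"
    unfolding fml_cost_def
  proof (intro conjI allI impI)
    show "pbound (%m. p m + (10 * u m + 7 * m + 9) + 1)"
      by (intro pbound_intros trm_cost_pbound[OF p] v)
    fix X e rh k s m z
    assume *: "env_ok s X e rh k" "length X \<le> m" "\<forall>i. e i \<le> m"
    have k: "6 < k" using env_ok_k[OF *(1)] .
    have fr: "s r = []" if "r \<ge> k" for r using *(1) that by (auto simp: env_ok_def)
    have s2: "s 2 = []" "s 1 = X" using *(1) by (auto simp: env_ok_def)
    let ?x = "tval X e a"
    have 1: "runs (ct a k rh (Suc k)) z s (p m) z (s(k := replicate ?x True))"
      by (rule runs_eval_fresh[OF p *(1)]) (use * fr in auto)
    have 2: "runs (lookup k) z (s(k := replicate ?x True)) (10 * u m + 7 * m + 9) z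
        (s(5 := fval X e (FBit a) # s 5))"
      by (rule runs_eq[OF runs_lookup])
        (use k s2 fr v(2)[OF *(2,3)] *(2) in "auto simp: fun_eq_iff")
    show "runs (cf (FBit a) rh k) z s (p m + (10 * u m + 7 * m + 9) + 1) z (s(5 := fval X e (FBit a) # s 5))"
      unfolding cf.simps by (rule runs_Seq[OF 1 2])
  qed
  then show ?case by blast
next
  case (FNeg f)
  then obtain p where p: "fml_cost f p" by blast
  have "fml_cost (FNeg f) (%m. p m + 6 + 1)"
    unfolding fml_cost_def
  proof (intro conjI allI impI)
    show "pbound (%m. p m + 6 + 1)" by (intro pbound_intros fml_cost_pbound[OF p])
    fix X e rh k s m z
    assume *: "env_ok s X e rh k" "length X \<le> m" "\<forall>i. e i \<le> m"
    let ?s1 = "s(5 := fval X e f # s 5)"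
    have 1: "runs (cf f rh k) z s (p m) z ?s1" using fml_costD[OF p] * by blast
    have 2: "runs (IfTop 5 set_false (Seq (Pop 5) (Push 5 True))) z ?s1 6 z (s(5 := (~ fval X e f) # s 5))"
      by (rule runs_weaken[OF runs_IfTop[where T = 5]])
        (auto intro!: runs_eq[OF runs_set_false] runs_eq[OF runs_Seq[OF runs_Pop runs_Push]])
    show "runs (cf (FNeg f) rh k) z s (p m + 6 + 1) z (s(5 := fval X e (FNeg f) # s 5))"
      unfolding cf.simps fval.simps by (rule runs_Seq[OF 1 2])
  qed
  then show ?case by blast
next
  case (FAnd f g)
  then obtain p q where p: "fml_cost f p" and q: "fml_cost g q" by blast
  have "fml_cost (FAnd f g) (%m. p m + (q m + 8 + 1) + 1)"
    unfolding fml_cost_def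
  proof (intro conjI allI impI)
    show "pbound (%m. p m + (q m + 8 + 1) + 1)"
      by (intro pbound_intros fml_cost_pbound[OF p] fml_cost_pbound[OF q])
    fix X e rh k s m z
    assume *: "env_ok s X e rh k" "length X \<le> m" "\<forall>i. e i \<le> m"
    let ?s1 = "s(5 := fval X e f # s 5)"
    let ?s2 = "s(5 := fval X e g # fval X e f # s 5)"
    have 1: "runs (cf f rh k) z s (p m) z ?s1" using fml_costD[OF p] * by blast
    have ok: "env_ok ?s1 X e rh k"
      using * env_ok_not_range[OF *(1), of 5] env_ok_k[OF *(1)] by (intro env_ok_fresh) auto
    have 2: "runs (cf g rh k) z ?s1 (q m) z ?s2" using fml_costD[OF q ok] * by simp
    have 3: "runs (IfTop 5 (Pop 5) (Seq (Pop 5) set_false)) z ?s2 8 z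
        (s(5 := (fval X e f & fval X e g) # s 5))"
      by (rule runs_weaken[OF runs_IfTop[where T = 7]])
        (auto intro!: runs_eq[OF runs_Pop] runs_eq[OF runs_Seq[OF runs_Pop runs_set_false]])
    show "runs (cf (FAnd f g) rh k) z s (p m + (q m + 8 + 1) + 1) z (s(5 := fval X e (FAnd f g) # s 5))"
      unfolding cf.simps fval.simps by (rule runs_Seq[OF 1 runs_Seq[OF 2 3]])
  qed
  then show ?case by blast
next
  case (FEx t f)
  then obtain q where q: "fml_cost f q" by blast
  obtain p u where p: "trm_cost t p"
    and v: "pbound u" "!!X e m. length X \<le> m ==> (\<forall>i. e i \<le> m) ==> tval X e t \<le> u m"
    using trm_cost_ex pbound_tval by metis
  have "fml_cost (FEx t f) (%m. p m + (3 + (u m * (q (m + u m) + 12) + 1) + 1) + 1)"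
    unfolding fml_cost_def
  proof (intro conjI allI impI)
    show "pbound (%m. p m + (3 + (u m * (q (m + u m) + 12) + 1) + 1) + 1)"
      by (intro pbound_intros trm_cost_pbound[OF p] v pbound_comp[OF fml_cost_pbound[OF q]])
    fix X e rh k s m z
    assume *: "env_ok s X e rh k" "length X \<le> m" "\<forall>i. e i \<le> m"
    have k: "6 < k" using env_ok_k[OF *(1)] .
    have fr: "s r = []" if "r \<ge> k" for r using *(1) that by (auto simp: env_ok_def)
    let ?x = "tval X e t"
    let ?sel = "IfTop 5 (Seq (Pop 5) (Seq (Pop 5) (Push 5 True))) (Pop 5)"
    let ?body = "Seq (Pop k) (Seq (cf f (case_nat k rh) (Suc k)) ?sel)"
    have 1: "runs (ct t k rh (Suc k)) z s (p m) z (s(k := replicate ?x True))"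
      by (rule runs_eval_fresh[OF p *(1)]) (use * fr in auto)
    have 2: "runs (Push 5 False) z (s(k := replicate ?x True)) 3 z (s(k := replicate ?x True, 5 := False # s 5))"
      by (rule runs_eq[OF runs_Push]) (use k in "auto simp: fun_eq_iff")
    have xu: "?x \<le> u m" using v(2)[OF *(2,3)] .
    have 3: "runs (WhileNE k ?body) z (s(k := replicate n True, 5 := b # s 5)) (n * (q (m + u m) + 12) + 1) z
        (s(5 := (b | (\<exists>j<n. fval X (case_nat j e) f)) # s 5))" if "n \<le> u m" for n b
      using that
    proof (induction n arbitrary: b)
      case 0
      show ?case by (rule runs_eq[OF runs_While_done]) (use k fr in "auto simp: fun_eq_iff")
    next
      case (Suc n)
      let ?c = "fval X (case_nat n e) f"
      have 1: "runs (Pop k) z (s(k := replicate (Suc n) True, 5 := b # s 5)) 1 z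
          (s(k := replicate n True, 5 := b # s 5))"
        by (rule runs_eq[OF runs_Pop]) (use k in "auto simp: fun_eq_iff")
      have ok: "env_ok (s(k := replicate n True, 5 := b # s 5)) X (case_nat n e) (case_nat k rh) (Suc k)"
        using *(1) k env_ok_not_range[OF *(1), of 5] unfolding env_ok_def
        by (auto split: nat.split simp: less_Suc_eq)
      have 2: "runs (cf f (case_nat k rh) (Suc k)) z (s(k := replicate n True, 5 := b # s 5)) (q (m + u m)) z
          (s(k := replicate n True, 5 := ?c # b # s 5))"
        by (rule runs_eq[OF fml_costD[OF q ok, of "m + u m"]])
          (use * Suc.prems k in "auto split: nat.split simp: trans_le_add1")
      have 3: "runs ?sel z (s(k := replicate n True, 5 := ?c # b # s 5)) 8 z
          (s(k := replicate n True, 5 := (b | ?c) # s 5))"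
        by (rule runs_weaken[OF runs_IfTop[where T = 7]])
          (auto intro!: runs_eq[OF runs_Pop] runs_eq[OF runs_Seq[OF runs_Pop runs_Seq[OF runs_Pop runs_Push]]])
      show ?case
        by (rule runs_eq[OF runs_While_step[OF _ _ runs_Seq[OF 1 runs_Seq[OF 2 3]] Suc.IH]])
          (use k Suc.prems in "auto simp: less_Suc_eq fun_eq_iff")
    qed
    show "runs (cf (FEx t f) rh k) z s (p m + (3 + (u m * (q (m + u m) + 12) + 1) + 1) + 1) z
       (s(5 := fval X e (FEx t f) # s 5))"
      unfolding cf.simps
      by (rule runs_eq[OF runs_Seq[OF 1 runs_Seq[OF 2 3[OF xu]]]]) (use xu in auto)
  qed
  then show ?case by blast
qed

section \<open>Polynomial-time string transformations\<close>

definition fmap :: "trm => fml => bool list => bool list" where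
  "fmap t f X = map (%j. fval X (case_nat j (%_. 0)) f) [0..<tval X (%_. 0) t]"

text \<open>Register 7 counts down, so the last bit is pushed first and bit 0 ends on top; the
  reversals of the two final moves cancel. Register 4 stays free for the loop counter of
  \<open>ptrans_iter\<close>.\<close>

definition fmap_com :: "trm => fml => com" where
  "fmap_com t f = Seq (ct t 7 (%_. 6) 8) (Seq (WhileNE 7 (Seq (Pop 7) (cf f (case_nat 7 (%_. 6)) 8)))
     (Seq (WhileNE 1 (Pop 1)) (Seq (mvall 5 2) (mvall 2 1))))"

lemma runs_clear: "r \<ge> 1 ==> runs (WhileNE r (Pop r)) z s (2 * length (s r) + 1) z (s(r := []))"
proof (induction "s r" arbitrary: s)
  case Nil
  show ?case by (rule runs_eq[OF runs_While_done]) (use Nil in "auto simp: fun_eq_iff")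
next
  case (Cons x xs)
  have xs: "xs = (s(r := tl (s r))) r" using Cons(2)[symmetric] by simp
  show ?case
    by (rule runs_eq[OF runs_While_step[OF _ _ runs_Pop Cons(1)[of "s(r := tl (s r))", OF xs]]])
      (use Cons(2)[symmetric] Cons(3) in auto)
qed

lemma runs_fmap_com:
  "\<exists>p. pbound p & (\<forall>X. length (fmap t f X) \<le> p (length X)) &
    (\<forall>X s z. s 1 = X --> (\<forall>r\<ge>2. r ~= 4 --> s r = []) -->
       runs (fmap_com t f) z s (p (length X)) z (s(1 := fmap t f X)))"
proof -
  obtain q p u where q: "fml_cost f q" and p: "trm_cost t p"
    and v: "pbound u" "!!X e m. length X \<le> m ==> (\<forall>i. e i \<le> m) ==> tval X e t \<le> u m"
    using fml_cost_ex trm_cost_ex pbound_tval by metis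
  let ?p = "%m. p m + ((u m * (q (m + u m) + 3) + 1) + ((2 * m + 1) + ((7 * u m + 1) + (7 * u m + 1) + 1) + 1) + 1) + 1"
  have "pbound ?p"
    by (intro pbound_intros trm_cost_pbound[OF p] v pbound_comp[OF fml_cost_pbound[OF q]])
  moreover have "runs (fmap_com t f) z s (?p (length X)) z (s(1 := fmap t f X))"
    if s1: "s 1 = X" and s: "\<forall>r\<ge>2. r ~= 4 --> s r = []" for X s z
  proof -
    let ?m = "length X"
    let ?x = "tval X (%_. 0) t"
    let ?g = "%j. fval X (case_nat j (%_. 0)) f"
    have xu: "?x \<le> u ?m" using v(2) by simp
    have ok: "env_ok s X (%_. 0) (%_. 6) 7" using s1 s by (simp add: env_ok_def)
    have 1: "runs (ct t 7 (%_. 6) 8) z s (p ?m) z (s(7 := replicate ?x True))"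
      by (rule runs_eval_fresh[OF p ok]) (use s in auto)
    have 2: "runs (WhileNE 7 (Seq (Pop 7) (cf f (case_nat 7 (%_. 6)) 8))) z (s(7 := replicate n True, 5 := R))
        (n * (q (?m + u ?m) + 3) + 1) z (s(5 := map ?g [0..<n] @ R))" if "n \<le> u ?m" for n R
      using that
    proof (induction n arbitrary: R)
      case 0
      show ?case by (rule runs_eq[OF runs_While_done]) (use s in "auto simp: fun_eq_iff")
    next
      case (Suc n)
      have 1: "runs (Pop 7) z (s(7 := replicate (Suc n) True, 5 := R)) 1 z (s(7 := replicate n True, 5 := R))"
        by (rule runs_eq[OF runs_Pop]) (auto simp: fun_eq_iff)
      have ok: "env_ok (s(7 := replicate n True, 5 := R)) X (case_nat n (%_. 0)) (case_nat 7 (%_. 6)) 8"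
        using s1 s unfolding env_ok_def by (auto split: nat.split)
      have 2: "runs (cf f (case_nat 7 (%_. 6)) 8) z (s(7 := replicate n True, 5 := R)) (q (?m + u ?m)) z
          (s(7 := replicate n True, 5 := ?g n # R))"
        by (rule runs_eq[OF fml_costD[OF q ok, of "?m + u ?m"]])
          (use Suc.prems in "auto split: nat.split")
      show ?case
        by (rule runs_eq[OF runs_While_step[OF _ _ runs_Seq[OF 1 2] Suc.IH]]) (use Suc.prems in auto)
    qed
    have s7: "s(7 := replicate ?x True) = s(7 := replicate ?x True, 5 := [])"
      using s by (auto simp: fun_eq_iff)
    have 22: "runs (WhileNE 7 (Seq (Pop 7) (cf f (case_nat 7 (%_. 6)) 8))) z (s(7 := replicate ?x True))
        (u ?m * (q (?m + u ?m) + 3) + 1) z (s(5 := fmap t f X))"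
      by (rule runs_eq[OF 2[OF xu, of "[]", folded s7]]) (use xu in "auto simp: fmap_def")
    have 3: "runs (WhileNE 1 (Pop 1)) z (s(5 := fmap t f X)) (2 * ?m + 1) z (s(5 := fmap t f X, 1 := []))"
      by (rule runs_eq[OF runs_clear]) (use s1 in auto)
    have 4: "runs (mvall 5 2) z (s(5 := fmap t f X, 1 := [])) (7 * u ?m + 1) z (s(2 := rev (fmap t f X), 1 := []))"
      by (rule runs_eq[OF runs_mvall]) (use s xu in "auto simp: fun_eq_iff fmap_def")
    have 5: "runs (mvall 2 1) z (s(2 := rev (fmap t f X), 1 := [])) (7 * u ?m + 1) z (s(1 := fmap t f X))"
      by (rule runs_eq[OF runs_mvall]) (use s xu in "auto simp: fun_eq_iff fmap_def")
    show ?thesis unfolding fmap_com_def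
      by (rule runs_Seq[OF 1 runs_Seq[OF 22 runs_Seq[OF 3 runs_Seq[OF 4 5]]]])
  qed
  moreover have "length (fmap t f X) \<le> ?p (length X)" for X
  proof -
    have "tval X (%_. 0) t \<le> u (length X)" using v(2) by simp
    then show ?thesis by (simp add: fmap_def)
  qed
  ultimately show ?thesis by (intro exI[of _ ?p] conjI) simp_all
qed

definition ptrans :: "(bool list => bool list) => bool" where
  "ptrans f <-> (\<exists>c p. good c & pbound p & (\<forall>X. length (f X) \<le> p (length X)) &
     (\<forall>X s z. s 1 = X --> (\<forall>r\<ge>2. s r = []) --> runs c z s (p (length X)) z (s(1 := f X))))"

lemma good_fmap_com [simp]: "good (fmap_com t f)"
  by (simp add: fmap_com_def)

lemma ptrans_fmap: "ptrans (fmap t f)"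
proof -
  obtain p where "pbound p" "\<forall>X. length (fmap t f X) \<le> p (length X)"
    "\<forall>X s z. s 1 = X --> (\<forall>r\<ge>2. r ~= 4 --> s r = []) -->
       runs (fmap_com t f) z s (p (length X)) z (s(1 := fmap t f X))"
    using runs_fmap_com[of t f] by (elim exE conjE)
  then show ?thesis unfolding ptrans_def
    by (intro exI[of _ "fmap_com t f"] exI[of _ p]) simp
qed

lemma ptrans_comp:
  assumes "ptrans f" "ptrans g"
  shows "ptrans (%X. g (f X))"
proof -
  obtain c p where c: "good c" "pbound p" "!!X. length (f X) \<le> p (length X)"
    "!!X s z. s 1 = X ==> (\<forall>r\<ge>2. s r = []) ==> runs c z s (p (length X)) z (s(1 := f X))"
    using assms(1) unfolding ptrans_def by blast
  obtain c' p' where c': "good c'" "pbound p'" "!!X. length (g X) \<le> p' (length X)"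
    "!!X s z. s 1 = X ==> (\<forall>r\<ge>2. s r = []) ==> runs c' z s (p' (length X)) z (s(1 := g X))"
    using assms(2) unfolding ptrans_def by blast
  \<comment> \<open>\<open>p'\<close> need not be monotone; a polynomial above it is, and can be
    evaluated at a bound for the length of \<open>f X\<close>.\<close>
  obtain a d where ad: "!!n. p' n \<le> a * n ^ d + a" using c'(2) by (auto simp: pbound_def)
  define q where "q n = a * p n ^ d + a" for n
  have q: "p' (length (f X)) \<le> q (length X)" for X
    unfolding q_def
    by (rule order_trans[OF ad]) (use c(3) in "auto intro!: mult_le_mono2 power_mono")
  have "pbound q" unfolding q_def by (intro pbound_intros pbound_power c)
  show ?thesis
    unfolding ptrans_def
  proof (intro exI[of _ "Seq c c'"] exI[of _ "%n. p n + q n + 1"] conjI allI impI)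
    show "pbound (%n. p n + q n + 1)" by (intro pbound_intros c \<open>pbound q\<close>)
    fix X
    show "length (g (f X)) \<le> p (length X) + q (length X) + 1"
      using c'(3)[of "f X"] q[of X] by linarith
    fix s :: store and z assume s: "s 1 = X" "\<forall>r\<ge>2. s r = []"
    show "runs (Seq c c') z s (p (length X) + q (length X) + 1) z (s(1 := g (f X)))"
      by (rule runs_eq[OF runs_Seq[OF c(4)[OF s] c'(4)[of _ "f X"]]]) (use s q[of X] in auto)
  qed (use c c' in auto)
qed

text \<open>Polynomially many rounds of a polynomial-time map may blow a string up exponentially;
  this cannot happen here because the map preserves the length.\<close>

lemma ptrans_iter:
  assumes len: "!!X. length (fmap t f X) = length X"
  shows "ptrans (%X. (fmap t f ^^ length X) X)"
proof -
  let ?g = "fmap t f"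
  obtain p where p: "pbound p"
    "\<forall>X s z. s 1 = X --> (\<forall>r\<ge>2. r ~= 4 --> s r = []) -->
       runs (fmap_com t f) z s (p (length X)) z (s(1 := ?g X))"
    using runs_fmap_com[of t f] by (elim exE conjE)
  have leni: "length ((?g ^^ n) X) = length X" for n X
    by (induction n) (simp_all add: len)
  let ?c = "Seq (lencount 4) (WhileNE 4 (Seq (Pop 4) (fmap_com t f)))"
  let ?p = "%m. (18 * m + 3) + (m * (p m + 3) + 1) + 1"
  have loop: "runs (WhileNE 4 (Seq (Pop 4) (fmap_com t f))) z (s(1 := X, 4 := replicate n True))
      (n * (p (length X) + 3) + 1) z (s(1 := (?g ^^ n) X))"
    if s: "!!r. r \<ge> 2 ==> s r = []" for n s z X
  proof (induction n arbitrary: X)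
    case 0
    show ?case by (rule runs_eq[OF runs_While_done]) (use s in "auto simp: fun_eq_iff")
  next
    case (Suc n)
    have 1: "runs (Pop 4) z (s(1 := X, 4 := replicate (Suc n) True)) 1 z (s(1 := X, 4 := replicate n True))"
      by (rule runs_eq[OF runs_Pop]) (auto simp: fun_eq_iff)
    have 2: "runs (fmap_com t f) z (s(1 := X, 4 := replicate n True)) (p (length X)) z
        (s(1 := ?g X, 4 := replicate n True))"
      by (rule runs_eq[OF p(2)[rule_format]]) (use s in "auto simp: fun_eq_iff")
    show ?case
      by (rule runs_eq[OF runs_While_step[OF _ _ runs_Seq[OF 1 2] Suc]])
        (auto simp: len funpow_swap1)
  qed
  show ?thesis unfolding ptrans_def
  proof (intro exI[of _ ?c] exI[of _ ?p] conjI allI impI)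
    show "pbound ?p" by (intro pbound_intros p)
    fix X
    show "length ((?g ^^ length X) X) \<le> ?p (length X)" by (simp add: leni)
    fix s :: store and z assume s: "s 1 = X" "\<forall>r\<ge>2. s r = []"
    have 1: "runs (lencount 4) z s (18 * length X + 3) z (s(1 := X, 4 := replicate (length X) True))"
      by (rule runs_eq[OF runs_lencount]) (use s in auto)
    show "runs ?c z s (?p (length X)) z (s(1 := (?g ^^ length X) X))"
      by (rule runs_Seq[OF 1 loop]) (use s in auto)
  qed simp
qed

section \<open>Reading the input tape and writing the output tape\<close>

definition emp :: store where "emp = (%_. [])"

lemma emp_apply [simp]: "emp r = []" by (simp add: emp_def)

definition intape :: "bool list => nat => tape" where
  "intape x j = (%i. if int j \<le> i & i < int (length x) then bit_symbol (x ! nat i) else 0, int j)"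

definition outtape :: "bool list => nat => tape" where
  "outtape y j = (%i. if 0 \<le> i & i < int j then bit_symbol (y ! nat i) else 0, int j)"

text \<open>The tape is erased while it is read, so nothing marks cell 0 any more and register 2
  counts the way back. Reading reverses the word; three further transfers, an odd number, undo this
  and end in register 1.\<close>

definition "read_input = Seq
  (While 0 nonblank (Seq (If 0 truesym (Push 1 True) (Push 1 False)) (Seq (Push 2 True) (Op 0 (%_. 0) Move_Right))))
  (Seq (WhileNE 2 (Seq (Pop 2) (Op 0 (%x. x) Move_Left))) (Seq (mvall 1 2) (Seq (mvall 2 3) (mvall 3 1))))"

definition "write_output = WhileNE 1
  (Seq (IfTop 1 (Op 0 (%_. 2) Move_Right) (Op 0 (%_. 1) Move_Right)) (Pop 1))"

lemma outtape_0: "outtape y 0 = outtape [] 0"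
  by (auto simp: outtape_def fun_eq_iff)

lemma runs_read_input:
  "runs read_input (input_tape x) emp (40 * length x + 13) (outtape [] 0) (emp(1 := x))"
proof -
  let ?n = "length x"
  let ?s = "%j. emp(1 := rev (take j x), 2 := replicate j True)"
  let ?c = "Seq (If 0 truesym (Push 1 True) (Push 1 False)) (Seq (Push 2 True) (Op 0 (%_. 0) Move_Right))"
  have loop: "runs (While 0 nonblank ?c) (intape x (?n - d)) (?s (?n - d)) (11 * d + 1) (intape x ?n) (?s ?n)"
    if "d \<le> ?n" for d
    using that
  proof (induction d)
    case 0
    show ?case unfolding diff_zero
      by (rule runs_weaken[OF runs_While0_done]) (auto simp: intape_def nonblank_def)
  next
    case (Suc d)
    let ?j = "?n - Suc d"
    have j: "?j < ?n" "Suc ?j = ?n - d" using Suc.prems by auto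
    have rd: "read (intape x ?j) = bit_symbol (x ! ?j)" using j(1) by (auto simp: intape_def)
    have act: "act (intape x ?j) (0, Move_Right) = intape x (Suc ?j)"
      by (auto simp: intape_def fun_eq_iff)
    have tk: "rev (take (Suc ?j) x) = x ! ?j # rev (take ?j x)"
      using j(1) by (simp add: take_Suc_conv_app_nth)
    have 1: "runs (If 0 truesym (Push 1 True) (Push 1 False)) (intape x ?j) (?s ?j) (3 + 1) (intape x ?j)
        ((?s ?j)(1 := x ! ?j # rev (take ?j x)))"
      by (rule runs_If0; rule runs_eq[OF runs_Push])
        (auto simp: rd truesym_def bit_symbol_def fun_eq_iff split: if_splits)
    have 2: "runs (Push 2 True) (intape x ?j) ((?s ?j)(1 := x ! ?j # rev (take ?j x))) 3 (intape x ?j) (?s (Suc ?j))"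
      by (rule runs_eq[OF runs_Push]) (auto simp: tk fun_eq_iff)
    have 3: "runs (Op 0 (%_. 0) Move_Right) (intape x ?j) (?s (Suc ?j)) 1 (intape x (Suc ?j)) (?s (Suc ?j))"
      using runs_Op0[of "%_. 0" Move_Right "intape x ?j"] by (simp add: act)
    have "runs (While 0 nonblank ?c) (intape x ?j) (?s ?j) (3 + 1 + (3 + 1 + 1) + 1 + (11 * d + 1) + 1) (intape x ?n) (?s ?n)"
    proof (rule runs_While0_step[OF _ runs_Seq[OF 1 runs_Seq[OF 2 3]]])
      show "nonblank (read (intape x ?j))" by (simp add: rd nonblank_def bit_symbol_def)
      show "runs (While 0 nonblank ?c) (intape x (Suc ?j)) (?s (Suc ?j)) (11 * d + 1) (intape x ?n) (?s ?n)"
        unfolding j(2) by (rule Suc.IH) (use Suc.prems in simp)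
    qed
    then show ?case by (rule runs_weaken) simp
  qed
  have return: "runs (WhileNE 2 (Seq (Pop 2) (Op 0 (%x. x) Move_Left))) (%_. 0, int d)
      (emp(1 := rev x, 2 := replicate d True)) (4 * d + 1) (%_. 0, 0) (emp(1 := rev x))" for d
  proof (induction d)
    case 0
    show ?case unfolding of_nat_0 by (rule runs_eq[OF runs_While_done]) (auto simp: fun_eq_iff)
  next
    case (Suc d)
    have 1: "runs (Pop 2) (%_. 0, int (Suc d)) (emp(1 := rev x, 2 := replicate (Suc d) True)) 1
        (%_. 0, int (Suc d)) (emp(1 := rev x, 2 := replicate d True))"
      by (rule runs_eq[OF runs_Pop]) (auto simp: fun_eq_iff)
    have 2: "runs (Op 0 (%x. x) Move_Left) (%_. 0, int (Suc d)) s 1 (%_. 0, int d) s" for s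
      using runs_Op0[of "%x. x" Move_Left "(%_. 0, int (Suc d))" s] by (simp add: fun_upd_def)
    show ?case
      by (rule runs_weaken[OF runs_While_step[OF _ _ runs_Seq[OF 1 2] Suc]]) auto
  qed
  have 1: "runs (While 0 nonblank ?c) (input_tape x) emp (11 * ?n + 1) (%_. 0, int ?n)
      (emp(1 := rev x, 2 := replicate ?n True))"
  proof -
    have "input_tape x = intape x 0" by (auto simp: input_tape_def intape_def)
    moreover have "intape x ?n = (%_. 0, int ?n)" by (auto simp: intape_def)
    moreover have "?s 0 = emp" by auto
    ultimately show ?thesis using loop[of ?n] by simp
  qed
  have m: "runs (mvall 1 2) z (emp(1 := rev x)) (7 * ?n + 1) z (emp(2 := x))"
    "runs (mvall 2 3) z (emp(2 := x)) (7 * ?n + 1) z (emp(3 := rev x))"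
    "runs (mvall 3 1) z (emp(3 := rev x)) (7 * ?n + 1) z (emp(1 := x))" for z
    by (rule runs_eq[OF runs_mvall]; auto simp: fun_eq_iff)+
  have "(%_. 0, 0) = outtape [] 0" by (auto simp: outtape_def)
  then show ?thesis unfolding read_input_def
    using runs_Seq[OF 1 runs_Seq[OF return runs_Seq[OF m(1) runs_Seq[OF m(2,3)]]]]
    by (auto elim!: runs_weaken)
qed

lemma runs_write_output:
  "runs write_output (outtape y 0) (emp(1 := y)) (5 * length y + 1) (outtape y (length y)) emp"
proof -
  let ?n = "length y"
  let ?s = "%j. emp(1 := drop j y)"
  have "runs write_output (outtape y (?n - d)) (?s (?n - d)) (5 * d + 1) (outtape y ?n) emp"
    if "d \<le> ?n" for d
    using that
  proof (induction d)
    case 0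
    show ?case unfolding write_output_def diff_zero
      by (rule runs_eq[OF runs_While_done]) (auto simp: fun_eq_iff)
  next
    case (Suc d)
    let ?j = "?n - Suc d"
    have j: "?j < ?n" "Suc ?j = ?n - d" using Suc.prems by auto
    have dr: "drop ?j y = y ! ?j # drop (Suc ?j) y" using j(1) by (simp add: Cons_nth_drop_Suc)
    have act: "act (outtape y ?j) (bit_symbol (y ! ?j), Move_Right) = outtape y (Suc ?j)"
      by (auto simp: outtape_def fun_eq_iff)
    have hd: "hd (?s ?j 1) = y ! ?j" "?s ?j 1 ~= []" using dr by simp_all
    have 1: "runs (IfTop 1 (Op 0 (%_. 2) Move_Right) (Op 0 (%_. 1) Move_Right)) (outtape y ?j) (?s ?j) (1 + 1)
        (outtape y (Suc ?j)) (?s ?j)"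
    proof (rule runs_IfTop)
      assume "hd (?s ?j 1)"
      then show "runs (Op 0 (%_. 2) Move_Right) (outtape y ?j) (?s ?j) 1 (outtape y (Suc ?j)) (?s ?j)"
        using runs_Op0[of "%_. 2" Move_Right "outtape y ?j" "?s ?j"] act hd by (simp add: bit_symbol_def)
    next
      assume "?s ?j 1 = [] | ~ hd (?s ?j 1)"
      then have "~ y ! ?j" using hd by simp
      then show "runs (Op 0 (%_. 1) Move_Right) (outtape y ?j) (?s ?j) 1 (outtape y (Suc ?j)) (?s ?j)"
        using runs_Op0[of "%_. 1" Move_Right "outtape y ?j" "?s ?j"] act by (simp add: bit_symbol_def)
    qed simp
    have 2: "runs (Pop 1) (outtape y (Suc ?j)) (?s ?j) 1 (outtape y (Suc ?j)) (?s (Suc ?j))"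
      by (rule runs_eq[OF runs_Pop]) (simp_all add: dr)
    have 3: "runs write_output (outtape y (Suc ?j)) (?s (Suc ?j)) (5 * d + 1) (outtape y ?n) emp"
      unfolding j(2) by (rule Suc.IH) (use Suc.prems in simp)
    show ?case unfolding write_output_def
      by (rule runs_weaken[OF runs_While_step[OF _ hd(2) runs_Seq[OF 1 2] 3[unfolded write_output_def]]]) auto
  qed
  from this[of ?n] show ?thesis by simp
qed

lemma good_io [simp]: "good read_input" "good write_output"
  by (simp_all add: read_input_def write_output_def)

theorem ptrans_poly_time: assumes "ptrans f" shows "poly_time_computable f"
proof -
  obtain c p where c: "good c" "pbound p" "!!X. length (f X) \<le> p (length X)"
    "!!X s z. s 1 = X ==> (\<forall>r\<ge>2. s r = []) ==> runs c z s (p (length X)) z (s(1 := f X))"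
    using assms unfolding ptrans_def by blast
  let ?c = "Seq read_input (Seq c write_output)"
  let ?q = "%n. (40 * n + 13) + (p n + (5 * p n + 1) + 1) + 1"
  have "good ?c" using c(1) by simp
  then obtain K where K: "K \<ge> 1" "wf_com K ?c" using good_wf_com by blast
  obtain M where M: "wf_tm M" "tapes M = K" "!!sg t sg'. exec ?c sg t sg' ==>
       (step M ^^ t) (0, map sg [0..<K]) = (states M, map sg' [0..<K])"
    using compile_com[OF K(2,1)] by blast
  have "pbound ?q" by (intro pbound_intros c)
  then obtain a d where q: "!!n. ?q n \<le> a * n ^ d + a" unfolding pbound_def by blast
  have "computes_in_time M f (%n. a * n ^ d + a)"
    unfolding computes_in_time_def
  proof (intro conjI allI M(1))
    fix x
    let ?y = "f x"
    have 2: "runs c (outtape [] 0) (emp(1 := x)) (p (length x)) (outtape ?y 0) (emp(1 := ?y))"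
      using c(4)[of "emp(1 := x)" x "outtape [] 0"] by (simp add: outtape_0[of ?y])
    have 3: "runs write_output (outtape ?y 0) (emp(1 := ?y)) (5 * p (length x) + 1)
        (outtape ?y (length ?y)) emp"
      by (rule runs_weaken[OF runs_write_output]) (use c(3)[of x] in simp)
    have r: "runs ?c (input_tape x) emp (?q (length x)) (outtape ?y (length ?y)) emp"
      by (rule runs_Seq[OF runs_read_input runs_Seq[OF 2 3]])
    let ?sg = "%r::nat. if r = 0 then input_tape x else (%_. 0, 0)"
    have "?sg 0 = input_tape x & (\<forall>r\<ge>1. stk (?sg r) (emp r))" by (simp add: stk_def)
    from r[unfolded runs_def, rule_format, OF this] obtain t sg' where t: "t \<le> ?q (length x)" "exec ?c ?sg t sg'" "sg' 0 = outtape ?y (length ?y)"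
      by (elim exE conjE)
    have ini: "init M x = (0, map ?sg [0..<K])"
    proof -
      have "map ?sg [0..<K] = input_tape x # map ?sg [1..<K]" using K(1) by (simp add: upt_conv_Cons)
      also have "map ?sg [1..<K] = replicate (K - 1) (%_. 0, 0)"
        by (rule nth_equalityI) auto
      finally show ?thesis by (simp add: init_def M(2))
    qed
    have fin: "(step M ^^ t) (init M x) = (states M, map sg' [0..<K])" using M(3)[OF t(2)] ini by simp
    have "hd (map sg' [0..<K]) = outtape ?y (length ?y)" using K(1) t(3)
      by (cases K) (simp_all add: upt_conv_Cons del: upt_Suc)
    then have "has_output ((step M ^^ t) (init M x)) ?y" unfolding fin by (auto simp: outtape_def)
    moreover have "t \<le> a * length x ^ d + a" using t(1) q[of "length x"] by (rule order_trans)
    ultimately show "\<exists>t\<le>a * length x ^ d + a. fst ((step M ^^ t) (init M x)) = states M &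
        has_output ((step M ^^ t) (init M x)) ?y"
      using fin by (intro exI[of _ t]) simp
  qed
  then show ?thesis unfolding poly_time_computable_def by blast
qed

section \<open>Definable predicates\<close>

text \<open>Definability is stated for HOL functions, so that formulas are never written down: the
  closure rules follow the syntax of the HOL term.\<close>

definition pt :: "(bool list => (nat => nat) => nat) => bool" where
  "pt g <-> (\<exists>t. \<forall>X e. g X e = tval X e t)"

definition pb :: "(bool list => (nat => nat) => bool) => bool" where
  "pb P <-> (\<exists>f. \<forall>X e. P X e <-> fval X e f)"

lemma pt_var: "pt (%X e. e k)"
  unfolding pt_def by (rule exI[of _ "TVar k"]) simp

lemma pt_const: "pt (%X e. n)"
  unfolding pt_def by (rule exI[of _ "TConst n"]) simp

lemma pt_len: "pt (%X e. length X)"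
  unfolding pt_def by (rule exI[of _ TLen]) simp

lemma pt_add: "pt f ==> pt g ==> pt (%X e. f X e + g X e)"
  unfolding pt_def by (metis tval.simps(4))

lemma pt_mult: "pt f ==> pt g ==> pt (%X e. f X e * g X e)"
  unfolding pt_def by (metis tval.simps(5))

lemma pt_Suc: "pt f ==> pt (%X e. Suc (f X e))"
  using pt_add[OF _ pt_const[of 1], of f] by simp

lemma pt_power: "pt f ==> pt (%X e. f X e ^ d)"
  by (induction d) (simp_all add: pt_const pt_mult)

lemma pb_eq: "pt f ==> pt g ==> pb (%X e. f X e = g X e)"
  unfolding pt_def pb_def by (metis fval.simps(1))

lemma pb_bit: "pt f ==> pb (%X e. f X e < length X & X ! f X e)"
  unfolding pt_def pb_def by (metis fval.simps(2))

lemma pb_not: "pb P ==> pb (%X e. ~ P X e)"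
  unfolding pb_def by (metis fval.simps(3))

lemma pb_and: "pb P ==> pb Q ==> pb (%X e. P X e & Q X e)"
  unfolding pb_def by (metis fval.simps(4))

lemma pb_or: "pb P ==> pb Q ==> pb (%X e. P X e | Q X e)"
  using pb_not[OF pb_and[OF pb_not pb_not], of P Q] by simp

lemma pb_imp: "pb P ==> pb Q ==> pb (%X e. P X e --> Q X e)"
  unfolding imp_conv_disj by (intro pb_or pb_not)

lemma pb_iff: "pb P ==> pb Q ==> pb (%X e. P X e <-> Q X e)"
  unfolding iff_conv_conj_imp by (intro pb_and pb_imp)

lemma pb_const: "pb (%X e. b)"
proof (cases b)
  case True
  then show ?thesis using pb_eq[OF pt_const[of 0] pt_const[of 0]] by simp
next
  case False
  then show ?thesis using pb_eq[OF pt_const[of 0] pt_const[of 1]] by simp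
qed

text \<open>The bound variable is index 0 in the body, so the body reads the outer variables through
  the shifted environment.\<close>

lemma pb_ex:
  assumes "pt g" "pb (%X e. P X (%i. e (Suc i)) (e 0))"
  shows "pb (%X e. \<exists>j<g X e. P X e j)"
proof -
  obtain t f where "!!X e. g X e = tval X e t" "!!X e. P X (%i. e (Suc i)) (e 0) <-> fval X e f"
    using assms unfolding pt_def pb_def by blast
  note f = this(1) this(2)[of _ "case_nat _ _", simplified]
  show ?thesis unfolding pb_def by (rule exI[of _ "FEx t f"]) (simp add: f)
qed

lemma pb_all:
  assumes "pt g" "pb (%X e. P X (%i. e (Suc i)) (e 0))"
  shows "pb (%X e. \<forall>j<g X e. P X e j)"
  using pb_not[OF pb_ex[OF assms(1) pb_not[OF assms(2)]]] by simp

lemma pt_shift: "pt f ==> pt (%X e. f X (%i. e (Suc i)))"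
proof -
  assume "pt f"
  then obtain t where f: "!!X e. f X e = tval X e t" by (auto simp: pt_def)
  have "\<exists>t'. \<forall>X e. tval X (%i. e (Suc i)) t = tval X e t'"
  proof (induction t)
    case (TVar i)
    show ?case by (rule exI[of _ "TVar (Suc i)"]) simp
  next
    case (TConst n)
    show ?case by (rule exI[of _ "TConst n"]) simp
  next
    case TLen
    show ?case by (rule exI[of _ TLen]) simp
  next
    case (TAdd a b)
    then show ?case by (metis tval.simps(4))
  next
    case (TMul a b)
    then show ?case by (metis tval.simps(5))
  qed
  then show ?thesis by (simp add: pt_def f)
qed

text \<open>The language has no order; a bounded quantifier supplies it.\<close>

lemma pb_less: assumes "pt f" "pt g" shows "pb (%X e. f X e < g X e)"
proof -
  have "pb (%X e. \<exists>j<g X e. j = f X e)"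
    by (intro pb_ex pb_eq pt_var pt_shift assms)
  then show ?thesis by simp
qed

lemma pb_le: assumes "pt f" "pt g" shows "pb (%X e. f X e \<le> g X e)"
  using pb_not[OF pb_less[OF assms(2,1)]] by (simp add: not_less)

lemma pb_if: "pb P ==> pb Q ==> pb R ==> pb (%X e. if P X e then Q X e else R X e)"
  using pb_and[OF pb_imp pb_imp[OF pb_not], of P Q P R] by (simp add: if_bool_eq_conj)

text \<open>A quantifier over a fixed finite set becomes a disjunction over constants. This is how
  the finite data of a machine or of a gadget enter a formula.\<close>

lemma pb_finite_ex: "finite S ==> (!!s. s \<in> S ==> pb (P s)) ==> pb (%X e. \<exists>s\<in>S. P s X e)"
  by (induction S rule: finite_induct) (simp_all add: pb_const pb_or)

lemma pb_finite_all: "finite S ==> (!!s. s \<in> S ==> pb (P s)) ==> pb (%X e. \<forall>s\<in>S. P s X e)"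
  by (induction S rule: finite_induct) (simp_all add: pb_const pb_and)

lemmas pt_intros = pt_var pt_const pt_len pt_add pt_mult pt_Suc pt_power
lemmas pb_intros = pb_const pb_eq pb_less pb_le pb_bit pb_not pb_and pb_or pb_imp pb_iff pb_if pb_ex pb_all

lemma map_fmap:
  assumes "pt (%X e. p X)" "pb (%X e. P X (e 0))"
  obtains t f where "(%X. map (P X) [0..<p X]) = fmap t f"
proof -
  obtain t f where "!!X (e :: nat => nat). p X = tval X e t" "!!X (e :: nat => nat). P X (e 0) <-> fval X e f"
    using assms unfolding pt_def pb_def by blast
  note f = this(1) this(2)[of _ "case_nat _ _", simplified]
  show ?thesis by (rule that[of t f]) (auto simp: fmap_def fun_eq_iff f(2) f(1)[symmetric])
qed

lemma ptrans_map:
  assumes "pt (%X e. p X)" "pb (%X e. P X (e 0))"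
  shows "ptrans (%X. map (P X) [0..<p X])"
  using map_fmap[OF assms] ptrans_fmap by metis

lemma ptrans_map_iter:
  assumes "pt (%X e. length X)" "pb (%X e. P X (e 0))"
  shows "ptrans (%X. ((%X. map (P X) [0..<length X]) ^^ length X) X)"
proof -
  obtain t f where f: "(%X. map (P X) [0..<length X]) = fmap t f"
    using map_fmap[OF assms] .
  have "length (fmap t f X) = length X" for X
    unfolding f[symmetric] by simp
  from ptrans_iter[OF this] show ?thesis unfolding f .
qed

lemma class_P_ptrans:
  assumes "ptrans f" "pb (%X e. P X)"
  shows "{X. P (f X)} \<in> class_P"
proof -
  have "ptrans (%X. map (%_. P X) [0..<1])"
    by (rule ptrans_map) (intro pt_intros assms)+
  from ptrans_comp[OF assms(1) this] have "ptrans (%X. [P (f X)])" by simp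
  from ptrans_poly_time[OF this] show ?thesis by (simp add: class_P_def)
qed

lemma ptrans_id: "ptrans (%X. X)"
proof -
  have "ptrans (%X. map (%j. j < length X & X ! j) [0..<length X])"
    by (rule ptrans_map) (intro pt_intros pb_intros)+
  moreover have "map (%j. j < length X & X ! j) [0..<length X] = X" for X
    by (rule nth_equalityI) auto
  ultimately show ?thesis by simp
qed

lemma class_P_definable: "pb (%X e. P X) ==> {X. P X} \<in> class_P"
  using class_P_ptrans[OF ptrans_id] .

section \<open>List colorings and gadgets\<close>

text \<open>Edges are given by an arbitrary relation: only its symmetric closure matters.\<close>

definition col :: "'v set => ('v => 'v => bool) => ('v => nat set) => ('v => nat) => bool" where
  "col V E L c <-> (\<forall>v\<in>V. c v \<in> L v) & (\<forall>u\<in>V. \<forall>v\<in>V. E u v --> c u ~= c v)"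

definition lists_on :: "nat => ('v => nat) => 'v set => ('v => nat set) => bool" where
  "lists_on k f V L <-> (\<forall>v\<in>V. L v \<subseteq> {1..k} & card (L v) = f v)"

definition fch :: "nat => ('v => nat) => 'v set => ('v => 'v => bool) => bool" where
  "fch k f V E <-> (\<forall>L. lists_on k f V L --> (\<exists>c. col V E L c))"

lemma fchD: "fch k f V E ==> lists_on k f V L ==> \<exists>c. col V E L c"
  by (simp add: fch_def)

lemma fch_iso:
  assumes "inj_on \<phi> V" "!!u v. u \<in> V ==> v \<in> V ==> E u v <-> E' (\<phi> u) (\<phi> v)"
    "!!v. v \<in> V ==> f v = f' (\<phi> v)"
  shows "fch k f V E <-> fch k f' (\<phi> ` V) E'"
proof
  assume fc: "fch k f V E"
  show "fch k f' (\<phi> ` V) E'"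
    unfolding fch_def
  proof (intro allI impI)
    fix L assume "lists_on k f' (\<phi> ` V) L"
    then have "lists_on k f V (%v. L (\<phi> v))" using assms(3) by (auto simp: lists_on_def)
    then obtain c where "col V E (%v. L (\<phi> v)) c" using fc fchD by blast
    then have "col (\<phi> ` V) E' L (%w. c (inv_into V \<phi> w))"
      using assms(1,2) by (auto simp: col_def)
    then show "\<exists>c. col (\<phi> ` V) E' L c" by blast
  qed
next
  assume fc: "fch k f' (\<phi> ` V) E'"
  show "fch k f V E"
    unfolding fch_def
  proof (intro allI impI)
    fix L assume "lists_on k f V L"
    then have "lists_on k f' (\<phi> ` V) (%w. L (inv_into V \<phi> w))"
      using assms(1,3) by (auto simp: lists_on_def)
    then obtain c where "col (\<phi> ` V) E' (%w. L (inv_into V \<phi> w)) c" using fc fchD by blast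
    then have "col V E L (%v. c (\<phi> v))"
      using assms(1,2) by (auto simp: col_def)
    then show "\<exists>c. col V E L c" by blast
  qed
qed

text \<open>A gadget of capacity \<open>j\<close> attached to a vertex through \<open>S\<close> can forbid any \<open>j\<close> colors
  there, but never more than \<open>j\<close>.\<close>

definition gadget :: "nat => nat => nat => 'r set => ('r => 'r => bool) => 'r set => bool" where
  "gadget l k j R E S <-> finite R & S \<subseteq> R &
    (\<forall>L. lists_on k (%_. l) R L -->
       (\<exists>K. finite K & card K \<le> j & (\<forall>a\<in>{1..k} - K. \<exists>c. col R E L c & a ~: c ` S))) &
    (\<forall>J \<subseteq> {1..k}. card J = j -->
       (\<exists>L. lists_on k (%_. l) R L & (\<forall>c. col R E L c --> J \<subseteq> c ` S))) &
    (\<exists>s. (\<forall>u v. E u v --> s u ~= s v) & (\<forall>x\<in>S. s x))"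

definition attV :: "'v set => ('v => nat) => 'r set => ('v + 'v \<times> nat \<times> 'r) set" where
  "attV V n R = Inl ` V \<union> Inr ` {(v, i, r). v \<in> V & i < n v & r \<in> R}"

fun attE :: "('v => 'v => bool) => ('r => 'r => bool) => 'r set =>
    ('v + 'v \<times> nat \<times> 'r) => ('v + 'v \<times> nat \<times> 'r) => bool" where
  "attE E ER S (Inl u) (Inl v) <-> E u v"
| "attE E ER S (Inl u) (Inr (v, i, r)) <-> u = v & r \<in> S"
| "attE E ER S (Inr (v, i, r)) (Inl u) <-> False"
| "attE E ER S (Inr (v, i, r)) (Inr (v', i', r')) <-> v = v' & i = i' & ER r r'"

lemma split_card:
  assumes "finite J" "card J = n * j"
  shows "\<exists>P. (\<forall>i<n. P i \<subseteq> J & card (P i) = j) & J = (\<Union>i<n. P i)"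
  using assms
proof (induction n arbitrary: J)
  case (Suc n)
  have "j \<le> card J" using Suc.prems by simp
  then obtain A where A: "A \<subseteq> J" "card A = j" using obtain_subset_with_card_n by blast
  have "card (J - A) = n * j" using A Suc.prems by (simp add: card_Diff_subset finite_subset)
  then obtain P where P: "\<forall>i<n. P i \<subseteq> J - A & card (P i) = j" "J - A = (\<Union>i<n. P i)"
    using Suc.IH[of "J - A"] Suc.prems by auto
  have "(\<Union>i<Suc n. (P(n := A)) i) = A \<union> (\<Union>i<n. P i)"
    by (auto simp: less_Suc_eq split: if_splits)
  then have "J = (\<Union>i<Suc n. (P(n := A)) i)" using P(2) A by auto
  moreover have "\<forall>i<Suc n. (P(n := A)) i \<subseteq> J & card ((P(n := A)) i) = j"
    using P(1) A by (auto simp: less_Suc_eq)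
  ultimately show ?case by blast
qed auto

lemma card_UN_bound:
  "(!!i. i < m ==> card (K i) \<le> j) ==> card (\<Union>i<m. K i) \<le> m * j"
  using order_trans[OF card_UN_le[of "{..<m}" K] sum_bounded_above[of "{..<m}" "%i. card (K i)" j]]
  by simp

text \<open>The list of \<open>v\<close> is filled up with \<open>n v\<close> disjoint blocks of j
  colors outside \<open>L v\<close>, for which the palette has room since l \<le> k. The i-th gadget
  at \<open>v\<close> blocks the i-th block, so only the colors of \<open>L v\<close> remain
  usable.\<close>

lemma attach_lists:
  assumes g: "gadget l k j R ER S" and n: "!!v. v \<in> V ==> f v + n v * j = l" and "l \<le> k"
    and L: "lists_on k f V L"
  shows "\<exists>L'. lists_on k (%_. l) (attV V n R) L' &
    (\<forall>c. col (attV V n R) (attE E ER S) L' c --> col V E L (%v. c (Inl v)))"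
proof -
  have "\<forall>v\<in>V. \<exists>P. (\<forall>i<n v. P i \<subseteq> {1..k} - L v & card (P i) = j) &
      card (\<Union>i<n v. P i) = n v * j"
  proof
    fix v assume v: "v \<in> V"
    have Lv: "L v \<subseteq> {1..k}" "card (L v) = f v" using L v by (auto simp: lists_on_def)
    have "card ({1..k} - L v) = k - f v" using Lv by (simp add: card_Diff_subset finite_subset)
    then have "n v * j \<le> card ({1..k} - L v)" using n[OF v] assms(3) by simp
    then obtain J where J: "J \<subseteq> {1..k} - L v" "card J = n v * j" "finite J"
      using obtain_subset_with_card_n by blast
    from split_card[OF J(3,2)] obtain P where
      P: "\<forall>i<n v. P i \<subseteq> J & card (P i) = j" "J = (\<Union>i<n v. P i)" by blast
    show "\<exists>P. (\<forall>i<n v. P i \<subseteq> {1..k} - L v & card (P i) = j) & card (\<Union>i<n v. P i) = n v * j"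
      by (rule exI[of _ P]) (use P J in auto)
  qed
  from bchoice[OF this] obtain P where
    P0: "\<forall>v\<in>V. (\<forall>i<n v. P v i \<subseteq> {1..k} - L v & card (P v i) = j) & card (\<Union>i<n v. P v i) = n v * j"
    by blast
  have P: "!!v i. v \<in> V ==> i < n v ==> P v i \<subseteq> {1..k} - L v & card (P v i) = j"
    "!!v. v \<in> V ==> card (\<Union>i<n v. P v i) = n v * j"
    using P0 by blast+
  define M where "M v i = (SOME M. lists_on k (%_. l) R M & (\<forall>c. col R ER M c --> P v i \<subseteq> c ` S))"
    for v i
  have M0: "lists_on k (%_. l) R (M v i) & (\<forall>c. col R ER (M v i) c --> P v i \<subseteq> c ` S)"
    if "v \<in> V" "i < n v" for v i
  proof -
    have "P v i \<subseteq> {1..k}" "card (P v i) = j" using P(1) that by blast+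
    then have ex: "\<exists>M. lists_on k (%_. l) R M & (\<forall>c. col R ER M c --> P v i \<subseteq> c ` S)"
      using g unfolding gadget_def by blast
    show ?thesis unfolding M_def by (rule someI_ex[OF ex])
  qed
  then have M: "!!v i. v \<in> V ==> i < n v ==> lists_on k (%_. l) R (M v i)"
    "!!v i c. v \<in> V ==> i < n v ==> col R ER (M v i) c ==> P v i \<subseteq> c ` S"
    by blast+
  define L' where "L' w = (case w of Inl v => L v \<union> (\<Union>i<n v. P v i) | Inr (v, i, r) => M v i r)" for w
  have "lists_on k (%_. l) (attV V n R) L'"
    unfolding lists_on_def
  proof
    fix w assume "w \<in> attV V n R"
    then consider v where "w = Inl v" "v \<in> V" | v i r where "w = Inr (v, i, r)" "v \<in> V" "i < n v" "r \<in> R"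
      by (auto simp: attV_def)
    then show "L' w \<subseteq> {1..k} & card (L' w) = l"
    proof cases
      case 1
      have Lv: "L v \<subseteq> {1..k}" "card (L v) = f v" using L 1 by (auto simp: lists_on_def)
      have sub: "(\<Union>i<n v. P v i) \<subseteq> {1..k} - L v" using P(1) 1 by blast
      have "finite (L v)" "finite (\<Union>i<n v. P v i)"
        using Lv sub by (meson finite_Diff finite_atLeastAtMost finite_subset)+
      then have "card (L v \<union> (\<Union>i<n v. P v i)) = f v + n v * j"
        using sub Lv P(2)[OF 1(2)] by (subst card_Un_disjoint) auto
      then show ?thesis using n 1 Lv sub by (auto simp: L'_def)
    next
      case 2
      then show ?thesis using M(1) by (auto simp: L'_def lists_on_def)
    qed
  qed
  moreover have "col V E L (%v. c (Inl v))" if c: "col (attV V n R) (attE E ER S) L' c" for c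
    unfolding col_def
  proof (intro conjI ballI impI)
    fix u v assume "u \<in> V" "v \<in> V" "E u v"
    then have "Inl u \<in> attV V n R" "Inl v \<in> attV V n R" "attE E ER S (Inl u) (Inl v)"
      by (auto simp: attV_def)
    then show "c (Inl u) ~= c (Inl v)" using c unfolding col_def by blast
  next
    fix v assume v: "v \<in> V"
    have inl: "Inl v \<in> attV V n R" using v by (simp add: attV_def)
    have "c (Inl v) ~: P v i" if i: "i < n v" for i
    proof
      have inr: "Inr (v, i, r) \<in> attV V n R" if "r \<in> R" for r using v i that by (auto simp: attV_def)
      have "col R ER (M v i) (%r. c (Inr (v, i, r)))"
        using c inr unfolding col_def by (force simp: L'_def)
      then have sub: "P v i \<subseteq> (%r. c (Inr (v, i, r))) ` S" using M(2) v i by blast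
      assume "c (Inl v) \<in> P v i"
      then obtain r where "r \<in> S" "c (Inl v) = c (Inr (v, i, r))" using sub by blast
      moreover have "r \<in> R" using \<open>r \<in> S\<close> g by (auto simp: gadget_def)
      ultimately show False using c inl inr unfolding col_def by fastforce
    qed
    moreover have "c (Inl v) \<in> L v \<union> (\<Union>i<n v. P v i)" using c inl by (auto simp: col_def L'_def)
    ultimately show "c (Inl v) \<in> L v" by blast
  qed
  ultimately show ?thesis by blast
qed

text \<open>Whatever the lists are, each gadget at \<open>v\<close> can be colored around all but j
  colors of \<open>v\<close>, so \<open>f v\<close> colors of its list survive. The base graph is
  colored from these, and then the gadgets one by one.\<close>

lemma attach_fch:
  assumes g: "gadget l k j R ER S" and n: "!!v. v \<in> V ==> f v + n v * j = l" and fc: "fch k f V E"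
  shows "fch k (%_. l) (attV V n R) (attE E ER S)"
  unfolding fch_def
proof (intro allI impI)
  fix L assume L: "lists_on k (%_. l) (attV V n R) L"
  define K where "K v i = (SOME K. finite K & card K \<le> j &
      (\<forall>a\<in>{1..k} - K. \<exists>c. col R ER (%r. L (Inr (v, i, r))) c & a ~: c ` S))" for v i
  have K: "finite (K v i) & card (K v i) \<le> j &
      (\<forall>a\<in>{1..k} - K v i. \<exists>c. col R ER (%r. L (Inr (v, i, r))) c & a ~: c ` S)"
    if "v \<in> V" "i < n v" for v i
  proof -
    have "lists_on k (%_. l) R (%r. L (Inr (v, i, r)))"
      using L that by (auto simp: lists_on_def attV_def)
    then have ex: "\<exists>K. finite K & card K \<le> j &
      (\<forall>a\<in>{1..k} - K. \<exists>c. col R ER (%r. L (Inr (v, i, r))) c & a ~: c ` S)"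
      using g unfolding gadget_def by blast
    show ?thesis unfolding K_def by (rule someI_ex[OF ex])
  qed
  have "\<forall>v\<in>V. \<exists>A. A \<subseteq> L (Inl v) - (\<Union>i<n v. K v i) & card A = f v"
  proof
    fix v assume v: "v \<in> V"
    have "card (\<Union>i<n v. K v i) \<le> n v * j" using K[OF v] by (intro card_UN_bound) blast
    moreover have "card (L (Inl v)) = l" using L v by (auto simp: lists_on_def attV_def)
    moreover have "card (L (Inl v)) - card (\<Union>i<n v. K v i) \<le> card (L (Inl v) - (\<Union>i<n v. K v i))"
      using K[OF v] by (intro diff_card_le_card_Diff) auto
    ultimately have "f v \<le> card (L (Inl v) - (\<Union>i<n v. K v i))" using n[OF v] by linarith
    then show "\<exists>A. A \<subseteq> L (Inl v) - (\<Union>i<n v. K v i) & card A = f v"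
      using obtain_subset_with_card_n by metis
  qed
  then obtain A where A: "!!v. v \<in> V ==> A v \<subseteq> L (Inl v) - (\<Union>i<n v. K v i) & card (A v) = f v"
    by metis
  have "lists_on k f V A"
    using A L by (force simp: lists_on_def attV_def)
  then obtain c0 where c0: "col V E A c0" using fc fchD by blast
  define d where "d v i = (SOME c. col R ER (%r. L (Inr (v, i, r))) c & c0 v ~: c ` S)" for v i
  have d: "col R ER (%r. L (Inr (v, i, r))) (d v i) & c0 v ~: d v i ` S"
    if "v \<in> V" "i < n v" for v i
  proof -
    have "c0 v \<in> L (Inl v)" "c0 v ~: K v i" using c0 A that by (auto simp: col_def)
    moreover have "L (Inl v) \<subseteq> {1..k}" using L that by (auto simp: lists_on_def attV_def)
    ultimately have ex: "\<exists>c. col R ER (%r. L (Inr (v, i, r))) c & c0 v ~: c ` S"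
      using K[OF that] by blast
    show ?thesis unfolding d_def by (rule someI_ex[OF ex])
  qed
  let ?c = "%w. case w of Inl v => c0 v | Inr (v, i, r) => d v i r"
  have "col (attV V n R) (attE E ER S) L ?c"
    unfolding col_def
  proof (intro conjI ballI impI)
    fix w assume "w \<in> attV V n R"
    then show "?c w \<in> L w" using c0 A d unfolding attV_def col_def by fastforce
  next
    fix x y assume xy: "x \<in> attV V n R" "y \<in> attV V n R" "attE E ER S x y"
    from xy(3) show "?c x ~= ?c y"
      by (cases "(E, ER, S, x, y)" rule: attE.cases)
        (use xy c0 d in "force simp: attV_def col_def")+
  qed
  then show "\<exists>c. col (attV V n R) (attE E ER S) L c" by blast
qed

theorem attach_iff:
  assumes "gadget l k j R ER S" "!!v. v \<in> V ==> f v + n v * j = l" "l \<le> k"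
  shows "fch k (%_. l) (attV V n R) (attE E ER S) <-> fch k f V E"
proof
  assume fc: "fch k (%_. l) (attV V n R) (attE E ER S)"
  show "fch k f V E"
    unfolding fch_def
  proof (intro allI impI)
    fix L assume L: "lists_on k f V L"
    have "\<exists>L'. lists_on k (%_. l) (attV V n R) L' &
      (\<forall>c. col (attV V n R) (attE E ER S) L' c --> col V E L (%v. c (Inl v)))"
      by (rule attach_lists[OF assms(1) _ assms(3) L]) (rule assms(2))
    then obtain L' where L': "lists_on k (%_. l) (attV V n R) L'"
      "\<forall>c. col (attV V n R) (attE E ER S) L' c --> col V E L (%v. c (Inl v))" by blast
    then show "\<exists>c. col V E L c" using fchD[OF fc L'(1)] by blast
  qed
qed (use attach_fch assms in blast)

section \<open>Existence of a graph that forces the color of a vertex\<close>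

lemma ex_permutation:
  assumes "finite X" "A \<subseteq> X" "B \<subseteq> X" "card A = card B"
  obtains \<pi> where "bij_betw \<pi> X X" "\<pi> ` A = B"
proof -
  have fin: "finite A" "finite B" using assms finite_subset by blast+
  obtain f where f: "bij_betw f A B" using fin assms(4) finite_same_card_bij by blast
  have "card (X - A) = card (X - B)" using assms fin by (simp add: card_Diff_subset)
  then obtain g where g: "bij_betw g (X - A) (X - B)"
    using assms(1) finite_same_card_bij by blast
  define \<pi> where "\<pi> x = (if x \<in> A then f x else g x)" for x
  have "bij_betw \<pi> A B" using f by (rule bij_betw_cong[THEN iffD1, rotated]) (simp add: \<pi>_def)
  moreover have "bij_betw \<pi> (X - A) (X - B)"
    using g by (rule bij_betw_cong[THEN iffD1, rotated]) (simp add: \<pi>_def)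
  ultimately have "bij_betw \<pi> (A \<union> (X - A)) (B \<union> (X - B))" by (rule bij_betw_combine) auto
  moreover have "A \<union> (X - A) = X" "B \<union> (X - B) = X" using assms by auto
  moreover have "\<pi> ` A = B" using \<open>bij_betw \<pi> A B\<close> by (simp add: bij_betw_def)
  ultimately show ?thesis using that by simp
qed

definition forcing :: "nat => nat => 'v set => ('v => 'v => bool) => 'v => bool" where
  "forcing l k V E u <-> finite V & u \<in> V & fch k (%_. l) V E & (\<exists>s. \<forall>x y. E x y --> s x ~= (s y :: bool)) &
    (\<forall>a\<in>{1..k}. \<exists>L. lists_on k (%_. l) V L & (\<forall>c. col V E L c --> c u = a))"

text \<open>For given lists, any one coloring c shows that at most the color \<open>c u\<close> is
  blocked.\<close>

lemma forcing_gadget: assumes "forcing l k V E u" shows "gadget l k 1 V E {u}"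
proof -
  obtain s where s: "!!x y. E x y ==> s x ~= (s y :: bool)" using assms by (auto simp: forcing_def)
  have "\<exists>s. (\<forall>x y. E x y --> s x ~= s y) & (\<forall>x\<in>{u}. s x)"
    by (rule exI[of _ "%x. s x = s u"]) (use s in auto)
  moreover have "\<exists>K. finite K & card K \<le> 1 & (\<forall>a\<in>{1..k} - K. \<exists>c. col V E L c & a ~: c ` {u})"
    if L: "lists_on k (%_. l) V L" for L
  proof -
    have "fch k (%_. l) V E" using assms by (simp add: forcing_def)
    then obtain c where c: "col V E L c" using fchD L by blast
    show ?thesis by (rule exI[of _ "{c u}"]) (use c in auto)
  qed
  moreover have "\<exists>L. lists_on k (%_. l) V L & (\<forall>c. col V E L c --> J \<subseteq> c ` {u})"
    if "J \<subseteq> {1..k}" "card J = 1" for J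
  proof -
    obtain a where "J = {a}" using \<open>card J = 1\<close> card_1_singletonE by blast
    then show ?thesis using assms that unfolding forcing_def by fastforce
  qed
  ultimately show ?thesis using assms by (auto simp: gadget_def forcing_def)
qed

text \<open>Both sides carry all l-subsets of {1..2l-1}. The colors used on one side meet every such
  set, so at least l of them lie in {1..2l-1}; they contain an l-set, and the vertex with this list
  on the other side has no color left.\<close>

lemma complete_bipartite_not_fch:
  assumes "l \<ge> 1" "k \<ge> 2 * l - 1"
  shows "\<exists>V (s :: nat set \<times> bool => bool). finite V & ~ fch k (%_. l) V (%x y. s x & ~ s y)"
proof -
  define N where "N = {1..2 * l - 1}"
  define F where "F = {A. A \<subseteq> N & card A = l}"
  have N: "finite N" "card N = 2 * l - 1" "N \<subseteq> {1..k}" using assms by (auto simp: N_def)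
  have "finite F" unfolding F_def using N by simp
  have "~ fch k (%_. l) (F \<times> UNIV) (%x y. snd x & ~ snd y)"
  proof
    assume "fch k (%_. l) (F \<times> UNIV) (%x y. snd x & ~ snd y)"
    moreover have "lists_on k (%_. l) (F \<times> UNIV) fst" using N by (auto simp: lists_on_def F_def)
    ultimately obtain c where c: "col (F \<times> UNIV) (%x y. snd x & ~ snd y) fst c" using fchD by blast
    define C where "C = N \<inter> (%A. c (A, True)) ` F"
    have fC: "finite C" "C \<subseteq> N" using N by (auto simp: C_def)
    have "card C \<ge> l"
    proof (rule ccontr)
      assume "~ l \<le> card C"
      then have "l \<le> card (N - C)" using fC N by (simp add: card_Diff_subset)
      then obtain A where A: "A \<subseteq> N - C" "card A = l" using obtain_subset_with_card_n by blast
      then have "A \<in> F" by (auto simp: F_def)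
      then have "c (A, True) \<in> A" using c by (auto simp: col_def)
      moreover have "c (A, True) \<in> C" using A \<open>A \<in> F\<close> \<open>c (A, True) \<in> A\<close> by (auto simp: C_def)
      ultimately show False using A by blast
    qed
    then obtain A where A: "A \<subseteq> C" "card A = l" using obtain_subset_with_card_n by blast
    then have AF: "A \<in> F" using fC by (auto simp: F_def)
    then have "c (A, False) \<in> A" using c by (auto simp: col_def)
    then have "c (A, False) \<in> C" using A by blast
    then obtain B where "B \<in> F" "c (A, False) = c (B, True)" by (auto simp: C_def)
    moreover have h: "\<forall>u\<in>F \<times> UNIV. \<forall>v\<in>F \<times> UNIV. snd u & ~ snd v --> c u ~= c v"
      using c unfolding col_def by (rule conjunct2)
    ultimately show False using AF h[THEN bspec, of "(B, True)", THEN bspec, of "(A, False)"] by simp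
  qed
  then show ?thesis using \<open>finite F\<close> by (intro exI[of _ "F \<times> UNIV"] exI[of _ snd]) simp
qed

text \<open>In an edge-minimal bipartite graph that is not choosable, the lists of some bad assignment
  differ along an edge; deleting that edge turns an endpoint into the attachment point of a gadget
  that kills some, but not all, colors of a list there.\<close>

lemma partial_gadget:
  fixes V0 :: "'v set"
  assumes "l \<ge> 2" "finite V0" "~ fch k (%_. l) V0 (%x y. s x & ~ s y)"
  shows "\<exists>j (R :: 'v set) E S. 1 \<le> j & j < l & gadget l k j R E S"
proof -
  note V = assms(2,3)
  define bad where "bad F <-> F \<subseteq> V0 \<times> V0 & (\<forall>(x, y)\<in>F. s x & ~ s y) & ~ fch k (%_. l) V0 (%x y. (x, y) \<in> F)"
    for F
  let ?F0 = "{(x, y). x \<in> V0 & y \<in> V0 & s x & ~ s y}"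
  have "fch k (%_. l) V0 (%x y. (x, y) \<in> ?F0) = fch k (%_. l) V0 (%x y. s x & ~ s y)"
    by (simp add: fch_def col_def)
  then have "bad ?F0" using V(2) by (auto simp: bad_def)
  then obtain F where F: "bad F" "!!F'. bad F' ==> card F \<le> card F'"
    using ex_has_least_nat[of bad ?F0 card] by blast
  have "F \<subseteq> V0 \<times> V0" using F(1) by (simp add: bad_def)
  then have finF: "finite F" using V(1) by (meson finite_SigmaI finite_subset)
  have sF: "s x" "~ s y" "x \<in> V0" "y \<in> V0" if "(x, y) \<in> F" for x y
    using F(1) that unfolding bad_def by blast+
  obtain L where L: "lists_on k (%_. l) V0 L" "!!c. ~ col V0 (%x y. (x, y) \<in> F) L c"
    using F(1) unfolding bad_def fch_def by blast
  have "\<exists>(x, y)\<in>F. L x ~= L y"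
  proof (rule ccontr)
    assume eq: "~ (\<exists>(x, y)\<in>F. L x ~= L y)"
    \<comment> \<open>If lists agree along all edges, minima on one side and maxima on the other
      never clash, since every list has at least two elements.\<close>
    define c where "c v = (if s v then Min (L v) else Max (L v))" for v
    have Lv: "finite (L v)" "card (L v) \<ge> 2" "L v ~= {}" if "v \<in> V0" for v
    proof -
      have "L v \<subseteq> {1..k}" "card (L v) = l" using L(1) that by (auto simp: lists_on_def)
      then show "finite (L v)" "card (L v) \<ge> 2" "L v ~= {}" using assms finite_subset by auto
    qed
    have mm: "Min (L v) ~= Max (L v)" if "v \<in> V0" for v
    proof
      assume m: "Min (L v) = Max (L v)"
      have "L v \<subseteq> {Min (L v)}"
        using Lv[OF that] m by (metis Max_ge Min_le antisym singletonI subsetI)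
      then show False using Lv(2)[OF that] card_mono[of "{Min (L v)}" "L v"] by simp
    qed
    have "col V0 (%x y. (x, y) \<in> F) L c"
      unfolding col_def
    proof (intro conjI ballI impI)
      fix v assume "v \<in> V0" then show "c v \<in> L v" using Lv by (simp add: c_def)
    next
      fix x y assume "(x, y) \<in> F"
      moreover from this have "L x = L y" using eq by blast
      ultimately show "c x ~= c y" using sF[of x y] mm[of x] by (simp add: c_def)
    qed
    then show False using L(2) by blast
  qed
  then obtain x y where xy: "(x, y) \<in> F" "L x ~= L y" by blast
  define E where "E a b <-> (a, b) \<in> F - {(x, y)}" for a b
  have "fch k (%_. l) V0 E"
  proof (rule ccontr)
    assume "~ fch k (%_. l) V0 E"
    then have "bad (F - {(x, y)})" using F(1) unfolding bad_def E_def by auto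
    moreover have "card (F - {(x, y)}) < card F" using finF xy(1) by (intro psubset_card_mono) auto
    ultimately show False using F(2) by (meson leD)
  qed
  note fcE = this
  define R where "R = V0 - {y}"
  define S where "S = {r \<in> R. E r y}"
  define Kl where "Kl M = {a \<in> {1..k}. \<forall>c. col R E M c --> a \<in> c ` S}" for M
  have Kl_fin: "finite (Kl M)" for M by (simp add: Kl_def)
  have extend: "col V0 E M (c(y := a))" if "col R E M c" "a \<in> M y" "a ~: c ` S" for M c a
    unfolding col_def
  proof (intro conjI ballI impI)
    fix v assume "v \<in> V0" then show "(c(y := a)) v \<in> M v" using that by (auto simp: col_def R_def)
  next
    fix u v assume uv: "u \<in> V0" "v \<in> V0" "E u v"
    have "u ~= y" using uv(3) sF[of u v] sF[OF xy(1)] by (auto simp: E_def)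
    then show "(c(y := a)) u ~= (c(y := a)) v"
      using uv that by (cases "v = y") (auto simp: col_def R_def S_def)
  qed
  have yV: "y \<in> V0" "x \<in> V0" "x ~= y" using sF[OF xy(1)] by auto
  \<comment> \<open>If l colors were blocked, they would be a list for \<open>y\<close> from which
    the graph without the deleted edge could not be colored, against minimality.\<close>
  have Klt: "card (Kl M) < l" if M: "lists_on k (%_. l) R M" for M
  proof (rule ccontr)
    assume "~ card (Kl M) < l"
    then obtain A where A: "A \<subseteq> Kl M" "card A = l" using obtain_subset_with_card_n by (meson not_less)
    have "lists_on k (%_. l) V0 (M(y := A))"
      using M A by (auto simp: lists_on_def R_def Kl_def)
    then obtain c where c: "col V0 E (M(y := A)) c" using fcE fchD by blast
    have cR: "c v \<in> M v" if "v \<in> R" for v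
    proof -
      have "v \<in> V0" "v ~= y" using that by (auto simp: R_def)
      moreover have "c v \<in> (M(y := A)) v" using c \<open>v \<in> V0\<close> unfolding col_def by blast
      ultimately show ?thesis by simp
    qed
    then have "col R E M c" using c by (simp add: col_def R_def)
    moreover have "c y \<in> (M(y := A)) y" using c yV unfolding col_def by blast
    then have "c y \<in> Kl M" using A by auto
    ultimately have "c y \<in> c ` S" by (auto simp: Kl_def)
    then obtain r where "r \<in> R" "E r y" "c y = c r" by (auto simp: S_def)
    then show False using c yV unfolding col_def R_def by fastforce
  qed
  define P where "P m <-> (\<exists>M. lists_on k (%_. l) R M & card (Kl M) = m)" for m
  have LR: "lists_on k (%_. l) R L" using L(1) by (auto simp: lists_on_def R_def)
  have Pl: "\<forall>m. P m --> m \<le> l" using Klt unfolding P_def by (auto simp: less_imp_le)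
  have PL: "P (card (Kl L))" using LR by (auto simp: P_def)
  \<comment> \<open>With the maximum over all lists, no lists block more than j colors and some
    lists block exactly j.\<close>
  define j where "j = (GREATEST m. P m)"
  have Pj: "P j" unfolding j_def by (rule GreatestI_nat[of P, OF PL]) (use Pl in blast)
  have jmax: "m \<le> j" if "P m" for m unfolding j_def by (rule Greatest_le_nat[of P, OF that]) (use Pl in blast)
  have "card (Kl L) \<ge> 1"
  proof -
    have Lxy: "finite (L x)" "card (L x) = card (L y)" "finite (L y)" "L y \<subseteq> {1..k}"
      using L(1) yV finite_subset[of "L x" "{1..k}"] finite_subset[of "L y" "{1..k}"]
      by (auto simp: lists_on_def)
    then obtain a where a: "a \<in> L y" "a ~: L x" using xy(2) by (metis card_subset_eq subsetI)
    have "a \<in> Kl L" unfolding Kl_def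
    proof (intro CollectI conjI allI impI)
      show "a \<in> {1..k}" using a(1) Lxy(4) by blast
      fix c assume c: "col R E L c"
      show "a \<in> c ` S"
      proof (rule ccontr)
        assume "a ~: c ` S"
        then have c': "col V0 E L (c(y := a))" using extend c a by blast
        have "c x \<in> L x" using c yV by (auto simp: col_def R_def)
        then have "c x ~= a" using a by blast
        then have "col V0 (%x y. (x, y) \<in> F) L (c(y := a))"
          using c' yV unfolding col_def E_def by fastforce
        then show False using L(2) by blast
      qed
    qed
    then have "Kl L ~= {}" by blast
    then show ?thesis using Kl_fin by (simp add: Suc_le_eq card_gt_0_iff)
  qed
  then have "1 \<le> j" using jmax[OF PL] by linarith
  moreover have "j < l" using Pj Klt unfolding P_def by blast
  moreover have "gadget l k j R E S"
    unfolding gadget_def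
  proof (intro conjI allI impI)
    show "finite R" "S \<subseteq> R" using V(1) by (auto simp: R_def S_def)
  next
    fix M assume M: "lists_on k (%_. l) R M"
    have "card (Kl M) \<le> j" using jmax M by (auto simp: P_def)
    moreover have "\<forall>a\<in>{1..k} - Kl M. \<exists>c. col R E M c & a ~: c ` S" by (auto simp: Kl_def)
    ultimately show "\<exists>K. finite K & card K \<le> j & (\<forall>a\<in>{1..k} - K. \<exists>c. col R E M c & a ~: c ` S)"
      using Kl_fin by blast
  next
    fix J assume J: "J \<subseteq> {1..k}" "card J = j"
    obtain M where M: "lists_on k (%_. l) R M" "card (Kl M) = j" using Pj by (auto simp: P_def)
    have "Kl M \<subseteq> {1..k}" by (auto simp: Kl_def)
    \<comment> \<open>A permutation of the palette carries the colors that happen to be blocked to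
      the prescribed set \<open>J\<close>.\<close>
    then obtain \<pi> where \<pi>: "bij_betw \<pi> {1..k} {1..k}" "\<pi> ` Kl M = J"
      using ex_permutation[of "{1..k}" "Kl M" J] J M(2) by auto
    have inj: "inj_on \<pi> {1..k}" using \<pi>(1) by (simp add: bij_betw_def)
    define rh where "rh = inv_into {1..k} \<pi>"
    have rh: "rh (\<pi> a) = a" if "a \<in> {1..k}" for a using inj that by (simp add: rh_def)
    have Msub: "M v \<subseteq> {1..k}" "card (M v) = l" if "v \<in> R" for v using M(1) that by (auto simp: lists_on_def)
    have "lists_on k (%_. l) R (%v. \<pi> ` M v)"
      unfolding lists_on_def
    proof (intro ballI conjI)
      fix v assume v: "v \<in> R"
      show "\<pi> ` M v \<subseteq> {1..k}" using Msub[OF v] \<pi>(1) unfolding bij_betw_def by blast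
      show "card (\<pi> ` M v) = l" using Msub[OF v] inj by (metis card_image inj_on_subset)
    qed
    moreover have "J \<subseteq> c ` S" if c: "col R E (%v. \<pi> ` M v) c" for c
    proof -
      have pc: "rh (c v) \<in> M v & \<pi> (rh (c v)) = c v" if v: "v \<in> R" for v
      proof -
        have "c v \<in> \<pi> ` M v" using c v by (auto simp: col_def)
        then obtain a where a: "a \<in> M v" "c v = \<pi> a" by blast
        then have "rh (c v) = a" using Msub[OF v] rh by auto
        then show ?thesis using a by simp
      qed
      have "col R E M (%v. rh (c v))"
        unfolding col_def
      proof (intro conjI ballI impI)
        fix u v assume "u \<in> R" "v \<in> R" "E u v"
        then show "rh (c u) ~= rh (c v)" using c pc unfolding col_def by metis
      qed (use pc in blast)
      then have K: "Kl M \<subseteq> (%v. rh (c v)) ` S" by (auto simp: Kl_def)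
      show ?thesis
      proof
        fix b assume "b \<in> J"
        then obtain a where "a \<in> Kl M" "b = \<pi> a" using \<pi>(2) by blast
        then obtain r where "r \<in> S" "a = rh (c r)" using K by blast
        then show "b \<in> c ` S" using pc[of r] \<open>b = \<pi> a\<close> by (auto simp: S_def)
      qed
    qed
    ultimately show "\<exists>L. lists_on k (%_. l) R L & (\<forall>c. col R E L c --> J \<subseteq> c ` S)" by blast
  next
    have "\<forall>u v. E u v --> s u ~= s v" using sF by (auto simp: E_def)
    moreover have "\<forall>r\<in>S. s r" using sF by (auto simp: S_def E_def)
    ultimately show "\<exists>s. (\<forall>u v. E u v --> s u ~= s v) & (\<forall>x\<in>S. s x)" by blast
  qed
  ultimately show ?thesis by blast
qed

lemma ex_partial_gadget:
  assumes "l \<ge> 2" "k \<ge> 2 * l - 1"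
  shows "\<exists>j (R :: (nat set \<times> bool) set) E S. 1 \<le> j & j < l & gadget l k j R E S"
  using complete_bipartite_not_fch[of l k] partial_gadget[of l] assms
  by (metis One_nat_def Suc_1 Suc_leD)

lemma attE_bipartite:
  fixes s :: "'v => bool"
  assumes "!!u v. E u v ==> s u ~= s v" "gadget l k j R ER S"
  shows "\<exists>s' :: ('v + 'v \<times> nat \<times> 'r) => bool. \<forall>x y. attE E ER S x y --> s' x ~= s' y"
proof -
  have "\<exists>t. (\<forall>u v. ER u v --> t u ~= t v) & (\<forall>x\<in>S. t x)"
    using assms(2) unfolding gadget_def by (elim conjE)
  then obtain t where t0: "(\<forall>u v. ER u v --> t u ~= t v) & (\<forall>x\<in>S. t x)" by (rule exE)
  have t: "!!u v. ER u v ==> t u ~= t v" "!!x. x \<in> S ==> t x"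
    using conjunct1[OF t0] conjunct2[OF t0] by blast+
  \<comment> \<open>All attachment points have \<open>t\<close> true, so each copy is placed with
    that side opposite to its vertex.\<close>
  define s' where "s' w = (case w of Inl v => s v | Inr (v, i, r) => (s v ~= t r))" for w :: "'v + 'v \<times> nat \<times> 'r"
  have "s' x ~= s' y" if xy: "attE E ER S x y" for x y
  proof (cases x)
    case (Inl u)
    show ?thesis
    proof (cases y)
      case y: (Inl v)
      then show ?thesis using xy Inl assms(1)[of u v] by (simp add: s'_def)
    next
      case y: (Inr w)
      obtain v i r where w: "w = (v, i, r)" by (cases w)
      then show ?thesis using xy Inl y t(2)[of r] by (simp add: s'_def)
    qed
  next
    case (Inr z)
    obtain u i r where z: "z = (u, i, r)" by (cases z)
    show ?thesis
    proof (cases y)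
      case y: (Inl v)
      then show ?thesis using xy Inr z by simp
    next
      case y: (Inr w)
      obtain v i' r' where w: "w = (v, i', r')" by (cases w)
      have "ER r r'" "u = v" using xy Inr y z w by simp_all
      then have "t r ~= t r'" using t(1) by blast
      then show ?thesis using Inr y z w \<open>u = v\<close> by (simp add: s'_def)
    qed
  qed
  then show ?thesis by blast
qed

text \<open>Induction on l. Attaching q = (l - 1) div j copies of a gadget of capacity j turns lists
  of size l into lists of size m = l - q * j with 1 \<le> m < l, and a forcing graph for m exists
  because k >= 2l - 1 >= 2m - 1. For m = 1 a single vertex is forced by its list.\<close>

theorem ex_forcing:
  "l \<ge> 1 ==> k \<ge> 2 * l - 1 ==> \<exists>(V :: nat set) E u. forcing l k V E u"
proof (induction l rule: less_induct)
  case (less l)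
  show ?case
  proof (cases "l = 1")
    case True
    have "forcing l k {0::nat} (%_ _. False) 0"
      unfolding forcing_def
    proof (intro conjI ballI)
      show "fch k (%_. l) {0::nat} (%_ _. False)"
        unfolding fch_def
      proof (intro allI impI)
        fix L assume "lists_on k (%_. l) {0::nat} L"
        then have "L 0 ~= {}" using True by (auto simp: lists_on_def)
        then obtain a where "a \<in> L 0" by blast
        then show "\<exists>c. col {0} (%_ _. False) L c" by (intro exI[of _ "%_. a"]) (simp add: col_def)
      qed
      fix a assume "a \<in> {1..k}"
      then show "\<exists>L. lists_on k (%_. l) {0::nat} L & (\<forall>c. col {0} (%_ _. False) L c --> c 0 = a)"
        using True by (intro exI[of _ "%_. {a}"]) (auto simp: lists_on_def col_def)
    qed auto
    then show ?thesis by blast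
  next
    case False
    then have l: "l \<ge> 2" "l \<le> k" using less.prems by auto
    obtain j and R :: "(nat set \<times> bool) set" and ER S where j: "1 \<le> j" "j < l" and g: "gadget l k j R ER S"
      using ex_partial_gadget[OF l(1) less.prems(2)] by blast
    define q where "q = (l - 1) div j"
    define m where "m = l - q * j"
    have qj: "q * j \<le> l - 1" unfolding q_def by (simp add: div_times_less_eq_dividend)
    have m1: "1 \<le> m" "m + q * j = l" using qj l by (auto simp: m_def)
    have "m < l"
    proof -
      have "q \<ge> 1" unfolding q_def using j by (simp add: div_greater_zero_iff Suc_le_eq)
      then have "1 * 1 \<le> q * j" using j by (intro mult_le_mono) auto
      then show ?thesis using m1 by linarith
    qed
    have "2 * m - 1 \<le> k" using \<open>m < l\<close> less.prems by linarith
    then obtain V :: "nat set" and E u where f: "forcing m k V E u" using less.IH[OF \<open>m < l\<close> m1(1)] by blast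
    let ?V = "attV V (%_. q) R" and ?E = "attE E ER S"
    have finV: "finite ?V"
    proof -
      have "{(v, i, r). v \<in> V & i < q & r \<in> R} = V \<times> {..<q} \<times> R" by auto
      then show ?thesis using f g by (simp add: attV_def forcing_def gadget_def)
    qed
    have fc: "fch k (%_. l) ?V ?E"
      by (rule attach_fch[OF g, where f = "%_. m"]) (use m1 f in "auto simp: forcing_def")
    obtain s where s: "!!x y. E x y ==> s x ~= (s y :: bool)" using f by (auto simp: forcing_def)
    have "\<exists>s'. \<forall>x y. ?E x y --> s' x ~= (s' y :: bool)" by (rule attE_bipartite[OF s g])
    then obtain s' where s': "\<forall>x y. ?E x y --> s' x ~= (s' y :: bool)" by (rule exE)
    \<comment> \<open>Attaching enlarges the type of vertices; renaming them by natural numbers lets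
      the induction stay within one type.\<close>
    obtain \<phi> :: "nat + nat \<times> nat \<times> nat set \<times> bool => nat" where \<phi>: "inj_on \<phi> ?V"
      using finite_imp_inj_to_nat_seg[OF finV] by blast
    define \<psi> where "\<psi> = inv_into ?V \<phi>"
    have \<psi>: "\<psi> (\<phi> w) = w" if "w \<in> ?V" for w using \<phi> that by (simp add: \<psi>_def)
    define E' where "E' a b <-> a \<in> \<phi> ` ?V & b \<in> \<phi> ` ?V & ?E (\<psi> a) (\<psi> b)" for a b
    have uV: "Inl u \<in> ?V" using f by (auto simp: attV_def forcing_def)
    have "forcing l k (\<phi> ` ?V) E' (\<phi> (Inl u))"
      unfolding forcing_def
    proof (intro conjI ballI)
      show "finite (\<phi> ` ?V)" "\<phi> (Inl u) \<in> \<phi> ` ?V" using finV uV by auto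
      show "fch k (%_. l) (\<phi> ` ?V) E'"
        using fch_iso[OF \<phi>, of ?E E' "%_. l" "%_. l" k] \<psi> fc by (simp add: E'_def)
      show "\<exists>s. \<forall>x y. E' x y --> s x ~= (s y :: bool)"
        by (rule exI[of _ "%a. s' (\<psi> a)"]) (use s' in "simp add: E'_def")
      fix a assume "a \<in> {1..k}"
      then obtain L where L: "lists_on k (%_. m) V L" "!!c. col V E L c ==> c u = a"
        using f unfolding forcing_def by blast
      have "\<exists>L'. lists_on k (%_. l) ?V L' & (\<forall>c. col ?V ?E L' c --> col V E L (%v. c (Inl v)))"
        by (rule attach_lists[OF g _ l(2) L(1)]) (use m1 in simp)
      then obtain L' where L': "lists_on k (%_. l) ?V L'" "!!c. col ?V ?E L' c ==> col V E L (%v. c (Inl v))"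
        by blast
      have "lists_on k (%_. l) (\<phi> ` ?V) (%b. L' (\<psi> b))" using L'(1) \<psi> by (auto simp: lists_on_def)
      moreover have "c (\<phi> (Inl u)) = a" if c: "col (\<phi> ` ?V) E' (%b. L' (\<psi> b)) c" for c
      proof -
        have "col ?V ?E L' (%w. c (\<phi> w))" using c \<psi> by (auto simp: col_def E'_def)
        from L(2)[OF L'(2)[OF this]] show ?thesis .
      qed
      ultimately show "\<exists>L. lists_on k (%_. l) (\<phi> ` ?V) L &
          (\<forall>c. col (\<phi> ` ?V) E' L c --> c (\<phi> (Inl u)) = a)" by blast
    qed
    then show ?thesis by blast
  qed
qed

section \<open>The reduction graph\<close>

text \<open>\<open>K a d\<close> says that a connecting piece between two vertices rules out colors \<open>a\<close> and \<open>d\<close> for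
  them; a path of vertices with lists of size 2 has a thin relation \<open>K\<close>.\<close>

definition thin :: "(nat => nat => bool) => bool" where
  "thin K <-> (\<forall>a d d'. K a d --> K a d' --> d = d') &
     (\<forall>a a' d d'. K a d --> K a' d' --> a ~= a' --> d = a' & d' = a)"

definition kill1 :: "nat set => nat => nat => bool" where
  "kill1 M a d <-> (\<forall>c\<in>M. c = a | c = d)"

definition kill3 :: "nat set => nat set => nat set => nat => nat => bool" where
  "kill3 Y1 Y2 Y3 a d <-> (\<forall>x\<in>Y1. \<forall>y\<in>Y2. \<forall>z\<in>Y3. x = a | x = y | y = z | z = d)"

lemma kill1_form: assumes "card M = 2" "kill1 M a d" shows "M = {a, d}" "a ~= d"
proof -
  obtain x y where "M = {x, y}" "x ~= y" using assms(1) by (auto simp: card_2_iff)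
  then show "M = {a, d}" "a ~= d" using assms(2) by (auto simp: kill1_def)
qed

lemma two_elem_cases:
  assumes "card Y = 2" "!!y. y \<in> Y ==> y ~= a ==> y = (c::nat)"
  shows "Y = {a, c}" "a ~= c"
proof -
  obtain x y where "Y = {x, y}" "x ~= y" using assms(1) by (auto simp: card_2_iff)
  then show "Y = {a, c}" "a ~= c" using assms(2)[of x] assms(2)[of y] by auto
qed

text \<open>Each color of the first vertex other than \<open>a\<close>, and each color of the second
  other than that one, determines the lists that follow. Two such choices would ask for different
  lists, so the lists must be linked in a chain from \<open>a\<close> to \<open>d\<close>.\<close>

lemma kill3_form:
  assumes Y: "card Y1 = 2" "card Y2 = 2" "card Y3 = 2" and k: "kill3 Y1 Y2 Y3 a d"
  shows "\<exists>c1 c2. Y1 = {a, c1} & a ~= c1 & Y2 = {c1, c2} & c1 ~= c2 & Y3 = {c2, d} & c2 ~= d"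
proof -
  have 3: "Y3 = {y, d} & y ~= d" if "x \<in> Y1" "x ~= a" "y \<in> Y2" "y ~= x" for x y
  proof -
    have "x = a | x = y | y = z | z = d" if "z \<in> Y3" for z
      using k \<open>x \<in> Y1\<close> \<open>y \<in> Y2\<close> \<open>z \<in> Y3\<close> unfolding kill3_def by blast
    then have "kill1 Y3 y d" using that by (auto simp: kill1_def)
    then show ?thesis using kill1_form[OF Y(3)] by blast
  qed
  have 2: "\<exists>c2. Y2 = {x, c2} & x ~= c2 & Y3 = {c2, d} & c2 ~= d" if x: "x \<in> Y1" "x ~= a" for x
  proof -
    obtain c2 where c2: "c2 \<in> Y2" "c2 ~= x" using Y(2) by (auto simp: card_2_iff)
    have "y = c2" if "y \<in> Y2" "y ~= x" for y
      using 3[OF x that] 3[OF x c2] by (auto simp: doubleton_eq_iff)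
    then have "Y2 = {x, c2}" "x ~= c2" using two_elem_cases[OF Y(2), of x c2] by blast+
    then show ?thesis using 3[OF x c2] by blast
  qed
  obtain c1 where c1: "c1 \<in> Y1" "c1 ~= a" using Y(1) by (auto simp: card_2_iff)
  have "x = c1" if x: "x \<in> Y1" "x ~= a" for x
    using 2[OF x] 2[OF c1] by (auto simp: doubleton_eq_iff)
  then have "Y1 = {a, c1}" "a ~= c1" using two_elem_cases[OF Y(1), of a c1] by blast+
  then show ?thesis using 2[OF c1] by blast
qed

lemma thin_kill1:
  assumes "card M = 2"
  shows "thin (kill1 M)" "~ kill1 M a a"
proof -
  have 1: "d = d'" if "kill1 M a d" "kill1 M a d'" for a d d'
    using kill1_form[OF assms that(1)] kill1_form[OF assms that(2)] by (auto simp: doubleton_eq_iff)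
  have 2: "d = a' & d' = a" if "kill1 M a d" "kill1 M a' d'" "a ~= a'" for a a' d d'
    using kill1_form[OF assms that(1)] kill1_form[OF assms that(2)] that(3) by (auto simp: doubleton_eq_iff)
  show "thin (kill1 M)" unfolding thin_def using 1 2 by blast
  show "~ kill1 M a a" using kill1_form[OF assms] by blast
qed

lemma thin_kill3:
  assumes "card Y1 = 2" "card Y2 = 2" "card Y3 = 2"
  shows "thin (kill3 Y1 Y2 Y3)"
proof -
  have 1: "d = d'" if "kill3 Y1 Y2 Y3 a d" "kill3 Y1 Y2 Y3 a d'" for a d d'
    using kill3_form[OF assms that(1)] kill3_form[OF assms that(2)] by (auto simp: doubleton_eq_iff)
  have 2: "d = a' & d' = a" if k: "kill3 Y1 Y2 Y3 a d" "kill3 Y1 Y2 Y3 a' d'" and ne: "a ~= a'" for a a' d d'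
  proof -
    obtain c1 c2 where c: "Y1 = {a, c1}" "a ~= c1" "Y2 = {c1, c2}" "c1 ~= c2" "Y3 = {c2, d}" "c2 ~= d"
      using kill3_form[OF assms k(1)] by blast
    obtain e1 e2 where e: "Y1 = {a', e1}" "a' ~= e1" "Y2 = {e1, e2}" "e1 ~= e2" "Y3 = {e2, d'}" "e2 ~= d'"
      using kill3_form[OF assms k(2)] by blast
    have 1: "c1 = a'" "e1 = a" using c(1) e(1) ne by (auto simp: doubleton_eq_iff)
    have 2: "c2 = a" "e2 = a'" using c(3) e(3) ne 1 by (auto simp: doubleton_eq_iff)
    show ?thesis using c(5) e(5) ne 2 by (auto simp: doubleton_eq_iff)
  qed
  show ?thesis unfolding thin_def using 1 2 by blast
qed

lemma thinD1: "thin K ==> K a d ==> K a d' ==> d = d'"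
  and thinD2: "thin K ==> K a d ==> K a' d' ==> a ~= a' ==> d = a' & d' = a"
  unfolding thin_def by blast+

text \<open>If the two color sets differ, a thin relation holds for at most one of the four pairs,
  since two pairs would force the sets to be equal; three relations leave a pair. If the sets are
  equal, the pairs \<open>v, v\<close> and \<open>v', v'\<close> escape \<open>K1\<close> and
  \<open>K2\<close>, and \<open>K3\<close> cannot hold for both.\<close>

lemma thin3_survivor:
  assumes K: "thin K1" "thin K2" "thin K3" "!!a. ~ K1 a a" "!!a. ~ K2 a a" "v ~= v'" "w ~= w'"
  shows "\<exists>s\<in>{v, v'}. \<exists>t\<in>{w, w'}. ~ K1 s t & ~ K2 s t & ~ K3 s t"
proof (cases "{v, v'} = {w, w'}")
  case True
  have "~ K3 v v | ~ K3 v' v'" using thinD2[OF K(3), of v v v' v'] K(6) by blast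
  moreover have "v \<in> {w, w'}" "v' \<in> {w, w'}" using True by blast+
  ultimately show ?thesis using K(4,5) by blast
next
  case False
  let ?A = "%K. {(s, t) \<in> {v, v'} \<times> {w, w'}. K s t}"
  have le1: "card (?A K) \<le> 1" if "thin K" for K
  proof -
    have "x = y" if xy: "x \<in> ?A K" "y \<in> ?A K" for x y
    proof -
      obtain s t s' t' where st: "x = (s, t)" "y = (s', t')" by (cases x; cases y)
      have m: "s \<in> {v, v'}" "s' \<in> {v, v'}" "t \<in> {w, w'}" "t' \<in> {w, w'}" "K s t" "K s' t'"
        using xy st by auto
      show ?thesis
      proof (cases "s = s'")
        case True
        then show ?thesis using thinD1[OF \<open>thin K\<close>] m st by blast
      next
        case ne: False
        have "t = s'" "t' = s" using thinD2[OF \<open>thin K\<close> m(5,6) ne] by auto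
        then have "{v, v'} = {w, w'}" using m(1-4) ne by auto
        then show ?thesis using False by blast
      qed
    qed
    moreover have "finite (?A K)" by (rule finite_subset[of _ "{v, v'} \<times> {w, w'}"]) auto
    ultimately show ?thesis using card_le_Suc0_iff_eq[of "?A K"] by simp
  qed
  show ?thesis
  proof (rule ccontr)
    assume "~ ?thesis"
    then have "{v, v'} \<times> {w, w'} \<subseteq> ?A K1 \<union> ?A K2 \<union> ?A K3" by blast
    moreover have "finite (?A K1 \<union> ?A K2 \<union> ?A K3)"
      by (rule finite_subset[of _ "{v, v'} \<times> {w, w'}"]) auto
    ultimately have "card ({v, v'} \<times> {w, w'}) \<le> card (?A K1 \<union> ?A K2 \<union> ?A K3)" by (intro card_mono)
    also have "\<dots> \<le> card (?A K1) + card (?A K2) + card (?A K3)"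
      by (meson add_le_mono1 card_Un_le order_trans)
    also have "\<dots> \<le> 3" using le1[OF K(1)] le1[OF K(2)] le1[OF K(3)] by linarith
    finally show False using K(6,7) by (simp add: card_cartesian_product)
  qed
qed

lemma thin2_survivor:
  assumes "thin K1" "!!a. ~ K1 a a" "thin K2" "v ~= v'" "w ~= w'"
  shows "\<exists>s\<in>{v, v'}. \<exists>t\<in>{w, w'}. ~ K1 s t & ~ K2 s t"
  using thin3_survivor[of K1 "%_ _. False" K2 v v' w w'] assms by (simp add: thin_def)

lemma ex_two: assumes "card A \<ge> 3" obtains v v' where "v \<in> A" "v' \<in> A" "v ~= v'" "v ~= a" "v' ~= (a::'a)"
proof -
  have fin: "finite A" using assms card.infinite by fastforce
  have "card A \<le> Suc (card (A - {a}))" using fin by (cases "a \<in> A") (simp_all add: card_Suc_Diff1 del: card_Diff_singleton)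
  then have "2 \<le> card (A - {a})" using assms by linarith
  from obtain_subset_with_card_n[OF this] obtain B where "B \<subseteq> A - {a}" "card B = 2" by metis
  then show ?thesis using that by (auto simp: card_2_iff)
qed

lemma ex_other: assumes "card A \<ge> 2" obtains v where "v \<in> A" "v ~= (a::'a)"
proof -
  from obtain_subset_with_card_n[OF assms] obtain B where "B \<subseteq> A" "card B = 2" by metis
  then show ?thesis using that by (auto simp: card_2_iff)
qed

text \<open>The vertices 1 and 2 are joined by paths of lengths 2, 2 and 4: through 0, through 3,
  and through 4, 5, 6. Vertex 0 is the input of the graph, 1 and 2 are its outputs.\<close>

definition ge :: "nat => nat => bool" where
  "ge p p' <-> (p, p') \<in> {(0,1),(0,2),(3,1),(3,2),(1,4),(4,5),(5,6),(6,2)}"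

definition gcol :: "(nat => nat set) => (nat => nat) => bool" where
  "gcol LL g <-> (\<forall>p<7. g p \<in> LL p) & (\<forall>p p'. ge p p' --> g p ~= g p')"

definition glists :: "(nat => nat set) => bool" where
  "glists LL <-> (\<forall>p<7. card (LL p) = (if p = 1 | p = 2 then 3 else 2))"

lemma gcol_extend:
  assumes "x \<in> LL 0" "s \<in> LL 1" "t \<in> LL 2" "x ~= s" "x ~= t" "~ kill1 (LL 3) s t"
    "~ kill3 (LL 4) (LL 5) (LL 6) s t"
  shows "\<exists>g. gcol LL g & g 0 = x & g 1 = s & g 2 = t"
proof -
  obtain m where m: "m \<in> LL 3" "m ~= s" "m ~= t" using assms(6) by (auto simp: kill1_def)
  obtain y1 y2 y3 where y: "y1 \<in> LL 4" "y2 \<in> LL 5" "y3 \<in> LL 6" "y1 ~= s" "y1 ~= y2" "y2 ~= y3" "y3 ~= t"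
    using assms(7) by (auto simp: kill3_def)
  define g where "g p = (if p = 0 then x else if p = 1 then s else if p = 2 then t else if p = 3 then m
    else if p = 4 then y1 else if p = 5 then y2 else (y3::nat))" for p :: nat
  have "\<forall>p<7. g p \<in> LL p"
  proof (intro allI impI)
    fix p :: nat assume "p < 7"
    then have "p = 0 | p = 1 | p = 2 | p = 3 | p = 4 | p = 5 | p = 6" by linarith
    then show "g p \<in> LL p" using assms m y by (elim disjE) (simp_all add: g_def)
  qed
  moreover have "\<forall>p p'. ge p p' --> g p ~= g p'"
    unfolding ge_def using assms m y by (auto simp: g_def)
  ultimately show ?thesis unfolding gcol_def by (intro exI[of _ g]) (simp add: g_def)
qed

lemma glistsD:
  assumes "glists LL"
  shows "card (LL 0) = 2" "card (LL 1) = 3" "card (LL 2) = 3" "card (LL 3) = 2" "card (LL 4) = 2"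
    "card (LL 5) = 2" "card (LL 6) = 2"
  using assms unfolding glists_def by simp_all

text \<open>Vertices 1 and 2 keep two colors other than \<open>x\<close>, and only two of the three
  paths still have to be colored.\<close>

lemma gamma_ext: assumes "glists LL" "x \<in> LL 0" shows "\<exists>g. gcol LL g & g 0 = x"
proof -
  note c = glistsD[OF assms(1)]
  obtain v v' where v: "v \<in> LL 1" "v' \<in> LL 1" "v ~= v'" "v ~= x" "v' ~= x" using ex_two[of "LL 1"] c by auto
  obtain w w' where w: "w \<in> LL 2" "w' \<in> LL 2" "w ~= w'" "w ~= x" "w' ~= x" using ex_two[of "LL 2"] c by auto
  obtain s t where "s \<in> {v, v'}" "t \<in> {w, w'}" "~ kill1 (LL 3) s t" "~ kill3 (LL 4) (LL 5) (LL 6) s t"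
    using thin2_survivor[OF thin_kill1(1)[OF c(4)] thin_kill1(2)[OF c(4)] thin_kill3[OF c(5-7)] v(3) w(3)] by blast
  then show ?thesis using gcol_extend[of x LL s t] v w assms(2) by auto
qed

text \<open>The lists of size 3 pay for the forbidden colors: two colors remain at each output, and
  now all three paths, including the one through the input, enter the count of
  \<open>thin3_survivor\<close>.\<close>

lemma gamma_avoid:
  assumes "glists LL" shows "\<exists>g. gcol LL g & g 1 ~= \<alpha> & g 2 ~= \<beta>"
proof -
  note c = glistsD[OF assms(1)]
  obtain v v' where v: "v \<in> LL 1" "v' \<in> LL 1" "v ~= v'" "v ~= \<alpha>" "v' ~= \<alpha>" using ex_two[of "LL 1"] c by auto
  obtain w w' where w: "w \<in> LL 2" "w' \<in> LL 2" "w ~= w'" "w ~= \<beta>" "w' ~= \<beta>" using ex_two[of "LL 2"] c by auto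
  obtain s t where st: "s \<in> {v, v'}" "t \<in> {w, w'}" "~ kill1 (LL 3) s t" "~ kill1 (LL 0) s t"
      "~ kill3 (LL 4) (LL 5) (LL 6) s t"
    using thin3_survivor[OF thin_kill1(1)[OF c(4)] thin_kill1(1)[OF c(1)] thin_kill3[OF c(5-7)]
        thin_kill1(2)[OF c(4)] thin_kill1(2)[OF c(1)] v(3) w(3)] by blast
  obtain x where "x \<in> LL 0" "x ~= s" "x ~= t" using st(4) by (auto simp: kill1_def)
  then obtain g where "gcol LL g" "g 1 = s" "g 2 = t" using gcol_extend[of x LL s t] st v w by auto
  then show ?thesis using st v w by (intro exI[of _ g]) auto
qed

text \<open>Suppose each of the two input colors forces a color at vertex 1. Then for each input
  color \<open>x\<close> some color at 1 has all of \<open>LL 2 - {x}\<close> excluded by the two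
  other paths, one color by each path. Thinness makes the two colors at 1 equal, so the same two
  colors of \<open>LL 2\<close> are excluded both times and exhaust it, although it has
  three.\<close>

lemma gamma_free:
  assumes "glists LL" shows "\<exists>x\<in>LL 0. \<forall>\<omega>. \<exists>g. gcol LL g & g 0 = x & g 1 ~= \<omega>"
proof (rule ccontr)
  assume neg: "~ ?thesis"
  note c = glistsD[OF assms(1)]
  let ?K1 = "kill1 (LL 3)" and ?K3 = "kill3 (LL 4) (LL 5) (LL 6)"
  have row: "\<exists>v\<in>LL 1. \<forall>t\<in>LL 2 - {x}. ?K1 v t | ?K3 v t" if x: "x \<in> LL 0" for x
  proof -
    obtain \<omega> where \<omega>: "!!g. gcol LL g ==> g 0 = x ==> g 1 = \<omega>" using neg x by blast
    obtain v v' where v: "v \<in> LL 1" "v' \<in> LL 1" "v ~= v'" "v ~= x" "v' ~= x" using ex_two[of "LL 1"] c by auto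
    define u where "u = (if v = \<omega> then v' else v)"
    have u: "u \<in> LL 1" "u ~= x" "u ~= \<omega>" using v by (auto simp: u_def)
    have "?K1 u t | ?K3 u t" if t: "t \<in> LL 2 - {x}" for t
    proof (rule ccontr)
      assume "~ (?K1 u t | ?K3 u t)"
      then obtain g where "gcol LL g" "g 0 = x" "g 1 = u" using gcol_extend[of x LL u t] x u t by auto
      then show False using \<omega> u by blast
    qed
    then show ?thesis using u by blast
  qed
  obtain x1 x2 where x: "LL 0 = {x1, x2}" "x1 ~= x2" using c(1) by (auto simp: card_2_iff)
  obtain v1 where v1: "\<forall>t\<in>LL 2 - {x1}. ?K1 v1 t | ?K3 v1 t" using row[of x1] x by auto
  obtain v2 where v2: "\<forall>t\<in>LL 2 - {x2}. ?K1 v2 t | ?K3 v2 t" using row[of x2] x by auto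
  obtain w1 w1' where w1: "w1 \<in> LL 2" "w1' \<in> LL 2" "w1 ~= w1'" "w1 ~= x1" "w1' ~= x1" using ex_two[of "LL 2"] c by auto
  obtain w2 w2' where w2: "w2 \<in> LL 2" "w2' \<in> LL 2" "w2 ~= w2'" "w2 ~= x2" "w2' ~= x2" using ex_two[of "LL 2"] c by auto
  have t1: "thin ?K1" "thin ?K3" using thin_kill1(1)[OF c(4)] thin_kill3[OF c(5-7)] .
  have k: "?K1 v1 w1 & ?K3 v1 w1' | ?K1 v1 w1' & ?K3 v1 w1"
    using v1 w1 thinD1[OF t1(1)] thinD1[OF t1(2)] by blast
  have k': "?K1 v2 w2 & ?K3 v2 w2' | ?K1 v2 w2' & ?K3 v2 w2"
    using v2 w2 thinD1[OF t1(1)] thinD1[OF t1(2)] by blast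
  have v12: "v1 = v2"
    using k k' w1(3) w2(3) thinD2[OF t1(1)] thinD2[OF t1(2)] by metis
  have sub: "t = w1 | t = w1'" if "?K1 v1 t | ?K3 v1 t" for t
    using k that thinD1[OF t1(1)] thinD1[OF t1(2)] by metis
  have fin: "finite (LL 2)" using c(3) card.infinite by fastforce
  have "LL 2 \<subseteq> {w1, w1'}"
  proof
    fix t assume t: "t \<in> LL 2"
    have "t ~= x1 | t ~= x2" using x(2) by blast
    then show "t \<in> {w1, w1'}" using t v1 v2 v12 sub by auto
  qed
  then have "card (LL 2) \<le> card {w1, w1'}" by (intro card_mono) auto
  then show False using c(3) w1(3) by simp
qed

lemma gamma_avoid_in:
  assumes "glists LL" shows "\<exists>g. gcol LL g & g 0 ~= z"
proof -
  obtain x where "x \<in> LL 0" "x ~= z" using ex_other[of "LL 0"] glistsD(1)[OF assms] by auto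
  then show ?thesis using gamma_ext[OF assms, of x] by auto
qed

text \<open>The 4-cycle of a universal variable: its opposite vertices cannot both be forced.\<close>

definition pairok :: "nat set => nat set => nat set => nat set => nat => nat => bool" where
  "pairok U1 U2 MA MB u v <-> u \<in> U1 & v \<in> U2 & ~ kill1 MA u v & ~ kill1 MB u v"

text \<open>If both vertices were forced, two thin irreflexive relations would exclude three of the
  four pairs \<open>a, b\<close>, \<open>a, b'\<close>, \<open>a', b\<close>, \<open>a', b'\<close>.
  Pairs with the same first color need different relations, and then thinness makes the third pair
  collide with one of them.\<close>

lemma cycle4_free:
  assumes "card U1 = 2" "card U2 = 2" "card MA = 2" "card MB = 2"
  shows "(\<forall>\<omega>. \<exists>u v. pairok U1 U2 MA MB u v & v ~= \<omega>) | (\<forall>\<omega>. \<exists>u v. pairok U1 U2 MA MB u v & u ~= \<omega>)"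
proof (rule ccontr)
  assume "~ ?thesis"
  then obtain \<omega>2 \<omega>1 where \<omega>: "!!u v. pairok U1 U2 MA MB u v ==> v = \<omega>2" "!!u v. pairok U1 U2 MA MB u v ==> u = \<omega>1"
    by blast
  obtain a where a: "a \<in> U1" "a ~= \<omega>1" using ex_other[of U1] assms by auto
  obtain b where b: "b \<in> U2" "b ~= \<omega>2" using ex_other[of U2] assms by auto
  obtain a' where a': "a' \<in> U1" "a' ~= a" using ex_other[of U1] assms by auto
  obtain b' where b': "b' \<in> U2" "b' ~= b" using ex_other[of U2] assms by auto
  have k: "kill1 MA a b | kill1 MB a b" "kill1 MA a b' | kill1 MB a b'" "kill1 MA a' b | kill1 MB a' b"
    using \<omega> a b a' b' unfolding pairok_def by blast+
  show False
    using k a'(2) b'(2) thin_kill1[OF assms(3)] thin_kill1[OF assms(4)] unfolding thin_def by metis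
qed

lemma pairok_ex:
  assumes "card U1 = 2" "card U2 = 2" "card MA = 2" "card MB = 2"
  shows "\<exists>u v. pairok U1 U2 MA MB u v"
  using cycle4_free[OF assms] by blast

text \<open>The chain is colored from its end, so that each copy can avoid both the color asked for
  at its leaf and the root color of the next copy. The price is that the color of the first root is
  not controlled.\<close>

lemma chain_avoid:
  "(!!i. i \<le> n ==> glists (LL i)) ==>
   \<exists>g. \<forall>i\<le>n. gcol (LL i) (g i) & g i 1 ~= \<alpha> i & (i < n --> g i 2 ~= g (Suc i) 0)"
proof (induction n arbitrary: LL \<alpha>)
  case 0
  obtain g where "gcol (LL 0) g" "g 1 ~= \<alpha> 0" using gamma_avoid[of "LL 0"] 0 by blast
  then show ?case by (intro exI[of _ "%_. g"]) simp
next
  case (Suc n)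
  obtain g' where g': "\<forall>i\<le>n. gcol (LL (Suc i)) (g' i) & g' i 1 ~= \<alpha> (Suc i) & (i < n --> g' i 2 ~= g' (Suc i) 0)"
    using Suc.IH[of "%i. LL (Suc i)" "%i. \<alpha> (Suc i)"] Suc.prems by auto
  obtain g where g: "gcol (LL 0) g" "g 1 ~= \<alpha> 0" "g 2 ~= g' 0 0"
    using gamma_avoid[of "LL 0"] Suc.prems by blast
  show ?case
  proof (intro exI[of _ "case_nat g g'"] allI impI)
    fix i assume "i \<le> Suc n"
    then show "gcol (LL i) (case_nat g g' i) & case_nat g g' i 1 ~= \<alpha> i &
        (i < Suc n --> case_nat g g' i 2 ~= case_nat g g' (Suc i) 0)"
      using g g' by (cases i) auto
  qed
qed

text \<open>Here the chain is colored from its beginning: the first root avoids a given color, and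
  each further root avoids the output of its predecessor. The leaves are not controlled.\<close>

lemma chain_any:
  "(!!i. i \<le> n ==> glists (LL i)) ==>
   \<exists>g. g 0 0 ~= z & (\<forall>i\<le>n. gcol (LL i) (g i) & (i < n --> g i 2 ~= g (Suc i) 0))"
proof (induction n arbitrary: LL z)
  case 0
  obtain g where "gcol (LL 0) g" "g 0 ~= z" using gamma_avoid_in[of "LL 0"] 0 by blast
  then show ?case by (intro exI[of _ "%_. g"]) simp
next
  case (Suc n)
  obtain g where g: "gcol (LL 0) g" "g 0 ~= z"
    using gamma_avoid_in[of "LL 0"] Suc.prems by blast
  obtain g' where g': "g' 0 0 ~= g 2" "\<forall>i\<le>n. gcol (LL (Suc i)) (g' i) & (i < n --> g' i 2 ~= g' (Suc i) 0)"
    using Suc.IH[of "%i. LL (Suc i)" "g 2"] Suc.prems by auto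
  show ?case
  proof (intro exI[of _ "case_nat g g'"] conjI allI impI)
    fix i assume "i \<le> Suc n"
    then show "gcol (LL i) (case_nat g g' i)" using g g' by (cases i) auto
    assume "i < Suc n"
    then show "case_nat g g' i 2 ~= case_nat g g' (Suc i) 0"
      using g' by (cases i) auto
  qed (use g in simp)
qed

text \<open>Lists of \<open>gcol\<close> under which color 4 at part 0 forces color \<open>p\<close> at parts 1 and 2.\<close>

definition forced_lists :: "nat => nat => nat => nat set" where
  "forced_lists s p j = (let p2 = (if p = 1 then 2 else 1) in
     if j = 0 then {s, 4} else if j = 1 | j = 2 then {4, p, p2} else if j = 3 then {p, p2}
     else if j = 4 then {p2, p} else if j = 5 then {p, 4} else {4, p2})"

lemma forced_gcol:
  assumes p: "p \<in> {1, 2, 3}" and g: "!!j. j < 7 ==> g j \<in> forced_lists s p j"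
    "!!j j'. ge j j' ==> g j ~= (g j' :: nat)" and "g 0 = 4"
  shows "g 1 = p" "g 2 = p"
proof -
  define p2 :: nat where "p2 = (if p = 1 then 2 else 1)"
  have p2: "p2 ~= p" "p2 ~= 4" "p ~= 4" using p by (auto simp: p2_def)
  have l: "g 1 \<in> {4, p, p2}" "g 2 \<in> {4, p, p2}" "g 3 \<in> {p, p2}" "g 4 \<in> {p2, p}" "g 5 \<in> {p, 4}" "g 6 \<in> {4, p2}"
    using g(1)[of 1] g(1)[of 2] g(1)[of 3] g(1)[of 4] g(1)[of 5] g(1)[of 6]
    by (simp_all add: forced_lists_def Let_def p2_def)
  have e: "g 0 ~= g 1" "g 0 ~= g 2" "g 3 ~= g 1" "g 3 ~= g 2" "g 1 ~= g 4" "g 4 ~= g 5" "g 5 ~= g 6" "g 6 ~= g 2"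
    by (rule g(2), simp add: ge_def)+
  have g12: "g 1 = p | g 1 = p2" "g 2 = p | g 2 = p2" using l(1,2) e(1,2) assms(4) by auto
  have "g 3 = p | g 3 = p2" using l(3) by auto
  then have "g 1 = g 2" using g12 e(3,4) by metis
  \<comment> \<open>Vertex 3 has made both outputs equal; the color \<open>p2\<close> at them would
    force \<open>p\<close>, 4 and \<open>p2\<close> along 4, 5, 6 and clash at the end.\<close>
  moreover have "g 1 ~= p2"
  proof
    assume "g 1 = p2"
    then have "g 4 = p" using l(4) e(5) by auto
    then have "g 5 = 4" using l(5) e(6) by auto
    then have "g 6 = p2" using l(6) e(7) by auto
    then show False using e(8) \<open>g 1 = p2\<close> \<open>g 1 = g 2\<close> by simp
  qed
  ultimately show "g 1 = p" "g 2 = p" using g12 by metis+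
qed

text \<open>Part \<open>p\<close> of the \<open>i\<close>-th copy for the literal \<open>b\<close> of variable \<open>e\<close> is \<open>Gad e b i t p\<close>, where \<open>t\<close>
  tells the leaves from the chain itself; leaf \<open>i\<close> serves clause \<open>i\<close>. \<open>Aux e 0\<close> makes one of the two literals
  false, \<open>Aux e 1\<close> to \<open>Aux e 4\<close> are the 4-cycle of a universal variable, and \<open>Aux e 5\<close> and \<open>Aux e 6\<close> link it to
  the last leaves of the two literals.\<close>

datatype vx = Gad nat bool nat bool nat | Aux nat nat | Cla nat

section \<open>The graph of a formula with clauses of at most three literals\<close>

lemma ge_side: "ge p p' ==> (p = 1 | p = 2 | p = 5) ~= (p' = 1 | p' = 2 | p' = 5)"
  by (auto simp: ge_def)

locale qformula =
  fixes nE nC :: nat and lit :: "nat => nat => bool => bool" and univ :: "nat => bool"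
begin

definition lits :: "nat => (nat \<times> bool) set" where
  "lits c = {(e, b). e < nE & lit c e b}"

text \<open>Empty clauses count as true because clause numbers that stem from no clause have no
  literals.\<close>

definition csat :: "(nat => bool) => nat => bool" where
  "csat B c <-> lits c = {} | (\<exists>e. (e, B e) \<in> lits c)"

definition vset :: "vx set" where
  "vset = {Gad e b i t p | e b i t p. e < nE & i \<le> nC & p < 7} \<union> {Aux e j | e j. e < nE & j < 7} \<union> Cla ` {..<nC}"

fun adj :: "vx => vx => bool" where
  "adj (Gad e b i t p) (Gad e' b' i' t' p') <-> e = e' & b = b' &
     (i = i' & t = t' & ge p p' | i = i' & ~ t & t' & p = 1 & p' = 0 |
      i' = Suc i & ~ t & ~ t' & p = 2 & p' = 0)"
| "adj (Gad e b i t p) (Aux e' j) <-> e = e' &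
     (~ t & i = 0 & p = 0 & j = 0 | t & i = nC & p = 1 & univ e & j = (if b then 5 else 6))"
| "adj (Gad e b i t p) (Cla c) <-> t & i = c & p = 1 & lit c e b"
| "adj (Aux e j) (Aux e' j') <-> e = e' & (j, j') \<in> {(5,1),(6,2),(3,1),(3,2),(4,1),(4,2)}"
| "adj _ _ <-> False"

text \<open>A clause vertex has as many colors as literals, so that it is stuck exactly when each of
  them blocks a different color; without literals it still gets one color.\<close>

fun lsize :: "vx => nat" where
  "lsize (Gad e b i t p) = (if p = 1 | p = 2 then 3 else 2)"
| "lsize (Aux e j) = 2"
| "lsize (Cla c) = max 1 (card (lits c))"

fun side :: "vx => bool" where
  "side (Gad e b i t p) <-> p = 1 | p = 2 | p = 5"
| "side (Aux e j) <-> j = 0 | j = 1 | j = 2"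
| "side (Cla c) <-> False"

lemma adj_side: assumes "adj x y" shows "side x ~= side y"
proof (cases x)
  case (Gad e b i t p)
  show ?thesis
  proof (cases y)
    case y: (Gad e' b' i' t' p')
    have "ge p p' | p = 1 & p' = 0 | p = 2 & p' = 0" using assms Gad y by auto
    then show ?thesis using ge_side[of p p'] Gad y by auto
  next
    case y: (Aux e' j)
    have "adj (Gad e b i t p) (Aux e' j)" using assms unfolding Gad y .
    then consider "p = 0" "j = 0" | "p = 1" "j = (if b then 5 else 6)" unfolding adj.simps by blast
    then show ?thesis by cases (simp_all add: Gad y)
  next
    case y: (Cla c)
    then show ?thesis using assms Gad by auto
  qed
next
  case (Aux e j)
  show ?thesis
  proof (cases y)
    case y: (Aux e' j')
    have "adj (Aux e j) (Aux e' j')" using assms unfolding Aux y .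
    then have "(j, j') \<in> {(5,1),(6,2),(3,1),(3,2),(4,1),(4,2)}" unfolding adj.simps by blast
    then show ?thesis unfolding Aux y by (elim insertE emptyE) simp_all
  qed (use assms Aux in auto)
qed (use assms in auto)

lemma finite_lits: "finite (lits c)"
proof -
  have "lits c \<subseteq> {..<nE} \<times> UNIV" by (auto simp: lits_def)
  then show ?thesis by (rule finite_subset) simp
qed

text \<open>The lists dictate a value of each universal variable, and the formula answers with an
  assignment \<open>B\<close>. The chain of the true literal is colored from its end so that no leaf
  is forced; the chain of the false literal is colored somehow. A clause vertex chooses a color
  outside those of all literals but one true literal, whose leaf then gives way.\<close>

lemma ae_choosable_if_true:
  assumes card3: "!!c. c < nC ==> card (lits c) \<le> 3"
    and true: "!!A. \<exists>B. (\<forall>e<nE. univ e --> B e = A e) & (\<forall>c<nC. csat B c)"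
  shows "fch k lsize vset adj"
  unfolding fch_def
proof (intro allI impI)
  fix L assume "lists_on k lsize vset L"
  then have cardL: "card (L v) = lsize v" if "v \<in> vset" for v using that by (simp add: lists_on_def)
  have mem: "Gad e b i t p \<in> vset <-> e < nE & i \<le> nC & p < 7" "Aux e j \<in> vset <-> e < nE & j < 7"
    "Cla c \<in> vset <-> c < nC" for e b i t p j c
    by (auto simp: vset_def)
  define LL where "LL e b i t p = L (Gad e b i t p)" for e b i t p
  have gl: "glists (LL e b i t)" if "e < nE" "i \<le> nC" for e b i t
    using that cardL mem(1) by (simp add: glists_def LL_def)
  have cX: "card (L (Aux e j)) = 2" if "e < nE" "j < 7" for e j
    using cardL[of "Aux e j"] that mem(2) by simp
  define PO where "PO e = pairok (L (Aux e 1)) (L (Aux e 2)) (L (Aux e 3)) (L (Aux e 4))" for e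
  \<comment> \<open>By \<open>cycle4_free\<close> one of the opposite vertices of the 4-cycle can
    avoid any given color; \<open>A e\<close> says that it is the second. It protects the link to
    the literal that becomes false.\<close>
  define A where "A e <-> (\<forall>\<omega>. \<exists>u v. PO e u v & v ~= \<omega>)" for e
  have notA: "\<exists>u v. PO e u v & u ~= \<omega>" if "e < nE" "~ A e" for e \<omega>
    using cycle4_free[of "L (Aux e 1)" "L (Aux e 2)" "L (Aux e 3)" "L (Aux e 4)"] that cX[of e]
    unfolding A_def PO_def by auto
  obtain B where B: "!!e. e < nE ==> univ e ==> B e = A e" "!!c. c < nC ==> csat B c"
    using true[of A] by blast
  \<comment> \<open>The root color under which a leaf copy is not forced at its vertex 1, from
    \<open>gamma_free\<close>. The chain of the true literal avoids this color next to the leaf, so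
    the leaf can use it.\<close>
  define xs where "xs e b i = (SOME x. \<forall>\<omega>. \<exists>g. gcol (LL e b i True) g & g 0 = x & g 1 ~= \<omega>)" for e b i
  have xs: "\<exists>g. gcol (LL e b i True) g & g 0 = xs e b i & g 1 ~= \<omega>" if "e < nE" "i \<le> nC" for e b i \<omega>
  proof -
    have "\<exists>x. \<forall>\<omega>. \<exists>g. gcol (LL e b i True) g & g 0 = x & g 1 ~= \<omega>"
      using gamma_free[OF gl[OF that]] by blast
    from someI_ex[OF this] show ?thesis unfolding xs_def by blast
  qed
  define Pm where "Pm e q m <-> q \<in> L (Aux e 0) & (\<forall>b. m b 0 0 ~= q) &
    (\<forall>b. \<forall>i\<le>nC. gcol (LL e b i False) (m b i) & (i < nC --> m b i 2 ~= m b (Suc i) 0)) &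
    (\<forall>i\<le>nC. m (B e) i 1 ~= xs e (B e) i)" for e q and m :: "bool => nat => nat => nat"
  have "\<exists>q m. Pm e q m" if e: "e < nE" for e
  proof -
    obtain gT where gT: "\<forall>i\<le>nC. gcol (LL e (B e) i False) (gT i) & gT i 1 ~= xs e (B e) i &
        (i < nC --> gT i 2 ~= gT (Suc i) 0)"
      using chain_avoid[of nC "%i. LL e (B e) i False" "xs e (B e)"] gl e by auto
    obtain q where q: "q \<in> L (Aux e 0)" "q ~= gT 0 0" using ex_other[of "L (Aux e 0)"] cX e by auto
    obtain gF where gF: "gF 0 0 ~= q" "\<forall>i\<le>nC. gcol (LL e (~ B e) i False) (gF i) & (i < nC --> gF i 2 ~= gF (Suc i) 0)"
      using chain_any[of nC "%i. LL e (~ B e) i False" q] gl e by auto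
    define m where "m b = (if b = B e then gT else gF)" for b
    have mb: "b = B e & m b = gT | b = (~ B e) & m b = gF" for b by (auto simp: m_def)
    have "Pm e q m" unfolding Pm_def
    proof (intro conjI allI impI)
      fix b show "m b 0 0 ~= q" using mb[of b] q(2) gF(1) by auto
    next
      fix b i assume "i \<le> nC"
      then show "gcol (LL e b i False) (m b i)" using mb[of b] gT gF by auto
      assume "i < nC"
      then show "m b i 2 ~= m b (Suc i) 0" using mb[of b] gT gF \<open>i \<le> nC\<close> by auto
    next
      fix i assume "i \<le> nC"
      then show "m (B e) i 1 ~= xs e (B e) i" using gT by (simp add: m_def)
    qed (rule q(1))
    then show ?thesis by blast
  qed
  then have "\<forall>e. \<exists>y. e < nE --> Pm e (fst y) (snd y)" by (metis fst_conv snd_conv)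
  from choice[OF this] obtain qm where qm: "\<forall>e. e < nE --> Pm e (fst (qm e)) (snd (qm e))" by (rule exE)
  define q where "q e = fst (qm e)" for e
  define mc where "mc e = snd (qm e)" for e
  have Pm: "Pm e (q e) (mc e)" if "e < nE" for e using qm that by (simp add: q_def mc_def)
  have q: "q e \<in> L (Aux e 0)" "mc e b 0 0 ~= q e" if "e < nE" for e b
    using Pm[OF that] unfolding Pm_def by blast+
  have mc: "gcol (LL e b i False) (mc e b i)" "i < nC ==> mc e b i 2 ~= mc e b (Suc i) 0"
    "mc e (B e) i 1 ~= xs e (B e) i" if "e < nE" "i \<le> nC" for e b i
    using Pm[OF that(1)] that(2) unfolding Pm_def by blast+
  define Pl where "Pl e b i g <-> gcol (LL e b i True) g & g 0 ~= mc e b i 1" for e b i g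
  define lf0 where "lf0 e b i = (SOME g. Pl e b i g)" for e b i
  have lf0: "Pl e b i (lf0 e b i)" if "e < nE" "i \<le> nC" for e b i
  proof -
    have "\<exists>g. Pl e b i g" using gamma_avoid_in[OF gl[OF that]] unfolding Pl_def by blast
    from someI_ex[OF this] show ?thesis unfolding lf0_def .
  qed
  have lfT: "\<exists>g. Pl e (B e) i g & g 1 ~= \<omega>" if "e < nE" "i \<le> nC" for e i \<omega>
    using xs[OF that] mc(3)[OF that] unfolding Pl_def by metis
  define lfr where "lfr e i \<omega> = (SOME g. Pl e (B e) i g & g 1 ~= \<omega>)" for e i \<omega>
  have lfr: "Pl e (B e) i (lfr e i \<omega>)" "lfr e i \<omega> 1 ~= \<omega>" if "e < nE" "i \<le> nC" for e i \<omega>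
    using someI_ex[OF lfT[OF that, of \<omega>]] unfolding lfr_def by blast+
  define resp where "resp c = (SOME e. (e, B e) \<in> lits c)" for c
  have resp: "(resp c, B (resp c)) \<in> lits c" if "c < nC" "lits c ~= {}" for c
  proof -
    have "\<exists>e. (e, B e) \<in> lits c" using B(2)[OF that(1)] that(2) unfolding csat_def by blast
    from someI_ex[OF this] show ?thesis unfolding resp_def .
  qed
  \<comment> \<open>The colors blocked at a clause by all literals except the responsible true one:
    fewer than the list has.\<close>
  define oth where "oth c = (%(e, b). lf0 e b c 1) ` (lits c - {(resp c, B (resp c))})" for c
  have ex\<omega>: "\<exists>\<omega>. \<omega> \<in> L (Cla c) & (lits c ~= {} --> \<omega> ~: oth c)" if c: "c < nC" for c
  proof (cases "lits c = {}")
    case True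
    have "card (L (Cla c)) = 1" using cardL[of "Cla c"] c mem(3) True by simp
    then have "L (Cla c) ~= {}" by auto
    then show ?thesis using True by blast
  next
    case False
    have "card (oth c) \<le> card (lits c - {(resp c, B (resp c))})"
      unfolding oth_def by (rule card_image_le) (simp add: finite_lits)
    also have "\<dots> < card (lits c)"
      by (intro psubset_card_mono finite_lits) (use resp[OF c False] in blast)
    also have "\<dots> \<le> card (L (Cla c))" using cardL[of "Cla c"] c mem(3) by simp
    finally have "card (oth c) < card (L (Cla c))" .
    moreover have "finite (oth c)" unfolding oth_def by (simp add: finite_lits)
    ultimately have "~ L (Cla c) \<subseteq> oth c" using card_mono by (meson leD)
    then show ?thesis by blast
  qed
  define \<omega> where "\<omega> c = (SOME \<omega>. \<omega> \<in> L (Cla c) & (lits c ~= {} --> \<omega> ~: oth c))" for c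
  have \<omega>: "\<omega> c \<in> L (Cla c)" "lits c ~= {} ==> \<omega> c ~: oth c" if "c < nC" for c
    using someI_ex[OF ex\<omega>[OF that]] unfolding \<omega>_def by blast+
  \<comment> \<open>Only the link to the false literal has to respect a given leaf color; the leaf
    of the true literal adapts to its link.\<close>
  define PU where "PU e u v w1 w2 <-> PO e u v & w1 \<in> L (Aux e 5) & w2 \<in> L (Aux e 6) & w1 ~= u & w2 ~= v &
    (univ e --> (if B e then w2 ~= lf0 e False nC 1 else w1 ~= lf0 e True nC 1))" for e u v w1 w2
  have exU: "\<exists>u v w1 w2. PU e u v w1 w2" if e: "e < nE" for e
  proof -
    have c56: "card (L (Aux e 5)) \<ge> 2" "card (L (Aux e 6)) \<ge> 2" using cX[OF e] by simp_all
    consider "~ univ e" | "univ e" "B e" | "univ e" "~ B e" by blast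
    then show ?thesis
    proof cases
      case 1
      obtain u v where uv: "PO e u v"
        using pairok_ex[of "L (Aux e 1)" "L (Aux e 2)" "L (Aux e 3)" "L (Aux e 4)"] cX[OF e] unfolding PO_def by auto
      obtain w1 where "w1 \<in> L (Aux e 5)" "w1 ~= u" using ex_other[OF c56(1)] .
      moreover obtain w2 where "w2 \<in> L (Aux e 6)" "w2 ~= v" using ex_other[OF c56(2)] .
      ultimately show ?thesis using uv 1 unfolding PU_def by blast
    next
      case 2
      obtain w2 where w2: "w2 \<in> L (Aux e 6)" "w2 ~= lf0 e False nC 1" using ex_other[OF c56(2)] .
      have "A e" using B(1)[OF e] 2 by simp
      then obtain u v where uv: "PO e u v" "v ~= w2" unfolding A_def by blast
      obtain w1 where "w1 \<in> L (Aux e 5)" "w1 ~= u" using ex_other[OF c56(1)] .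
      then show ?thesis using uv w2 2 unfolding PU_def by (intro exI[of _ u] exI[of _ v] exI[of _ w1] exI[of _ w2]) auto
    next
      case 3
      obtain w1 where w1: "w1 \<in> L (Aux e 5)" "w1 ~= lf0 e True nC 1" using ex_other[OF c56(1)] .
      have "~ A e" using B(1)[OF e] 3 by simp
      then obtain u v where uv: "PO e u v" "u ~= w1" using notA[OF e] by blast
      obtain w2 where "w2 \<in> L (Aux e 6)" "w2 ~= v" using ex_other[OF c56(2)] .
      then show ?thesis using uv w1 3 unfolding PU_def by (intro exI[of _ u] exI[of _ v] exI[of _ w1] exI[of _ w2]) auto
    qed
  qed
  have "\<forall>e. \<exists>y. e < nE --> PU e (fst y) (fst (snd y)) (fst (snd (snd y))) (snd (snd (snd y)))"
    using exU by (metis fst_conv snd_conv)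
  from choice[OF this] obtain uu where
    uu: "\<forall>e. e < nE --> PU e (fst (uu e)) (fst (snd (uu e))) (fst (snd (snd (uu e)))) (snd (snd (snd (uu e))))"
    by (rule exE)
  define u where "u e = fst (uu e)" for e
  define v where "v e = fst (snd (uu e))" for e
  define w1 where "w1 e = fst (snd (snd (uu e)))" for e
  define w2 where "w2 e = snd (snd (snd (uu e)))" for e
  have PU: "PU e (u e) (v e) (w1 e) (w2 e)" if "e < nE" for e
    using uu that by (simp add: u_def v_def w1_def w2_def)
  have PO: "PO e (u e) (v e)" if "e < nE" for e using PU[OF that] by (simp add: PU_def)
  define m3 where "m3 e j = (SOME a. a \<in> L (Aux e j) & a ~= u e & a ~= v e)" for e j
  have m3: "m3 e j \<in> L (Aux e j) & m3 e j ~= u e & m3 e j ~= v e" if "e < nE" "j = 3 | j = 4" for e j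
  proof -
    have "\<exists>a. a \<in> L (Aux e j) & a ~= u e & a ~= v e"
      using PO[OF that(1)] that(2) unfolding PO_def pairok_def kill1_def by blast
    from someI_ex[OF this] show ?thesis unfolding m3_def .
  qed
  \<comment> \<open>A leaf of the true literal gives way to its clause vertex if it is responsible
    for that clause, and the last one to the link vertex; all others take the default
    coloring.\<close>
  define lf where "lf e b i = (if b = B e then
      (if i < nC then (if lits i ~= {} & e = resp i then lfr e i (\<omega> i) else lf0 e b i)
       else lfr e i (if b then w1 e else w2 e)) else lf0 e b i)" for e b i
  have lf: "Pl e b i (lf e b i)" if "e < nE" "i \<le> nC" for e b i
    using lf0[OF that] lfr(1)[OF that] unfolding lf_def by auto
  define c where "c w = (case w of Gad e b i t p => if t then lf e b i p else mc e b i p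
    | Aux e j => if j = 0 then q e else if j = 1 then u e else if j = 2 then v e
        else if j = 5 then w1 e else if j = 6 then w2 e else m3 e j
    | Cla i => \<omega> i)" for w
  have "col vset adj L c"
    unfolding col_def
  proof (intro conjI ballI impI)
    fix w assume w: "w \<in> vset"
    show "c w \<in> L w"
    proof (cases w)
      case (Gad e b i t p)
      then have *: "e < nE" "i \<le> nC" "p < 7" using w mem(1) by auto
      have "gcol (LL e b i True) (lf e b i)" "gcol (LL e b i False) (mc e b i)"
        using lf[OF *(1,2)] mc(1)[OF *(1,2)] by (auto simp: Pl_def)
      then show ?thesis using Gad *(3) by (auto simp: c_def gcol_def LL_def)
    next
      case (Aux e j)
      then have *: "e < nE" "j < 7" using w mem(2) by auto
      then have "j = 0 | j = 1 | j = 2 | j = 3 | j = 4 | j = 5 | j = 6" by linarith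
      then show ?thesis using Aux q(1)[OF *(1)] PU[OF *(1)] m3[OF *(1)]
        unfolding PU_def PO_def pairok_def by (elim disjE) (simp_all add: c_def)
    next
      case (Cla i)
      then show ?thesis using w mem(3) \<omega>(1) by (simp add: c_def)
    qed
  next
    fix x y assume xy: "x \<in> vset" "y \<in> vset" "adj x y"
    show "c x ~= c y"
    proof (cases x)
      case (Gad e b i t p)
      then have *: "e < nE" "i \<le> nC" "p < 7" using xy(1) mem(1) by auto
      have lfe: "gcol (LL e b i True) (lf e b i)" "lf e b i 0 ~= mc e b i 1" using lf[OF *(1,2)] by (auto simp: Pl_def)
      have mce: "gcol (LL e b i False) (mc e b i)" using mc(1)[OF *(1,2)] .
      show ?thesis
      proof (cases y)
        case y: (Gad e' b' i' t' p')
        consider "e = e'" "b = b'" "i = i'" "t = t'" "ge p p'"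
          | "e = e'" "b = b'" "i = i'" "~ t" "t'" "p = 1" "p' = 0"
          | "e = e'" "b = b'" "i' = Suc i" "~ t" "~ t'" "p = 2" "p' = 0"
          using xy(3) Gad y by auto
        then show ?thesis
        proof cases
          case 1
          then show ?thesis using Gad y lfe(1) mce by (auto simp: c_def gcol_def)
        next
          case 2
          then show ?thesis using Gad y lfe(2) by (auto simp: c_def)
        next
          case 3
          have "i < nC" using xy(2) y mem(1) 3 by auto
          then show ?thesis using Gad y 3 mc(2)[OF *(1,2)] by (auto simp: c_def)
        qed
      next
        case y: (Aux e' j)
        consider "e = e'" "~ t" "i = 0" "p = 0" "j = 0" | "e = e'" "t" "i = nC" "p = 1" "univ e" "j = (if b then 5 else 6)"
          using xy(3) Gad y by auto
        then show ?thesis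
        proof cases
          case 1
          then show ?thesis using Gad y q(2)[OF *(1)] by (simp add: c_def)
        next
          case 2
          have "lf e b nC 1 ~= (if b then w1 e else w2 e)"
          proof (cases "b = B e")
            case True
            then show ?thesis using lfr(2)[OF *(1), of nC] by (simp add: lf_def)
          next
            case False
            then show ?thesis using PU[OF *(1)] 2(5) by (auto simp: lf_def PU_def split: if_splits)
          qed
          then show ?thesis using 2 Gad y by (auto simp: c_def)
        qed
      next
        case y: (Cla i')
        then have **: "t" "i = i'" "p = 1" "lit i e b" using xy(3) Gad by auto
        have i: "i < nC" using xy(2) y mem(3) ** by auto
        have inl: "(e, b) \<in> lits i" using **(4) *(1) by (simp add: lits_def)
        then have ne: "lits i ~= {}" by blast
        have "lf e b i 1 ~= \<omega> i"
        proof (cases "b = B e & e = resp i")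
          case True
          then show ?thesis using lfr(2)[OF *(1,2)] i ne by (simp add: lf_def)
        next
          case False
          then have "lf e b i = lf0 e b i" using i by (auto simp: lf_def)
          moreover have "lf0 e b i 1 \<in> oth i" unfolding oth_def using inl False by force
          ultimately show ?thesis using \<omega>(2)[OF i ne] by metis
        qed
        then show ?thesis using ** Gad y by (simp add: c_def)
      qed
    next
      case (Aux e j)
      show ?thesis
      proof (cases y)
        case y: (Aux e' j')
        have e: "e = e'" "e < nE" using xy Aux y mem(2) by auto
        have "(j, j') \<in> {(5,1),(6,2),(3,1),(3,2),(4,1),(4,2)}" using xy(3) Aux y by simp
        moreover have "w1 e ~= u e" "w2 e ~= v e" using PU[OF e(2)] unfolding PU_def by blast+
        moreover have "m3 e 3 ~= u e" "m3 e 3 ~= v e" "m3 e 4 ~= u e" "m3 e 4 ~= v e" using m3[OF e(2)] by blast+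
        ultimately show ?thesis unfolding Aux y c_def e(1) by (elim insertE emptyE) simp_all
      qed (use xy Aux in auto)
    next
      case (Cla i)
      then show ?thesis using xy by auto
    qed
  qed
  then show "\<exists>c. col vset adj L c" by blast
qed

text \<open>With suitable lists a false literal carries color 4 along its whole chain and forces one
  fixed color at every leaf. Literals of a clause force different colors, namely those of its list,
  so the color of the clause vertex points to a true literal.\<close>

lemma true_if_ae_choosable:
  assumes card3: "!!c. c < nC ==> card (lits c) \<le> 3" and k: "k \<ge> 4" and fc: "fch k lsize vset adj"
  shows "\<exists>B. (\<forall>e<nE. univ e --> B e = A e) & (\<forall>c<nC. csat B c)"
proof -
  have mem: "Gad e b i t p \<in> vset <-> e < nE & i \<le> nC & p < 7" "Aux e j \<in> vset <-> e < nE & j < 7"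
    "Cla c \<in> vset <-> c < nC" for e b i t p j c
    by (auto simp: vset_def)
  define pos where "pos c = (SOME f. inj_on f (lits c) & f ` lits c \<subseteq> {1, 2, 3::nat})" for c
  have pos: "inj_on (pos c) (lits c)" "pos c ` lits c \<subseteq> {1, 2, 3}" if "c < nC" for c
  proof -
    have "card (lits c) \<le> card {1, 2, 3::nat}" using card3[OF that] by simp
    then have "\<exists>f. inj_on f (lits c) & f ` lits c \<subseteq> {1, 2, 3::nat}"
      using card_le_inj[OF finite_lits, of "{1, 2, 3::nat}" c] by auto
    from someI_ex[OF this] show "inj_on (pos c) (lits c)" "pos c ` lits c \<subseteq> {1, 2, 3}"
      unfolding pos_def by blast+
  qed
  define p where "p e b i = (if i < nC & (e, b) \<in> lits i then pos i (e, b) else 1)" for e b i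
  have p: "p e b i \<in> {1, 2, 3}" for e b i using pos(2)[of i] by (auto simp: p_def)
  \<comment> \<open>Color 4 at a root is the bad one; color 1 passes it on, as the next root has
    list {1, 4}. The first roots differ, {1, 4} and {2, 4}, so that either color of
    \<open>Aux e 0\<close> turns one literal bad.\<close>
  define L where "L w = (case w of
      Gad e b i t j => forced_lists (if ~ t & i = 0 & ~ b then 2 else 1) (if t then p e b i else 1) j
    | Aux e j => if j = 0 | j = 5 | j = 6 then {1, 2} else if j = 3 then {3, 1} else if j = 4 then {3, 4}
        else if (j = 1) = A e then {2, 3} else {1, 4}
    | Cla c => if lits c = {} then {1} else pos c ` lits c)" for w
  have "lists_on k lsize vset L"
    unfolding lists_on_def
  proof
    fix w assume w: "w \<in> vset"
    have sub: "{1, 2, 3, 4} \<subseteq> {1..k}" using k by auto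
    have "L w \<subseteq> {1, 2, 3, 4} & card (L w) = lsize w"
    proof (cases w)
      case (Gad e b i t j)
      have "j < 7" using w Gad mem(1) by simp
      then have "j = 0 | j = 1 | j = 2 | j = 3 | j = 4 | j = 5 | j = 6" by linarith
      then show ?thesis using p[of e b i] unfolding Gad L_def forced_lists_def Let_def
        by (elim disjE) auto
    next
      case (Aux e j)
      then show ?thesis by (auto simp: L_def)
    next
      case (Cla c)
      then have c: "c < nC" using w mem(3) by simp
      show ?thesis
      proof (cases "lits c = {}")
        case False
        then have "card (lits c) \<ge> 1" using finite_lits[of c] by (simp add: Suc_le_eq card_gt_0_iff)
        then show ?thesis using False Cla pos[OF c] by (auto simp: L_def card_image)
      qed (use Cla in "simp add: L_def")
    qed
    then show "L w \<subseteq> {1..k} & card (L w) = lsize w" using sub by blast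
  qed
  then obtain c where c: "col vset adj L c" using fc fchD by blast
  have cin: "c w \<in> L w" if "w \<in> vset" for w using c that by (auto simp: col_def)
  have cadj: "c x ~= c y" if "x \<in> vset" "y \<in> vset" "adj x y" for x y using c that unfolding col_def by blast
  define B where "B e <-> c (Aux e 0) = 2" for e
  have forced: "c (Gad e b i t 1) = (if t then p e b i else 1) & c (Gad e b i t 2) = (if t then p e b i else 1)"
    if e: "e < nE" "i \<le> nC" and r: "c (Gad e b i t 0) = 4" for e b i t
  proof -
    have 1: "(if t then p e b i else 1) \<in> {1, 2, 3}" using p by auto
    have 2: "c (Gad e b i t j) \<in> forced_lists (if ~ t & i = 0 & ~ b then 2 else 1) (if t then p e b i else 1) j"
      if "j < 7" for j
      using cin[of "Gad e b i t j"] e that mem(1) by (simp add: L_def)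
    have 3: "c (Gad e b i t j) ~= c (Gad e b i t j')" if "ge j j'" for j j'
    proof -
      have "j < 7" "j' < 7" using that by (auto simp: ge_def)
      then show ?thesis using cadj[of "Gad e b i t j" "Gad e b i t j'"] e that mem(1) by simp
    qed
    show ?thesis using forced_gcol[OF 1 2 3 r] by simp
  qed
  have root: "c (Gad e b 0 False 0) = 4" if e: "e < nE" and b: "b ~= B e" for e b
  proof -
    have "c (Aux e 0) \<in> {1, 2}" using cin[of "Aux e 0"] e mem(2) by (simp add: L_def)
    moreover have "c (Gad e b 0 False 0) \<in> {if ~ b then 2 else 1, 4}"
      using cin[of "Gad e b 0 False 0"] e mem(1) by (simp add: L_def forced_lists_def)
    moreover have "c (Gad e b 0 False 0) ~= c (Aux e 0)"
      using cadj[of "Gad e b 0 False 0" "Aux e 0"] e mem by simp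
    ultimately show ?thesis using b unfolding B_def by (auto split: if_splits)
  qed
  have main: "c (Gad e b i False 0) = 4" if e: "e < nE" and b: "b ~= B e" and i: "i \<le> nC" for e b i
    using i
  proof (induction i)
    case 0
    then show ?case using root e b by blast
  next
    case (Suc i)
    have "c (Gad e b i False 2) = 1" using forced[of e i b False] Suc e by simp
    moreover have "c (Gad e b i False 2) ~= c (Gad e b (Suc i) False 0)"
      using cadj[of "Gad e b i False 2" "Gad e b (Suc i) False 0"] Suc e mem(1) by simp
    moreover have "c (Gad e b (Suc i) False 0) \<in> {1, 4}"
      using cin[of "Gad e b (Suc i) False 0"] Suc e mem(1) by (simp add: L_def forced_lists_def)
    ultimately show ?case by auto
  qed
  have leaf: "c (Gad e b i True 1) = p e b i" if e: "e < nE" and b: "b ~= B e" and i: "i \<le> nC" for e b i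
  proof -
    have "c (Gad e b i False 1) = 1" using forced[of e i b False] main[OF e b i] e i by simp
    moreover have "c (Gad e b i False 1) ~= c (Gad e b i True 0)"
      using cadj[of "Gad e b i False 1" "Gad e b i True 0"] i e mem(1) by simp
    moreover have "c (Gad e b i True 0) \<in> {1, 4}"
      using cin[of "Gad e b i True 0"] i e mem(1) by (simp add: L_def forced_lists_def)
    ultimately have "c (Gad e b i True 0) = 4" by auto
    then show ?thesis using forced[of e i b True] e i by simp
  qed
  have "csat B i" if i: "i < nC" for i
  proof (cases "lits i = {}")
    case False
    have "c (Cla i) \<in> pos i ` lits i" using cin[of "Cla i"] i mem(3) False by (simp add: L_def)
    then obtain e b where eb: "(e, b) \<in> lits i" "c (Cla i) = pos i (e, b)" by auto
    have e: "e < nE" "lit i e b" using eb by (auto simp: lits_def)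
    have "c (Gad e b i True 1) ~= c (Cla i)"
      using cadj[of "Gad e b i True 1" "Cla i"] e i mem by simp
    moreover have "p e b i = pos i (e, b)" using eb i by (simp add: p_def)
    ultimately have "c (Gad e b i True 1) ~= p e b i" using eb(2) by simp
    then have "b = B e" using leaf[OF e(1), of b i] i less_imp_le by blast
    then show ?thesis using eb(1) unfolding csat_def by blast
  qed (simp add: csat_def)
  moreover have "B e = A e" if e: "e < nE" and un: "univ e" for e
  proof -
    have x: "c (Aux e j) \<in> L (Aux e j)" if "j < 7" for j using cin[of "Aux e j"] e that mem(2) by simp
    have l: "c (Aux e 1) \<in> (if A e then {2, 3} else {1, 4})" "c (Aux e 2) \<in> (if ~ A e then {2, 3} else {1, 4})"
      "c (Aux e 3) \<in> {3, 1}" "c (Aux e 4) \<in> {3, 4}" "c (Aux e 5) \<in> {1, 2}" "c (Aux e 6) \<in> {1, 2}"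
      using x[of 1] x[of 2] x[of 3] x[of 4] x[of 5] x[of 6] by (simp_all add: L_def)
    have a: "c (Aux e 5) ~= c (Aux e 1)" "c (Aux e 6) ~= c (Aux e 2)" "c (Aux e 3) ~= c (Aux e 1)" "c (Aux e 3) ~= c (Aux e 2)"
      "c (Aux e 4) ~= c (Aux e 1)" "c (Aux e 4) ~= c (Aux e 2)"
      by (rule cadj; simp add: mem e)+
    \<comment> \<open>The middle lists {3, 1} and {3, 4} rule out color 3 at the vertex with list
      {2, 3}, because its opposite has list {1, 4}. So it gets 2 and its link gets 1, the color that
      a false literal forces at its last leaf.\<close>
    define j where "j = (if A e then 5 else 6 :: nat)"
    have cj: "c (Aux e j) = 1"
      using l a by (cases "A e") (auto simp: j_def)
    show ?thesis
    proof (rule ccontr)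
      assume "B e ~= A e"
      then have "c (Gad e (A e) nC True 1) = p e (A e) nC" using leaf[OF e, of "A e" nC] by auto
      then have "c (Gad e (A e) nC True 1) = 1" by (simp add: p_def)
      moreover have "c (Gad e (A e) nC True 1) ~= c (Aux e j)"
        by (rule cadj) (use e un mem in "auto simp: j_def")
      ultimately show False using cj by simp
    qed
  qed
  ultimately show ?thesis by blast
qed

theorem ae_choosable:
  assumes "!!c. c < nC ==> card (lits c) \<le> 3" "k \<ge> 4"
  shows "fch k lsize vset adj <-> (\<forall>A. \<exists>B. (\<forall>e<nE. univ e --> B e = A e) & (\<forall>c<nC. csat B c))"
  using ae_choosable_if_true[OF assms(1)] true_if_ae_choosable[OF assms] by blast

end

section \<open>Computations as formulas\<close>

lemma dbl_length: "length (concat (map (%b. [b, b]) x)) = 2 * length x"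
  by (induction x) auto

lemma dbl_nth: "j < 2 * length x ==> concat (map (%b. [b, b]) x) ! j = x ! (j div 2)"
proof (induction x arbitrary: j)
  case (Cons b x)
  show ?case
  proof (cases "j < 2")
    case True
    then have "j = 0 | j = 1" by auto
    then show ?thesis by auto
  next
    case False
    then obtain i where i: "j = Suc (Suc i)" by (metis add_2_eq_Suc le_Suc_ex not_less)
    then show ?thesis using Cons.IH[of i] Cons.prems by simp
  qed
qed simp

lemma pair_length: "length (pair x u) = 2 * length x + 2 + length u"
  by (simp add: pair_def dbl_length)

lemma pair_nth1: "j < 2 * length x ==> pair x u ! j = x ! (j div 2)"
  by (simp add: pair_def nth_append dbl_length dbl_nth)

lemma pair_nth2: "pair x u ! (2 * length x) = True" "pair x u ! (2 * length x + 1) = False"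
  by (simp_all add: pair_def nth_append dbl_length)

lemma pair_nth3: "pair x u ! (2 * length x + 2 + i) = u ! i"
  by (simp add: pair_def nth_append dbl_length)

text \<open>The facts \<open>UP\<close> and \<open>UB\<close> at \<open>i\<close> say that the universally quantified string has a bit
  \<open>i\<close> and that this bit is 1, \<open>Pre\<close> and \<open>End\<close> that its length is at least and exactly \<open>i\<close>; they are
  meaningful for the longest prefix of positions with \<open>UP\<close>, so every assignment to \<open>UP\<close> and \<open>UB\<close> yields a string.
  The other facts concern a time and a tape position; position \<open>NN X\<close> is the tape cell \<open>0\<close>.\<close>

datatype tag = UP | UB | Pre | End | Cell nat nat | Head nat | NoHead nat | St nat "nat list"
  | Rd nat nat | Wr nat nat | Mv nat move

datatype rule = RPreI | RPreS | REndS | REndL | RPrefix nat | RBit bool bool | REndT | REndF | RAny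
  | RMono | RStop | RLeft | RBlank nat | RHead nat | RNoHead nat | RStart | RRead nat nat
  | RCollect nat "nat list" nat | RNext nat "nat list" | RWrite nat "nat list" nat
  | RMove nat "nat list" nat | RUpd nat nat | RKeep nat nat | RHeadM nat move | RNoHeadM nat move | RGoal

fun tgt :: "move => nat => nat => bool" where
  "tgt Move_Right b c <-> c = Suc b"
| "tgt Stay b c <-> c = b"
| "tgt Move_Left b c <-> b = Suc c"

text \<open>The input \<open>pair (pair X u) w\<close> of the machine starts with this symbol sequence of length
  \<open>4 * length X + 4\<close>.\<close>

definition prefix_symbol :: "bool list => nat => nat => bool" where
  "prefix_symbol X a s <->
     (\<exists>i<length X. \<exists>r<4. a = 4 * i + r & (if i < length X & X ! i then s = 2 else s = 1)) |
     (a = 4 * length X | a = 4 * length X + 1) & s = 2 |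
     (a = 4 * length X + 2 | a = 4 * length X + 3) & s = 1"

text \<open>\<open>PP\<close> bounds the universal string, \<open>wb\<close> the existential one in
  terms of the length of the former, and \<open>ZB\<close> the whole input. \<open>NN\<close>
  exceeds \<open>ZB\<close> and all running times, so a head that starts at position
  \<open>NN\<close> stays among the positions below 2 * NN.\<close>

locale cook =
  fixes M :: tm and R :: language and PP ZB NN :: "bool list => nat" and wb :: "bool list => nat => nat"
  assumes wf: "wf_tm M"
    and room_ZB: "!!X i. i \<le> PP X ==> 4 * length X + 6 + 2 * i + wb X i \<le> ZB X" "!!X. ZB X < NN X"
    and halts: "!!X Z. length Z \<le> ZB X ==> \<exists>t. Suc t < NN X &
      fst ((step M ^^ t) (init M Z)) = states M & has_output ((step M ^^ t) (init M Z)) [Z \<in> R]"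
begin

lemma room: "i \<le> PP X ==> 4 * length X + 6 + 2 * i + wb X i < NN X"
  using room_ZB by (meson le_less_trans)

abbreviation "K \<equiv> tapes M"
abbreviation "Sy \<equiv> symbols M"

text \<open>The halting state gets a transition that changes nothing, so that the result can be
  inspected at one fixed time.\<close>

definition dl :: "nat => nat list => nat \<times> (nat \<times> move) list" where
  "dl q ss = (if q = states M then (q, map (%s. (s, Stay)) ss) else trans M q ss)"

fun cond :: "rule => bool list => nat => nat => nat => bool" where
  "cond RPreI X a b c <-> True"
| "cond RPreS X a b c <-> a < PP X"
| "cond REndS X a b c <-> a < PP X"
| "cond REndL X a b c <-> True"
| "cond (RPrefix s) X a b c <-> prefix_symbol X a s"
| "cond (RBit v off) X a b c <-> a < PP X"
| "cond REndT X a b c <-> a \<le> PP X"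
| "cond REndF X a b c <-> a \<le> PP X"
| "cond RAny X a b c <-> a < 2 * NN X"
| "cond RMono X a b c <-> a \<le> PP X & NN X + 4 * length X + 6 + 2 * a \<le> b & Suc b < 2 * NN X"
| "cond RStop X a b c <-> a \<le> PP X"
| "cond RLeft X a b c <-> a < NN X"
| "cond (RBlank ta) X a b c <-> a < 2 * NN X"
| "cond (RHead ta) X a b c <-> True"
| "cond (RNoHead ta) X a b c <-> a < 2 * NN X & a ~= NN X"
| "cond RStart X a b c <-> True"
| "cond (RRead ta s) X a b c <-> Suc a < NN X & b < 2 * NN X"
| "cond (RCollect q ss s) X a b c <-> Suc a < NN X"
| "cond (RNext q ss) X a b c <-> Suc a < NN X"
| "cond (RWrite q ss ta) X a b c <-> Suc a < NN X"
| "cond (RMove q ss ta) X a b c <-> Suc a < NN X"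
| "cond (RUpd ta s) X a b c <-> Suc a < NN X & b < 2 * NN X"
| "cond (RKeep ta s) X a b c <-> Suc a < NN X & b < 2 * NN X"
| "cond (RHeadM ta m) X a b c <-> Suc a < NN X & b < 2 * NN X & c < 2 * NN X & tgt m b c"
| "cond (RNoHeadM ta m) X a b c <-> Suc a < NN X & b < 2 * NN X & c < 2 * NN X & ~ tgt m b c"
| "cond RGoal X a b c <-> Suc a = NN X"

text \<open>The clauses only force the facts of a run; further facts may hold besides.
  \<open>RGoal\<close> is the only clause without a positive literal. To keep to three literals, the
  symbols under the heads are collected tape by tape in the second argument of \<open>St\<close>.
  The guessed string is the content that \<open>RAny\<close> leaves open, with \<open>RMono\<close>
  and \<open>RStop\<close> making it end in blanks soon enough.\<close>

fun cls :: "rule => bool list => nat => nat => nat => (tag \<times> nat \<times> nat \<times> bool) list" where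
  "cls RPreI X a b c = [(Pre, 0, 0, True)]"
| "cls RPreS X a b c = [(Pre, a, 0, False), (UP, a, 0, False), (Pre, Suc a, 0, True)]"
| "cls REndS X a b c = [(Pre, a, 0, False), (UP, a, 0, True), (End, a, 0, True)]"
| "cls REndL X a b c = [(Pre, PP X, 0, False), (End, PP X, 0, True)]"
| "cls (RPrefix s) X a b c = [(Cell 0 s, 0, NN X + a, True)]"
| "cls (RBit v off) X a b c = [(Pre, Suc a, 0, False), (UB, a, 0, ~ v),
     (Cell 0 (bit_symbol v), 0, NN X + 4 * length X + 4 + 2 * a + (if off then 1 else 0), True)]"
| "cls REndT X a b c = [(End, a, 0, False), (Cell 0 2, 0, NN X + 4 * length X + 4 + 2 * a, True)]"
| "cls REndF X a b c = [(End, a, 0, False), (Cell 0 1, 0, NN X + 4 * length X + 5 + 2 * a, True)]"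
| "cls RAny X a b c = [(Cell 0 0, 0, a, True), (Cell 0 1, 0, a, True), (Cell 0 2, 0, a, True)]"
| "cls RMono X a b c = [(End, a, 0, False), (Cell 0 0, 0, b, False), (Cell 0 0, 0, Suc b, True)]"
| "cls RStop X a b c = [(End, a, 0, False), (Cell 0 0, 0, NN X + 4 * length X + 6 + 2 * a + wb X a, True)]"
| "cls RLeft X a b c = [(Cell 0 0, 0, a, True)]"
| "cls (RBlank ta) X a b c = [(Cell ta 0, 0, a, True)]"
| "cls (RHead ta) X a b c = [(Head ta, 0, NN X, True)]"
| "cls (RNoHead ta) X a b c = [(NoHead ta, 0, a, True)]"
| "cls RStart X a b c = [(St 0 [], 0, 0, True)]"
| "cls (RRead ta s) X a b c = [(Head ta, a, b, False), (Cell ta s, a, b, False), (Rd ta s, a, 0, True)]"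
| "cls (RCollect q ss s) X a b c =
     [(St q ss, a, 0, False), (Rd (length ss) s, a, 0, False), (St q (ss @ [s]), a, 0, True)]"
| "cls (RNext q ss) X a b c = [(St q ss, a, 0, False), (St (fst (dl q ss)) [], Suc a, 0, True)]"
| "cls (RWrite q ss ta) X a b c = [(St q ss, a, 0, False), (Wr ta (fst (snd (dl q ss) ! ta)), a, 0, True)]"
| "cls (RMove q ss ta) X a b c = [(St q ss, a, 0, False), (Mv ta (snd (snd (dl q ss) ! ta)), a, 0, True)]"
| "cls (RUpd ta s) X a b c = [(Head ta, a, b, False), (Wr ta s, a, 0, False), (Cell ta s, Suc a, b, True)]"
| "cls (RKeep ta s) X a b c = [(NoHead ta, a, b, False), (Cell ta s, a, b, False), (Cell ta s, Suc a, b, True)]"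
| "cls (RHeadM ta m) X a b c = [(Head ta, a, b, False), (Mv ta m, a, 0, False), (Head ta, Suc a, c, True)]"
| "cls (RNoHeadM ta m) X a b c = [(Head ta, a, b, False), (Mv ta m, a, 0, False), (NoHead ta, Suc a, c, True)]"
| "cls RGoal X a b c = [(Cell 0 1, a, NN X, False)]"

definition syms :: "nat => nat list set" where
  "syms j = {ss. length ss = j & set ss \<subseteq> {..<Sy}}"

definition symss :: "nat list set" where
  "symss = (\<Union>j\<le>K. syms j)"

fun rok :: "rule => bool" where
  "rok (RPrefix s) <-> s < 3"
| "rok (RBlank ta) <-> 1 \<le> ta & ta < K"
| "rok (RHead ta) <-> ta < K"
| "rok (RNoHead ta) <-> ta < K"
| "rok (RRead ta s) <-> ta < K & s < Sy"
| "rok (RCollect q ss s) <-> q \<le> states M & ss \<in> symss & length ss < K & s < Sy"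
| "rok (RNext q ss) <-> q \<le> states M & ss \<in> syms K"
| "rok (RWrite q ss ta) <-> q \<le> states M & ss \<in> syms K & ta < K"
| "rok (RMove q ss ta) <-> q \<le> states M & ss \<in> syms K & ta < K"
| "rok (RUpd ta s) <-> ta < K & s < Sy"
| "rok (RKeep ta s) <-> ta < K & s < Sy"
| "rok (RHeadM ta m) <-> ta < K"
| "rok (RNoHeadM ta m) <-> ta < K"
| "rok _ <-> True"

fun tok :: "tag => bool" where
  "tok (Cell ta s) <-> ta < K & s < Sy"
| "tok (Head ta) <-> ta < K"
| "tok (NoHead ta) <-> ta < K"
| "tok (St q ss) <-> q \<le> states M & ss \<in> symss"
| "tok (Rd ta s) <-> ta < K & s < Sy"
| "tok (Wr ta s) <-> ta < K & s < Sy"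
| "tok (Mv ta m) <-> ta < K"
| "tok _ <-> True"

lemma finite_syms: "finite (syms j)"
proof -
  have "syms j = {ss. set ss \<subseteq> {..<Sy} & length ss = j}" by (auto simp: syms_def)
  then show ?thesis by (simp add: finite_lists_length_eq)
qed

lemma finite_symss: "finite symss"
  unfolding symss_def by (intro finite_UN_I finite_syms) simp

lemma finite_move: "finite (UNIV :: move set)"
proof -
  have "(UNIV :: move set) = {Move_Left, Stay, Move_Right}" using move.exhaust by auto
  then show ?thesis by (metis finite.emptyI finite.insertI)
qed

lemma finite_tok: "finite {t. tok t}"
proof -
  let ?S = "{UP, UB, Pre, End} \<union> (%(a, b). Cell a b) ` ({..<K} \<times> {..<Sy}) \<union> Head ` {..<K}
    \<union> NoHead ` {..<K} \<union> (%(a, b). St a b) ` ({..states M} \<times> symss) \<union> (%(a, b). Rd a b) ` ({..<K} \<times> {..<Sy})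
    \<union> (%(a, b). Wr a b) ` ({..<K} \<times> {..<Sy}) \<union> (%(a, b). Mv a b) ` ({..<K} \<times> UNIV)"
  have "{t. tok t} \<subseteq> ?S"
  proof
    fix t assume "t \<in> {t. tok t}"
    then show "t \<in> ?S" by (cases t) auto
  qed
  then show ?thesis by (rule finite_subset) (simp add: finite_symss finite_move)
qed

lemma finite_rok: "finite {r. rok r}"
proof -
  let ?S = "{RPreI, RPreS, REndS, REndL, REndT, REndF, RAny, RMono, RStop, RLeft, RStart, RGoal}
    \<union> RPrefix ` {..<3} \<union> (%(a, b). RBit a b) ` UNIV \<union> RBlank ` {..<K} \<union> RHead ` {..<K} \<union> RNoHead ` {..<K}
    \<union> (%(a, b). RRead a b) ` ({..<K} \<times> {..<Sy}) \<union> (%(a, b, c). RCollect a b c) ` ({..states M} \<times> symss \<times> {..<Sy})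
    \<union> (%(a, b). RNext a b) ` ({..states M} \<times> syms K)
    \<union> (%(a, b, c). RWrite a b c) ` ({..states M} \<times> syms K \<times> {..<K})
    \<union> (%(a, b, c). RMove a b c) ` ({..states M} \<times> syms K \<times> {..<K})
    \<union> (%(a, b). RUpd a b) ` ({..<K} \<times> {..<Sy}) \<union> (%(a, b). RKeep a b) ` ({..<K} \<times> {..<Sy})
    \<union> (%(a, b). RHeadM a b) ` ({..<K} \<times> UNIV) \<union> (%(a, b). RNoHeadM a b) ` ({..<K} \<times> UNIV)"
  have "{r. rok r} \<subseteq> ?S"
  proof
    fix r assume "r \<in> {r. rok r}"
    then show "r \<in> ?S" by (cases r) (auto simp: image_iff)
  qed
  then show ?thesis by (rule finite_subset) (simp add: finite_symss finite_syms finite_move)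
qed

lemma K1: "K \<ge> 1" and Sy3: "Sy \<ge> 3"
  using wf by (auto simp: wf_tm_def)

lemma dl_wf:
  assumes "q \<le> states M" "ss \<in> syms K"
  shows "fst (dl q ss) \<le> states M" "length (snd (dl q ss)) = K"
    "!!ta. ta < K ==> fst (snd (dl q ss) ! ta) < Sy"
proof -
  have *: "fst (dl q ss) \<le> states M & length (snd (dl q ss)) = K & fst ` set (snd (dl q ss)) \<subseteq> {..<Sy}"
  proof (cases "q = states M")
    case True
    then show ?thesis using assms(2) by (auto simp: dl_def syms_def)
  next
    case False
    obtain q' acts where t: "trans M q ss = (q', acts)" by (cases "trans M q ss")
    have "q < states M" "length ss = K" "set ss \<subseteq> {..<Sy}" using False assms by (auto simp: syms_def)
    then have "q' \<le> states M & length acts = K & fst ` set acts \<subseteq> {..<Sy}"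
      using wf t unfolding wf_tm_def by blast
    then show ?thesis using False t by (simp add: dl_def)
  qed
  then show "fst (dl q ss) \<le> states M" "length (snd (dl q ss)) = K" by auto
  fix ta assume "ta < K"
  then have "snd (dl q ss) ! ta \<in> set (snd (dl q ss))" using * by simp
  then show "fst (snd (dl q ss) ! ta) < Sy" using * by blast
qed

lemma cls_ok:
  assumes "rok r" "cond r X a b c" "(tg, f, g, s) \<in> set (cls r X a b c)"
  shows "tok tg" "f < 2 * NN X" "g < 2 * NN X"
proof -
  have r: "4 * length X + 6 + 2 * i + wb X i < NN X" if "i \<le> PP X" for i using room that .
  have r0: "4 * length X + 6 + 2 * PP X < NN X" using r[of "PP X"] by linarith
  have sy: "ss \<in> symss" if "ss \<in> syms K" for ss using that by (auto simp: symss_def)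
  have nil: "[] \<in> symss" by (auto simp: symss_def syms_def)
  have app: "ss @ [s'] \<in> symss" if "ss \<in> symss" "length ss < K" "s' < Sy" for ss s'
    using that by (auto simp: symss_def syms_def)
  have px: "a < 4 * length X + 4" if "prefix_symbol X a s'" for s' using that by (auto simp: prefix_symbol_def)
  show "tok tg"
    using assms K1 Sy3 sy nil app dl_wf by (cases r) (auto simp: bit_symbol_def)
  show "f < 2 * NN X"
    using assms r0 by (cases r) (auto simp: bit_symbol_def)
  show "g < 2 * NN X"
    using assms r0 r[of a] by (cases r) (auto simp: bit_symbol_def dest: px)
qed

lemma cls_small: "length (cls r X a b c) \<le> 3" "cls r X a b c ~= []"
  by (cases r; simp)+

text \<open>Parameters that a rule ignores are not bounded by \<open>cond\<close>; putting 0 for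
  them gives the same clause with a number in range.\<close>

lemma cond_bound:
  assumes "cond r X a b c"
  shows "\<exists>a' b' c'. a' < 2 * NN X & b' < 2 * NN X & c' < 2 * NN X & cond r X a' b' c' &
    cls r X a' b' c' = cls r X a b c"
proof -
  have r0: "4 * length X + 6 + 2 * PP X < NN X" using room[of "PP X" X] by simp
  have px: "a < 4 * length X + 4" if "prefix_symbol X a s'" for s' using that by (auto simp: prefix_symbol_def)
  define a' where "a' = (if a < 2 * NN X then a else 0)"
  define b' where "b' = (if b < 2 * NN X then b else 0)"
  define c' where "c' = (if c < 2 * NN X then c else 0)"
  have "a' < 2 * NN X" "b' < 2 * NN X" "c' < 2 * NN X" using r0 by (auto simp: a'_def b'_def c'_def)
  moreover have "cond r X a' b' c' & cls r X a' b' c' = cls r X a b c"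
    using assms r0 by (cases r) (auto simp: a'_def b'_def c'_def dest: px)
  ultimately show ?thesis by blast
qed

definition sat :: "(tag => nat => nat => bool) => bool list => bool" where
  "sat B X <-> (\<forall>r a b c. rok r --> cond r X a b c --> (\<exists>(tg, f, g, s)\<in>set (cls r X a b c). B tg f g = s))"

section \<open>Runs of the verifying machine\<close>

definition cfg :: "bool list => nat => config" where "cfg Z t = (step M ^^ t) (init M Z)"
definition qs :: "bool list => nat => nat" where "qs Z t = fst (cfg Z t)"
definition tp :: "bool list => nat => nat => tape" where "tp Z t ta = snd (cfg Z t) ! ta"
definition rds :: "bool list => nat => nat list" where "rds Z t = map read (snd (cfg Z t))"

lemma cfg_Suc:
  "cfg Z (Suc t) = (fst (dl (qs Z t) (rds Z t)), map2 act (snd (cfg Z t)) (snd (dl (qs Z t) (rds Z t))))"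
proof -
  obtain q ts where c: "cfg Z t = (q, ts)" by (cases "cfg Z t")
  have "map2 act ts (map (%s. (s, Stay)) (map read ts)) = ts"
  proof (rule nth_equalityI)
    fix i assume "i < length (map2 act ts (map (%s. (s, Stay)) (map read ts)))"
    then show "map2 act ts (map (%s. (s, Stay)) (map read ts)) ! i = ts ! i"
      by (cases "ts ! i") simp
  qed simp
  moreover have "cfg Z (Suc t) = step M (q, ts)" using c by (simp add: cfg_def)
  ultimately show ?thesis by (simp add: qs_def rds_def dl_def c split: prod.splits)
qed

lemma read_fst: "read x = fst x (snd x)"
  by (cases x) simp

lemma run_inv: "qs Z t \<le> states M & length (snd (cfg Z t)) = K & (\<forall>ta<K. \<forall>i. fst (tp Z t ta) i < Sy)"
proof (induction t)
  case 0
  have l: "length (input_tape Z # replicate (K - 1) (%_. 0, 0)) = K" using K1 by simp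
  have "fst ((input_tape Z # replicate (K - 1) (%_. 0, 0)) ! ta) i < Sy" if "ta < K" for ta i
    using that Sy3 by (cases ta) (auto simp: input_tape_def bit_symbol_def)
  then show ?case using l by (simp add: qs_def cfg_def init_def tp_def)
next
  case (Suc t)
  have ss: "rds Z t \<in> syms K"
  proof -
    have "read (tp Z t ta) < Sy" if "ta < K" for ta using Suc that by (simp add: read_fst)
    then have "\<forall>x\<in>set (snd (cfg Z t)). read x < Sy" using Suc by (metis in_set_conv_nth tp_def)
    then show ?thesis using Suc by (simp add: syms_def rds_def image_subset_iff)
  qed
  note d = dl_wf[OF conjunct1[OF Suc] ss]
  have "fst (act (tp Z t ta) (snd (dl (qs Z t) (rds Z t)) ! ta)) i < Sy" if "ta < K" for ta i
    using d(3)[OF that] Suc that by (cases "tp Z t ta"; cases "snd (dl (qs Z t) (rds Z t)) ! ta") force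
  then show ?case using d Suc by (simp add: qs_def tp_def cfg_Suc)
qed

lemma rds_syms: "rds Z t \<in> syms K"
proof -
  have "read (tp Z t ta) < Sy" if "ta < K" for ta using run_inv[of Z t] that by (simp add: read_fst)
  then have "\<forall>x\<in>set (snd (cfg Z t)). read x < Sy" using run_inv[of Z t] by (metis in_set_conv_nth tp_def)
  then show ?thesis using run_inv[of Z t] by (simp add: syms_def rds_def image_subset_iff)
qed

lemma length_rds: "length (rds Z t) = K"
  using run_inv[of Z t] by (simp add: rds_def)

lemma rds_nth: "ta < K ==> rds Z t ! ta = read (tp Z t ta)"
  using run_inv[of Z t] by (simp add: rds_def tp_def)

lemma rds_less: "ta < K ==> rds Z t ! ta < Sy"
  using run_inv[of Z t] by (simp add: rds_nth read_fst)

lemma tp_0: "ta < K ==> tp Z 0 ta = (if ta = 0 then input_tape Z else (%_. 0, 0))"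
  by (cases ta) (auto simp: tp_def cfg_def init_def)

lemma tp_Suc: "ta < K ==> tp Z (Suc t) ta = act (tp Z t ta) (snd (dl (qs Z t) (rds Z t)) ! ta)"
  using run_inv[of Z t] dl_wf[of "qs Z t" "rds Z t"] rds_syms by (simp add: tp_def cfg_Suc)

lemma qs_0: "qs Z 0 = 0" by (simp add: qs_def cfg_def init_def)

lemma qs_Suc: "qs Z (Suc t) = fst (dl (qs Z t) (rds Z t))" by (simp add: qs_def cfg_Suc)

lemma head_bound: "ta < K ==> \<bar>snd (tp Z t ta)\<bar> \<le> int t"
proof (induction t)
  case 0
  then show ?case by (simp add: tp_0 input_tape_def)
next
  case (Suc t)
  obtain f p where fp: "tp Z t ta = (f, p)" by (cases "tp Z t ta")
  obtain s m where sm: "snd (dl (qs Z t) (rds Z t)) ! ta = (s, m)" by (cases "snd (dl (qs Z t) (rds Z t)) ! ta")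
  have "\<bar>p\<bar> \<le> int t" using Suc fp by simp
  then show ?case using tp_Suc[OF Suc.prems, of Z t] fp sm by (cases m) auto
qed

lemma stays_halted: "fst (cfg Z t) = states M ==> t \<le> t' ==> cfg Z t' = cfg Z t"
proof (induction t')
  case (Suc t')
  show ?case
  proof (cases "t = Suc t'")
    case False
    then have "cfg Z t' = cfg Z t" using Suc by simp
    moreover have "cfg Z (Suc t') = step M (cfg Z t')" by (simp add: cfg_def)
    ultimately show ?thesis using Suc.prems(1) by (cases "cfg Z t") simp
  qed simp
qed simp

lemma final_cell:
  assumes "length Z \<le> ZB X" "Suc t = NN X"
  shows "fst (tp Z t 0) 0 = (if Z \<in> R then 2 else 1)"
proof -
  have "\<exists>t. Suc t < NN X & fst (cfg Z t) = states M & has_output (cfg Z t) [Z \<in> R]"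
    unfolding cfg_def by (rule halts[OF assms(1)])
  then obtain t0 where t0: "Suc t0 < NN X" "fst (cfg Z t0) = states M" "has_output (cfg Z t0) [Z \<in> R]" by blast
  have "t0 \<le> t" using t0(1) assms(2) by linarith
  then have "cfg Z t = cfg Z t0" by (rule stays_halted[OF t0(2)])
  moreover have "fst (tp Z t0 0) 0 = bit_symbol (Z \<in> R)"
  proof -
    obtain q ts where c: "cfg Z t0 = (q, ts)" by (cases "cfg Z t0")
    have "length ts = K" using run_inv[of Z t0] c by simp
    then have "hd ts = tp Z t0 0" using K1 c by (cases ts) (auto simp: tp_def)
    then show ?thesis using t0(3) c by simp
  qed
  ultimately show ?thesis by (simp add: tp_def bit_symbol_def)
qed

section \<open>The symbols of a doubly paired input\<close>

definition sy :: "bool list => nat => nat" where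
  "sy Z j = (if j < length Z then bit_symbol (Z ! j) else 0)"

lemma input_tape_sy: "fst (input_tape Z) (int j) = sy Z j"
  by (simp add: input_tape_def sy_def)

lemma input_tape_neg: "i < 0 ==> fst (input_tape Z) i = 0"
  by (simp add: input_tape_def)

context
  fixes X u w Z :: "bool list"
  assumes Z: "Z = pair (pair X u) w"
begin

lemma length_Z: "length Z = 4 * length X + 6 + 2 * length u + length w"
  by (simp add: Z pair_length)

text \<open>Pairing twice doubles \<open>X\<close> twice, so each of its bits fills four cells, and
  the doubled inner delimiter appears as the symbols 2, 2, 1, 1.\<close>

lemma sy_prefix: "a < 4 * length X + 4 ==> prefix_symbol X a s <-> s = sy Z a"
proof -
  assume a: "a < 4 * length X + 4"
  have "a div 2 < length (pair X u)" using a by (simp add: pair_length)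
  have Za: "Z ! a = pair X u ! (a div 2)" unfolding Z
    by (rule pair_nth1) (use a in "simp add: pair_length")
  have sa: "sy Z a = bit_symbol (pair X u ! (a div 2))" using Za a by (simp add: sy_def length_Z)
  consider "a < 4 * length X" | "a = 4 * length X | a = 4 * length X + 1" | "a = 4 * length X + 2 | a = 4 * length X + 3"
    using a by linarith
  then show ?thesis
  proof cases
    case 1
    have "pair X u ! (a div 2) = X ! (a div 2 div 2)" by (rule pair_nth1) (use 1 in simp)
    also have "a div 2 div 2 = a div 4" by (simp add: div_mult2_eq[symmetric])
    finally have s: "sy Z a = (if X ! (a div 4) then 2 else 1)" using sa by (simp add: bit_symbol_def)
    have un: "(a = 4 * i + r & r < 4) = (i = a div 4 & r = a mod 4)" for i r by auto
    have l: "a div 4 < length X" using 1 by auto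
    have "prefix_symbol X a s <-> (\<exists>i<length X. \<exists>r<4. a = 4 * i + r & (if X ! i then s = 2 else s = 1))"
      using 1 unfolding prefix_symbol_def by auto
    also have "\<dots> <-> (\<exists>i r. (a = 4 * i + r & r < 4) & i < length X & (if X ! i then s = 2 else s = 1))" by blast
    also have "\<dots> <-> s = sy Z a" unfolding un s using l by auto
    finally show ?thesis .
  next
    case 2
    then have "a div 2 = 2 * length X" by auto
    then have "sy Z a = 2" using sa pair_nth2(1)[of X u] by (simp add: bit_symbol_def)
    then show ?thesis using 2 unfolding prefix_symbol_def by auto
  next
    case 3
    then have "a div 2 = 2 * length X + 1" by auto
    then have "sy Z a = 1" using sa pair_nth2(2)[of X u] by (simp add: bit_symbol_def)
    then show ?thesis using 3 unfolding prefix_symbol_def by auto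
  qed
qed

lemma sy_u: "i < length u ==> off < 2 ==> sy Z (4 * length X + 4 + 2 * i + off) = bit_symbol (u ! i)"
proof -
  assume i: "i < length u" "off < 2"
  have "Z ! (4 * length X + 4 + 2 * i + off) = pair X u ! ((4 * length X + 4 + 2 * i + off) div 2)"
    unfolding Z by (rule pair_nth1) (use i in "simp add: pair_length")
  moreover have "(4 * length X + 4 + 2 * i + off) div 2 = 2 * length X + 2 + i" using i(2) by simp
  ultimately have "Z ! (4 * length X + 4 + 2 * i + off) = u ! i" by (simp only: pair_nth3)
  then show ?thesis using i by (simp add: sy_def length_Z)
qed

lemma sy_end: "sy Z (4 * length X + 4 + 2 * length u) = 2" "sy Z (4 * length X + 5 + 2 * length u) = 1"
proof -
  have e: "4 * length X + 4 + 2 * length u = 2 * length (pair X u)"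
    "4 * length X + 5 + 2 * length u = 2 * length (pair X u) + 1" by (simp_all add: pair_length)
  show "sy Z (4 * length X + 4 + 2 * length u) = 2" "sy Z (4 * length X + 5 + 2 * length u) = 1"
    unfolding e Z sy_def pair_nth2 by (simp_all add: bit_symbol_def pair_length)
qed

lemma sy_w: "sy Z (4 * length X + 6 + 2 * length u + i) = (if i < length w then bit_symbol (w ! i) else 0)"
proof -
  have e: "4 * length X + 6 + 2 * length u + i = 2 * length (pair X u) + 2 + i" by (simp add: pair_length)
  show ?thesis unfolding e sy_def Z pair_nth3 by (simp add: pair_length)
qed

end

fun run_fact :: "bool list => (nat => bool) => (nat => bool) => bool list => bool list => tag => nat => nat => bool" where
  "run_fact X a1 a2 u Z UP i j <-> a1 i"
| "run_fact X a1 a2 u Z UB i j <-> a2 i"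
| "run_fact X a1 a2 u Z Pre i j <-> i \<le> length u"
| "run_fact X a1 a2 u Z End i j <-> i = length u"
| "run_fact X a1 a2 u Z (Cell ta s) t p <-> fst (tp Z t ta) (int p - int (NN X)) = s"
| "run_fact X a1 a2 u Z (Head ta) t p <-> snd (tp Z t ta) = int p - int (NN X)"
| "run_fact X a1 a2 u Z (NoHead ta) t p <-> snd (tp Z t ta) ~= int p - int (NN X)"
| "run_fact X a1 a2 u Z (St q ss) t p <-> q = qs Z t & ss = take (length ss) (rds Z t)"
| "run_fact X a1 a2 u Z (Rd ta s) t p <-> read (tp Z t ta) = s"
| "run_fact X a1 a2 u Z (Wr ta s) t p <-> fst (snd (dl (qs Z t) (rds Z t)) ! ta) = s"
| "run_fact X a1 a2 u Z (Mv ta m) t p <-> snd (snd (dl (qs Z t) (rds Z t)) ! ta) = m"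

lemma tp_Suc_cell: "ta < K ==> fst (tp Z (Suc t) ta) i =
   (if i = snd (tp Z t ta) then fst (snd (dl (qs Z t) (rds Z t)) ! ta) else fst (tp Z t ta) i)"
  by (cases "tp Z t ta"; cases "snd (dl (qs Z t) (rds Z t)) ! ta") (simp add: tp_Suc)

lemma tp_Suc_head: "ta < K ==> snd (tp Z (Suc t) ta) =
   shift (snd (snd (dl (qs Z t) (rds Z t)) ! ta)) (snd (tp Z t ta))"
  by (cases "tp Z t ta"; cases "snd (dl (qs Z t) (rds Z t)) ! ta") (simp add: tp_Suc)

lemma tgt_shift: "tgt m b c <-> shift m (int b - n) = int c - n"
  by (cases m) auto

lemma sat_run_fact:
  assumes Z: "Z = pair (pair X u) w" and ZR: "Z \<in> R" and u: "length u \<le> PP X" and w: "length w \<le> wb X (length u)"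
    and a1: "!!i. i < length u ==> a1 i" "length u < PP X ==> ~ a1 (length u)"
    and a2: "!!i. i < length u ==> a2 i = u ! i"
  shows "sat (run_fact X a1 a2 u Z) X"
  unfolding sat_def
proof (intro allI impI)
  fix r a b c assume r: "rok r" "cond r X a b c"
  let ?B = "run_fact X a1 a2 u Z" and ?N = "NN X" and ?D = "4 * length X + 4"
  have lZ: "length Z \<le> ZB X" using room_ZB(1)[OF u] w length_Z[OF Z] by linarith
  have c0: "fst (tp Z 0 0) (int p - int ?N) = (if p < ?N then 0 else sy Z (p - ?N))" for p
  proof (cases "p < ?N")
    case True
    then show ?thesis using K1 by (simp add: tp_0 input_tape_neg)
  next
    case False
    then have e: "int p - int ?N = int (p - ?N)" by (simp add: of_nat_diff)
    have "tp Z 0 0 = input_tape Z" using K1 by (simp add: tp_0)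
    then show ?thesis using False unfolding e by (simp only: input_tape_sy if_False)
  qed
  have sy3: "sy Z j = 0 | sy Z j = 1 | sy Z j = 2" for j by (simp add: sy_def bit_symbol_def)
  have "list_ex (%(tg, f, g, s). ?B tg f g = s) (cls r X a b c)"
  proof (cases r)
    case RPreI then show ?thesis by simp
  next
    case RPreS then show ?thesis using r a1 by (auto simp: not_le order_le_less)
  next
    case REndS then show ?thesis using r a1 by (auto simp: not_le order_le_less)
  next
    case REndL then show ?thesis using u by auto
  next
    case (RPrefix s)
    then have p: "prefix_symbol X a s" using r by simp
    then have "a < ?D" by (auto simp: prefix_symbol_def)
    then show ?thesis using p sy_prefix[OF Z] RPrefix c0 by auto
  next
    case (RBit v off)
    have "sy Z (?D + 2 * a + (if off then 1 else 0)) = bit_symbol (u ! a)" if "a < length u"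
      using sy_u[OF Z that, of "if off then 1 else 0"] by simp
    then show ?thesis using RBit c0 a2[of a] by (auto simp: add.assoc)
  next
    case REndT
    then show ?thesis using c0 sy_end[OF Z] by (auto simp: add.assoc)
  next
    case REndF
    then show ?thesis using c0 sy_end[OF Z] by (auto simp: add.assoc)
  next
    case RAny
    then show ?thesis using c0[of a] sy3[of "a - ?N"] by auto
  next
    case RMono
    show ?thesis
    proof (cases "a = length u")
      case True
      have b: "?N + 4 * length X + 6 + 2 * a \<le> b" using r RMono by simp
      then obtain i where i: "b = ?N + (4 * length X + 6 + 2 * length u + i)"
        using True by (metis add.assoc le_Suc_ex)
      show ?thesis using RMono c0[of b] c0[of "Suc b"] sy_w[OF Z, of i] sy_w[OF Z, of "Suc i"] i True
        by (auto simp: bit_symbol_def split: if_splits)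
    qed (use RMono in simp)
  next
    case RStop
    then show ?thesis using c0 sy_w[OF Z, of "wb X (length u)"] w by (auto simp: add.assoc)
  next
    case RLeft
    then show ?thesis using c0 r by simp
  next
    case (RBlank ta)
    then show ?thesis using r by (simp add: tp_0)
  next
    case (RHead ta)
    then show ?thesis using r by (simp add: tp_0 input_tape_def)
  next
    case (RNoHead ta)
    then show ?thesis using r by (auto simp: tp_0 input_tape_def)
  next
    case RStart
    then show ?thesis by (simp add: qs_0)
  next
    case (RRead ta s)
    then show ?thesis by (auto simp: read_fst)
  next
    case (RCollect q ss s)
    then have l: "length ss < K" using r by simp
    then show ?thesis using RCollect rds_nth[OF l, of Z a] length_rds[of Z a]
      by (auto simp: take_Suc_conv_app_nth)
  next
    case (RNext q ss)
    then have "length ss = K" using r by (simp add: syms_def)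
    then show ?thesis using RNext length_rds[of Z a] by (auto simp: qs_Suc)
  next
    case (RWrite q ss ta)
    then have "length ss = K" using r by (simp add: syms_def)
    then show ?thesis using RWrite length_rds[of Z a] by auto
  next
    case (RMove q ss ta)
    then have "length ss = K" using r by (simp add: syms_def)
    then show ?thesis using RMove length_rds[of Z a] by auto
  next
    case (RUpd ta s)
    then show ?thesis using r by (auto simp: tp_Suc_cell)
  next
    case (RKeep ta s)
    then show ?thesis using r by (auto simp: tp_Suc_cell)
  next
    case (RHeadM ta m)
    then show ?thesis using r tgt_shift[of m b c "int ?N"] by (auto simp: tp_Suc_head)
  next
    case (RNoHeadM ta m)
    then show ?thesis using r tgt_shift[of m b c "int ?N"] by (auto simp: tp_Suc_head)
  next
    case RGoal
    then show ?thesis using final_cell[OF lZ, of a] r ZR by simp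
  qed
  then show "\<exists>(tg, f, g, s)\<in>set (cls r X a b c). ?B tg f g = s"
    by (simp add: list_ex_iff)
qed

lemma satD:
  assumes "sat B X" "rok r" "cond r X a b c"
  shows "list_ex (%(tg, f, g, s). B tg f g = s) (cls r X a b c)"
  using assms unfolding sat_def list_ex_iff by blast

text \<open>Apart from the goal, the clauses about later times are implications from facts at one
  time to facts at the same or the next time, so induction on time carries the run along. The
  initial cells are a hypothesis because they hold the guessed string. At time t a head is at most t
  cells away from \<open>NN\<close>, hence never at the border.\<close>

lemma sat_forces_run:
  assumes B: "sat B X"
    and cell0: "!!ta p. ta < K ==> p < 2 * NN X ==> B (Cell ta (fst (tp Z 0 ta) (int p - int (NN X)))) 0 p"
    and t: "t < NN X"
  shows "(\<forall>ta<K. \<forall>p<2 * NN X. B (Cell ta (fst (tp Z t ta) (int p - int (NN X)))) t p) &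
    (\<forall>ta<K. \<forall>p<2 * NN X. B (if snd (tp Z t ta) = int p - int (NN X) then Head ta else NoHead ta) t p) &
    B (St (qs Z t) []) t 0"
  using t
proof (induction t)
  case 0
  have "B (if snd (tp Z 0 ta) = int p - int (NN X) then Head ta else NoHead ta) 0 p"
    if "ta < K" "p < 2 * NN X" for ta p
  proof -
    have "snd (tp Z 0 ta) = 0" using that by (simp add: tp_0 input_tape_def)
    then show ?thesis using satD[OF B, of "RHead ta"] satD[OF B, of "RNoHead ta" p] that
      by (cases "p = NN X") auto
  qed
  moreover have "B (St (qs Z 0) []) 0 0" using satD[OF B, of RStart] by (simp add: qs_0)
  ultimately show ?case using cell0 by blast
next
  case (Suc t)
  let ?N = "NN X"
  let ?q = "qs Z t" and ?rs = "rds Z t"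
  have t: "Suc t < ?N" using Suc.prems .
  have IH: "!!ta p. ta < K ==> p < 2 * ?N ==> B (Cell ta (fst (tp Z t ta) (int p - int ?N))) t p"
    "!!ta p. ta < K ==> p < 2 * ?N ==> B (if snd (tp Z t ta) = int p - int ?N then Head ta else NoHead ta) t p"
    "B (St ?q []) t 0"
    using Suc.IH t by auto
  have q: "?q \<le> states M" using run_inv by blast
  define h where "h ta = nat (snd (tp Z t ta) + int ?N)" for ta
  have h: "int (h ta) = snd (tp Z t ta) + int ?N" "h ta \<ge> 2" "Suc (h ta) < 2 * ?N" if "ta < K" for ta
    using head_bound[OF that, of Z t] t unfolding h_def by linarith+
  have hd: "B (Head ta) t (h ta)" if "ta < K" for ta
    using IH(2)[OF that, of "h ta"] h[OF that] by (simp add: algebra_simps)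
  have rd: "B (Rd ta (?rs ! ta)) t 0" if ta: "ta < K" for ta
  proof -
    have e: "?rs ! ta = fst (tp Z t ta) (int (h ta) - int ?N)"
      using rds_nth[OF ta, of Z t] h[OF ta] by (simp add: read_fst)
    have "B (Cell ta (?rs ! ta)) t (h ta)" unfolding e using IH(1)[OF ta, of "h ta"] h[OF ta] by simp
    then show ?thesis
      using satD[OF B, of "RRead ta (?rs ! ta)" t "h ta"] hd[OF ta] h[OF ta] t ta rds_less[OF ta, of Z t]
      by simp
  qed
  have lr: "length ?rs = K" using length_rds .
  have col: "B (St ?q (take j ?rs)) t 0" if "j \<le> K" for j
    using that
  proof (induction j)
    case 0
    then show ?case using IH(3) by simp
  next
    case (Suc j)
    have sub: "set (take j ?rs) \<subseteq> {..<Sy}" using rds_syms[of Z t] set_take_subset by (fastforce simp: syms_def)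
    have "take j ?rs \<in> symss" using sub lr Suc.prems by (auto simp: symss_def syms_def)
    moreover have "?rs ! j < Sy" using rds_less[of j] Suc.prems by simp
    ultimately have "rok (RCollect ?q (take j ?rs) (?rs ! j))" using q lr Suc.prems by simp
    from satD[OF B this, of t] have "B (St ?q (take j ?rs @ [?rs ! j])) t 0"
      using Suc rd[of j] t lr by simp
    then show ?case using lr Suc.prems by (simp add: take_Suc_conv_app_nth)
  qed
  have full: "B (St ?q ?rs) t 0" using col[of K] lr by simp
  have rs: "?rs \<in> syms K" using rds_syms .
  have st: "B (St (qs Z (Suc t)) []) (Suc t) 0"
    using satD[OF B, of "RNext ?q ?rs" t] full q rs t by (simp add: qs_Suc)
  let ?a = "snd (dl ?q ?rs)"
  have wr: "B (Wr ta (fst (?a ! ta))) t 0" "B (Mv ta (snd (?a ! ta))) t 0" if "ta < K" for ta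
    using satD[OF B, of "RWrite ?q ?rs ta" t] satD[OF B, of "RMove ?q ?rs ta" t] full q rs t that by auto
  have cell: "B (Cell ta (fst (tp Z (Suc t) ta) (int p - int ?N))) (Suc t) p" if ta: "ta < K" and p: "p < 2 * ?N" for ta p
  proof (cases "snd (tp Z t ta) = int p - int ?N")
    case True
    then have "p = h ta" using h(1)[OF ta] by simp
    moreover have "fst (?a ! ta) < Sy" using dl_wf(3)[OF q rs ta] .
    ultimately show ?thesis using satD[OF B, of "RUpd ta (fst (?a ! ta))" t p] hd[OF ta] wr[OF ta] ta p t True
      by (simp add: tp_Suc_cell)
  next
    case False
    have "fst (tp Z t ta) (int p - int ?N) < Sy" using run_inv ta by blast
    then show ?thesis using satD[OF B, of "RKeep ta (fst (tp Z t ta) (int p - int ?N))" t p]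
        IH(1)[OF ta p] IH(2)[OF ta p] ta p t False
      by (auto simp: tp_Suc_cell)
  qed
  have head: "B (if snd (tp Z (Suc t) ta) = int p - int ?N then Head ta else NoHead ta) (Suc t) p"
    if ta: "ta < K" and p: "p < 2 * ?N" for ta p
  proof -
    let ?m = "snd (?a ! ta)"
    have "snd (tp Z t ta) = int (h ta) - int ?N" using h(1)[OF ta] by simp
    then have "snd (tp Z (Suc t) ta) = int p - int ?N <-> tgt ?m (h ta) p"
      using tp_Suc_head[OF ta, of Z t] tgt_shift[of ?m "h ta" p "int ?N"] by simp
    then show ?thesis
      using satD[OF B, of "RHeadM ta ?m" t "h ta" p] satD[OF B, of "RNoHeadM ta ?m" t "h ta" p]
        hd[OF ta] wr(2)[OF ta] h[OF ta] ta p t by auto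
  qed
  show ?case using cell head st by blast
qed

theorem sat_iff:
  "(\<forall>A. \<exists>B. (\<forall>i<PP X. B UP i 0 = A True i & B UB i 0 = A False i) & sat B X) <->
   (\<forall>u. length u \<le> PP X --> (\<exists>w. length w \<le> wb X (length u) & pair (pair X u) w \<in> R))"
proof (intro iffI allI impI)
  fix A :: "bool => nat => bool"
  assume *: "\<forall>u. length u \<le> PP X --> (\<exists>w. length w \<le> wb X (length u) & pair (pair X u) w \<in> R)"
  \<comment> \<open>The universal string has as many bits as the longest prefix on which
    \<open>UP\<close> holds, but at most \<open>PP X\<close>.\<close>
  define n where "n = (LEAST i. i = PP X | ~ A True i)"
  have n: "n = PP X | ~ A True n" unfolding n_def by (rule LeastI[of _ "PP X"]) simp
  have nle: "n \<le> PP X" unfolding n_def by (rule Least_le) simp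
  have nl: "A True i" if "i < n" for i using not_less_Least[of i] that unfolding n_def by blast
  define u where "u = map (A False) [0..<n]"
  have u: "length u = n" by (simp add: u_def)
  obtain w where w: "length w \<le> wb X (length u)" "pair (pair X u) w \<in> R" using * nle u by auto
  have "sat (run_fact X (A True) (A False) u (pair (pair X u) w)) X"
    by (rule sat_run_fact[OF refl w(2) _ w(1)]) (use n nle nl u in "auto simp: u_def")
  then show "\<exists>B. (\<forall>i<PP X. B UP i 0 = A True i & B UB i 0 = A False i) & sat B X"
    by (intro exI[of _ "run_fact X (A True) (A False) u (pair (pair X u) w)"]) simp
next
  fix u :: "bool list" assume *: "\<forall>A. \<exists>B. (\<forall>i<PP X. B UP i 0 = A True i & B UB i 0 = A False i) & sat B X"
    and u: "length u \<le> PP X"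
  let ?N = "NN X" and ?D = "4 * length X + 4"
  obtain B where B: "!!i. i < PP X ==> B UP i 0 = (i < length u)" "!!i. i < PP X ==> B UB i 0 = (i < length u & u ! i)" "sat B X"
    using spec[OF *, of "%b i. if b then i < length u else i < length u & u ! i"] by auto
  note D = satD[OF B(3)]
  define b0 where "b0 = ?N + (4 * length X + 6 + 2 * length u)"
  have rm: "4 * length X + 6 + 2 * length u + wb X (length u) < ?N" using room[OF u] .
  have pre: "B Pre i 0" if "i \<le> length u" for i
    using that
  proof (induction i)
    case 0
    then show ?case using D[of RPreI] by simp
  next
    case (Suc i)
    then show ?case using D[of RPreS i] B(1)[of i] u by simp
  qed
  have en: "B End (length u) 0"
  proof (cases "length u = PP X")
    case True
    then show ?thesis using D[of REndL] pre[of "length u"] by simp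
  next
    case False
    then show ?thesis using D[of REndS "length u"] pre[of "length u"] B(1)[of "length u"] u by simp
  qed
  have stop: "B (Cell 0 0) 0 (b0 + wb X (length u))"
    using D[of RStop "length u"] en u by (simp add: b0_def algebra_simps)
  \<comment> \<open>The guessed string ends before the first cell that is blank according to
    \<open>B\<close>; a cell may carry several symbols in \<open>B\<close>, and one of them is
    selected.\<close>
  define m where "m = (LEAST j. B (Cell 0 0) 0 (b0 + j))"
  have m: "B (Cell 0 0) 0 (b0 + m)" unfolding m_def by (rule LeastI[of _ "wb X (length u)"]) (rule stop)
  have mle: "m \<le> wb X (length u)" unfolding m_def by (rule Least_le) (rule stop)
  have ml: "~ B (Cell 0 0) 0 (b0 + j)" if "j < m" for j
    using not_less_Least[of j] that unfolding m_def by blast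
  define w where "w = map (%j. B (Cell 0 2) 0 (b0 + j)) [0..<m]"
  have w: "length w = m" by (simp add: w_def)
  define Z where "Z = pair (pair X u) w"
  have lZ: "length Z \<le> ZB X" using length_Z[OF Z_def] w mle room_ZB(1)[OF u] by linarith
  have sy_cell: "B (Cell 0 (sy Z j)) 0 (?N + j)" if j: "j < ?N" for j
  proof -
    consider "j < ?D" | "?D \<le> j" "j < ?D + 2 * length u" | "j = ?D + 2 * length u" | "j = ?D + 2 * length u + 1"
      | "?D + 2 * length u + 2 \<le> j" by linarith
    then show ?thesis
    proof cases
      case 1
      then have p: "prefix_symbol X j (sy Z j)" using sy_prefix[OF Z_def] by blast
      moreover have "sy Z j < 3" by (simp add: sy_def bit_symbol_def)
      ultimately show ?thesis using D[of "RPrefix (sy Z j)" j] by simp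
    next
      case 2
      define i where "i = (j - ?D) div 2"
      define off where "off = (j - ?D) mod 2"
      have i: "j = ?D + 2 * i + off" "i < length u" "off < 2" using 2 unfolding i_def off_def by auto
      have "sy Z j = bit_symbol (u ! i)" using sy_u[OF Z_def i(2,3)] i(1) by simp
      moreover have "off = 0 | off = 1" using i(3) by auto
      ultimately show ?thesis
        using D[of "RBit (u ! i) (off = 1)" i] pre[of "Suc i"] B(2)[of i] i u by (auto simp: algebra_simps)
    next
      case 3
      then show ?thesis using D[of REndT "length u"] en u sy_end[OF Z_def] by (simp add: algebra_simps)
    next
      case 4
      then show ?thesis using D[of REndF "length u"] en u sy_end[OF Z_def] by (simp add: algebra_simps)
    next
      case 5
      then obtain i where i: "j = 4 * length X + 6 + 2 * length u + i"
        by (intro that[of "j - (4 * length X + 6 + 2 * length u)"]) linarith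
      have Nj: "?N + j = b0 + i" by (simp add: b0_def i)
      show ?thesis
      proof (cases "i < m")
        case True
        have "B (Cell 0 0) 0 (b0 + i) | B (Cell 0 1) 0 (b0 + i) | B (Cell 0 2) 0 (b0 + i)"
          using D[of RAny "b0 + i"] Nj j by auto
        then show ?thesis unfolding Nj using ml[OF True] True sy_w[OF Z_def, of i, folded i] w
          by (auto simp: w_def bit_symbol_def)
      next
        case False
        \<comment> \<open>From the first blank on, \<open>RMono\<close> propagates blanks to the end
          of the range.\<close>
        have "B (Cell 0 0) 0 (b0 + (m + d))" if "b0 + (m + d) < 2 * ?N" for d
          using that
        proof (induction d)
          case (Suc d)
          then show ?case using D[of RMono "length u" "b0 + (m + d)"] en u by (simp add: b0_def)
        qed (use m in simp)
        from this[of "i - m"] have "B (Cell 0 0) 0 (b0 + i)" using False Nj j by simp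
        then show ?thesis unfolding Nj using sy_w[OF Z_def, of i, folded i] w False by simp
      qed
    qed
  qed
  have cell0: "B (Cell ta (fst (tp Z 0 ta) (int p - int ?N))) 0 p" if ta: "ta < K" and p: "p < 2 * ?N" for ta p
  proof (cases "ta = 0")
    case False
    then show ?thesis using D[of "RBlank ta" p] ta p by (simp add: tp_0)
  next
    case t0: True
    show ?thesis
    proof (cases "p < ?N")
      case True
      then show ?thesis using D[of RLeft p] ta t0 by (simp add: tp_0 input_tape_neg)
    next
      case False
      then obtain j where j: "p = ?N + j" using le_Suc_ex not_less by metis
      then show ?thesis using sy_cell[of j] p t0 ta by (simp add: tp_0 input_tape_sy)
    qed
  qed
  obtain t where t: "Suc t = ?N" using rm by (metis less_imp_Suc_add)
  have "B (Cell 0 (fst (tp Z t 0) (int ?N - int ?N))) t ?N"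
    using sat_forces_run[OF B(3) cell0, of t] t K1 by (metis (no_types, lifting) lessI less_add_same_cancel1 mult_2 zero_less_Suc zero_less_one_class.zero_less_one less_le_trans)
  moreover have "~ B (Cell 0 1) t ?N" using D[of RGoal t] t by simp
  ultimately have "Z \<in> R" using final_cell[OF lZ t] by (auto split: if_splits)
  then show "\<exists>w. length w \<le> wb X (length u) & pair (pair X u) w \<in> R"
    using w mle Z_def by (intro exI[of _ w]) simp
qed

end

section \<open>Encoded graphs\<close>

lemma pair_graph_iff:
  "pair_graph G <-> finite (pverts G) & parcs G \<subseteq> pverts G \<times> pverts G & (\<forall>u v. (u, v) \<in> parcs G --> u ~= v & (v, u) \<in> parcs G)"
proof
  assume "pair_graph G"
  then interpret pair_graph G .
  have "parcs G \<subseteq> pverts G \<times> pverts G" using in_arcsD1 in_arcsD2 by auto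
  moreover have "(v, u) \<in> parcs G" if "(u, v) \<in> parcs G" for u v
    using pair_sym_arcs that by (auto simp: symmetric_def sym_def)
  ultimately show "finite (pverts G) & parcs G \<subseteq> pverts G \<times> pverts G &
      (\<forall>u v. (u, v) \<in> parcs G --> u ~= v & (v, u) \<in> parcs G)"
    using pair_finite_verts no_loops' by blast
next
  assume a: "finite (pverts G) & parcs G \<subseteq> pverts G \<times> pverts G & (\<forall>u v. (u, v) \<in> parcs G --> u ~= v & (v, u) \<in> parcs G)"
  then have "finite (parcs G)" using finite_subset by blast
  then show "pair_graph G" using a by unfold_locales (auto simp: symmetric_def sym_def)
qed

lemma choosable_fch:
  assumes "pair_graph G"
  shows "choosable l k G <-> fch k (%_. l) (pverts G) (%u v. (u, v) \<in> parcs G)"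
proof -
  have "col (pverts G) (%u v. (u, v) \<in> parcs G) L c <-> proper_coloring G c & (\<forall>v\<in>pverts G. c v \<in> L v)" for L c
    using assms unfolding pair_graph_iff col_def proper_coloring_def by blast
  then show ?thesis by (simp add: choosable_def fch_def lists_on_def)
qed

lemma bipartite_iff:
  assumes "parcs G \<subseteq> pverts G \<times> pverts G"
  shows "bipartite G <-> (\<exists>s. \<forall>u v. (u, v) \<in> parcs G --> s u ~= (s v :: bool))"
proof
  assume "bipartite G"
  then obtain A B where AB: "A \<inter> B = {}" "\<forall>(u, v)\<in>parcs G. u \<in> A & v \<in> B | u \<in> B & v \<in> A"
    unfolding bipartite_def by (elim exE conjE)
  show "\<exists>s. \<forall>u v. (u, v) \<in> parcs G --> s u ~= (s v :: bool)"
  proof (intro exI allI impI)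
    fix u v assume "(u, v) \<in> parcs G"
    then have "u \<in> A & v \<in> B | u \<in> B & v \<in> A" using AB(2) by fast
    then show "(u \<in> A) ~= (v \<in> A)" using AB(1) by blast
  qed
next
  assume "\<exists>s. \<forall>u v. (u, v) \<in> parcs G --> s u ~= (s v :: bool)"
  then obtain s where s: "!!u v. (u, v) \<in> parcs G ==> s u ~= (s v :: bool)" by blast
  show "bipartite G"
    unfolding bipartite_def
    by (rule exI[of _ "{v \<in> pverts G. s v}"], rule exI[of _ "{v \<in> pverts G. ~ s v}"])
      (use s assms in auto)
qed

text \<open>\<open>encode_graph\<close> bit by bit, in the form that \<open>ptrans_map\<close>
  needs: past the unary prefix, entry x, y of the matrix is bit \<open>y + n * x\<close>.\<close>

definition gcode :: "nat => (nat => nat => bool) => bool list" where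
  "gcode n E = map (%j. j < n | (\<exists>x<n. \<exists>y<n. j = Suc n + (y + n * x) & E x y)) [0..<Suc n + n * n]"

lemma mixed_radix:
  fixes a b m :: nat
  assumes "a < m" "a' < m" "a + m * b = a' + m * b'"
  shows "a = a'" "b = b'"
proof -
  have "(a + m * b) mod m = (a' + m * b') mod m" "(a + m * b) div m = (a' + m * b') div m"
    using assms(3) by simp_all
  then show "a = a'" "b = b'" using assms(1,2) by simp_all
qed

lemma mixed_radix_less:
  fixes a b m n :: nat
  assumes "a < m" "b < n"
  shows "a + m * b < m * n"
proof -
  have "a + m * b < m * Suc b" using assms(1) by simp
  also have "\<dots> \<le> m * n" using assms(2) by (intro mult_le_mono) auto
  finally show ?thesis .
qed

lemma length_gcode: "length (gcode n E) = Suc n + n * n"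
  by (simp add: gcode_def)

lemma gcode_prefix: "j \<le> n ==> gcode n E ! j <-> j < n"
  by (simp add: gcode_def less_Suc_eq_le nth_append del: upt_Suc)

lemma gcode_edge:
  assumes "x < n" "y < n"
  shows "Suc n + (y + n * x) < length (gcode n E)" "gcode n E ! (Suc n + (y + n * x)) <-> E x y"
proof -
  have l: "y + n * x < n * n" by (rule mixed_radix_less) fact+
  then show "Suc n + (y + n * x) < length (gcode n E)" by (simp add: length_gcode)
  have "gcode n E ! (Suc n + (y + n * x)) <-> (\<exists>x'<n. \<exists>y'<n. Suc n + (y + n * x) = Suc n + (y' + n * x') & E x' y')"
    using l by (simp add: gcode_def del: upt_Suc)
  then show "gcode n E ! (Suc n + (y + n * x)) <-> E x y"
    using mixed_radix[of y n _ x] assms by (metis add_left_cancel)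
qed

lemma gcode_inj:
  assumes "gcode n E = gcode n' E'"
  shows "n = n'" "x < n ==> y < n ==> E x y <-> E' x y"
proof -
  have "~ n < n'" using gcode_prefix[of n n E] gcode_prefix[of n n' E'] assms by auto
  moreover have "~ n' < n" using gcode_prefix[of n' n E] gcode_prefix[of n' n' E'] assms by auto
  ultimately show n: "n = n'" by simp
  show "E x y <-> E' x y" if "x < n" "y < n"
    using gcode_edge(2)[OF that, of E] gcode_edge(2)[of x n' y E'] that assms n by simp
qed

lemma encode_graph_eq:
  assumes "pverts G = {..<n}"
  shows "encode_graph G = gcode n (%x y. (x, y) \<in> parcs G)"
proof (rule nth_equalityI)
  have l: "length (List.product [0..<n] [0..<n]) = n * n" by simp
  have e: "encode_graph G = replicate n True @ [False] @ map (%(i, j). (i, j) \<in> parcs G) (List.product [0..<n] [0..<n])"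
    by (simp add: encode_graph_def assms)
  show "length (encode_graph G) = length (gcode n (%x y. (x, y) \<in> parcs G))"
    unfolding e length_gcode by simp
  fix j assume "j < length (encode_graph G)"
  then have j: "j < Suc n + n * n" unfolding e by simp
  show "encode_graph G ! j = gcode n (%x y. (x, y) \<in> parcs G) ! j"
  proof (cases "j \<le> n")
    case True
    then show ?thesis unfolding gcode_prefix[OF True] e by (auto simp: nth_append)
  next
    case False
    then obtain i where i: "j = Suc n + i" by (metis Suc_leI less_eqE not_less)
    then have "i < n * n" using j by simp
    then have n: "n > 0" by (cases n) auto
    define x y where "x = i div n" and "y = i mod n"
    have xy: "x < n" "y < n" "i = y + n * x"
      using \<open>i < n * n\<close> n by (simp_all add: x_def y_def less_mult_imp_div_less)
    have "encode_graph G ! j <-> (x, y) \<in> parcs G"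
      unfolding e i using \<open>i < n * n\<close> xy(1,2) by (simp add: nth_append product_nth x_def y_def)
    then show ?thesis using gcode_edge(2)[OF xy(1,2)] unfolding i xy(3) by simp
  qed
qed

text \<open>The existence of \<open>s\<close> also excludes loops.\<close>

lemma bipartite_CH_iff:
  "X \<in> bipartite_CH l k <-> (\<exists>n E. X = gcode n E & (\<forall>x y. E x y --> x < n & y < n & E y x) &
     (\<exists>s. \<forall>x y. E x y --> s x ~= (s y :: bool)) & fch k (%_. l) {..<n} E)"
proof
  assume "X \<in> bipartite_CH l k"
  then obtain G n where G: "X = encode_graph G" "pair_graph G" "pverts G = {..<n}" "bipartite G" "choosable l k G"
    unfolding bipartite_CH_def by blast
  have "\<exists>s. \<forall>x y. (x, y) \<in> parcs G --> s x ~= (s y :: bool)"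
    using bipartite_iff[of G] G(2,4) unfolding pair_graph_iff by blast
  moreover have "\<forall>x y. (x, y) \<in> parcs G --> x < n & y < n & (y, x) \<in> parcs G"
    using G(2,3) unfolding pair_graph_iff by auto
  moreover have "fch k (%_. l) {..<n} (%x y. (x, y) \<in> parcs G)"
    using choosable_fch[OF G(2)] G(3,5) by simp
  ultimately show "\<exists>n E. X = gcode n E & (\<forall>x y. E x y --> x < n & y < n & E y x) &
     (\<exists>s. \<forall>x y. E x y --> s x ~= (s y :: bool)) & fch k (%_. l) {..<n} E"
    unfolding G(1) encode_graph_eq[OF G(3)] by blast
next
  assume "\<exists>n E. X = gcode n E & (\<forall>x y. E x y --> x < n & y < n & E y x) &
     (\<exists>s. \<forall>x y. E x y --> s x ~= (s y :: bool)) & fch k (%_. l) {..<n} E"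
  then obtain n E s where E: "X = gcode n E" "!!x y. E x y ==> x < n & y < n & E y x"
    "!!x y. E x y ==> s x ~= (s y :: bool)" "fch k (%_. l) {..<n} E" by blast
  define G where "G = \<lparr>pverts = {..<n}, parcs = {(x, y). E x y}\<rparr>"
  have g: "pverts G = {..<n}" "!!x y. (x, y) \<in> parcs G <-> E x y" by (simp_all add: G_def)
  have pg: "pair_graph G" unfolding pair_graph_iff g using E(2,3) by (auto simp: G_def)
  have "bipartite G" using bipartite_iff[of G] pg E(3) g unfolding pair_graph_iff by metis
  moreover have "choosable l k G" unfolding choosable_fch[OF pg] g by (rule E(4))
  moreover have "encode_graph G = X" unfolding encode_graph_eq[OF g(1)] g E(1) ..
  ultimately show "X \<in> bipartite_CH l k" unfolding bipartite_CH_def using pg g(1) by blast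
qed

lemma gcode_bipartite_CH:
  assumes "!!x y. E x y ==> x < n & y < n & E y x"
  shows "gcode n E \<in> bipartite_CH l k <->
    (\<exists>s. \<forall>x y. E x y --> s x ~= (s y :: bool)) & fch k (%_. l) {..<n} E"
proof
  assume "gcode n E \<in> bipartite_CH l k"
  then obtain n' E' where E': "gcode n E = gcode n' E'" "!!x y. E' x y ==> x < n' & y < n' & E' y x"
     "\<exists>s. \<forall>x y. E' x y --> s x ~= (s y :: bool)" "fch k (%_. l) {..<n'} E'"
    unfolding bipartite_CH_iff by blast
  have n: "n = n'" using gcode_inj(1)[OF E'(1)] .
  have "E x y = E' x y" for x y
    using gcode_inj(2)[OF E'(1), of x y] E'(2)[of x y] assms[of x y] n by blast
  then have "E = E'" by blast
  then show "(\<exists>s. \<forall>x y. E x y --> s x ~= (s y :: bool)) & fch k (%_. l) {..<n} E" using E'(3,4) n by simp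
next
  assume "(\<exists>s. \<forall>x y. E x y --> s x ~= (s y :: bool)) & fch k (%_. l) {..<n} E"
  then show "gcode n E \<in> bipartite_CH l k" unfolding bipartite_CH_iff using assms by blast
qed

lemma fch_symmetric: "fch k f V (%x y. E x y | E y x) <-> fch k f V E"
proof -
  have "col V (%x y. E x y | E y x) L c <-> col V E L c" for L c 
    unfolding col_def by (intro conj_cong refl) (metis (full_types))
  then show ?thesis by (simp add: fch_def)
qed

text \<open>Used because the numbering of the vertices of the reduction graph has gaps, which become
  isolated vertices.\<close>

lemma fch_isolated:
  assumes "V \<subseteq> W" "!!x y. E x y ==> x \<in> V & y \<in> V" "1 \<le> l" "l \<le> k"
  shows "fch k (%_. l) W E <-> fch k (%_. l) V E"
proof
  assume f: "fch k (%_. l) W E"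
  show "fch k (%_. l) V E"
    unfolding fch_def
  proof (intro allI impI)
    fix L assume "lists_on k (%_. l) V L"
    then have "lists_on k (%_. l) W (%v. if v \<in> V then L v else {1..l})"
      using assms(4) by (auto simp: lists_on_def)
    from fchD[OF f this] show "\<exists>c. col V E L c" using assms(1) unfolding col_def by (metis subsetD)
  qed
next
  assume f: "fch k (%_. l) V E"
  show "fch k (%_. l) W E"
    unfolding fch_def
  proof (intro allI impI)
    fix L assume L: "lists_on k (%_. l) W L"
    then have "lists_on k (%_. l) V L" using assms(1) unfolding lists_on_def by blast
    from fchD[OF f this] obtain c where c: "col V E L c" by blast
    have "L v ~= {}" if "v \<in> W" for v using L that assms(3) unfolding lists_on_def by fastforce
    then have "col W E L (%v. if v \<in> V then c v else (SOME a. a \<in> L v))"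
      using c assms(2) unfolding col_def by (auto simp: some_in_eq)
    then show "\<exists>c. col W E L c" by blast
  qed
qed

section \<open>The reduction is definable\<close>

text \<open>Substitution without touching syntax: the value of the term is named by a variable
  bounded by its successor.\<close>

lemma pb_subst1:
  assumes P: "pb (%X e. P X (e 0))" and f: "pt f"
  shows "pb (%X e. P X (f X e))"
proof -
  have "pb (%X e. \<exists>a<Suc (f X e). a = f X e & P X a)"
    by (intro pb_ex pb_and pb_eq pt_Suc pt_var pt_shift f P)
  then show ?thesis by simp
qed

lemma pb_subst2:
  assumes P: "pb (%X e. P X (e 1) (e 0))" and f: "pt f" "pt g"
  shows "pb (%X e. P X (f X e) (g X e))"
proof -
  have P': "pb (%X e. P X (e (Suc 0)) (e 0))" using P by simp
  have "pb (%X e. \<exists>a<Suc (f X e). a = f X e & (\<exists>b<Suc (g X e). b = g X e & P X a b))"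
    by (intro pb_ex pb_and pb_eq pt_Suc pt_var P' pt_shift[OF pt_shift[OF f(2)]] pt_shift[OF f(1)]
        pt_shift[OF f(2)] f(1))
  then show ?thesis by simp
qed

locale cook_definable = cook +
  assumes pt_PP: "pt (%X e. PP X)" and pt_NN: "pt (%X e. NN X)"
    and pt_wb: "!!i. pt (%X e. wb X (e i))"
begin

section \<open>Numbering facts and clauses\<close>

definition "Tg = card {t. tok t}"
definition "tnum = (SOME h. bij_betw h {t. tok t} {0..<Tg})"
definition "Ru = card {r. rok r}"
definition "rnum = (SOME h. bij_betw h {r. rok r} {0..<Ru})"

lemma tnum: "bij_betw tnum {t. tok t} {0..<Tg}"
  unfolding tnum_def Tg_def by (rule someI_ex[OF ex_bij_betw_finite_nat[OF finite_tok]])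

lemma rnum: "bij_betw rnum {r. rok r} {0..<Ru}"
  unfolding rnum_def Ru_def by (rule someI_ex[OF ex_bij_betw_finite_nat[OF finite_rok]])

definition fc :: "bool list => tag => nat => nat => nat" where
  "fc X tg f g = tnum tg + Tg * (f + 2 * NN X * g)"

definition cc :: "bool list => rule => nat => nat => nat => nat" where
  "cc X r a b c = rnum r + Ru * (a + 2 * NN X * (b + 2 * NN X * c))"

definition nE :: "bool list => nat" where "nE X = Tg * (2 * NN X * (2 * NN X))"
definition nC :: "bool list => nat" where "nC X = Ru * (2 * NN X * (2 * NN X * (2 * NN X)))"

lemma fc_less: "tok tg ==> f < 2 * NN X ==> g < 2 * NN X ==> fc X tg f g < nE X"
  unfolding fc_def nE_def using bij_betwE[OF tnum] by (intro mixed_radix_less) auto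

lemma cc_less: "rok r ==> a < 2 * NN X ==> b < 2 * NN X ==> c < 2 * NN X ==> cc X r a b c < nC X"
  unfolding cc_def nC_def using bij_betwE[OF rnum] by (intro mixed_radix_less) auto

lemma fc_inj:
  assumes "tok tg" "tok tg'" "f < 2 * NN X" "f' < 2 * NN X" "fc X tg f g = fc X tg' f' g'"
  shows "tg = tg'" "f = f'" "g = g'"
proof -
  have t: "tnum tg < Tg" "tnum tg' < Tg" using bij_betwE[OF tnum] assms by auto
  note m = mixed_radix[OF t assms(5)[unfolded fc_def]]
  show "tg = tg'" using m(1) assms(1,2) bij_betw_imp_inj_on[OF tnum] by (auto dest: inj_onD)
  show "f = f'" "g = g'" using mixed_radix[OF assms(3,4) m(2)] by auto
qed

lemma cc_inj:
  assumes "rok r" "rok r'" "a < 2 * NN X" "a' < 2 * NN X" "b < 2 * NN X" "b' < 2 * NN X"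
    "cc X r a b c = cc X r' a' b' c'"
  shows "r = r'" "a = a'" "b = b'" "c = c'"
proof -
  have t: "rnum r < Ru" "rnum r' < Ru" using bij_betwE[OF rnum] assms by auto
  note m = mixed_radix[OF t assms(7)[unfolded cc_def]]
  show "r = r'" using m(1) assms(1,2) bij_betw_imp_inj_on[OF rnum] by (auto dest: inj_onD)
  note m' = mixed_radix[OF assms(3,4) m(2)]
  show "a = a'" "b = b'" "c = c'" using m'(1) mixed_radix[OF assms(5,6) m'(2)] by auto
qed

fun lnum :: "bool list => tag \<times> nat \<times> nat \<times> bool => nat \<times> bool" where
  "lnum X (tg, f, g, s) = (fc X tg f g, s)"

definition lit :: "bool list => nat => nat => bool => bool" where
  "lit X C e s <-> (\<exists>r\<in>{r. rok r}. \<exists>a<2 * NN X. \<exists>b<2 * NN X. \<exists>c<2 * NN X. C = cc X r a b c & cond r X a b c &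
     (e, s) \<in> lnum X ` set (cls r X a b c))"

definition univ :: "bool list => nat => bool" where
  "univ X e <-> (\<exists>i<PP X. e = fc X UP i 0 | e = fc X UB i 0)"

abbreviation "lits X \<equiv> qformula.lits (nE X) (lit X)"
abbreviation "csat X \<equiv> qformula.csat (nE X) (lit X)"

lemma litI:
  assumes "rok r" "a < 2 * NN X" "b < 2 * NN X" "c < 2 * NN X" "cond r X a b c" "(e, s) \<in> lnum X ` set (cls r X a b c)"
  shows "lit X (cc X r a b c) e s"
proof -
  let ?P = "%a' b' c'. cc X r a b c = cc X r a' b' c' & cond r X a' b' c' & (e, s) \<in> lnum X ` set (cls r X a' b' c')"
  have "\<exists>c'<2 * NN X. ?P a b c'" by (rule exI[of _ c]) (use assms in simp)
  then have "\<exists>b'<2 * NN X. \<exists>c'<2 * NN X. ?P a b' c'" using assms(3) by blast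
  then have "\<exists>a'<2 * NN X. \<exists>b'<2 * NN X. \<exists>c'<2 * NN X. ?P a' b' c'" using assms(2) by blast
  then show ?thesis unfolding lit_def using assms(1) by blast
qed

lemma lits_cc:
  assumes "rok r" "a < 2 * NN X" "b < 2 * NN X" "c < 2 * NN X" "cond r X a b c"
  shows "lits X (cc X r a b c) = lnum X ` set (cls r X a b c)"
proof (rule equalityI; rule subsetI)
  fix y assume "y \<in> lits X (cc X r a b c)"
  then obtain e s where y: "y = (e, s)" and l: "lit X (cc X r a b c) e s" unfolding qformula.lits_def by blast
  from l obtain r' a' b' c' where "rok r'" "a' < 2 * NN X" "b' < 2 * NN X" "cc X r a b c = cc X r' a' b' c'"
    "(e, s) \<in> lnum X ` set (cls r' X a' b' c')" unfolding lit_def by blast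
  then show "y \<in> lnum X ` set (cls r X a b c)" using cc_inj[OF assms(1) _ assms(2) _ assms(3)] y by metis
next
  fix y assume y: "y \<in> lnum X ` set (cls r X a b c)"
  then obtain tg f g s where t: "(tg, f, g, s) \<in> set (cls r X a b c)" "y = (fc X tg f g, s)" by auto
  have "lit X (cc X r a b c) (fc X tg f g) s" by (rule litI[OF assms]) (use y t(2) in simp)
  moreover have "fc X tg f g < nE X" by (rule fc_less) (rule cls_ok[OF assms(1,5) t(1)])+
  ultimately show "y \<in> lits X (cc X r a b c)" unfolding qformula.lits_def t(2) by blast
qed

lemma lits_empty:
  assumes "lits X C ~= {}"
  shows "\<exists>r a b c. rok r & a < 2 * NN X & b < 2 * NN X & c < 2 * NN X & cond r X a b c & C = cc X r a b c"
proof -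
  obtain e s where "lit X C e s" using assms unfolding qformula.lits_def by auto
  then show ?thesis unfolding lit_def by blast
qed

lemma card_lits: "card (lits X C) \<le> 3"
proof (cases "lits X C = {}")
  case False
  then obtain r a b c where r: "rok r" "a < 2 * NN X" "b < 2 * NN X" "c < 2 * NN X" "cond r X a b c" "C = cc X r a b c"
    using lits_empty by blast
  have "card (lits X C) \<le> card (set (cls r X a b c))" unfolding r(6) lits_cc[OF r(1-5)] by (rule card_image_le) simp
  also have "\<dots> \<le> 3" using card_length cls_small(1) by (rule order_trans)
  finally show ?thesis .
qed simp

lemma csat_cc:
  assumes "rok r" "a < 2 * NN X" "b < 2 * NN X" "c < 2 * NN X" "cond r X a b c"
  shows "csat X B (cc X r a b c) <-> (\<exists>(tg, f, g, s)\<in>set (cls r X a b c). B (fc X tg f g) = s)"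
proof -
  have im: "(\<exists>e. (e, B e) \<in> h ` S) <-> (\<exists>t\<in>S. B (fst (h t)) = snd (h t))" for h :: "'x => nat \<times> bool" and S
  proof -
    have "(\<exists>e. (e, B e) \<in> h ` S) <-> (\<exists>t\<in>S. \<exists>e. (e, B e) = h t)" by blast
    then show ?thesis by (simp add: prod_eq_iff eq_commute)
  qed
  have "csat X B (cc X r a b c) <-> (\<exists>t\<in>set (cls r X a b c). B (fst (lnum X t)) = snd (lnum X t))"
    unfolding qformula.csat_def lits_cc[OF assms] im using cls_small(2)[of r X a b c] by simp
  moreover have "(%t. B (fst (lnum X t)) = snd (lnum X t)) = (%(tg, f, g, s). B (fc X tg f g) = s)"
    by (auto simp: fun_eq_iff)
  ultimately show ?thesis by (simp only:)
qed

text \<open>Clause numbers only cover parameters below 2 * NN, which is enough by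
  \<open>cond_bound\<close>; the remaining numbers have no literals and are true.\<close>

lemma csat_iff_sat: "(\<forall>C<nC X. csat X B C) <-> sat (%tg f g. B (fc X tg f g)) X"
proof
  assume c: "\<forall>C<nC X. csat X B C"
  show "sat (%tg f g. B (fc X tg f g)) X"
    unfolding sat_def
  proof (intro allI impI)
    fix r a b c assume r: "rok r" "cond r X a b c"
    obtain a' b' c' where b: "a' < 2 * NN X" "b' < 2 * NN X" "c' < 2 * NN X" "cond r X a' b' c'"
      "cls r X a' b' c' = cls r X a b c" using cond_bound[OF r(2)] by blast
    have "csat X B (cc X r a' b' c')" using c cc_less[OF r(1) b(1-3)] by blast
    then show "\<exists>(tg, f, g, s)\<in>set (cls r X a b c). B (fc X tg f g) = s"
      unfolding csat_cc[OF r(1) b(1-4)] b(5) .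
  qed
next
  assume s: "sat (%tg f g. B (fc X tg f g)) X"
  show "\<forall>C<nC X. csat X B C"
  proof (intro allI impI)
    fix C
    show "csat X B C"
    proof (cases "lits X C = {}")
      case True
      then show ?thesis by (simp add: qformula.csat_def)
    next
      case False
      then obtain r a b c where r: "rok r" "a < 2 * NN X" "b < 2 * NN X" "c < 2 * NN X" "cond r X a b c" "C = cc X r a b c"
        using lits_empty by blast
      show ?thesis unfolding r(6) csat_cc[OF r(1-5)] using s r unfolding sat_def by blast
    qed
  qed
qed

theorem lit_correct:
  "(\<forall>A. \<exists>B. (\<forall>e<nE X. univ X e --> B e = A e) & (\<forall>C<nC X. csat X B C)) <->
   (\<forall>u. length u \<le> PP X --> (\<exists>w. length w \<le> wb X (length u) & pair (pair X u) w \<in> R))"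
  unfolding sat_iff[symmetric] csat_iff_sat
proof (intro iffI allI)
  have NP: "PP X < 2 * NN X" using room[of "PP X" X] by simp
  fix A :: "bool => nat => bool"
  assume *: "\<forall>A. \<exists>B. (\<forall>e<nE X. univ X e --> B e = A e) & sat (%tg f g. B (fc X tg f g)) X"
  obtain B where B: "!!e. e < nE X ==> univ X e ==> B e = (\<exists>i<PP X. e = fc X UP i 0 & A True i | e = fc X UB i 0 & A False i)"
    "sat (%tg f g. B (fc X tg f g)) X"
    using spec[OF *, of "%e. \<exists>i<PP X. e = fc X UP i 0 & A True i | e = fc X UB i 0 & A False i"] by auto
  have "B (fc X UP i 0) = A True i" "B (fc X UB i 0) = A False i" if i: "i < PP X" for i
  proof -
    have l: "i < 2 * NN X" "0 < 2 * NN X" using i NP by auto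
    have inj: "t = t' & i = j" if "fc X t i 0 = fc X t' j 0" "t \<in> {UP, UB}" "t' \<in> {UP, UB}" "j < PP X" for t t' j
    proof -
      have "tok t" "tok t'" "j < 2 * NN X" using that NP by auto
      then show ?thesis using fc_inj[OF _ _ l(1) _ that(1)] by blast
    qed
    have u: "univ X (fc X UP i 0)" "univ X (fc X UB i 0)" using i unfolding univ_def by blast+
    have "fc X UP i 0 < nE X" "fc X UB i 0 < nE X" using l by (auto intro: fc_less)
    note B1 = B(1)[OF this(1) u(1)] B(1)[OF this(2) u(2)]
    show "B (fc X UP i 0) = A True i" unfolding B1(1) using i inj[of UP UP] inj[of UP UB] by blast
    show "B (fc X UB i 0) = A False i" unfolding B1(2) using i inj[of UB UP] inj[of UB UB] by blast
  qed
  then show "\<exists>B. (\<forall>i<PP X. B UP i 0 = A True i & B UB i 0 = A False i) & sat B X"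
    using B(2) by (intro exI[of _ "%tg f g. B (fc X tg f g)"]) simp
next
  fix A :: "nat => bool"
  assume *: "\<forall>A. \<exists>B. (\<forall>i<PP X. B UP i 0 = A True i & B UB i 0 = A False i) & sat B X"
  have NP: "PP X < 2 * NN X" using room[of "PP X" X] by simp
  obtain B where B: "!!i. i < PP X ==> B UP i 0 = A (fc X UP i 0)" "!!i. i < PP X ==> B UB i 0 = A (fc X UB i 0)" "sat B X"
    using spec[OF *, of "%b i. A (fc X (if b then UP else UB) i 0)"] by auto
  \<comment> \<open>\<open>B\<close> is read through the numbering, which is injective only on
    admissible facts in range; by \<open>cls_ok\<close> no clause leaves this range.\<close>
  define B' where "B' e = (\<exists>tg f g. tok tg & f < 2 * NN X & g < 2 * NN X & e = fc X tg f g & B tg f g)" for e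
  have B': "B' (fc X tg f g) = B tg f g" if t: "tok tg" "f < 2 * NN X" "g < 2 * NN X" for tg f g
    unfolding B'_def using t fc_inj[OF t(1) _ t(2)] by metis
  have "sat (%tg f g. B' (fc X tg f g)) X"
    unfolding sat_def
  proof (intro allI impI)
    fix r a b c assume r: "rok r" "cond r X a b c"
    then obtain t where t: "t \<in> set (cls r X a b c)" "case t of (tg, f, g, s) => B tg f g = s"
      using B(3) unfolding sat_def by blast
    obtain tg f g s where tt: "t = (tg, f, g, s)" by (cases t)
    have "B' (fc X tg f g) = s" using B'[OF cls_ok[OF r, of tg f g s]] t tt by simp
    then show "\<exists>(tg, f, g, s)\<in>set (cls r X a b c). B' (fc X tg f g) = s" using t(1) tt by blast
  qed
  moreover have "B' e = A e" if "univ X e" for e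
    using that B(1,2) B' NP unfolding univ_def by fastforce
  ultimately show "\<exists>B. (\<forall>e<nE X. univ X e --> B e = A e) & sat (%tg f g. B (fc X tg f g)) X" by blast
qed

lemma pt_nE: "pt (%X e. nE X)" and pt_nC: "pt (%X e. nC X)"
  unfolding nE_def nC_def by (intro pt_intros pt_NN)+

lemma pb_fc_eq: assumes "pt h" "pt f" "pt g" shows "pb (%X e. h X e = fc X tg (f X e) (g X e))"
  unfolding fc_def by (intro pb_intros pt_intros pt_NN assms)

lemma pb_univ: "pb (%X e. univ X (e 0))"
  unfolding univ_def by (intro pb_intros pb_fc_eq pt_intros pt_PP)

lemma pb_prefix_symbol: "pb (%X e. prefix_symbol X (e i) s)"
  unfolding prefix_symbol_def by (intro pb_intros pt_intros)

lemma pb_cond: "pb (%X e. cond r X (e i) (e j) (e k))"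
proof -
  have "pb (%X e. tgt m (e j) (e k))" for m
    by (cases m; simp; intro pb_intros pt_intros)
  then show ?thesis
    by (cases r; simp; intro pb_intros pt_intros pb_prefix_symbol pt_PP pt_NN)
qed

text \<open>For a fixed rule the clause is a list of fixed shape, so membership is a finite
  disjunction of equations between numbers.\<close>

lemma pb_cls: "pb (%X e. (e m, s) \<in> lnum X ` set (cls r X (e i) (e j) (e k)))"
  by (cases r; simp; intro conjI impI pb_const pb_not pb_and pb_or pb_fc_eq pt_intros pt_PP pt_NN pt_wb)

lemma pb_lit: "pb (%X e. lit X (e 1) (e 0) s)"
  unfolding lit_def cc_def
  by (intro pb_finite_ex finite_rok pb_ex pb_and pb_eq pt_intros pt_NN pb_cond pb_cls)

end

section \<open>Counting up to a fixed threshold\<close>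

lemma card_ge_Suc:
  fixes n :: nat
  shows "Suc m \<le> card {j. j < n & P j} <-> (\<exists>j<n. P j & m \<le> card {i. i < j & P i})"
proof
  assume a: "Suc m \<le> card {j. j < n & P j}"
  define j where "j = Max {j. j < n & P j}"
  have ne: "{j. j < n & P j} ~= {}" using a by (metis card.empty not_less_eq_eq zero_le)
  have fin: "finite {j. j < n & P j}" by simp
  have j: "j < n" "P j" using Max_in[OF fin ne] by (simp_all add: j_def)
  have "{j. j < n & P j} \<subseteq> insert j {i. i < j & P i}"
  proof
    fix i assume i: "i \<in> {j. j < n & P j}"
    then have "i \<le> j" using Max_ge[OF fin] by (simp add: j_def)
    then show "i \<in> insert j {i. i < j & P i}" using i by auto
  qed
  then have "card {j. j < n & P j} \<le> card (insert j {i. i < j & P i})" by (intro card_mono) auto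
  also have "\<dots> = Suc (card {i. i < j & P i})" by (subst card_insert_disjoint) auto
  finally show "\<exists>j<n. P j & m \<le> card {i. i < j & P i}" using a j by auto
next
  assume "\<exists>j<n. P j & m \<le> card {i. i < j & P i}"
  then obtain j where j: "j < n" "P j" "m \<le> card {i. i < j & P i}" by blast
  have "card (insert j {i. i < j & P i}) \<le> card {j. j < n & P j}" using j by (intro card_mono) auto
  moreover have "card (insert j {i. i < j & P i}) = Suc (card {i. i < j & P i})" by (subst card_insert_disjoint) auto
  ultimately show "Suc m \<le> card {j. j < n & P j}" using j(3) by linarith
qed

text \<open>For fixed m, taking the largest element off m times yields m nested quantifiers. Needed
  because the number of gadgets at a clause vertex depends on the number of its literals.\<close>

lemma pb_card:
  assumes P: "pb (%X e. P X (e 1) (e 0))"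
  shows "pb (%X e. m \<le> card {j. j < e 0 & P X (e 1) j})"
proof (induction m)
  case 0
  show ?case by (simp add: pb_const)
next
  case (Suc m)
  have "pb (%X e. m \<le> card {j. j < e 0 & P X (e (Suc (Suc 0))) j})"
    using pb_subst2[OF _ pt_var[of 2] pt_var[of 0], of "%X c n. m \<le> card {j. j < n & P X c j}"] Suc
    by (simp add: numeral_2_eq_2)
  moreover have "pb (%X e. P X (e (Suc (Suc 0))) (e 0))"
    using pb_subst2[OF P pt_var[of 2] pt_var[of 0]] by (simp add: numeral_2_eq_2)
  ultimately show ?case unfolding card_ge_Suc One_nat_def by (intro pb_ex pb_and pt_var)
qed

locale reduction = cook_definable +
  fixes l k \<delta> :: nat and D :: "nat set" and DE :: "nat => nat => bool" and du :: nat
  assumes l3: "3 \<le> l" and k: "2 * l - 1 \<le> k" and gad: "gadget l k 1 D DE {du}" and D: "D \<subseteq> {..<\<delta>}"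
begin

section \<open>Numbering the vertices of the reduction graph\<close>

abbreviation "vs X \<equiv> qformula.vset (nE X) (nC X)"
abbreviation "adj X \<equiv> qformula.adj (nC X) (lit X) (univ X)"
abbreviation "lsize X \<equiv> qformula.lsize (nE X) (lit X)"
abbreviation "WV X \<equiv> attV (vs X) (%v. l - lsize X v) D"
abbreviation "WE X \<equiv> attE (adj X) DE {du}"

text \<open>The remainder modulo 3 tells the constructors apart; the rest is a mixed radix
  number.\<close>

fun vc :: "bool list => vx => nat" where
  "vc X (Gad e b i t p) = 3 * (of_bool b + 2 * (of_bool t + 2 * (p + 7 * (e + nE X * i))))"
| "vc X (Aux e j) = 1 + 3 * (j + 7 * e)"
| "vc X (Cla c) = 2 + 3 * c"

definition N0 :: "bool list => nat" where
  "N0 X = 3 * (2 * (2 * (7 * (nE X * Suc (nC X)))) + 7 * nE X + nC X)"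

definition Wd :: nat where "Wd = 1 + \<delta> * l"

text \<open>The remainder modulo \<open>Wd\<close> is 0 for a vertex itself and otherwise one more
  than the number of a gadget vertex, so that the two kinds never collide.\<close>

fun wc :: "bool list => vx + vx \<times> nat \<times> nat => nat" where
  "wc X (Inl v) = 0 + Wd * vc X v"
| "wc X (Inr (v, i, r)) = Suc (r + \<delta> * i) + Wd * vc X v"

definition Nv :: "bool list => nat" where "Nv X = Wd * N0 X"

lemma vc_less: "v \<in> vs X ==> vc X v < N0 X"
proof -
  assume v: "v \<in> vs X"
  have b: "of_bool b < (2::nat)" for b by simp
  consider e bb i t p where "v = Gad e bb i t p" "e < nE X" "i < Suc (nC X)" "p < 7"
    | e j where "v = Aux e j" "e < nE X" "j < 7" | c where "v = Cla c" "c < nC X"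
    using v unfolding qformula.vset_def by (auto simp: less_Suc_eq_le)
  then show ?thesis
  proof cases
    case 1
    have "of_bool bb + 2 * (of_bool t + 2 * (p + 7 * (e + nE X * i))) < 2 * (2 * (7 * (nE X * Suc (nC X))))"
      by (intro mixed_radix_less b 1)
    then show ?thesis using 1(1) by (simp add: N0_def del: mult_Suc_right)
  next
    case 2
    have "j + 7 * e < 7 * nE X" by (intro mixed_radix_less 2)
    then show ?thesis using 2(1) by (simp add: N0_def del: mult_Suc_right)
  next
    case 3
    then show ?thesis by (simp add: N0_def del: mult_Suc_right)
  qed
qed

lemma vc_inj: assumes "v \<in> vs X" "w \<in> vs X" "vc X v = vc X w" shows "v = w"
proof -
  have b: "of_bool b < (2::nat)" for b by simp
  have m: "vc X (Gad e b i t p) mod 3 = 0" "vc X (Aux e j) mod 3 = 1" "vc X (Cla c) mod 3 = 2" for e b i t p j c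
  proof -
    show "vc X (Gad e b i t p) mod 3 = 0" by simp
    show "vc X (Aux e j) mod 3 = 1" "vc X (Cla c) mod 3 = 2" unfolding vc.simps by presburger+
  qed
  show ?thesis
  proof (cases v)
    case (Gad e bb i t p)
    then have v: "e < nE X" "p < 7" using assms(1) by (auto simp: qformula.vset_def)
    have "vc X w mod 3 = 0" using Gad assms(3) m(1) by metis
    then obtain e' bb' i' t' p' where w: "w = Gad e' bb' i' t' p'" using m(2,3) by (cases w) auto
    then have v': "e' < nE X" "p' < 7" using assms(2) by (auto simp: qformula.vset_def)
    have "of_bool bb + 2 * (of_bool t + 2 * (p + 7 * (e + nE X * i))) =
        of_bool bb' + 2 * (of_bool t' + 2 * (p' + 7 * (e' + nE X * i')))"
      using assms(3) Gad w by simp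
    note 1 = mixed_radix[OF b b this]
    note 2 = mixed_radix[OF b b 1(2)]
    note 3 = mixed_radix[OF v(2) v'(2) 2(2)]
    note 4 = mixed_radix[OF v(1) v'(1) 3(2)]
    show ?thesis using 1(1) 2(1) 3(1) 4 Gad w by (simp add: of_bool_eq_iff)
  next
    case (Aux e j)
    then have v: "j < 7" using assms(1) by (auto simp: qformula.vset_def)
    have "vc X w mod 3 = 1" using Aux assms(3) m(2) by metis
    then obtain e' j' where w: "w = Aux e' j'" using m(1,3) by (cases w) auto
    then have v': "j' < 7" using assms(2) by (auto simp: qformula.vset_def)
    have "j + 7 * e = j' + 7 * e'" using assms(3) Aux w by simp
    from mixed_radix[OF v v' this] show ?thesis using Aux w by simp
  next
    case (Cla c)
    have "vc X w mod 3 = 2" using Cla assms(3) m(3) by metis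
    then obtain c' where w: "w = Cla c'" using m(1,2) by (cases w) auto
    show ?thesis using assms(3) Cla w by simp
  qed
qed

lemma cw: "r \<in> D ==> i < l - n ==> Suc (r + \<delta> * i) < Wd"
  using mixed_radix_less[of r \<delta> i l] D by (auto simp: Wd_def)

lemma wc_inj: "inj_on (wc X) (WV X)"
proof (rule inj_onI)
  fix a b assume a: "a \<in> WV X" and b: "b \<in> WV X" and e: "wc X a = wc X b"
  have dec: "\<exists>v q. v \<in> vs X & q < Wd & wc X z = q + Wd * vc X v &
      (q = 0 & z = Inl v | (\<exists>i r. r \<in> D & q = Suc (r + \<delta> * i) & z = Inr (v, i, r)))" if "z \<in> WV X" for z
    using that cw unfolding attV_def by (auto simp: Wd_def)
  obtain v q where v: "v \<in> vs X" "q < Wd" "wc X a = q + Wd * vc X v"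
      "q = 0 & a = Inl v | (\<exists>i r. r \<in> D & q = Suc (r + \<delta> * i) & a = Inr (v, i, r))" using dec[OF a] by blast
  obtain w q' where w: "w \<in> vs X" "q' < Wd" "wc X b = q' + Wd * vc X w"
      "q' = 0 & b = Inl w | (\<exists>i r. r \<in> D & q' = Suc (r + \<delta> * i) & b = Inr (w, i, r))" using dec[OF b] by blast
  have q: "q = q'" "vc X v = vc X w" using mixed_radix[OF v(2) w(2)] e v(3) w(3) by simp_all
  have vw: "v = w" using vc_inj v(1) w(1) q(2) .
  show "a = b"
  proof (cases "q = 0")
    case True
    then show ?thesis using v(4) w(4) q(1) vw by auto
  next
    case False
    then obtain i r i' r' where x: "r \<in> D" "q = Suc (r + \<delta> * i)" "a = Inr (v, i, r)"
      "r' \<in> D" "q = Suc (r' + \<delta> * i')" "b = Inr (w, i', r')" using v(4) w(4) q(1) by blast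
    have "r < \<delta>" "r' < \<delta>" "r + \<delta> * i = r' + \<delta> * i'" using x D by auto
    from mixed_radix[OF this] show ?thesis using x vw by simp
  qed
qed

lemma wc_less: assumes "z \<in> WV X" shows "wc X z < Nv X"
proof -
  consider v where "z = Inl v" "v \<in> vs X" | v i r where "z = Inr (v, i, r)" "v \<in> vs X" "i < l - lsize X v" "r \<in> D"
    using assms unfolding attV_def by auto
  then show ?thesis
  proof cases
    case 1
    have "0 + Wd * vc X v < Wd * N0 X" by (rule mixed_radix_less[OF _ vc_less[OF 1(2)]]) (simp add: Wd_def)
    then show ?thesis using 1 by (simp add: Nv_def)
  next
    case 2
    have "Suc (r + \<delta> * i) + Wd * vc X v < Wd * N0 X"
      by (rule mixed_radix_less[OF _ vc_less[OF 2(2)]]) (rule cw[OF 2(4,3)])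
    then show ?thesis using 2 by (simp add: Nv_def)
  qed
qed

definition arc :: "bool list => nat => nat => bool" where
  "arc X x y <-> (\<exists>a\<in>WV X. \<exists>b\<in>WV X. WE X a b & x = wc X a & y = wc X b)"

definition edge :: "bool list => nat => nat => bool" where
  "edge X x y <-> arc X x y | arc X y x"

lemma edge_sym: "edge X x y ==> x < Nv X & y < Nv X & edge X y x"
  unfolding edge_def arc_def using wc_less by blast

lemma edge_bipartite: "\<exists>s. \<forall>x y. edge X x y --> s x ~= (s y :: bool)"
proof -
  have "\<exists>s' :: (vx + vx \<times> nat \<times> nat) => bool. \<forall>x y. WE X x y --> s' x ~= s' y"
    by (rule attE_bipartite[OF qformula.adj_side gad])
  then obtain s' :: "(vx + vx \<times> nat \<times> nat) => bool" where s': "!!x y. WE X x y ==> s' x ~= s' y" by blast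
  have "s' (inv_into (WV X) (wc X) x) ~= s' (inv_into (WV X) (wc X) y)" if "arc X x y" for x y
    using that s' unfolding arc_def by (auto simp: inv_into_f_f[OF wc_inj])
  then show ?thesis unfolding edge_def by (intro exI[of _ "%x. s' (inv_into (WV X) (wc X) x)"]) metis
qed

lemma lsize_le: "lsize X v \<le> 3"
  using card_lits[of X] by (cases v) (auto simp: qformula.lsize.simps)

text \<open>A vertex lacks l - lsize colors, and each missing color is accounted for by one gadget
  of capacity 1; there are never too many literals, since lsize \<le> 3 \<le> l.\<close>

lemma edge_fch: "fch k (%_. l) {..<Nv X} (edge X) <-> fch k (lsize X) (vs X) (adj X)"
proof -
  have lk: "1 \<le> l" "l \<le> k" using l3 k by auto
  have "fch k (%_. l) {..<Nv X} (edge X) <-> fch k (%_. l) (wc X ` WV X) (edge X)"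
    by (rule fch_isolated[OF _ _ lk]) (auto simp: wc_less edge_def arc_def)
  also have "\<dots> <-> fch k (%_. l) (wc X ` WV X) (arc X)"
  proof -
    have "edge X = (%x y. arc X x y | arc X y x)" by (intro ext) (simp add: edge_def)
    then show ?thesis by (simp only: fch_symmetric)
  qed
  also have "\<dots> <-> fch k (%_. l) (WV X) (WE X)"
  proof (rule fch_iso[symmetric, OF wc_inj])
    fix u v assume uv: "u \<in> WV X" "v \<in> WV X"
    show "WE X u v <-> arc X (wc X u) (wc X v)"
      unfolding arc_def using uv inj_onD[OF wc_inj[of X]] by metis
  qed simp
  also have "\<dots> <-> fch k (lsize X) (vs X) (adj X)"
  proof (rule attach_iff[OF gad _ lk(2)])
    fix v assume "v \<in> vs X"
    show "lsize X v + (l - lsize X v) * 1 = l" using lsize_le[of X v] l3 by simp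
  qed
  finally show ?thesis .
qed

theorem edge_correct:
  "gcode (Nv X) (edge X) \<in> bipartite_CH l k <->
   (\<forall>u. length u \<le> PP X --> (\<exists>w. length w \<le> wb X (length u) & pair (pair X u) w \<in> R))"
proof -
  have "gcode (Nv X) (edge X) \<in> bipartite_CH l k <-> fch k (lsize X) (vs X) (adj X)"
    using gcode_bipartite_CH[OF edge_sym] edge_bipartite edge_fch by simp
  also have "\<dots> <-> (\<forall>A. \<exists>B. (\<forall>e<nE X. univ X e --> B e = A e) & (\<forall>C<nC X. csat X B C))"
    by (rule qformula.ae_choosable[OF card_lits]) (use k l3 in simp)
  finally show ?thesis unfolding lit_correct .
qed

lemma pt_Nv: "pt (%X e. Nv X)"
  unfolding Nv_def N0_def by (intro pt_intros pt_nE pt_nC)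

text \<open>Literals are pairs, but \<open>pb_card\<close> counts numbers, so the literal of
  variable e with sign b is represented by 2 * e or 2 * e + 1.\<close>

lemma pb_lits_card: "pb (%X e. m \<le> card (lits X (e 0)))"
proof -
  define hit where "hit X c j <-> (\<exists>e<nE X. j = 2 * e & lit X c e False | j = Suc (2 * e) & lit X c e True)" for X c j
  have c: "card (lits X c) = card {j. j < 2 * nE X & hit X c j}" for X c
  proof (rule bij_betw_same_card[of "%(e, b). of_bool b + 2 * e"])
    have b: "of_bool b < (2::nat)" for b by simp
    have "inj_on (%(e, b). of_bool b + 2 * e) (lits X c)"
    proof (rule inj_onI)
      fix x y :: "nat \<times> bool" assume e: "(%(e, b). of_bool b + 2 * e) x = (%(e, b). of_bool b + 2 * e :: nat) y"
      then have "of_bool (snd x) + 2 * fst x = (of_bool (snd y) + 2 * fst y :: nat)" by (simp add: split_beta)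
      from mixed_radix[OF b b this] show "x = y" by (simp add: prod_eq_iff of_bool_eq_iff)
    qed
    moreover have "(%(e, b). of_bool b + 2 * e) ` lits X c = {j. j < 2 * nE X & hit X c j}"
    proof (rule equalityI; rule subsetI)
      fix j assume "j \<in> (%(e, b). of_bool b + 2 * e) ` lits X c"
      then obtain e b where e: "e < nE X" "lit X c e b" "j = of_bool b + 2 * e" by (auto simp: qformula.lits_def)
      then show "j \<in> {j. j < 2 * nE X & hit X c j}" by (cases b) (auto simp: hit_def)
    next
      fix j assume "j \<in> {j. j < 2 * nE X & hit X c j}"
      then obtain e where e: "e < nE X" "j = 2 * e & lit X c e False | j = Suc (2 * e) & lit X c e True"
        unfolding hit_def by blast
      define b where "b <-> j = Suc (2 * e)"
      have "lit X c e b" "j = of_bool b + 2 * e" using e(2) by (auto simp: b_def)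
      then show "j \<in> (%(e, b). of_bool b + 2 * e) ` lits X c" using e(1)
        by (intro image_eqI[of _ _ "(e, b)"]) (simp_all add: qformula.lits_def)
    qed
    ultimately show "bij_betw (%(e, b). of_bool b + 2 * e) (lits X c) {j. j < 2 * nE X & hit X c j}"
      by (simp add: bij_betw_def)
  qed
  have "pb (%X e. hit X (e 1) (e 0))"
    unfolding hit_def by (intro pb_intros pb_subst2[OF pb_lit] pt_intros pt_nE)
  from pb_subst2[OF pb_card[OF this, of m], of "%X e. e 0" "%X e. 2 * nE X"]
  show ?thesis unfolding c by (simp add: pt_intros pt_nE)
qed

lemma pb_copies: "pb (%X e. i < l - lsize X (Gad (f X e) b (g X e) t p))"
  "pb (%X e. i < l - lsize X (Aux (f X e) j))"
  "pt f ==> pb (%X e. i < l - lsize X (Cla (f X e)))"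
proof -
  have "pb (%X e. i < l - lsize X (Cla (e 0)))"
  proof -
    have e: "i < l - lsize X (Cla c) <-> Suc i < l & ~ l - i \<le> card (lits X c)" for X c
      by (auto simp: qformula.lsize.simps)
    show ?thesis unfolding e by (intro pb_intros pb_lits_card pt_intros)
  qed
  then show "pt f ==> pb (%X e. i < l - lsize X (Cla (f X e)))" by (rule pb_subst1)
qed (simp_all add: qformula.lsize.simps pb_const)

text \<open>The parameters of a vertex with finitely many values become constants, and only
  variable, copy and clause numbers are quantified inside the formula; with constructors exposed,
  \<open>adj\<close> and \<open>vc\<close> can be unfolded.\<close>

lemma pb_ex_vs:
  assumes "!!b t p. p < 7 ==> pb (%X e. Q X (%i. e (Suc (Suc i))) (Gad (e (Suc 0)) b (e 0) t p))"
    "!!j. j < 7 ==> pb (%X e. Q X (%i. e (Suc i)) (Aux (e 0) j))"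
    "pb (%X e. Q X (%i. e (Suc i)) (Cla (e 0)))"
  shows "pb (%X e. \<exists>v\<in>vs X. Q X e v)"
proof -
  have e: "(\<exists>v\<in>vs X. Q X e v) <->
     (\<exists>(b, t, p)\<in>UNIV \<times> UNIV \<times> {..<7}. \<exists>ee<nE X. \<exists>i<Suc (nC X). Q X e (Gad ee b i t p)) |
     (\<exists>j\<in>{..<7}. \<exists>ee<nE X. Q X e (Aux ee j)) | (\<exists>c<nC X. Q X e (Cla c))" for X and e :: "nat => nat"
    unfolding qformula.vset_def less_Suc_eq_le by (simp add: bex_Un) blast
  have "pb (%X e. \<exists>(b, t, p)\<in>UNIV \<times> UNIV \<times> {..<7}. \<exists>ee<nE X. \<exists>i<Suc (nC X). Q X e (Gad ee b i t p))"
    by (rule pb_finite_ex) (auto intro!: pb_ex pt_nE pt_Suc pt_nC assms)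
  moreover have "pb (%X e. \<exists>j\<in>{..<7}. \<exists>ee<nE X. Q X e (Aux ee j))"
    by (rule pb_finite_ex) (auto intro!: pb_ex pt_nE assms)
  moreover have "pb (%X e. \<exists>c<nC X. Q X e (Cla c))" by (intro pb_ex pt_nC assms)
  ultimately show ?thesis unfolding e by (intro pb_or)
qed

text \<open>Rewrites attached edges so that every quantifier has a definable form: vertices range
  over \<open>vs X\<close>, gadget data over fixed finite sets.\<close>

lemma arc_iff: "arc X x y <->
   (\<exists>u\<in>vs X. \<exists>v\<in>vs X. adj X u v & x = Wd * vc X u & y = Wd * vc X v) |
   (\<exists>u\<in>vs X. \<exists>i\<in>{..<l}. i < l - lsize X u & x = Wd * vc X u & y = Suc (du + \<delta> * i) + Wd * vc X u) |
   (\<exists>u\<in>vs X. \<exists>i\<in>{..<l}. \<exists>s\<in>{(r, r'). r \<in> D & r' \<in> D & DE r r'}. i < l - lsize X u &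
      x = Suc (fst s + \<delta> * i) + Wd * vc X u & y = Suc (snd s + \<delta> * i) + Wd * vc X u)" (is "_ <-> ?A | ?B | ?C")
proof
  have du: "du \<in> D" using gad by (simp add: gadget_def)
  have in1: "Inl u \<in> WV X" if "u \<in> vs X" for u using that by (simp add: attV_def)
  have in2: "Inr (u, i, r) \<in> WV X" if "u \<in> vs X" "i < l - lsize X u" "r \<in> D" for u i r
    using that by (auto simp: attV_def)
  {
    assume "arc X x y"
    then obtain a b where ab: "a \<in> WV X" "b \<in> WV X" "WE X a b" "x = wc X a" "y = wc X b" unfolding arc_def by blast
    have dec: "(\<exists>v\<in>vs X. z = Inl v) | (\<exists>v\<in>vs X. \<exists>i r. i < l - lsize X v & r \<in> D & z = Inr (v, i, r))"
      if "z \<in> WV X" for z using that unfolding attV_def by auto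
    show "?A | ?B | ?C"
      using dec[OF ab(1)]
    proof
      assume "\<exists>v\<in>vs X. a = Inl v"
      then obtain u where u: "u \<in> vs X" "a = Inl u" by blast
      show ?thesis
        using dec[OF ab(2)]
      proof
        assume "\<exists>v\<in>vs X. b = Inl v"
        then obtain v where v: "v \<in> vs X" "b = Inl v" by blast
        have "adj X u v & x = Wd * vc X u & y = Wd * vc X v" using ab u v by simp
        then show ?thesis using u v by blast
      next
        assume "\<exists>v\<in>vs X. \<exists>i r. i < l - lsize X v & r \<in> D & b = Inr (v, i, r)"
        then obtain v i r where v: "i < l - lsize X v" "b = Inr (v, i, r)" by blast
        have "i \<in> {..<l} & i < l - lsize X u & x = Wd * vc X u & y = Suc (du + \<delta> * i) + Wd * vc X u"
          using ab u v by simp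
        then show ?thesis using u by blast
      qed
    next
      assume "\<exists>v\<in>vs X. \<exists>i r. i < l - lsize X v & r \<in> D & a = Inr (v, i, r)"
      then obtain u i r where u: "u \<in> vs X" "i < l - lsize X u" "r \<in> D" "a = Inr (u, i, r)" by blast
      from dec[OF ab(2)] obtain r' where "b = Inr (u, i, r')" "DE r r'" "r' \<in> D" using ab(3) u(4) by auto
      then have "i \<in> {..<l} & (r, r') \<in> {(r, r'). r \<in> D & r' \<in> D & DE r r'} & i < l - lsize X u &
          x = Suc (fst (r, r') + \<delta> * i) + Wd * vc X u & y = Suc (snd (r, r') + \<delta> * i) + Wd * vc X u"
        using ab u by simp
      then show ?thesis using u(1) by blast
    qed
  next
    assume "?A | ?B | ?C"
    then show "arc X x y"
    proof (elim disjE)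
      assume ?A
      then obtain u v where u: "u \<in> vs X" "v \<in> vs X" "adj X u v" "x = Wd * vc X u" "y = Wd * vc X v" by blast
      show ?thesis unfolding arc_def
        by (rule bexI[of _ "Inl u"], rule bexI[of _ "Inl v"]) (use u in1 in auto)
    next
      assume ?B
      then obtain u i where u: "u \<in> vs X" "i < l - lsize X u" "x = Wd * vc X u" "y = Suc (du + \<delta> * i) + Wd * vc X u" by blast
      show ?thesis unfolding arc_def
        by (rule bexI[of _ "Inl u"], rule bexI[of _ "Inr (u, i, du)"]) (use u in1 in2 du in auto)
    next
      assume ?C
      then obtain u i r r' where u: "u \<in> vs X" "r \<in> D" "r' \<in> D" "DE r r'" "i < l - lsize X u"
        "x = Suc (r + \<delta> * i) + Wd * vc X u" "y = Suc (r' + \<delta> * i) + Wd * vc X u" by fastforce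
      show ?thesis unfolding arc_def
        by (rule bexI[of _ "Inr (u, i, r)"], rule bexI[of _ "Inr (u, i, r')"]) (use u in2 in auto)
    qed
  }
qed

lemmas pb_shape = pb_intros pt_intros pt_nE pt_nC pb_copies pb_subst2[OF pb_lit] pb_subst1[OF pb_univ]

lemma pb_arc: "pb (%X e. arc X (e 1) (e 0))"
proof -
  have "pb (%X e. \<exists>u\<in>vs X. \<exists>v\<in>vs X. adj X u v & e 1 = Wd * vc X u & e 0 = Wd * vc X v)"
    by (intro pb_ex_vs; simp only: qformula.adj.simps vc.simps One_nat_def; intro pb_shape)
  moreover have "pb (%X e. \<exists>u\<in>vs X. \<exists>i\<in>{..<l}. i < l - lsize X u & e 1 = Wd * vc X u &
      e 0 = Suc (du + \<delta> * i) + Wd * vc X u)"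
    by (intro pb_ex_vs pb_finite_ex finite_lessThan; simp only: vc.simps One_nat_def; intro pb_shape)
  moreover have "pb (%X e. \<exists>u\<in>vs X. \<exists>i\<in>{..<l}. \<exists>s\<in>{(r, r'). r \<in> D & r' \<in> D & DE r r'}. i < l - lsize X u &
      e 1 = Suc (fst s + \<delta> * i) + Wd * vc X u & e 0 = Suc (snd s + \<delta> * i) + Wd * vc X u)"
  proof -
    have "finite {(r, r'). r \<in> D & r' \<in> D & DE r r'}"
      by (rule finite_subset[of _ "{..<\<delta>} \<times> {..<\<delta>}"]) (use D in auto)
    then show ?thesis
      by (intro pb_ex_vs pb_finite_ex finite_lessThan; simp only: vc.simps One_nat_def; intro pb_shape)
  qed
  ultimately show ?thesis unfolding arc_iff by (intro pb_or)
qed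

lemma reduction: "poly_time_computable (%X. gcode (Nv X) (edge X))"
proof -
  have e: "pb (%X e. edge X (e 1) (e 0))"
    unfolding edge_def by (intro pb_or pb_arc pb_subst2[OF pb_arc] pt_var)
  have "ptrans (%X. gcode (Nv X) (edge X))"
    unfolding gcode_def by (intro ptrans_map pb_intros pt_intros pt_Nv pb_subst2[OF e])
  then show ?thesis by (rule ptrans_poly_time)
qed

end

text \<open>Unfolding the class gives a polynomial-time relation below two bounded quantifiers; what
  remains is to choose bounds that are terms in the length of the input, as the reduction
  requires.\<close>

theorem Pi2_hard:
  assumes l: "3 \<le> l" and k: "2 * l - 1 \<le> k" and A: "A \<in> class_Pi2"
  shows "poly_reducible A (bipartite_CH l k)"
proof -
  obtain R0 c1 d1 where R0: "R0 \<in> class_NP"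
    "!!x. x \<in> A <-> (\<forall>u. length u \<le> c1 * length x ^ d1 + c1 --> pair x u \<in> R0)"
    using A unfolding class_Pi2_def poly_forall_def by blast
  obtain R c2 d2 where R: "R \<in> class_P"
    "!!x. x \<in> R0 <-> (\<exists>u. length u \<le> c2 * length x ^ d2 + c2 & pair x u \<in> R)"
    using R0(1) unfolding class_NP_def poly_exists_def by blast
  obtain M c3 d3 where M: "computes_in_time M (%x. [x \<in> R]) (%n. c3 * n ^ d3 + c3)"
    using R(1) unfolding class_P_def poly_time_computable_def by blast
  obtain V :: "nat set" and E u where "forcing l k V E u"
    using ex_forcing[of l k] l k by auto
  then have g: "gadget l k 1 V E {u}" by (rule forcing_gadget)
  then have "finite V" unfolding gadget_def by simp
  then obtain \<delta> where \<delta>: "V \<subseteq> {..<\<delta>}" using finite_nat_iff_bounded by blast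
  define PP where "PP X = c1 * length X ^ d1 + c1" for X :: "bool list"
  \<comment> \<open>The inner bound is a polynomial in the length of \<open>pair X u\<close>, which
    is 2 * length X + 2 + length u.\<close>
  define wb where "wb X i = c2 * (2 * length X + 2 + i) ^ d2 + c2" for X :: "bool list" and i
  \<comment> \<open>\<open>wb\<close> is monotone in its second argument, so the longest universal
    string gives the longest input.\<close>
  define ZB where "ZB X = 4 * length X + 6 + 2 * PP X + wb X (PP X)" for X
  define NN where "NN X = Suc (Suc (ZB X + (c3 * ZB X ^ d3 + c3)))" for X
  interpret reduction M R PP ZB NN wb l k \<delta> V E u
  proof unfold_locales
    show "wf_tm M" using M by (simp add: computes_in_time_def)
    show "4 * length X + 6 + 2 * i + wb X i \<le> ZB X" if "i \<le> PP X" for X i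
    proof -
      have "wb X i \<le> wb X (PP X)" unfolding wb_def using that by (intro add_mono mult_le_mono power_mono) auto
      then show ?thesis using that by (simp add: ZB_def)
    qed
    show "ZB X < NN X" for X by (simp add: NN_def)
    show "\<exists>t. Suc t < NN X & fst ((step M ^^ t) (init M Z)) = states M &
        has_output ((step M ^^ t) (init M Z)) [Z \<in> R]" if "length Z \<le> ZB X" for X Z
    proof -
      obtain t where t: "t \<le> c3 * length Z ^ d3 + c3" "fst ((step M ^^ t) (init M Z)) = states M"
        "has_output ((step M ^^ t) (init M Z)) [Z \<in> R]"
        using M unfolding computes_in_time_def by blast
      have "c3 * length Z ^ d3 + c3 \<le> c3 * ZB X ^ d3 + c3" using that by (intro add_mono mult_le_mono power_mono) auto
      then have "Suc t < NN X" using t(1) unfolding NN_def by linarith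
      then show ?thesis using t(2,3) by blast
    qed
    show pP: "pt (%X e. PP X)" unfolding PP_def by (intro pt_intros)
    show "pt (%X e. wb X (e i))" for i unfolding wb_def by (intro pt_intros)
    show "pt (%X e. NN X)" unfolding NN_def ZB_def wb_def by (intro pt_intros pP)
  qed fact+
  have "x \<in> A <-> gcode (Nv x) (edge x) \<in> bipartite_CH l k" for x
    unfolding edge_correct R0(2) R(2) by (simp add: PP_def wb_def pair_def dbl_length algebra_simps)
  then show ?thesis unfolding poly_reducible_def using reduction by blast
qed

section \<open>Membership in the second level\<close>

definition bt :: "bool list => nat => bool" where "bt X j <-> j < length X & X ! j"

text \<open>The bits \<open>bx\<close> encode a graph on \<open>n\<close> vertices, the first \<open>n\<close> bits \<open>bw\<close> its bipartition, and the
  other bits \<open>bw\<close> a coloring from the lists \<open>bu\<close> in case these are lists of size \<open>l\<close>.\<close>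

definition verified :: "nat => nat => nat => nat => bool => (nat => bool) => (nat => bool) => (nat => bool) => bool" where
  "verified l k p n v bx bu bw <-> p = Suc n + n * n & (\<forall>i<n. bx i) & ~ bx n &
     (\<forall>i<n. \<forall>j<n. bx (Suc n + (j + n * i)) --> bx (Suc n + (i + n * j)) & ~ (bw i <-> bw j)) &
     (v & (\<forall>i<n. \<exists>S\<in>{S. S \<subseteq> {..<k} & card S = l}. \<forall>a\<in>{..<k}. bu (a + k * i) <-> a \<in> S) -->
        (\<forall>i<n. \<exists>a\<in>{..<k}. bu (a + k * i) & bw (n + (a + k * i))) &
        (\<forall>i<n. \<forall>j<n. bx (Suc n + (j + n * i)) -->
           (\<forall>a\<in>{..<k}. ~ (bu (a + k * i) & bw (n + (a + k * i)) & bu (a + k * j) & bw (n + (a + k * j))))))"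

text \<open>The delimiter of a pair is the first place at which the two bits of a doubled position
  differ; this determines the lengths m and p of the outer and the inner first component. Bits of
  the inner one occur at distance 4.\<close>

definition verifier :: "nat => nat => bool list => bool" where
  "verifier l k Z <-> (\<exists>m<length Z. \<exists>p<length Z. \<exists>n<length Z.
     (\<forall>i<m. bt Z (2 * i) <-> bt Z (2 * i + 1)) & ~ (bt Z (2 * m) <-> bt Z (2 * m + 1)) &
     (\<forall>i<p. bt Z (4 * i) <-> bt Z (4 * i + 2)) & ~ (bt Z (4 * p) <-> bt Z (4 * p + 2)) &
     verified l k p n (2 * p + 2 + n * k \<le> m) (%i. bt Z (4 * i)) (%i. bt Z (4 * p + 4 + 2 * i)) (%i. bt Z (2 * m + 2 + i)))"

lemma pb_verifier: "pb (%X e. verifier l k X)"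
  unfolding verifier_def verified_def bt_def
  by (intro pb_intros pt_intros pb_finite_ex pb_finite_all finite_lessThan finite_Collect_conjI disjI1 finite_Collect_subsets)

text \<open>Only bits of the matrix and, if the lists are complete, bits of the lists are inspected;
  beyond its own length a component is followed by other parts of the paired string, so nothing may
  depend on those bits.\<close>

lemma verified_cong:
  assumes "!!i. i < n ==> bx i = bx' i" "bx n = bx' n"
    "!!i j. i < n ==> j < n ==> bx (Suc n + (j + n * i)) = bx' (Suc n + (j + n * i))"
    "!!i a. v ==> i < n ==> a \<in> {..<k} ==> bu (a + k * i) = bu' (a + k * i)"
  shows "verified l k p n v bx bu bw <-> verified l k p n v bx' bu' bw"
  unfolding verified_def by (simp only: assms cong: conj_cong imp_cong ball_cong bex_cong)

lemma verifier_pair: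
  "verifier l k (pair (pair x u) w) <->
     (\<exists>n. verified l k (length x) n (n * k \<le> length u) (bt x) (bt u) (bt w))"
proof -
  define Z where "Z = pair (pair x u) w"
  define m where "m = length (pair x u)"
  define p where "p = length x"
  have m: "m = 2 * p + 2 + length u" by (simp add: m_def p_def pair_length)
  have lZ: "length Z = 2 * m + 2 + length w" by (simp add: Z_def m_def pair_length)
  have y: "bt Z (2 * i) = pair x u ! i" "bt Z (2 * i + 1) = pair x u ! i" if "i < m" for i
    using that pair_nth1[of "2 * i" "pair x u" w] pair_nth1[of "2 * i + 1" "pair x u" w] lZ
    by (simp_all add: bt_def Z_def m_def)
  have ym: "bt Z (2 * m)" "~ bt Z (2 * m + 1)"
    using pair_nth2[of "pair x u" w] lZ by (simp_all add: bt_def Z_def m_def)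
  have x: "bt Z (4 * i) = x ! i" "bt Z (4 * i + 2) = x ! i" if "i < p" for i
    using that y(1)[of "2 * i"] y(1)[of "2 * i + 1"] m pair_nth1[of "2 * i" x u] pair_nth1[of "2 * i + 1" x u]
    by (simp_all add: p_def)
  have xp: "bt Z (4 * p)" "~ bt Z (4 * p + 2)"
    using y(1)[of "2 * p"] y(1)[of "2 * p + 1"] m pair_nth2[of x u] by (simp_all add: p_def)
  have m_unique: "(\<forall>i<m'. bt Z (2 * i) <-> bt Z (2 * i + 1)) & ~ (bt Z (2 * m') <-> bt Z (2 * m' + 1)) <-> m' = m" for m'
    using y ym by (metis linorder_neqE_nat)
  have p_unique: "(\<forall>i<p'. bt Z (4 * i) <-> bt Z (4 * i + 2)) & ~ (bt Z (4 * p') <-> bt Z (4 * p' + 2)) <-> p' = p" for p'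
    using x xp by (metis linorder_neqE_nat)
  have bu: "bt Z (4 * p + 4 + 2 * i) = bt u i" if "i < length u" for i
  proof -
    have "bt Z (2 * (2 * p + 2 + i)) = pair x u ! (2 * p + 2 + i)" using y(1)[of "2 * p + 2 + i"] m that by simp
    also have "\<dots> = u ! i" unfolding p_def by (rule pair_nth3)
    finally have "bt Z (2 * (2 * p + 2 + i)) = u ! i" .
    moreover have "2 * (2 * p + 2 + i) = 4 * p + 4 + 2 * i" by simp
    ultimately show ?thesis using that by (metis bt_def)
  qed
  have bw: "bt Z (2 * m + 2 + i) = bt w i" for i
    using pair_nth3[of "pair x u" w i] lZ by (auto simp: bt_def Z_def m_def)
  have "verifier l k Z <-> (\<exists>n<length Z. verified l k p n (2 * p + 2 + n * k \<le> m) (%i. bt Z (4 * i))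
      (%i. bt Z (4 * p + 4 + 2 * i)) (%i. bt Z (2 * m + 2 + i)))"
  proof -
    have "m < length Z" "p < length Z" using lZ m by simp_all
    moreover have "verifier l k Z <-> (\<exists>m'<length Z. \<exists>p'<length Z. \<exists>n<length Z.
      ((\<forall>i<m'. bt Z (2 * i) <-> bt Z (2 * i + 1)) & ~ (bt Z (2 * m') <-> bt Z (2 * m' + 1))) &
      ((\<forall>i<p'. bt Z (4 * i) <-> bt Z (4 * i + 2)) & ~ (bt Z (4 * p') <-> bt Z (4 * p' + 2))) &
      verified l k p' n (2 * p' + 2 + n * k \<le> m') (%i. bt Z (4 * i)) (%i. bt Z (4 * p' + 4 + 2 * i)) (%i. bt Z (2 * m' + 2 + i)))"
      unfolding verifier_def by (simp only: conj_assoc)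
    ultimately show ?thesis unfolding m_unique p_unique by blast
  qed
  also have "\<dots> <-> (\<exists>n<length Z. verified l k p n (n * k \<le> length u) (bt x) (bt u) (bt w))"
  proof (intro ex_cong conj_cong refl)
    fix n
    show "verified l k p n (2 * p + 2 + n * k \<le> m) (%i. bt Z (4 * i)) (%i. bt Z (4 * p + 4 + 2 * i)) (%i. bt Z (2 * m + 2 + i))
      <-> verified l k p n (n * k \<le> length u) (bt x) (bt u) (bt w)"
    proof (cases "p = Suc n + n * n")
      case True
      have 1: "bt Z (4 * i) = bt x i" if "i < p" for i using x(1)[OF that] that by (simp add: bt_def p_def)
      have 2: "bt Z (4 * i) = bt x i" if "i < n" for i using 1 that True by simp
      have 3: "bt Z (4 * n) = bt x n" using 1 True by simp
      have 4: "bt Z (4 * (Suc n + (j + n * i))) = bt x (Suc n + (j + n * i))" if "i < n" "j < n" for i j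
        using 1[of "Suc n + (j + n * i)"] mixed_radix_less[OF that(2,1)] True by simp
      have 5: "bt Z (4 * p + 4 + 2 * (a + k * i)) = bt u (a + k * i)" if "n * k \<le> length u" "i < n" "a \<in> {..<k}" for i a
        using bu[of "a + k * i"] mixed_radix_less[of a k i n] that by (simp add: mult.commute)
      have v: "2 * p + 2 + n * k \<le> m <-> n * k \<le> length u" using m by simp
      show ?thesis unfolding v bw by (rule verified_cong) (use 2 3 4 5 in "simp_all only:")
    qed (simp add: verified_def)
  qed
  also have "\<dots> <-> (\<exists>n. verified l k p n (n * k \<le> length u) (bt x) (bt u) (bt w))"
  proof -
    have "n < length Z" if "p = Suc n + n * n" for n using that lZ m by simp
    moreover have "p = Suc n + n * n" if "verified l k p n (n * k \<le> length u) (bt x) (bt u) (bt w)" for n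
      using that unfolding verified_def by (rule conjunct1)
    ultimately show ?thesis by blast
  qed
  finally show ?thesis by (simp add: Z_def p_def)
qed

lemma gcode_bt:
  assumes "length x = Suc n + n * n" "!!i. i < n ==> bt x i" "~ bt x n"
  shows "x = gcode n (%i j. i < n & j < n & bt x (Suc n + (j + n * i)))" (is "x = gcode n ?E")
proof (rule nth_equalityI)
  show "length x = length (gcode n ?E)" using assms(1) by (simp add: length_gcode)
  fix q assume q: "q < length x"
  consider "q < n" | "q = n" | "Suc n \<le> q" by linarith
  then show "x ! q = gcode n ?E ! q"
  proof cases
    case 1
    then show ?thesis using assms(2)[OF 1] gcode_prefix[of q n ?E] by (simp add: bt_def)
  next
    case 2
    then show ?thesis using assms(3) q gcode_prefix[of q n ?E] by (simp add: bt_def)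
  next
    case 3
    then obtain i where i: "q = Suc n + i" by (metis less_eqE)
    then have "i < n * n" using q assms(1) by simp
    then have "n > 0" by (cases n) auto
    then have xy: "i div n < n" "i mod n < n" "i = i mod n + n * (i div n)"
      using \<open>i < n * n\<close> by (simp_all add: less_mult_imp_div_less)
    have "gcode n ?E ! q = ?E (i div n) (i mod n)" using gcode_edge(2)[OF xy(1,2), of ?E] xy(3) i by simp
    then show ?thesis using xy q i by (simp add: bt_def)
  qed
qed

lemma bt_map: "bt (map f [0..<n]) i <-> i < n & f i"
  by (auto simp: bt_def)

lemma verified_complete:
  assumes E: "!!x y. E x y ==> x < n & y < n & E y x" and s: "!!x y. E x y ==> s x ~= (s y :: bool)"
    and f: "fch k (%_. l) {..<n} E"
  shows "\<exists>w. length w = n + n * k & verified l k (length (gcode n E)) n v (bt (gcode n E)) (bt u) (bt w)"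
proof -
  let ?x = "gcode n E"
  define L where "L i = Suc ` {a. a < k & bt u (a + k * i)}" for i
  define ok where "ok <-> (\<forall>i<n. \<exists>S\<in>{S. S \<subseteq> {..<k} & card S = l}. \<forall>a\<in>{..<k}. bt u (a + k * i) <-> a \<in> S)"
  \<comment> \<open>If \<open>u\<close> describes no lists of size l, no coloring is demanded and
    any \<open>c\<close> will do.\<close>
  have "\<exists>c. ok --> col {..<n} E L c"
  proof (cases ok)
    case True
    have "lists_on k (%_. l) {..<n} L"
      unfolding lists_on_def
    proof (intro ballI conjI)
      fix i assume "i \<in> {..<n}"
      then obtain S where S: "S \<subseteq> {..<k}" "card S = l" "\<forall>a\<in>{..<k}. bt u (a + k * i) <-> a \<in> S"
        using True unfolding ok_def by blast
      then have "{a. a < k & bt u (a + k * i)} = S" by auto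
      then show "L i \<subseteq> {1..k}" "card (L i) = l" using S(1,2) by (auto simp: L_def card_image)
    qed
    then show ?thesis using fchD[OF f] by blast
  qed simp
  then obtain c where c: "ok ==> col {..<n} E L c" by blast
  define w where "w = map (%j. if j < n then s j else c ((j - n) div k) = Suc ((j - n) mod k)) [0..<n + n * k]"
  have w1: "bt w i <-> s i" if "i < n" for i using that by (simp add: w_def bt_map)
  have w2: "bt w (n + (a + k * i)) <-> c i = Suc a" if "i < n" "a < k" for i a
  proof -
    have "a + k * i < n * k" using mixed_radix_less[OF that(2,1)] by (simp add: mult.commute)
    then show ?thesis using that by (simp add: w_def bt_map)
  qed
  have x1: "bt ?x i" if "i < n" for i using that gcode_prefix[of i n E] by (simp add: bt_def length_gcode)
  have x2: "~ bt ?x n" using gcode_prefix[of n n E] by (simp add: bt_def)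
  have x3: "bt ?x (Suc n + (j + n * i)) <-> E i j" if "i < n" "j < n" for i j
    using gcode_edge[OF that, of E] by (simp add: bt_def)
  have "verified l k (length ?x) n v (bt ?x) (bt u) (bt w)"
    unfolding verified_def ok_def[symmetric]
  proof (intro conjI allI impI ballI)
    show "length ?x = Suc n + n * n" by (rule length_gcode)
    show "~ bt ?x n" by (rule x2)
    fix i assume i: "i < n"
    show "bt ?x i" using x1[OF i] .
    {
      fix j assume j: "j < n" and e: "bt ?x (Suc n + (j + n * i))"
      have ij: "E i j" using e x3[OF i j] by blast
      show "bt ?x (Suc n + (i + n * j))" using E[OF ij] x3[OF j i] by blast
      show "~ (bt w i <-> bt w j)" using s[OF ij] w1 i j by blast
      fix a assume v: "v & ok" and a: "a \<in> {..<k}"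
      have "c i ~= c j" using c v ij i j unfolding col_def by blast
      then show "~ (bt u (a + k * i) & bt w (n + (a + k * i)) & bt u (a + k * j) & bt w (n + (a + k * j)))"
        using w2[OF i] w2[OF j] a by auto
    }
    assume "v & ok"
    then have "c i \<in> L i" using c i unfolding col_def by blast
    then obtain a where "a < k" "bt u (a + k * i)" "c i = Suc a" unfolding L_def by blast
    then show "\<exists>a\<in>{..<k}. bt u (a + k * i) & bt w (n + (a + k * i))" using w2[OF i] by blast
  qed
  then show ?thesis by (intro exI[of _ w]) (simp add: w_def)
qed

lemma verified_sound:
  assumes "!!u. length u \<le> length x * k ==> \<exists>w n. verified l k (length x) n (n * k \<le> length u) (bt x) (bt u) (bt w)"
  shows "x \<in> bipartite_CH l k"
proof -
  \<comment> \<open>Already the empty string \<open>u\<close> certifies that \<open>x\<close>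
    encodes a bipartite graph; the lists come into play afterwards.\<close>
  obtain w n where v: "verified l k (length x) n (n * k \<le> length []) (bt x) (bt []) (bt w)" using assms[of "[]"] by auto
  define E where "E i j <-> i < n & j < n & bt x (Suc n + (j + n * i))" for i j
  have x: "length x = Suc n + n * n" "!!i. i < n ==> bt x i" "~ bt x n"
    "!!i j. E i j ==> E j i & ~ (bt w i <-> bt w j)"
    using v unfolding verified_def E_def by blast+
  have nu: "n' = n" if "length x = Suc n' + n' * n'" for n'
  proof -
    have "~ n' < n" "~ n < n'" using that x(1) mult_le_mono[of n n' n n'] mult_le_mono[of n' n n' n] by auto
    then show ?thesis by simp
  qed
  have xc: "x = gcode n E" using gcode_bt[OF x(1-3)] unfolding E_def by blast
  have E1: "i < n & j < n & E j i" if "E i j" for i j using that x(4) unfolding E_def by blast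
  have s: "\<exists>s. \<forall>i j. E i j --> s i ~= (s j :: bool)" using x(4) by blast
  have "fch k (%_. l) {..<n} E"
    unfolding fch_def
  proof (intro allI impI)
    fix L assume L: "lists_on k (%_. l) {..<n} L"
    \<comment> \<open>Bit \<open>a\<close> of a list stands for color \<open>Suc a\<close>, as
      colors start at 1.\<close>
    define u where "u = map (%j. Suc (j mod k) \<in> L (j div k)) [0..<n * k]"
    have lu: "length u = n * k" by (simp add: u_def)
    have bu: "bt u (a + k * i) <-> Suc a \<in> L i" if "i < n" "a < k" for i a
    proof -
      have "a + k * i < n * k" using mixed_radix_less[OF that(2,1)] by (simp add: mult.commute)
      then show ?thesis using that by (simp add: u_def bt_map)
    qed
    have "length u \<le> length x * k" unfolding lu by (rule mult_le_mono1) (simp add: x(1))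
    from assms[OF this] obtain w n' where "verified l k (length x) n' (n' * k \<le> length u) (bt x) (bt u) (bt w)" by blast
    moreover from this have "n' = n" using nu unfolding verified_def by blast
    ultimately have v: "verified l k (length x) n True (bt x) (bt u) (bt w)" using lu by simp
    have "\<exists>S\<in>{S. S \<subseteq> {..<k} & card S = l}. \<forall>a\<in>{..<k}. bt u (a + k * i) <-> a \<in> S" if i: "i < n" for i
    proof -
      have Li: "L i \<subseteq> {1..k}" "card (L i) = l" using L i unfolding lists_on_def by auto
      have "Suc ` {a. a < k & Suc a \<in> L i} = L i"
      proof
        show "L i \<subseteq> Suc ` {a. a < k & Suc a \<in> L i}"
        proof
          fix b assume b: "b \<in> L i"
          then have "1 \<le> b" "b \<le> k" using Li(1) by auto
          then have "b = Suc (b - 1)" "b - 1 < k" by linarith+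
          then show "b \<in> Suc ` {a. a < k & Suc a \<in> L i}" using b by (intro image_eqI[of _ _ "b - 1"]) auto
        qed
      qed auto
      then have "card {a. a < k & Suc a \<in> L i} = l" using Li(2) by (metis card_image inj_Suc)
      then show ?thesis using bu[OF i] by (intro bexI[of _ "{a. a < k & Suc a \<in> L i}"]) auto
    qed
    then have c1: "!!i. i < n ==> \<exists>a\<in>{..<k}. bt u (a + k * i) & bt w (n + (a + k * i))"
      and c2: "!!i j a. E i j ==> a < k ==> ~ (bt u (a + k * i) & bt w (n + (a + k * i)) & bt u (a + k * j) & bt w (n + (a + k * j)))"
      using v unfolding verified_def E_def by blast+
    have "\<forall>i\<in>{..<n}. \<exists>a. a < k & bt u (a + k * i) & bt w (n + (a + k * i))" using c1 by blast
    from bchoice[OF this] obtain c where c: "!!i. i < n ==> c i < k & bt u (c i + k * i) & bt w (n + (c i + k * i))"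
      by blast
    have "col {..<n} E L (%i. Suc (c i))"
      unfolding col_def
    proof (intro conjI ballI impI)
      fix i assume i: "i \<in> {..<n}"
      then show "Suc (c i) \<in> L i" using c[of i] bu[of i "c i"] by blast
      fix j assume j: "j \<in> {..<n}" and e: "E i j"
      show "Suc (c i) ~= Suc (c j)" using c2[OF e, of "c i"] c[of i] c[of j] i j by auto
    qed
    then show "\<exists>c. col {..<n} E L c" by blast
  qed
  then show ?thesis unfolding xc using gcode_bipartite_CH[OF E1] s by blast
qed

theorem in_Pi2: "bipartite_CH l k \<in> class_Pi2"
proof -
  let ?V = "{Z. verifier l k Z}"
  let ?R = "{y. \<exists>w. length w \<le> Suc k * length y ^ 1 + Suc k & pair y w \<in> ?V}"
  have "?V \<in> class_P" by (rule class_P_definable[OF pb_verifier])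
  then have "?R \<in> class_NP" unfolding class_NP_def poly_exists_def by blast
  moreover have "x \<in> bipartite_CH l k <-> (\<forall>u. length u \<le> k * length x ^ 1 + k --> pair x u \<in> ?R)" for x
  proof
    assume "x \<in> bipartite_CH l k"
    then obtain n E s where x: "x = gcode n E" "!!x y. E x y ==> x < n & y < n & E y x"
      "!!x y. E x y ==> s x ~= (s y :: bool)" "fch k (%_. l) {..<n} E" unfolding bipartite_CH_iff by blast
    show "\<forall>u. length u \<le> k * length x ^ 1 + k --> pair x u \<in> ?R"
    proof (intro allI impI CollectI)
      fix u
      obtain w where w: "length w = n + n * k" "verified l k (length x) n (n * k \<le> length u) (bt x) (bt u) (bt w)"
        using verified_complete[of E n s k l _ u] x by blast
      have "n \<le> length (pair x u)" using x(1) by (simp add: pair_length length_gcode)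
      then have "Suc k * n \<le> Suc k * length (pair x u)" by (rule mult_le_mono2)
      then have "length w \<le> Suc k * length (pair x u) ^ 1 + Suc k" using w(1) by (simp add: mult.commute)
      then show "\<exists>w. length w \<le> Suc k * length (pair x u) ^ 1 + Suc k & pair (pair x u) w \<in> ?V"
        using w(2) verifier_pair by blast
    qed
  next
    assume a: "\<forall>u. length u \<le> k * length x ^ 1 + k --> pair x u \<in> ?R"
    show "x \<in> bipartite_CH l k"
    proof (rule verified_sound)
      fix u :: "bool list" assume "length u \<le> length x * k"
      then have "pair x u \<in> ?R" using a by (simp add: mult.commute)
      then show "\<exists>w n. verified l k (length x) n (n * k \<le> length u) (bt x) (bt u) (bt w)"
        using verifier_pair by blast
    qed
  qed
  ultimately show ?thesis unfolding class_Pi2_def poly_forall_def by blast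
qed

section \<open>Palettes of fewer than 2l - 1 colors\<close>

lemma small_palette_choosable:
  assumes "k < 2 * l - 1" "pair_graph G" "bipartite G"
  shows "choosable l k G"
  unfolding choosable_def
proof (intro allI impI)
  fix L assume L: "\<forall>v\<in>pverts G. L v \<subseteq> {1..k} & card (L v) = l"
  have G: "parcs G \<subseteq> pverts G \<times> pverts G" using assms(2) by (simp add: pair_graph_iff)
  obtain s where s: "!!u v. (u, v) \<in> parcs G ==> s u ~= (s v :: bool)"
    using assms(3) unfolding bipartite_iff[OF G] by blast
  define P where "P v = (if s v then {..<l} else {l..})" for v
  have "L v \<inter> P v ~= {}" if v: "v \<in> pverts G" for v
  proof
    assume e: "L v \<inter> P v = {}"
    have "L v \<subseteq> (if s v then {l..k} else {1..<l})"
    proof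
      fix a assume a: "a \<in> L v"
      have "L v \<subseteq> {1..k}" using L v by blast
      then have "1 \<le> a" "a \<le> k" "a ~: P v" using a e by auto
      then show "a \<in> (if s v then {l..k} else {1..<l})" by (auto simp: P_def split: if_splits)
    qed
    then have "card (L v) \<le> card (if s v then {l..k} else {1..<l})" by (intro card_mono) auto
    moreover have "card (L v) = l" using L v by blast
    ultimately show False using assms(1) by (auto split: if_splits)
  qed
  then have "\<forall>v\<in>pverts G. \<exists>a. a \<in> L v & a \<in> P v" by blast
  from bchoice[OF this] obtain c where c: "!!v. v \<in> pverts G ==> c v \<in> L v & c v \<in> P v" by blast
  have "c u ~= c v" if "(u, v) \<in> parcs G" for u v
  proof -
    have "c u \<in> P u" "c v \<in> P v" using c G that by auto
    then show ?thesis using s[OF that] by (auto simp: P_def split: if_splits)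
  qed
  then show "\<exists>c. proper_coloring G c & (\<forall>v\<in>pverts G. c v \<in> L v)"
    using c by (intro exI[of _ c]) (auto simp: proper_coloring_def)
qed

section \<open>Graphs that are not choosable from lists of size 2\<close>

fun walk :: "('v => 'v => bool) => 'v => 'v list => 'v => bool" where
  "walk E x [] y <-> E x y"
| "walk E x (z # q) y <-> E x z & walk E z q y"

lemma walk_append: "walk E x (p @ z # q) y <-> walk E x p z & walk E z q y"
  by (induction p arbitrary: x) auto

lemma walk_rev: "(!!x y. E x y ==> E y x) ==> walk E x q y ==> walk E y (rev q) x"
  by (induction q arbitrary: x) (auto simp: walk_append)

lemma walk_parity: "(!!x y. E x y ==> s x ~= (s y :: bool)) ==> walk E x q y ==> (s x = s y) = odd (length q)"
  by (induction q arbitrary: x) fastforce+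

lemma colD: "col U E L c ==> x \<in> U ==> c x \<in> L x" "col U E L c ==> x \<in> U ==> y \<in> U ==> E x y ==> c x ~= c y"
  unfolding col_def by blast+

lemma col_mono: "col V E M c ==> U \<subseteq> V ==> (!!z. z \<in> U ==> M z = L z) ==> col U E L c"
  unfolding col_def by (metis subsetD)

abbreviation "lists2 \<equiv> lists_on 3 (%_. 2)"

lemma lists2_upd: "lists2 U L ==> a \<in> {1..3} ==> b \<in> {1..3} ==> a ~= b ==> lists2 (insert z U) (L(z := {a, b}))"
  by (simp add: lists_on_def)

lemma lists_on_subset: "lists_on k f U L ==> U' \<subseteq> U ==> lists_on k f U' L"
  unfolding lists_on_def by blast

lemma lists_on_if: "lists_on k f A L ==> lists_on k f (U - A) M ==> lists_on k f U (%z. if z \<in> A then L z else M z)"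
  by (simp add: lists_on_def)

section \<open>Lists on paths that exclude combinations of end colors\<close>

definition proper :: "('v => 'v => bool) => 'v set => ('v => nat) => bool" where
  "proper E U c <-> (\<forall>x\<in>U. \<forall>y\<in>U. E x y --> c x ~= c y)"

lemma proper_subset: "proper E U c ==> U' \<subseteq> U ==> proper E U' c"
  unfolding proper_def by blast

lemma col_proper: "col U E L c <-> (\<forall>z\<in>U. c z \<in> L z) & proper E U c"
  by (simp add: col_def proper_def)

text \<open>The first interior vertex gets the list {a, e} with a third color e, so that the color
  \<open>a\<close> at \<open>x\<close> forces e there. As e differs from \<open>d\<close>, the rest
  of the path can always continue, even if it is a single vertex.\<close>

lemma kill_one:
  assumes "walk E x q y" "distinct q" "q ~= []" "length q \<ge> 2 | a ~= d" "a \<in> {1..3}" "d \<in> {1..3}"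
  shows "\<exists>L. lists2 (set q) L & (\<forall>c. proper E (insert x (insert y (set q))) c --> (\<forall>z\<in>set q. c z \<in> L z) -->
    ~ (c x = a & c y = d))"
  using assms
proof (induction q arbitrary: x a)
  case (Cons z q)
  show ?case
  proof (cases q)
    case Nil
    then have "a ~= d" using Cons.prems by auto
    then have "lists2 (set (z # q)) (%_. {a, d})" using Nil Cons.prems by (simp add: lists_on_def)
    moreover have "~ (c x = a & c y = d)" if "proper E (insert x (insert y (set (z # q)))) c" "\<forall>z\<in>set (z # q). c z \<in> {a, d}" for c
      using that Nil Cons.prems(1) unfolding proper_def by (auto split: if_splits)
    ultimately show ?thesis by blast
  next
    case (Cons z' q')
    have "(1 ~= a & 1 ~= d) | (2 ~= a & 2 ~= d) | (3 ~= a & 3 ~= d)" by linarith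
    then obtain e where e: "e \<in> {1..3}" "e ~= a" "e ~= d" using that[of 1] that[of 2] that[of 3] by fastforce
    obtain L where L: "lists2 (set q) L" "\<forall>c. proper E (insert z (insert y (set q))) c --> (\<forall>z\<in>set q. c z \<in> L z) -->
        ~ (c z = e & c y = d)"
      using Cons.IH[of z e] Cons.prems Cons e by auto
    define L' where "L' = L(z := {a, e})"
    have zq: "z ~: set q" using Cons.prems by simp
    have "lists2 (set (z # q)) L'" using lists2_upd[OF L(1), of a e z] e Cons.prems(5) by (simp add: L'_def)
    moreover have "~ (c x = a & c y = d)" if c: "proper E (insert x (insert y (set (z # q)))) c" "\<forall>w\<in>set (z # q). c w \<in> L' w" for c
    proof
      assume xy: "c x = a & c y = d"
      have "c x ~= c z" using c(1) Cons.prems(1) unfolding proper_def by simp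
      then have "c z = e" using c(2) xy by (simp add: L'_def)
      moreover have "proper E (insert z (insert y (set q))) c" using c(1) by (rule proper_subset) auto
      moreover have "\<forall>w\<in>set q. c w \<in> L w"
      proof
        fix w assume "w \<in> set q"
        then show "c w \<in> L w" using c(2) zq by (auto simp: L'_def split: if_splits)
      qed
      ultimately show False using L(2) xy by blast
    qed
    ultimately show ?thesis by blast
  qed
qed simp

text \<open>With the same two colors everywhere a path alternates, which excludes two of the four
  combinations at its ends.\<close>

lemma kill_two:
  assumes "walk E x q y" "proper E (insert x (insert y (set q))) c" "\<forall>z\<in>insert x (insert y (set q)). c z \<in> {a, b}"
  shows "(c x = c y) = odd (length q)"
  using assms
proof (induction q arbitrary: x)
  case Nil
  then show ?case by (simp add: proper_def)
next
  case (Cons z q)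
  have "proper E (insert z (insert y (set q))) c" using Cons.prems(2) by (rule proper_subset) auto
  then have o: "(c z = c y) = odd (length q)" using Cons by simp
  have "c x ~= c z" using Cons.prems(1,2) unfolding proper_def by simp
  moreover have "c x \<in> {a, b}" "c y \<in> {a, b}" "c z \<in> {a, b}" using Cons.prems(3) by auto
  ultimately have "(c x = c y) = (c z ~= c y)" by (elim insertE emptyE; simp)
  then show ?case using o by simp
qed

lemma kill_extend:
  assumes "\<forall>c. proper E (insert x (insert y (set q))) c --> (\<forall>z\<in>set q. c z \<in> L z) --> ~ (c x = a & c y = d)"
    "col U E L' c" "insert x (insert y (set q)) \<subseteq> U" "\<forall>z\<in>set q. L' z = L z"
  shows "~ (c x = a & c y = d)"
proof -
  have "proper E (insert x (insert y (set q))) c" using assms(2,3) proper_subset unfolding col_proper by blast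
  moreover have "\<forall>z\<in>set q. c z \<in> L z" using assms(2-4) unfolding col_proper by fastforce
  ultimately show ?thesis using assms(1) by blast
qed

abbreviation "bad E U \<equiv> ~ fch 3 (%_. 2) U E"

lemma badI: "lists2 U L ==> (!!c. col U E L c ==> False) ==> bad E U"
  unfolding fch_def by blast

text \<open>Bad lists over three colors stay bad in a larger palette and a larger graph, so most
  obstructions are built from three colors only.\<close>

lemma bad_mono:
  assumes "bad E U" "U \<subseteq> V" "3 \<le> k" shows "~ fch k (%_. 2) V E"
proof
  assume f: "fch k (%_. 2) V E"
  obtain L where L: "lists2 U L" "\<nexists>c. col U E L c" using assms(1) unfolding fch_def by blast
  have "lists_on k (%_. 2) U L" using L(1) assms(3) unfolding lists_on_def by fastforce
  then have "lists_on k (%_. 2) V (%z. if z \<in> U then L z else {1, 2})"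
    by (rule lists_on_if) (use assms(3) in "simp add: lists_on_def")
  then obtain c where "col V E (%z. if z \<in> U then L z else {1, 2}) c" using fchD[OF f] by blast
  then have "col U E L c" using assms(2) unfolding col_def by fastforce
  then show False using L(2) by blast
qed

text \<open>The third path and both ends get the list {1, 2}, which leaves two combinations at the
  ends; each of the long paths excludes one of them.\<close>

lemma theta_bad:
  assumes w: "walk E u q1 v" "walk E u q2 v" "walk E u q3 v" and l: "length q1 \<ge> 2" "length q2 \<ge> 2"
    and d: "distinct q1" "distinct q2" "u ~= v" "set q1 \<inter> set q2 = {}" "set q1 \<inter> set q3 = {}" "set q2 \<inter> set q3 = {}"
    "u ~: set q1 \<union> set q2" "v ~: set q1 \<union> set q2"
  shows "bad E ({u, v} \<union> set q1 \<union> set q2 \<union> set q3)" (is "bad E ?U")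
proof -
  \<comment> \<open>The parity of the third path decides whether the ends have equal or different
    colors; \<open>d1\<close> and \<open>d2\<close> accompany the colors 1 and 2 at
    \<open>u\<close>.\<close>
  define d1 d2 where "d1 = (if odd (length q3) then 1 else 2 :: nat)" and "d2 = (if odd (length q3) then 2 else 1 :: nat)"
  have dd: "d1 \<in> {1..3}" "d2 \<in> {1..3}" by (simp_all add: d1_def d2_def)
  have ne: "q1 ~= []" "q2 ~= []" using l by auto
  obtain L1 where L1: "lists2 (set q1) L1"
    "\<forall>c. proper E (insert u (insert v (set q1))) c --> (\<forall>z\<in>set q1. c z \<in> L1 z) --> ~ (c u = 1 & c v = d1)"
    using kill_one[OF w(1) d(1) ne(1) disjI1[OF l(1)], of 1 d1] dd by auto
  obtain L2 where L2: "lists2 (set q2) L2"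
    "\<forall>c. proper E (insert u (insert v (set q2))) c --> (\<forall>z\<in>set q2. c z \<in> L2 z) --> ~ (c u = 2 & c v = d2)"
    using kill_one[OF w(2) d(2) ne(2) disjI1[OF l(2)], of 2 d2] dd by auto
  define L where "L z = (if z \<in> set q1 then L1 z else if z \<in> set q2 then L2 z else {1, 2})" for z
  have "lists2 ?U L" unfolding L_def by (intro lists_on_if L1(1) L2(1)) (simp add: lists_on_def)
  moreover have False if c: "col ?U E L c" for c
  proof -
    have L3: "\<forall>z\<in>insert u (insert v (set q3)). L z = {1, 2}" using d by (auto simp: L_def)
    have c3: "\<forall>z\<in>insert u (insert v (set q3)). c z \<in> {1, 2}"
    proof
      fix z assume z: "z \<in> insert u (insert v (set q3))"
      then have "c z \<in> L z" by (intro colD(1)[OF c]) auto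
      then show "c z \<in> {1, 2}" using bspec[OF L3 z] by simp
    qed
    have "proper E ?U c" using c unfolding col_proper by (rule conjunct2)
    then have "proper E (insert u (insert v (set q3))) c" by (rule proper_subset) auto
    then have p: "(c u = c v) = odd (length q3)" using kill_two[OF w(3) _ c3] by blast
    have "~ (c u = 1 & c v = d1)" by (rule kill_extend[OF L1(2) c]) (auto simp: L_def)
    moreover have "~ (c u = 2 & c v = d2)" by (rule kill_extend[OF L2(2) c]) (use d(4) in "auto simp: L_def")
    ultimately show False using p c3 unfolding d1_def d2_def by auto
  qed
  ultimately show ?thesis by (rule badI)
qed

text \<open>With lists {1, 2} at \<open>u\<close> and {1, 3} at \<open>v\<close> there are four
  combinations. Single vertices can exclude the three with different colors, but not 1, 1; that one
  is left to the long path.\<close>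

lemma theta4_bad:
  assumes E: "E u w1" "E w1 v" "E u w2" "E w2 v" "E u w3" "E w3 v" "walk E u q v" and l: "length q \<ge> 2"
    and d: "distinct [u, v, w1, w2, w3]" "distinct q" "set q \<inter> {u, v, w1, w2, w3} = {}"
  shows "bad E ({u, v, w1, w2, w3} \<union> set q)" (is "bad E ?U")
proof -
  obtain L1 where L1: "lists2 (set q) L1"
    "\<forall>c. proper E (insert u (insert v (set q))) c --> (\<forall>z\<in>set q. c z \<in> L1 z) --> ~ (c u = 1 & c v = 1)"
    using kill_one[OF E(7) d(2) _ disjI1[OF l], of 1 1] l by fastforce
  define L :: "'a => nat set" where "L z = (if z \<in> set q then L1 z else if u = z then {1, 2} else if v = z then {1, 3}
    else if w1 = z then {1, 3} else if w2 = z then {1, 2} else {2, 3})" for z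
  have "lists2 ?U L" unfolding L_def by (rule lists_on_if[OF L1(1)]) (simp add: lists_on_def)
  moreover have False if c: "col ?U E L c" for c
  proof -
    have n: "~ (c u = 1 & c v = 1)" by (rule kill_extend[OF L1(2) c]) (auto simp: L_def)
    have "u ~: set q" "v ~: set q" "w1 ~: set q" "w2 ~: set q" "w3 ~: set q" using d(3) by auto
    then have "L u = {1, 2}" "L v = {1, 3}" "L w1 = {1, 3}" "L w2 = {1, 2}" "L w3 = {2, 3}"
      using d(1) by (simp_all add: L_def)
    then have "c u \<in> {1, 2}" "c v \<in> {1, 3}" "c w1 \<in> {1, 3}" "c w2 \<in> {1, 2}" "c w3 \<in> {2, 3}"
      using colD(1)[OF c, of u] colD(1)[OF c, of v] colD(1)[OF c, of w1] colD(1)[OF c, of w2] colD(1)[OF c, of w3]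
      by simp_all
    moreover have "c u ~= c w1" "c w1 ~= c v" "c u ~= c w2" "c w2 ~= c v" "c u ~= c w3" "c w3 ~= c v"
      by (rule colD(2)[OF c], simp_all add: E)+
    ultimately show False using n by auto
  qed
  ultimately show ?thesis by (rule badI)
qed

text \<open>With four colors the ends can have disjoint lists, and each of the four middle vertices
  excludes one combination.\<close>

lemma K24_bad:
  assumes E: "E u w1" "E w1 v" "E u w2" "E w2 v" "E u w3" "E w3 v" "E u w4" "E w4 v"
    and d: "distinct [u, v, w1, w2, w3, w4]" and V: "{u, v, w1, w2, w3, w4} \<subseteq> V" and k: "4 \<le> k"
  shows "~ fch k (%_. 2) V E"
proof
  assume f: "fch k (%_. 2) V E"
  define L :: "'a => nat set" where "L z = (if u = z then {1, 2} else if v = z then {3, 4}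
    else if w1 = z then {1, 3} else if w2 = z then {1, 4} else if w3 = z then {2, 3} else {2, 4})" for z
  have "lists_on k (%_. 2) V L" using k by (auto simp: L_def lists_on_def)
  then obtain c where c: "col V E L c" using fchD[OF f] by blast
  then have "c u \<in> L u" "c v \<in> L v" "c w1 \<in> L w1" "c w2 \<in> L w2" "c w3 \<in> L w3" "c w4 \<in> L w4"
    using V unfolding col_def by auto
  moreover have "L u = {1, 2}" "L v = {3, 4}" "L w1 = {1, 3}" "L w2 = {1, 4}" "L w3 = {2, 3}" "L w4 = {2, 4}"
    using d by (simp_all add: L_def)
  ultimately have "c u \<in> {1, 2}" "c v \<in> {3, 4}" "c w1 \<in> {1, 3}" "c w2 \<in> {1, 4}" "c w3 \<in> {2, 3}" "c w4 \<in> {2, 4}"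
    by simp_all
  moreover have "c u ~= c w1" "c w1 ~= c v" "c u ~= c w2" "c w2 ~= c v" "c u ~= c w3" "c w3 ~= c v" "c u ~= c w4" "c w4 ~= c v"
    using c E V unfolding col_def by auto
  ultimately show False by auto
qed

section \<open>Subgraphs that force the color of a vertex\<close>

definition force :: "('v => 'v => bool) => 'v set => 'v => bool" where
  "force E U x <-> x \<in> U & (\<forall>a\<in>{1..3}. \<forall>b\<in>{1..3}. a ~= b -->
     (\<exists>L. lists2 U L & L x = {a, b} & (\<forall>c. col U E L c --> c x = a)))"

text \<open>A cycle is a path from \<open>z\<close> to itself, and a path with at least two interior
  vertices can exclude the combination \<open>b, b\<close>.\<close>

lemma force_cycle:
  assumes "walk E z q z" "distinct (z # q)" "length q \<ge> 2"
  shows "force E (insert z (set q)) z"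
  unfolding force_def
proof (intro conjI ballI impI)
  fix a b :: nat assume ab: "a \<in> {1..3}" "b \<in> {1..3}" "a ~= b"
  obtain L where L: "lists2 (set q) L"
    "\<forall>c. proper E (insert z (insert z (set q))) c --> (\<forall>z\<in>set q. c z \<in> L z) --> ~ (c z = b & c z = b)"
    using kill_one[OF assms(1), of b b] assms(2,3) ab by force
  define L' where "L' = L(z := {a, b})"
  have "lists2 (insert z (set q)) L'" unfolding L'_def by (rule lists2_upd[OF L(1) ab])
  moreover have "c z = a" if c: "col (insert z (set q)) E L' c" for c
  proof -
    have "~ (c z = b & c z = b)" by (rule kill_extend[OF L(2) c]) (use assms(2) in "auto simp: L'_def")
    moreover have "c z \<in> {a, b}" using c unfolding col_def by (simp add: L'_def)
    ultimately show ?thesis by blast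
  qed
  ultimately show "\<exists>L. lists2 (insert z (set q)) L & L z = {a, b} & (\<forall>c. col (insert z (set q)) E L c --> c z = a)"
    by (intro exI[of _ L']) (simp add: L'_def)
qed simp

lemma force_step:
  assumes "force E U x" "y ~: U" "E x y" shows "force E (insert y U) y"
  unfolding force_def
proof (intro conjI ballI impI)
  fix a b :: nat assume ab: "a \<in> {1..3}" "b \<in> {1..3}" "a ~= b"
  have xU: "x \<in> U" using assms(1) by (simp add: force_def)
  obtain L where L: "lists2 U L" "\<forall>c. col U E L c --> c x = b" using assms(1) ab unfolding force_def by metis
  define L' where "L' = L(y := {a, b})"
  have e: "L' z = L z" if "z \<in> U" for z using that assms(2) by (auto simp: L'_def)
  have "lists2 (insert y U) L'" unfolding L'_def by (rule lists2_upd[OF L(1) ab])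
  moreover have "c y = a" if c: "col (insert y U) E L' c" for c
  proof -
    have "col U E L c" using c e unfolding col_def by auto
    then have "c x = b" using L(2) by blast
    moreover have "c y \<in> {a, b}" "c x ~= c y" using c assms(3) xU unfolding col_def by (auto simp: L'_def)
    ultimately show ?thesis by auto
  qed
  ultimately show "\<exists>L. lists2 (insert y U) L & L y = {a, b} & (\<forall>c. col (insert y U) E L c --> c y = a)"
    by (intro exI[of _ L']) (simp add: L'_def)
qed simp

lemma force_walk:
  "force E U x ==> walk E x q y ==> distinct (q @ [y]) ==> set (q @ [y]) \<inter> U = {} ==> force E (insert y (set q \<union> U)) y"
proof (induction q arbitrary: x U)
  case Nil
  then show ?case using force_step[of E U x y] by simp
next
  case (Cons z q)
  have "force E (insert z U) z" using force_step[of E U x z] Cons.prems by simp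
  from Cons.IH[OF this] have "force E (insert y (set q \<union> insert z U)) y" using Cons.prems by auto
  then show ?case by simp
qed

text \<open>Both parts give \<open>x\<close> the list {1, 2}, but one forces color 1 and the other
  color 2. Together with \<open>force_cycle\<close> and \<open>force_walk\<close> this excludes two
  cycles that share one vertex or are linked by a path.\<close>

lemma force_join:
  assumes "force E U x" "force E U' x" "U \<inter> U' = {x}" shows "bad E (U \<union> U')"
proof -
  obtain L where L: "lists2 U L" "L x = {1, 2}" "\<forall>c. col U E L c --> c x = 1"
    using assms(1)[unfolded force_def, THEN conjunct2, THEN bspec[of _ _ 1], THEN bspec[of _ _ 2]] by auto
  obtain L' where L': "lists2 U' L'" "L' x = {1, 2}" "\<forall>c. col U' E L' c --> c x = 2"
    using assms(2)[unfolded force_def, THEN conjunct2, THEN bspec[of _ _ 2], THEN bspec[of _ _ 1]]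
    by (auto simp: insert_commute)
  define M where "M z = (if z \<in> U then L z else L' z)" for z
  have M': "M z = L' z" if "z \<in> U'" for z
  proof (cases "z \<in> U")
    case True
    then have "z = x" using that assms(3) by blast
    then show ?thesis using L(2) L'(2) True by (simp add: M_def)
  qed (simp add: M_def)
  have M: "M z = L z" if "z \<in> U" for z using that by (simp add: M_def)
  have "lists2 (U \<union> U') M" unfolding M_def by (rule lists_on_if[OF L(1)]) (rule lists_on_subset[OF L'(1)], blast)
  moreover have False if c: "col (U \<union> U') E M c" for c
  proof -
    have "col U E L c" "col U' E L' c" by (rule col_mono[OF c], simp, rule M M', assumption)+
    then have "c x = 1" "c x = 2" using L(3) L'(3) by blast+
    then show False by simp
  qed
  ultimately show ?thesis by (rule badI)
qed

section \<open>Structure of the cores that are choosable from lists of size 2\<close>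

definition deg2 :: "('a => 'a => bool) => 'a => bool" where
  "deg2 E x <-> (\<exists>y1 y2. y1 ~= y2 & (\<forall>y. E x y <-> y = y1 | y = y2))"

lemma cycle_rotate:
  assumes "walk E z q z" "distinct (z # q)" "t \<in> insert z (set q)"
  shows "\<exists>q'. walk E t q' t & distinct (t # q') & insert t (set q') = insert z (set q) & length q' = length q"
proof (cases "t = z")
  case False
  then obtain a b where q: "q = a @ t # b" using assms(3) by (metis insertE split_list)
  show ?thesis
    by (rule exI[of _ "b @ z # a"]) (use assms(1,2) in "auto simp: q walk_append")
qed (use assms in blast)

lemma walk_split_last: "walk E x q y ==> E (last (x # q)) y"
  by (induction q arbitrary: x) auto

lemma walk_snoc: "walk E x q y ==> E y z ==> walk E x (q @ [y]) z"
  by (simp add: walk_append)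

locale core_graph =
  fixes V :: "'a set" and E :: "'a => 'a => bool" and s :: "'a => bool"
  assumes fin: "finite V" and ed: "!!x y. E x y ==> x \<in> V & y \<in> V & E y x" and bip: "!!x y. E x y ==> s x ~= s y"
    and mind: "!!x y. E x y ==> \<exists>z. z ~= y & E x z"
begin

lemma sym: "E x y ==> E y x" using ed by blast
lemma irrefl: "~ E x x" using bip by blast

lemma walk_V: "walk E x q y ==> insert x (insert y (set q)) \<subseteq> V"
  by (induction q arbitrary: x) (auto dest: ed)

lemma parity: "walk E x q y ==> (s x = s y) = odd (length q)"
  by (rule walk_parity[OF bip])

lemma wrev: "walk E x q y ==> walk E y (rev q) x"
  by (rule walk_rev[OF sym])

lemma conn_sym: "E^** x y ==> E^** y x"
  using sym by (metis sympD sympI symp_rtranclp)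

lemma walk_conn: "walk E x q y ==> z \<in> set q ==> E^** x z" and walk_conn_end: "walk E x q y ==> E^** x y"
  by (induction q arbitrary: x) (auto intro: converse_rtranclp_into_rtranclp)

lemma closed_conn: "E^** x y ==> x \<in> S ==> (!!a b. a \<in> S ==> E a b ==> b \<in> S) ==> y \<in> S"
  by (induction rule: rtranclp_induct) auto

text \<open>A longest path that leaves \<open>S\<close> returns to \<open>S\<close> or closes a cycle.\<close>

lemma ear_or_cycle:
  assumes t: "E t y" "y ~: S" "t \<in> S"
  shows "(\<exists>q z. walk E t q z & q ~= [] & hd q = y & distinct q & set q \<inter> S = {} & z \<in> S & z ~= t) |
    (\<exists>q. walk E t q t & length q \<ge> 2 & distinct q & set q \<inter> S = {}) |
    (\<exists>q1 z q2. walk E t q1 z & walk E z q2 z & length q2 \<ge> 2 & distinct (q1 @ z # q2) & set (q1 @ z # q2) \<inter> S = {})"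
proof -
  define P where "P q <-> q ~= [] & hd q = y & walk E t (butlast q) (last q) & distinct q & set q \<inter> S = {}" for q
  have "P [y]" using t by (simp add: P_def)
  moreover have "length q \<le> card V" if "P q" for q
  proof -
    have "q ~= []" using that by (simp add: P_def)
    then obtain p w where q: "q = p @ [w]" by (cases q rule: rev_cases) auto
    then have "set q \<subseteq> V" using that walk_V[of t p w] by (simp add: P_def)
    then show ?thesis using that fin card_mono distinct_card unfolding P_def by metis
  qed
  ultimately obtain q where q: "P q" "!!q'. P q' ==> length q' \<le> length q"
    using ex_has_greatest_nat[of P "[y]" length "Suc (card V)"] by (auto simp: less_Suc_eq_le)
  obtain p w where qw: "q = p @ [w]" using q(1) by (metis P_def append_butlast_last_id)
  have w: "walk E t p w" "distinct (p @ [w])" "set (p @ [w]) \<inter> S = {}" "hd (p @ [w]) = y" using q(1) by (simp_all add: P_def qw)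
  have "E w (last (t # p))" using walk_split_last[OF w(1)] sym by blast
  then obtain z where z: "E w z" "z ~= last (t # p)" using mind by blast
  have wz: "walk E t (p @ [w]) z" using walk_snoc[OF w(1) z(1)] .
  show ?thesis
  proof (cases "z \<in> S")
    case True
    show ?thesis
    proof (cases "z = t")
      case False
      then show ?thesis using True wz w by blast
    next
      case zt: True
      then have "p ~= []" using z(2) by auto
      then have "length (p @ [w]) \<ge> 2" by (cases p) auto
      then show ?thesis using zt wz w by blast
    qed
  next
    case False
    have "z \<in> set p"
    proof (rule ccontr)
      assume "z ~: set p"
      then have "P (q @ [z])" using w wz False z(1) irrefl by (auto simp: P_def qw butlast_append hd_append)
      then show False using q(2) by fastforce
    qed
    then obtain q1 q2 where p: "p = q1 @ z # q2" by (metis split_list)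
    then have "q2 ~= []" using z(2) by auto
    then have "length (q2 @ [w]) \<ge> 2" by (cases q2) auto
    moreover have "walk E t q1 z" "walk E z (q2 @ [w]) z" using wz by (simp_all add: p walk_append)
    moreover have "distinct (q1 @ z # (q2 @ [w]))" "set (q1 @ z # (q2 @ [w])) \<inter> S = {}" using w by (simp_all add: p)
    ultimately show ?thesis by blast
  qed
qed

lemma ex_cycle:
  assumes x: "E x x'"
  shows "\<exists>z q. walk E z q z & length q \<ge> 2 & distinct (z # q) & E^** x z"
proof -
  have "x' ~: {x}" using x irrefl by blast
  from ear_or_cycle[OF x this] consider
    q where "walk E x q x" "length q \<ge> 2" "distinct q" "set q \<inter> {x} = {}"
    | q1 z q2 where "walk E x q1 z" "walk E z q2 z" "length q2 \<ge> 2" "distinct (q1 @ z # q2)" by blast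
  then show ?thesis
  proof cases
    case 1
    then show ?thesis by (intro exI[of _ x] exI[of _ q]) simp
  next
    case 2
    then show ?thesis using walk_conn_end[OF 2(1)] by (intro exI[of _ z] exI[of _ q2]) simp
  qed
qed

end

locale choosable_core = core_graph +
  assumes good: "fch 3 (%_. 2) V E"
begin

lemma not_bad: "bad E U ==> U \<subseteq> V ==> False"
  using bad_mono[where k = 3] good by blast

lemma force_join': "force E U x ==> force E U' x ==> U \<inter> U' = {x} ==> U \<subseteq> V ==> U' \<subseteq> V ==> False"
  using force_join not_bad by (metis Un_least)

text \<open>If a subgraph within \<open>S\<close> already forces \<open>t\<close>, both alternatives
  of \<open>ear_or_cycle\<close> that close a cycle outside \<open>S\<close> yield a second forcing
  subgraph and contradict \<open>force_join'\<close>; only the return to another vertex of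
  \<open>S\<close> is left.\<close>

lemma ear:
  assumes t: "E t y" "y ~: S" and f: "force E S' t" "S' \<subseteq> S" "S' \<subseteq> V"
  shows "\<exists>q z. walk E t q z & q ~= [] & hd q = y & distinct q & set q \<inter> S = {} & z \<in> S & z ~= t"
proof (rule ccontr)
  assume neg: "~ ?thesis"
  have tS: "t \<in> S'" using f(1) by (simp add: force_def)
  then have "t \<in> S" using f(2) by blast
  from ear_or_cycle[OF t this] neg consider
    q where "walk E t q t" "length q \<ge> 2" "distinct q" "set q \<inter> S = {}"
    | q1 z q2 where "walk E t q1 z" "walk E z q2 z" "length q2 \<ge> 2" "distinct (q1 @ z # q2)" "set (q1 @ z # q2) \<inter> S = {}"
    by blast
  then show False
  proof cases
    case 1
    then have d: "distinct (t # q)" using \<open>t \<in> S\<close> by auto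
    have "force E (insert t (set q)) t" using force_cycle[OF 1(1) d 1(2)] .
    moreover have "S' \<inter> insert t (set q) = {t}" using 1(4) f(2) tS by blast
    moreover have "insert t (set q) \<subseteq> V" using walk_V[OF 1(1)] by simp
    ultimately show False using force_join'[OF f(1) _ _ f(3)] by blast
  next
    case 2
    have "force E (insert z (set q1 \<union> S')) z"
      by (rule force_walk[OF f(1) 2(1)]) (use 2(4,5) f(2) in auto)
    moreover have "force E (insert z (set q2)) z" using force_cycle[OF 2(2) _ 2(3)] 2(4) by simp
    moreover have "insert z (set q1 \<union> S') \<inter> insert z (set q2) = {z}" using 2(4,5) f(2) by auto
    ultimately show False
      using force_join'[of "insert z (set q1 \<union> S')" z "insert z (set q2)"] walk_V[OF 2(1)] walk_V[OF 2(2)] f(3) by simp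
  qed
qed

lemma theta:
  assumes w: "walk E u q1 v" "walk E u q2 v" "walk E u q3 v"
    and d: "distinct q1" "distinct q2" "u ~= v" "set q1 \<inter> set q2 = {}" "set q1 \<inter> set q3 = {}" "set q2 \<inter> set q3 = {}"
    "u ~: set q1 \<union> set q2" "v ~: set q1 \<union> set q2"
  shows "length q1 < 2 | length q2 < 2"
proof (rule ccontr)
  assume "~ ?thesis"
  then have "bad E ({u, v} \<union> set q1 \<union> set q2 \<union> set q3)" by (intro theta_bad[OF w _ _ d]) auto
  moreover have "{u, v} \<union> set q1 \<union> set q2 \<union> set q3 \<subseteq> V" using walk_V[OF w(1)] walk_V[OF w(2)] walk_V[OF w(3)] by simp
  ultimately show False by (rule not_bad)
qed

text \<open>The edge makes \<open>u\<close> and \<open>v\<close> lie on different sides, so the two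
  paths have an even, hence at least two, number of interior vertices; the edge is the third path
  for \<open>theta\<close>.\<close>

lemma edge_theta:
  assumes w: "walk E u q1 v" "walk E u q2 v" "E u v" and d: "q1 ~= []" "q2 ~= []" "distinct q1" "distinct q2"
    "set q1 \<inter> set q2 = {}" "u ~: set q1 \<union> set q2" "v ~: set q1 \<union> set q2"
  shows False
proof -
  have "u ~= v" using w(3) irrefl by blast
  then have "length q1 < 2 | length q2 < 2" using theta[OF w(1,2), of "[]"] w(3) d by simp
  moreover have "even (length q1)" "even (length q2)" using parity[OF w(1)] parity[OF w(2)] bip[OF w(3)] by auto
  moreover have "length q1 ~= 0" "length q2 ~= 0" using d by auto
  ultimately show False by (metis One_nat_def less_2_cases odd_one)
qed

text \<open>At most one of the three paths is long, so two of them have a single interior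
  vertex.\<close>

lemma theta_cycle4:
  assumes w: "walk E u q1 v" "walk E u q2 v" "walk E u q3 v"
    and d: "distinct q1" "distinct q2" "distinct q3" "u ~= v" "set q1 \<inter> set q2 = {}" "set q1 \<inter> set q3 = {}" "set q2 \<inter> set q3 = {}"
    "u ~: set q1 \<union> set q2 \<union> set q3" "v ~: set q1 \<union> set q2 \<union> set q3" "q1 ~= []" "q2 ~= []"
  shows "\<exists>w1 w2. w1 ~= w2 & E u w1 & E w1 v & E u w2 & E w2 v"
proof -
  have q3: "q3 ~= []"
  proof
    assume "q3 = []"
    then show False using edge_theta[OF w(1,2)] w(3) d by simp
  qed
  have l: "length q1 < 2 | length q2 < 2" "length q1 < 2 | length q3 < 2" "length q2 < 2 | length q3 < 2"
    using theta[OF w(1,2,3)] theta[OF w(1,3,2)] theta[OF w(2,3,1)] d by (simp_all add: Int_commute)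
  have one: "\<exists>w. q = [w] & E u w & E w v" if "walk E u q v" "length q < 2" "q ~= []" for q
    using that by (cases q) auto
  show ?thesis
  proof (cases "length q1 < 2")
    case True
    show ?thesis
    proof (cases "length q2 < 2")
      case T: True
      show ?thesis using one[OF w(1) True d(10)] one[OF w(2) T d(11)] d(5) by (metis disjoint_iff list.set_intros(1))
    next
      case False
      then have "length q3 < 2" using l by blast
      from one[OF w(3) this q3] one[OF w(1) True d(10)] show ?thesis using d(6) by (metis disjoint_iff list.set_intros(1))
    qed
  next
    case False
    then have "length q2 < 2" "length q3 < 2" using l by blast+
    from one[OF w(2) this(1) d(11)] one[OF w(3) this(2) q3] show ?thesis using d(7) by (metis disjoint_iff list.set_intros(1))
  qed
qed

definition sq :: "'a => 'a => 'a => 'a => bool" where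
  "sq u v w1 w2 <-> u ~= v & w1 ~= w2 & E u w1 & E w1 v & E u w2 & E w2 v"

lemma sq_sym: "sq u v w1 w2 ==> sq v u w1 w2" "sq u v w1 w2 ==> sq u v w2 w1" "sq u v w1 w2 ==> sq w1 w2 u v"
  using sym by (auto simp: sq_def)

lemma sq_distinct: "sq u v w1 w2 ==> distinct [u, v, w1, w2]"
  using irrefl unfolding sq_def by auto

lemma sq_force: "sq u v w1 w2 ==> force E {u, v, w1, w2} u"
  using force_cycle[of E u "[w1, v, w2]"] sq_distinct[of u v w1 w2] sym
  by (auto simp: sq_def insert_commute)

text \<open>A cycle of the component either has an edge that leaves it, which extends to an ear, or
  is spanning; in the latter case \<open>x\<close> has a chord, as its degree exceeds 2. Either way
  three paths join two vertices of the cycle.\<close>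

lemma ex_sq:
  assumes x: "E x x'" "~ deg2 E x"
  shows "\<exists>u v w1 w2. sq u v w1 w2 & E^** x u"
proof -
  obtain z q where z: "walk E z q z" "length q \<ge> 2" "distinct (z # q)" "E^** x z"
    using ex_cycle[OF x(1)] by blast
  let ?C = "insert z (set q)"
  have CV: "?C \<subseteq> V" using walk_V[OF z(1)] by simp
  have cC: "E^** x t" if "t \<in> ?C" for t using that z(4) walk_conn[OF z(1)] by (metis insertE rtranclp_trans)
  have fin: ?thesis if th: "t \<in> ?C" "walk E t q' t" "distinct (t # q')" "q' = a @ y # b" "a ~= []" "b ~= []"
    "walk E t p y" "set p \<inter> set (t # q') = {}" "distinct p" for t q' a y b p
  proof -
    have w: "walk E t a y" "walk E t (rev b) y" using th(2) wrev[of y b t] by (simp_all add: th(4) walk_append)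
    have "\<exists>w1 w2. w1 ~= w2 & E t w1 & E w1 y & E t w2 & E w2 y"
      by (rule theta_cycle4[OF w th(7)]) (use th in auto)
    moreover have "t ~= y" using th(3,4) by auto
    ultimately show ?thesis using cC[OF th(1)] unfolding sq_def by blast
  qed
  show ?thesis
  proof (cases "\<exists>t\<in>?C. \<exists>y. E t y & y ~: ?C")
    case True
    then obtain t y where t: "t \<in> ?C" "E t y" "y ~: ?C" by blast
    obtain q' where q': "walk E t q' t" "distinct (t # q')" "insert t (set q') = ?C" "length q' = length q"
      using cycle_rotate[OF z(1,3) t(1)] by blast
    have "force E ?C t" using force_cycle[OF q'(1,2)] q'(3,4) z(2) by simp
    from ear[OF t(2,3) this order_refl CV] obtain p y' where p: "walk E t p y'" "p ~= []" "distinct p" "set p \<inter> ?C = {}" "y' \<in> ?C" "y' ~= t"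
      by blast
    then have "y' \<in> set q'" using q'(3) by blast
    then obtain a b where ab: "q' = a @ y' # b" by (metis split_list)
    have w: "walk E t a y'" "walk E t (rev b) y'" using q'(1) wrev[of y' b t] by (simp_all add: ab walk_append)
    have "set p \<inter> insert t (set q') = {}" using p(4) q'(3) by simp
    then have pd: "set p \<inter> insert t (set a \<union> insert y' (set b)) = {}" by (simp add: ab)
    have dq: "distinct (t # a @ y' # b)" using q'(2) by (simp add: ab)
    show ?thesis
    proof (cases "a = [] | b = []")
      case True
      then have ty: "E t y'" using w by auto
      have "a ~= [] | b ~= []" using q'(4) z(2) ab by auto
      then show ?thesis
      proof
        assume "a ~= []"
        then show ?thesis using edge_theta[OF w(1) p(1) ty _ p(2)] p(3) pd dq by (auto simp: Int_commute Int_Un_distrib)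
      next
        assume "b ~= []"
        then show ?thesis using edge_theta[OF w(2) p(1) ty _ p(2)] p(3) pd dq by (auto simp: Int_commute Int_Un_distrib)
      qed
    next
      case False
      then show ?thesis using fin[OF t(1) q'(1,2) ab _ _ p(1) _ p(3)] pd ab by auto
    qed
  next
    case False
    then have "x \<in> ?C" using closed_conn[OF conn_sym[OF z(4)], of ?C] by blast
    then obtain q' where q': "walk E x q' x" "distinct (x # q')" "insert x (set q') = ?C" "length q' = length q"
      using cycle_rotate[OF z(1,3)] by blast
    obtain h q'' where h: "q' = h # q''" using q'(4) z(2) by (cases q') auto
    then have "q'' ~= []" using q'(4) z(2) by auto
    then have "E x h" "E x (last q')" "h ~= last q'" using q'(1,2) h walk_split_last[OF q'(1)] sym by auto
    then obtain y where y: "E x y" "y ~= h" "y ~= last q'" using x(2) unfolding deg2_def by metis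
    have "y \<in> ?C" using False \<open>x \<in> ?C\<close> y(1) by blast
    moreover have "y ~= x" using y(1) irrefl by blast
    ultimately have "y \<in> set q'" using q'(3) by blast
    then obtain a b where ab: "q' = a @ y # b" by (metis split_list)
    have "a ~= []" "b ~= []" using y(2,3) ab h(1) by auto
    then show ?thesis using fin[OF \<open>x \<in> ?C\<close> q'(1,2) ab, of "[]"] y(1) by simp
  qed
qed

end

definition deg3 :: "('v => 'v => bool) => 'v => bool" where
  "deg3 E x <-> (\<exists>y1 y2 y3. y1 ~= y2 & y1 ~= y3 & y2 ~= y3 & (\<forall>y. E x y <-> y = y1 | y = y2 | y = y3))"

lemma deg2I: "y1 ~= y2 ==> E x y1 ==> E x y2 ==> (!!y. E x y ==> y = y1 | y = y2) ==> deg2 E x"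
  unfolding deg2_def by metis

lemma deg2_nbrs: "deg2 E x ==> E x y1 ==> E x y2 ==> y1 ~= y2 ==> E x y ==> y = y1 | y = y2"
  unfolding deg2_def by metis

lemma walk_segment: "walk E u q v ==> u # q @ [v] = A @ t # B @ z # D ==> walk E t B z"
proof -
  assume w: "walk E u q v" and R: "u # q @ [v] = A @ t # B @ z # D"
  show "walk E t B z"
  proof (cases A)
    case Nil
    then show ?thesis using w R by (cases D rule: rev_cases) (auto simp: walk_append)
  next
    case (Cons a A')
    then show ?thesis using w R by (cases D rule: rev_cases) (auto simp: walk_append)
  qed
qed

context choosable_core
begin

text \<open>A third edge at \<open>w1\<close> would extend to a path back to the 4-cycle or to
  \<open>p\<close>. Wherever it ends, \<open>w1\<close> and one of its neighbors \<open>u\<close>,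
  \<open>v\<close> are then joined by an edge and two disjoint longer paths, which
  \<open>edge_theta\<close> excludes.\<close>

lemma middle_deg2:
  assumes sq: "sq u v w1 w2" and p: "walk E u p v" "p ~= []" "distinct p" "set p \<inter> {u, v, w1, w2} = {}"
  shows "deg2 E w1"
proof (rule ccontr)
  assume neg: "~ deg2 E w1"
  let ?S = "{u, v, w1, w2} \<union> set p"
  note d = sq_distinct[OF sq]
  have e: "E u w1" "E w1 v" "E u w2" "E w2 v" "E w1 u" "E v w1" "E w2 u" "E v w2" using sq sym by (auto simp: sq_def)
  have key: False if q: "walk E w1 q z" "distinct q" "set q \<inter> ?S = {}" "z \<in> ?S" "z ~= w1" "q = [] --> z ~: {u, v}" for q z
  proof -
    consider "z = u" | "z = v" | "z = w2" | "z \<in> set p" using q(4,5) by auto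
    then show False
    proof cases
      case 1
      show False by (rule edge_theta[OF q(1)[unfolded 1] _ e(5), of "[v, w2]"]) (use q d e 1 in auto)
    next
      case 2
      show False by (rule edge_theta[OF q(1)[unfolded 2] _ e(2), of "[u, w2]"]) (use q d e 2 in auto)
    next
      case 3
      have "walk E w1 (q @ [w2]) u" using q(1) 3 e by (simp add: walk_append)
      moreover have "walk E w1 (v # rev p) u" using e wrev[OF p(1)] by simp
      ultimately show False by (rule edge_theta[OF _ _ e(5)]) (use q(2,3) d p in auto)
    next
      case 4
      then obtain a b where ab: "p = a @ z # b" by (metis split_list)
      then have "walk E u a z" using p(1) by (simp add: walk_append)
      then have "walk E w1 (q @ z # rev a) u" using q(1) wrev by (simp add: walk_append)
      moreover have "walk E w1 [v, w2] u" using e by simp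
      ultimately show False by (rule edge_theta[OF _ _ e(5)]) (use q(2,3) d p ab in auto)
    qed
  qed
  obtain y where y: "E w1 y" "y ~= u" "y ~= v" using neg e d unfolding deg2_def by (metis distinct_length_2_or_more)
  show False
  proof (cases "y \<in> ?S")
    case True
    then show False using key[of "[]" y] y irrefl by auto
  next
    case False
    have "force E {w1, w2, u, v} w1" using sq_force[OF sq_sym(3)[OF sq]] .
    moreover have "{w1, w2, u, v} \<subseteq> V" using e ed by blast
    ultimately show False using ear[OF y(1) False, of "{w1, w2, u, v}"] key by blast
  qed
qed

text \<open>Some edge leaves the 4-cycle, since otherwise the component would be that cycle and have
  no vertex such as \<open>x\<close>. The resulting ear cannot end at a neighbor of its starting
  vertex by \<open>edge_theta\<close>, so it ends at the opposite vertex.\<close>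

lemma ex_route:
  assumes x: "~ deg2 E x" and sq: "sq u v w1 w2" and xu: "E^** x u"
  shows "\<exists>u v w1 w2 p. sq u v w1 w2 & E^** x u & walk E u p v & p ~= [] & distinct p & set p \<inter> {u, v, w1, w2} = {}"
proof -
  let ?C = "{u, v, w1, w2}"
  have e: "E u w1" "E w1 v" "E u w2" "E w2 v" "E w1 u" "E v w1" "E w2 u" "E v w2" using sq sym by (auto simp: sq_def)
  have CV: "?C \<subseteq> V" using e ed by blast
  have cC: "E^** x t" if "t \<in> ?C" for t
    using that xu e by (auto intro: rtranclp.rtrancl_into_rtrancl)
  \<comment> \<open>Stated for a renamed 4-cycle \<open>a b c d\<close>, because the edge may leave
    at any of the four vertices.\<close>
  have go: ?thesis if a: "sq a b c d" "{a, b, c, d} = ?C" "E a y" "y ~: ?C" for a b c d y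
  proof -
    have f: "force E ?C a" using sq_force[OF a(1)] a(2) by simp
    obtain p z where p: "walk E a p z" "p ~= []" "distinct p" "set p \<inter> ?C = {}" "z \<in> ?C" "z ~= a"
      using ear[OF a(3,4) f order_refl CV] by blast
    have p': "set p \<inter> {a, b, c, d} = {}" "z = b | z = c | z = d" using p a(2) by auto
    have "z ~= c"
    proof
      assume z: "z = c"
      show False by (rule edge_theta[OF p(1)[unfolded z], of "[d, b]"]) (use p p' a(1) sq_distinct[OF a(1)] sym in "auto simp: sq_def")
    qed
    moreover have "z ~= d"
    proof
      assume z: "z = d"
      show False by (rule edge_theta[OF p(1)[unfolded z], of "[c, b]"]) (use p p' a(1) sq_distinct[OF a(1)] sym in "auto simp: sq_def")
    qed
    ultimately have "walk E a p b" using p p' by blast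
    moreover have "E^** x a" using cC a(2) by blast
    ultimately show ?thesis using a(1) p p' by blast
  qed
  have closed: "deg2 E a" if a: "sq a b c d" "{a, b, c, d} = ?C" "!!y. E a y ==> y \<in> ?C" for a b c d
  proof -
    have e: "E a c" "E a d" "c ~= d" using a(1) by (auto simp: sq_def)
    have "s a = s b" using bip a(1) unfolding sq_def by blast
    then have "~ E a b" using bip by blast
    moreover have "y \<in> {a, b, c, d}" if "E a y" for y using a(3)[OF that] a(2) by simp
    ultimately have "E a y <-> y = c | y = d" for y using e irrefl by blast
    then show ?thesis unfolding deg2_def using e(3) by blast
  qed
  note ss = sq sq_sym(1)[OF sq] sq_sym(3)[OF sq] sq_sym(1)[OF sq_sym(3)[OF sq]]
  show ?thesis
  proof (rule ccontr)
    assume neg: "~ ?thesis"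
    have ge: "y \<in> ?C" if "sq a b c d" "{a, b, c, d} = ?C" "E a y" for a b c d y
      using go[OF that] neg by blast
    have perm: "{v, u, w1, w2} = ?C" "{w1, w2, u, v} = ?C" "{w2, w1, u, v} = ?C" by auto
    have c: "y \<in> ?C" if "t \<in> ?C" "E t y" for t y
    proof -
      have "t = u | t = v | t = w1 | t = w2" using that(1) by simp
      then show ?thesis
        using ge[OF ss(1) refl, of y] ge[OF ss(2) perm(1), of y] ge[OF ss(3) perm(2), of y] ge[OF ss(4) perm(3), of y] that(2)
        by blast
    qed
    then have "x \<in> ?C" using closed_conn[OF conn_sym[OF xu], of ?C] by blast
    then have "x = u | x = v | x = w1 | x = w2" by simp
    moreover have "deg2 E u" by (rule closed[OF ss(1) refl]) (rule c[of u], simp_all)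
    moreover have "deg2 E v" by (rule closed[OF ss(2) perm(1)]) (rule c[of v], simp_all)
    moreover have "deg2 E w1" by (rule closed[OF ss(3) perm(2)]) (rule c[of w1], simp_all)
    moreover have "deg2 E w2" by (rule closed[OF ss(4) perm(3)]) (rule c[of w2], simp_all)
    ultimately show False using x by blast
  qed
qed

text \<open>A neighbor \<open>y\<close> of \<open>u\<close> that is not adjacent to \<open>v\<close>
  starts an ear \<open>q\<close> to \<open>v\<close> with at least two interior vertices. The
  4-cycle and this ear are shown to be the whole component: anything attached to them would create a
  forbidden configuration.\<close>

lemma long_ear:
  assumes sq: "sq u v w1 w2" and cd: "!!w. E u w ==> E w v ==> deg2 E w" and y: "E u y" "~ E y v"
  shows "deg3 E u & deg3 E v & (\<forall>t. E^** u t --> t = u | t = v | deg2 E t)"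
proof -
  let ?C = "{u, v, w1, w2}"
  note d = sq_distinct[OF sq]
  have e: "E u w1" "E w1 v" "E u w2" "E w2 v" "E w1 u" "E v w1" "E w2 u" "E v w2" using sq sym by (auto simp: sq_def)
  have CV: "?C \<subseteq> V" using e ed by blast
  have f: "force E ?C u" "force E ?C v" using sq_force[OF sq] sq_force[OF sq_sym(1)[OF sq]] by (simp_all add: insert_commute)
  have suv: "s u = s v" using bip e by blast
  have uv: "~ E u v" using suv bip by blast
  have nw: "t = u | t = v" if "E t w1 | E t w2" for t
    using that deg2_nbrs[OF cd[OF e(1,2)] e(5,2)] deg2_nbrs[OF cd[OF e(3,4)] e(7,4)] d sym by auto
  have "y ~: ?C" using y uv e irrefl by blast
  from ear[OF y(1) this f(1) order_refl CV] obtain q z where q0: "walk E u q z" "q ~= []" "hd q = y" "distinct q"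
    "set q \<inter> ?C = {}" "z \<in> ?C" "z ~= u" by blast
  have "last q \<in> set q" "E (last q) z" using q0(1,2) walk_split_last[OF q0(1)] by simp_all
  then have zv: "z = v" using q0(5-7) nw by blast
  have q: "walk E u q v" using q0(1) zv by simp
  have lq: "2 \<le> length q"
  proof (rule ccontr)
    assume "~ ?thesis"
    then have "q = [y]" using q0(2,3) by (cases q; cases "tl q") auto
    then show False using q y(2) by simp
  qed
  let ?R = "u # q @ [v]" and ?T = "?C \<union> set q"
  have dR: "distinct ?R" using q0(4,5) d by auto
  have wR: "w1 ~: set ?R" "w2 ~: set ?R" using q0(5) d by auto
  have qV: "set q \<subseteq> V" using walk_V[OF q] by simp
  \<comment> \<open>A third common neighbor lies off the ear and gives the configuration of
    \<open>theta4_bad\<close>, or lies on it and, having degree 2, would be the whole ear.\<close>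
  have third: "w = w1 | w = w2" if w: "E u w" "E w v" for w
  proof (rule ccontr)
    assume n: "~ ?thesis"
    have wn: "t = u | t = v" if "E w t" for t using deg2_nbrs[OF cd[OF w] sym[OF w(1)] w(2) _ that] d by simp
    show False
    proof (cases "w \<in> set q")
      case True
      then obtain a b where ab: "q = a @ w # b" by (metis split_list)
      have s1: "walk E u a w" "walk E w b v" using q ab by (simp_all add: walk_append)
      have "a = []"
      proof (rule ccontr)
        assume "a ~= []"
        then have "last a \<in> set q" "E w (last a)" using walk_split_last[OF s1(1)] sym ab by auto
        then show False using wn q0(5) by blast
      qed
      moreover have "b = []"
      proof (rule ccontr)
        assume "b ~= []"
        then have "hd b \<in> set q" "E w (hd b)" using s1(2) ab by (cases b; auto)+
        then show False using wn q0(5) by blast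
      qed
      ultimately show False using lq ab by simp
    next
      case False
      have "distinct [u, v, w1, w2, w]" using d n w irrefl uv by auto
      moreover have "set q \<inter> {u, v, w1, w2, w} = {}" using q0(5) False by auto
      ultimately have "bad E ({u, v, w1, w2, w} \<union> set q)" using theta4_bad[OF e(1-4) w q lq _ q0(4)] by blast
      then show False using not_bad CV qV ed[OF w(1)] by (metis Un_least insert_subset)
    qed
  qed
  \<comment> \<open>The shortcut and the segment \<open>B\<close> form a cycle. If it contains
    exactly one of \<open>u\<close> and \<open>v\<close>, it meets the 4-cycle in that vertex only;
    if it contains neither, the piece of the route from \<open>u\<close> leads to it. Both cases
    contradict \<open>force_join'\<close>.\<close>
  have shortcut: "A = [] & D = []" if R: "?R = A @ t # B @ z # D" and q': "walk E t q' z" "distinct q'" "set q' \<inter> ?T = {}"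
    and ne: "q' ~= [] | B ~= []" for A t B z D q'
  proof (rule ccontr)
    assume n: "~ (A = [] & D = [])"
    let ?Q = "B @ z # rev q'"
    let ?Y = "insert t (set ?Q)"
    have dR': "distinct (A @ t # B @ z # D)" using dR R by simp
    have sR: "set (A @ t # B @ z # D) = insert u (insert v (set q))" unfolding R[symmetric] by auto
    have w: "walk E t ?Q t" using walk_segment[OF q R] wrev[OF q'(1)] by (simp add: walk_append)
    have sT: "set q' \<inter> set (A @ t # B @ z # D) = {}" using q'(3) unfolding sR by blast
    have dQ: "distinct (t # ?Q)" using dR' q'(2) sT by auto
    have lQ: "length ?Q \<ge> 2" using ne by (cases q'; cases B; simp)
    have YV: "?Y \<subseteq> V" using walk_V[OF w] by simp
    have fY: "force E ?Y r" if r: "r \<in> ?Y" for r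
    proof -
      obtain Q' where Q': "walk E r Q' r" "distinct (r # Q')" "insert r (set Q') = ?Y" "length Q' = length ?Q"
        using cycle_rotate[OF w dQ r] by blast
      show ?thesis using force_cycle[OF Q'(1,2)] Q'(3,4) lQ by simp
    qed
    have wY: "w1 ~: ?Y" "w2 ~: ?Y" using q'(3) wR unfolding R by auto
    have uA: "A = [] & t = u | (\<exists>A'. A = u # A' & u ~: ?Y)"
    proof (cases A)
      case (Cons a A')
      then have "a = u" using R by simp
      then show ?thesis using Cons dR' q'(3) by auto
    qed (use R in simp)
    have vD: "D = [] & z = v | D ~= [] & v ~: ?Y"
    proof (cases D rule: rev_cases)
      case (snoc D' a)
      then have "A @ t # B @ z # D' @ [a] = u # q @ [v]" using R by simp
      then have "last (A @ t # B @ z # D' @ [a]) = last (u # q @ [v])" by simp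
      then have "a = v" by simp
      then show ?thesis using snoc dR' q'(3) by auto
    next
      case Nil
      then have "last (A @ t # B @ [z]) = last (u # q @ [v])" using R by simp
      then show ?thesis using Nil by simp
    qed
    show False
    proof (cases "A = []")
      case True
      then have "t = u" "v ~: ?Y" using uA vD n by auto
      then have "?Y \<inter> ?C = {u}" using wY by auto
      then show False using force_join'[OF fY f(1)] \<open>t = u\<close> YV CV by simp
    next
      case False
      then obtain A' where A': "A = u # A'" "u ~: ?Y" using uA by blast
      show False
      proof (cases "D = []")
        case True
        then have "z = v" using vD by blast
        then have "v \<in> ?Y" by simp
        moreover from this have "?Y \<inter> ?C = {v}" using wY A'(2) by blast
        ultimately show False using force_join'[OF fY f(2)] YV CV by blast
      next
        case D: False
        then have v: "v ~: ?Y" using vD by blast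
        have "?R = [] @ u # A' @ t # (B @ z # D)" using R A'(1) by simp
        from walk_segment[OF q this] have wA: "walk E u A' t" .
        have sA: "set (A' @ [t]) \<inter> ?C = {}"
        proof -
          have "set (A' @ [t]) \<subseteq> set ?R" unfolding R A'(1) by auto
          moreover have "u ~: set (A' @ [t])" using dR' A'(1) by auto
          moreover have "v ~: set (A' @ [t])"
          proof -
            obtain D' a where D': "D = D' @ [a]" using D by (cases D rule: rev_cases) auto
            have "last (A @ t # B @ z # D' @ [a]) = last (u # q @ [v])" using R D' by simp
            then show ?thesis using dR' D' A'(1) by auto
          qed
          ultimately show ?thesis using wR by auto
        qed
        have "force E (insert t (set A' \<union> ?C)) t" by (rule force_walk[OF f(1) wA]) (use sA dR' A'(1) in auto)
        moreover have "force E ?Y t" by (rule fY) simp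
        moreover have "insert t (set A' \<union> ?C) \<inter> ?Y = {t}"
        proof -
          have "set A' \<inter> ?Y = {}" using dR' A'(1) sT by auto
          then show ?thesis using wY v A'(2) by blast
        qed
        moreover have "insert t (set A' \<union> ?C) \<subseteq> V" using walk_V[OF wA] CV by simp
        ultimately show False using force_join' YV by blast
      qed
    qed
  qed
  \<comment> \<open>A further neighbor of a route vertex is the end of a chord or the beginning of
    an ear. Both are shortcuts, so at most a second connection between the ends \<open>u\<close> and
    \<open>v\<close> is possible, and \<open>ends\<close> excludes it.\<close>
  have nbr: "\<exists>A B. ?R = A @ t # y # B | ?R = A @ y # t # B" if t: "t \<in> set ?R" "E t y" "y ~= w1" "y ~= w2" for t y
  proof -
    have tT: "t \<in> ?T" "t ~= w2" "t ~= w1" using t(1) wR by auto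
    have "\<exists>q' z. walk E t q' z & distinct q' & set q' \<inter> ?T = {} & z \<in> set ?R & z ~= t & (q' ~= [] | z = y)"
    proof (cases "y \<in> ?T")
      case True
      then show ?thesis using t irrefl by (intro exI[of _ "[]"] exI[of _ y]) auto
    next
      case False
      have "walk E w1 (u # q @ [v]) w1" using e q by (simp add: walk_append)
      moreover have "distinct (w1 # u # q @ [v])" using dR wR by simp
      moreover have "t \<in> insert w1 (set (u # q @ [v]))" using t(1) by simp
      ultimately have "\<exists>Q'. walk E t Q' t & distinct (t # Q') & insert t (set Q') = insert w1 (set ?R) & length Q' = length ?R"
        by (rule cycle_rotate)
      then obtain Q' where Q': "walk E t Q' t" "distinct (t # Q')" "insert t (set Q') = insert w1 (set ?R)"
        "length Q' = length ?R" by (elim exE conjE)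
      have "force E (insert w1 (set ?R)) t" using force_cycle[OF Q'(1,2)] Q'(3,4) by simp
      moreover have "insert w1 (set ?R) \<subseteq> ?T" "insert w1 (set ?R) \<subseteq> V" using CV qV by auto
      ultimately have "\<exists>q' z. walk E t q' z & q' ~= [] & hd q' = y & distinct q' & set q' \<inter> ?T = {} & z \<in> ?T & z ~= t"
        by (rule ear[OF t(2) False])
      then obtain q' z where q': "walk E t q' z" "q' ~= []" "distinct q'" "set q' \<inter> ?T = {}" "z \<in> ?T" "z ~= t"
        by (elim exE conjE)
      have "last q' \<in> set q'" "E (last q') z" using q'(1,2) walk_split_last[OF q'(1)] by simp_all
      then have "z ~= w1 & z ~= w2" using nw[of "last q'"] q'(4) by blast
      then have "z \<in> set ?R" using q'(5) by auto
      then show ?thesis using q' by blast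
    qed
    then obtain q' z where q': "walk E t q' z" "distinct q'" "set q' \<inter> ?T = {}" "z \<in> set ?R" "z ~= t" "q' ~= [] | z = y"
      by blast
    \<comment> \<open>Such a connection has an odd number of interior vertices: one would be a third
      common neighbor, three or more contradict \<open>theta\<close> with \<open>[w1]\<close> as
      third path.\<close>
    have ends: False if "walk E u p v" "distinct p" "set p \<inter> ?T = {}" for p
    proof -
      have "odd (length p)" using parity[OF that(1)] suv by simp
      show False
      proof (cases "length p < 2")
        case True
        then obtain w where "p = [w]" using \<open>odd (length p)\<close> by (cases p) auto
        then show False using third[of w] that by auto
      next
        case False
        have "length q < 2 | length p < 2" by (rule theta[OF q that(1), of "[w1]"]) (use q0 that d e in auto)
        then show False using lq False by simp
      qed
    qed
    show ?thesis
    proof -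
      obtain A B D where R: "?R = A @ t # B @ z # D | ?R = A @ z # B @ t # D"
      proof -
        obtain X Y where X: "?R = X @ t # Y" using t(1) by (metis split_list)
        then have "z \<in> set X | z \<in> set Y" using q'(4,5) by auto
        then show ?thesis
        proof
          assume "z \<in> set X"
          then obtain X1 X2 where "X = X1 @ z # X2" by (metis split_list)
          then show ?thesis using that[of X1 X2 Y] X by simp
        next
          assume "z \<in> set Y"
          then obtain Y1 Y2 where "Y = Y1 @ z # Y2" by (metis split_list)
          then show ?thesis using that[of X Y1 Y2] X by simp
        qed
      qed
      have rq: "walk E z (rev q') t" "distinct (rev q')" "set (rev q') \<inter> ?T = {}" using wrev[OF q'(1)] q'(2,3) by simp_all
      show ?thesis
      proof (cases "q' ~= [] | B ~= []")
        case False
        then show ?thesis using R q'(6) by auto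
      next
        case True
        from R show ?thesis
        proof
          assume R: "?R = A @ t # B @ z # D"
          then have "A = [] & D = []" using shortcut[OF R q'(1-3) True] by blast
          then have "t = u" "z = v" using R by auto
          then show ?thesis using ends[OF _ q'(2,3)] q'(1) by blast
        next
          assume R: "?R = A @ z # B @ t # D"
          then have "A = [] & D = []" using shortcut[OF R rq] True by simp
          then have "z = u" "t = v" using R by auto
          then show ?thesis using ends[OF _ rq(2,3)] rq(1) by blast
        qed
      qed
    qed
  qed
  have split: "y = last X & X ~= [] | y = hd Y & Y ~= []" if R: "?R = X @ t # Y" and y: "E t y" "y ~= w1" "y ~= w2" for X t Y y
  proof -
    have "t \<in> set ?R" unfolding R by simp
    from nbr[OF this y] obtain A B where "?R = A @ t # y # B | ?R = A @ y # t # B" by blast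
    then have "X @ t # Y = A @ t # (y # B) | X @ t # Y = (A @ [y]) @ t # B" using R by auto
    moreover have "t ~: set X" "t ~: set Y" using dR unfolding R by auto
    then have i: "X = P & Y = Q" if "X @ t # Y = P @ t # Q" for P Q
      using append_Cons_eq_iff[of t X Y P Q] that by blast
    ultimately consider "X = A" "Y = y # B" | "X = A @ [y]" "Y = B" using i by blast
    then show ?thesis by cases auto
  qed
  have mid: "deg2 E t" if tq: "t \<in> set q" for t
  proof -
    obtain a b where ab: "q = a @ t # b" using split_list[OF tq] by (elim exE)
    have R: "?R = (u # a) @ t # (b @ [v])" by (simp add: ab)
    have w: "walk E u a t" "walk E t b v" using q ab by (simp_all add: walk_append)
    show ?thesis
    proof (rule deg2I)
      show "E t (last (u # a))" using walk_split_last[OF w(1)] sym by blast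
      show "E t (hd (b @ [v]))" using w(2) by (cases b) auto
      have "last (u # a) \<in> set (u # a)" "hd (b @ [v]) \<in> set (b @ [v])" by (rule last_in_set hd_in_set, simp)+
      moreover have "set (u # a) \<inter> set (b @ [v]) = {}" using dR unfolding R by auto
      ultimately show "last (u # a) ~= hd (b @ [v])" by (metis disjoint_iff)
      fix y assume y: "E t y"
      have "t ~= u" "t ~= v" using dR ab by auto
      then have "y ~= w1" "y ~= w2" using nw[of t] y by blast+
      then show "y = last (u # a) | y = hd (b @ [v])" using split[OF R y] by blast
    qed
  qed
  have "deg3 E u"
  proof -
    have "E u (hd q)" using q q0(2) by (cases q) auto
    moreover have "y = w1 | y = w2 | y = hd q" if "E u y" for y
      using split[of "[]" u "q @ [v]" y] that q0(2) by auto
    moreover have "hd q \<in> set q" using q0(2) by simp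
    ultimately show ?thesis unfolding deg3_def using e d q0(5) by (intro exI[of _ w1] exI[of _ w2] exI[of _ "hd q"]) auto
  qed
  moreover have "deg3 E v"
  proof -
    have "E v (last q)" using walk_split_last[OF q] q0(2) sym by auto
    moreover have "y = w1 | y = w2 | y = last q" if "E v y" for y
      using split[of "u # q" v "[]" y] that q0(2) by auto
    moreover have "last q \<in> set q" using q0(2) by simp
    ultimately show ?thesis unfolding deg3_def using e d q0(5) by (intro exI[of _ w1] exI[of _ w2] exI[of _ "last q"]) auto
  qed
  moreover have "t \<in> ?T" if "E^** u t" for t
  proof (rule closed_conn[OF that])
    fix a b assume a: "a \<in> ?T" "E a b"
    show "b \<in> ?T"
    proof (cases "a \<in> set ?R & b ~= w1 & b ~= w2")
      case True
      then have "b \<in> set ?R" using nbr[of a b] a(2) by (metis in_set_conv_decomp list.set_intros(1,2) Un_iff set_append)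
      then show ?thesis by auto
    next
      case False
      then show ?thesis using a nw[of b] sym[OF a(2)] by auto
    qed
  qed simp
  ultimately show ?thesis using mid cd e by blast
qed

text \<open>Given a 4-cycle with an ear between \<open>u\<close> and \<open>v\<close>, all common
  neighbors of these have degree 2. If all neighbors of \<open>u\<close> and \<open>v\<close> are
  common, the component is complete bipartite with \<open>u\<close> and \<open>v\<close> as one
  side; otherwise \<open>long_ear\<close> applies at one of them.\<close>

theorem component_structure:
  assumes x: "E x x'" "~ deg2 E x"
  shows "\<exists>u v w1 w2. E^** x u & sq u v w1 w2 & deg2 E w1 & deg2 E w2 &
    ((\<forall>y. E u y --> E y v & deg2 E y) & (\<forall>y. E v y --> E y u) |
     deg3 E u & deg3 E v & (\<forall>y. E^** x y --> y = u | y = v | deg2 E y))"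
proof -
  obtain u0 v0 w10 w20 where "sq u0 v0 w10 w20" "E^** x u0" using ex_sq[OF x] by blast
  then obtain u v w1 w2 p where sq: "sq u v w1 w2" and xu: "E^** x u" and p: "walk E u p v" "p ~= []" "distinct p" "set p \<inter> {u, v, w1, w2} = {}"
    using ex_route[OF x(2)] by blast
  have e: "E u w1" "E w1 v" "E u w2" "E w2 v" "E w1 u" "E v w1" "E w2 u" "E v w2" using sq sym by (auto simp: sq_def)
  have d1: "deg2 E w1" using middle_deg2[OF sq p] .
  have d2: "deg2 E w2" using middle_deg2[OF sq_sym(2)[OF sq] p(1-3)] p(4) by (simp add: insert_commute)
  have cd: "deg2 E w" if w: "E u w" "E w v" for w
  proof (cases "w = w1 | w = w2")
    case False
    have "sq u v w w1" using sq w False by (auto simp: sq_def)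
    moreover have "set [w2] \<inter> {u, v, w, w1} = {}" using sq_distinct[OF sq] False by auto
    ultimately show ?thesis using middle_deg2[of u v w w1 "[w2]"] e by auto
  qed (use d1 d2 in blast)
  have cd': "deg2 E w" if "E v w" "E w u" for w using cd that sym by blast
  have xc: "E^** u y" "E^** v y" if "E^** x y" for y
  proof -
    show "E^** u y" using conn_sym[OF xu] that by (rule rtranclp_trans)
    then show "E^** v y" using e(6,5) by (meson converse_rtranclp_into_rtranclp)
  qed
  show ?thesis
  proof (cases "\<exists>y. E u y & ~ E y v")
    case True
    then obtain y where "E u y" "~ E y v" by blast
    from long_ear[OF sq cd this] show ?thesis using xu sq d1 d2 xc by blast
  next
    case u: False
    show ?thesis
    proof (cases "\<exists>y. E v y & ~ E y u")
      case True
      then obtain y where "E v y" "~ E y u" by blast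
      from long_ear[OF sq_sym(1)[OF sq] cd' this] show ?thesis using xu sq d1 d2 xc by blast
    next
      case False
      then show ?thesis using u cd xu sq d1 d2 by blast
    qed
  qed
qed

end

section \<open>Colorings of the surviving components\<close>

fun kp :: "('v => nat set) => 'v list => nat => nat => bool" where
  "kp L [] a d <-> a = d"
| "kp L (z # q) a d <-> (\<forall>b\<in>L z. b ~= a --> kp L q b d)"

text \<open>\<open>kp\<close> is the relation of excluded end colors for a path of any length. A
  vertex with list {y1, y2} can contribute to an exclusion only if the preceding color is y1 or y2,
  and then it passes on the other one. So each vertex exchanges the colors, and for an odd number of
  vertices the relation is thin.\<close>

lemma kp_thin:
  assumes "\<forall>z\<in>set q. card (L z) = 2"
  shows "(\<forall>a d d'. kp L q a d --> kp L q a d' --> d = d') &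
    (\<forall>a a' d d'. kp L q a d --> kp L q a' d' --> a ~= a' --> (if odd (length q) then d = a' & d' = a else d = a & d' = a'))"
  using assms
proof (induction q)
  case (Cons z q)
  obtain y1 y2 where L: "L z = {y1, y2}" "y1 ~= y2" using Cons.prems by (auto simp: card_2_iff)
  have IH1: "d = d'" if "kp L q a d" "kp L q a d'" for a d d' using Cons that by auto
  have IH2: "if odd (length q) then d = a' & d' = a else d = a & d' = a'" if "kp L q a d" "kp L q a' d'" "a ~= a'" for a a' d d'
    using Cons that by auto
  have k: "kp L (z # q) a d <-> (y1 ~= a --> kp L q y1 d) & (y2 ~= a --> kp L q y2 d)" for a d
    using L by simp
  have 1: "d = d'" if "kp L (z # q) a d" "kp L (z # q) a d'" for a d d'
    using that L(2) IH1 unfolding k by metis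
  have mem: "a = y1 | a = y2" if "kp L (z # q) a d" for a d
  proof (rule ccontr)
    assume "~ ?thesis"
    then have "kp L q y1 d" "kp L q y2 d" using that unfolding k by auto
    from IH2[OF this L(2)] show False using L(2) by (auto split: if_splits)
  qed
  have 2: "if odd (length (z # q)) then d = a' & d' = a else d = a & d' = a'"
    if h: "kp L (z # q) a d" "kp L (z # q) a' d'" "a ~= a'" for a a' d d'
  proof -
    have "kp L q a' d & kp L q a d'" using mem[OF h(1)] mem[OF h(2)] h L(2) unfolding k by auto
    then show ?thesis using IH2[of a' d a d'] h(3) by auto
  qed
  show ?case using 1 2 by blast
qed simp

lemma kp_col:
  "distinct q ==> ~ kp L q a d ==> \<exists>f. (\<forall>z\<in>set q. f z \<in> L z) & (\<forall>c x y. c x = a --> c y = d -->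
     (\<forall>z\<in>set q. c z = f z) --> successively (%r t. c r ~= c t) (x # q @ [y]))"
proof (induction q arbitrary: a)
  case Nil
  then show ?case by auto
next
  case (Cons z q)
  then obtain b where b: "b \<in> L z" "b ~= a" "~ kp L q b d" by auto
  have "distinct q" using Cons.prems by simp
  from Cons.IH[OF this b(3)] obtain f where f: "\<forall>z\<in>set q. f z \<in> L z"
    "!!c x y. c x = b ==> c y = d ==> \<forall>z\<in>set q. c z = f z ==> successively (%r t. c r ~= c t) (x # q @ [y])" by blast
  have e: "(f(z := b)) r = f r" if "r \<in> set q" for r using that Cons.prems by auto
  show ?case
  proof (intro exI[of _ "f(z := b)"] conjI allI impI)
    show "\<forall>r\<in>set (z # q). (f(z := b)) r \<in> L r" using f(1) b(1) e by auto
    fix c :: "'a => nat" and x y assume c: "c x = a" "c y = d" "\<forall>r\<in>set (z # q). c r = (f(z := b)) r"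
    then have "c z = b" "\<forall>r\<in>set q. c r = f r" using e by auto
    from f(2)[of c z y, OF this(1) c(2) this(2)] show "successively (%r t. c r ~= c t) (x # (z # q) @ [y])"
      using c(1) b(2) \<open>c z = b\<close> by simp
  qed
qed

definition consec :: "'v list => 'v => 'v => bool" where
  "consec R r r' <-> (\<exists>A B. R = A @ r # r' # B | R = A @ r' # r # B)"

lemma consec_col: "successively (%r t. c r ~= c t) R ==> consec R r r' ==> c r ~= (c r' :: nat)"
  unfolding consec_def by (auto simp: successively_append_iff)

lemma consec_set: "consec R r r' ==> r' \<in> set R"
  unfolding consec_def by auto

lemma consec_hd: "q ~= [] ==> consec (x # q @ [y]) x (hd q)"
  and consec_last: "q ~= [] ==> consec (x # q @ [y]) y (last q)"
proof -
  show "q ~= [] ==> consec (x # q @ [y]) x (hd q)"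
    unfolding consec_def by (intro exI[of _ "[]"] exI[of _ "tl q @ [y]"]) simp
  show "q ~= [] ==> consec (x # q @ [y]) y (last q)"
    unfolding consec_def by (intro exI[of _ "x # butlast q"] exI[of _ "[]"]) simp
qed

context core_graph
begin

lemma inner_nbrs:
  assumes q: "walk E x q y" "distinct q" "x ~: set q" "y ~: set q" "x ~= y | length q \<ge> 2"
    and r: "r \<in> set q" "deg2 E r" "E r r'"
  shows "consec (x # q @ [y]) r r'"
proof -
  obtain a b where ab: "q = a @ r # b" using r(1) by (metis split_list)
  have w: "walk E x a r" "walk E r b y" using q(1) by (simp_all add: ab walk_append)
  have "E r (last (x # a))" using walk_split_last[OF w(1)] sym by blast
  moreover have "E r (hd (b @ [y]))" using w(2) by (cases b) auto
  moreover have "last (x # a) ~= hd (b @ [y])"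
    using q(2-5) by (cases a rule: rev_cases; cases b) (auto simp: ab)
  ultimately have "r' = last (x # a) | r' = hd (b @ [y])" using deg2_nbrs[OF r(2)] r(3) by blast
  then show ?thesis
  proof
    assume h: "r' = last (x # a)"
    have "x # q @ [y] = butlast (x # a) @ last (x # a) # r # b @ [y]"
      unfolding ab using append_butlast_last_id[of "x # a"] by (metis append.assoc append_Cons append_Nil list.distinct(1))
    then show ?thesis unfolding consec_def h by blast
  next
    assume h: "r' = hd (b @ [y])"
    have "x # q @ [y] = (x # a) @ r # hd (b @ [y]) # tl (b @ [y])" by (simp add: ab)
    then show ?thesis unfolding consec_def h by blast
  qed
qed

text \<open>The cycle is even, so an odd number of vertices lies beside \<open>z\<close>, and by
  \<open>kp_thin\<close> the combinations \<open>b, b\<close> and \<open>b', b'\<close> are not both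
  excluded for the two colors of \<open>z\<close>.\<close>

lemma cycle_component_col:
  assumes x: "E x x'" "!!y. E^** x y ==> deg2 E y" and L: "!!y. E^** x y ==> card (L y) = 2"
  shows "\<exists>c. col {y. E^** x y} E L c"
proof -
  obtain z q where z: "walk E z q z" "length q \<ge> 2" "distinct (z # q)" "E^** x z"
    using ex_cycle[OF x(1)] by blast
  let ?R = "z # q @ [z]"
  have xq: "E^** x r" if "r \<in> set ?R" for r using that z(4) walk_conn[OF z(1)] by (auto intro: rtranclp_trans)
  have ne: "q ~= []" using z(2) by auto
  have nb: "consec ?R r r'" if r: "r \<in> set ?R" "E r r'" for r r'
  proof (cases "r \<in> set q")
    case True
    then show ?thesis using inner_nbrs[OF z(1) _ _ _ disjI2[OF z(2)] True x(2)[OF xq[OF r(1)]] r(2)] z(3) by simp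
  next
    case False
    then have rz: "r = z" using r(1) by auto
    obtain h q' where h: "q = h # q'" "q' ~= []" using z(2) by (cases q; cases "tl q") auto
    have "E z (hd q)" "E z (last q)" "hd q ~= last q" using z(1,3) h walk_split_last[OF z(1)] sym by auto
    then have "r' = hd q | r' = last q" using deg2_nbrs[OF x(2)[OF z(4)]] r(2) rz by blast
    then show ?thesis using consec_hd[OF ne] consec_last[OF ne] rz by blast
  qed
  have comp: "{y. E^** x y} = set ?R"
  proof (intro equalityI subsetI)
    fix y assume "y \<in> {y. E^** x y}"
    then have "E^** z y" using conn_sym[OF z(4)] by (auto intro: rtranclp_trans)
    then show "y \<in> set ?R"
    proof (rule closed_conn)
      fix a b assume "a \<in> set ?R" "E a b"
      then show "b \<in> set ?R" by (rule consec_set[OF nb])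
    qed simp
  qed (use xq in blast)
  obtain b b' where b: "L z = {b, b'}" "b ~= b'" using L[OF z(4)] by (auto simp: card_2_iff)
  have "odd (length q)" using parity[OF z(1)] by simp
  moreover have "\<forall>r\<in>set q. card (L r) = 2" using L xq by simp
  ultimately have "kp L q b b ==> kp L q b' b' ==> b = b' & b' = b" using kp_thin[of q L] b(2) by metis
  then have "~ kp L q b b | ~ kp L q b' b'" using b(2) by blast
  then obtain a where a: "a \<in> L z" "~ kp L q a a" using b by auto
  have "distinct q" using z(3) by simp
  from kp_col[OF this a(2)] obtain f where f: "\<forall>r\<in>set q. f r \<in> L r"
    "!!c x y. c x = a ==> c y = a ==> \<forall>z\<in>set q. c z = f z ==> successively (%r t. c r ~= c t) (x # q @ [y])" by blast
  define c where "c = f(z := a)"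
  have cq: "\<forall>r\<in>set q. c r = f r" using z(3) by (auto simp: c_def)
  have cs: "successively (%r t. c r ~= c t) ?R" by (rule f(2)) (use cq in "simp_all add: c_def")
  have "col (set ?R) E L c"
    unfolding col_def
  proof (intro conjI ballI impI)
    fix r assume r: "r \<in> set ?R"
    show "c r \<in> L r" using r a(1) f(1) cq by (auto simp: c_def)
    fix r' assume "E r r'"
    then show "c r ~= c r'" using consec_col[OF cs] nb r by blast
  qed
  then show ?thesis unfolding comp by blast
qed

text \<open>Two paths through single vertices and one path with an odd number of interior vertices
  are three thin relations, the first two irreflexive, so \<open>thin3_survivor\<close> supplies the
  colors of \<open>u\<close> and \<open>v\<close>. This works for every palette.\<close>

lemma theta_component_col:
  assumes sq: "u ~= v" "w1 ~= w2" "E u w1" "E w1 v" "E u w2" "E w2 v" and d3: "deg3 E u" "deg3 E v"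
    and d2: "!!y. E^** u y ==> y = u | y = v | deg2 E y" and L: "!!y. E^** u y ==> card (L y) = 2"
  shows "\<exists>c. col {y. E^** u y} E L c"
proof -
  let ?S = "{u, v, w1, w2}"
  have e: "E w1 u" "E v w1" "E w2 u" "E v w2" using sq sym by auto
  have uv: "~ E u v" using bip sq(3,4) by blast
  have ds: "distinct [u, v, w1, w2]" using sq irrefl by auto
  have cu: "E^** u w1" "E^** u w2" using sq by blast+
  then have cv: "E^** u v" using sq by (meson rtranclp.rtrancl_into_rtrancl)
  have dw: "deg2 E w1" "deg2 E w2" using d2[OF cu(1)] d2[OF cu(2)] ds by auto
  have nw: "t = u | t = v" if "E w1 t | E w2 t" for t
    using that deg2_nbrs[OF dw(1) e(1) sq(4) sq(1)] deg2_nbrs[OF dw(2) e(3) sq(6) sq(1)] by blast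
  obtain y where y: "E u y" "y ~= w1" "y ~= w2" using d3(1) unfolding deg3_def by metis
  have un: "t = w1 | t = w2 | t = r" if "E u r" "r ~= w1" "r ~= w2" "E u t" for r t
    using d3(1) that sq(2,3,5) unfolding deg3_def by metis
  have vn: "t = w1 | t = w2 | t = r" if "E v r" "r ~= w1" "r ~= w2" "E v t" for r t
    using d3(2) that sq(2) e(2,4) unfolding deg3_def by metis
  have yS: "y ~: ?S" using y uv irrefl by blast
  have "\<exists>q. walk E u q v & q ~= [] & distinct q & set q \<inter> ?S = {}"
  proof -
    have "u \<in> ?S" by simp
    from ear_or_cycle[OF y(1) yS this] show ?thesis
    proof (elim disjE exE conjE, goal_cases)
      case (1 q z)
      have "last q \<in> set q" "E z (last q)" using 1(1,2) walk_split_last[OF 1(1)] sym by simp_all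
      then have "z = v" using nw 1(5-7) by blast
      then show ?thesis using 1 by blast
    next
      case (2 q)
      obtain h q' where h: "q = h # q'" "q' ~= []" using 2(2) by (cases q; cases "tl q") auto
      have "E u (hd q)" "E u (last q)" "hd q ~= last q" "hd q \<in> set q" "last q \<in> set q"
        using 2 h walk_split_last[OF 2(1)] sym by auto
      moreover from this have "hd q ~= w1" "hd q ~= w2" "last q ~= w1" "last q ~= w2" using 2(4) by blast+
      ultimately show ?thesis using un[of "hd q" "last q"] by metis
    next
      case (3 q1 z q2)
      obtain h q' where h: "q2 = h # q'" "q' ~= []" using 3(3) by (cases q2; cases "tl q2") auto
      have n: "E z (hd q2)" "E z (last q2)" "hd q2 ~= last q2" "hd q2 \<in> set q2" "last q2 \<in> set q2"
        using 3 h walk_split_last[OF 3(2)] sym by auto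
      have "E z (last (u # q1))" using walk_split_last[OF 3(1)] sym by blast
      moreover have "last (u # q1) \<in> insert u (set q1)" by auto
      moreover have "deg2 E z" using d2[OF walk_conn_end[OF 3(1)]] 3(5) by auto
      ultimately have "hd q2 \<in> insert u (set q1) | last q2 \<in> insert u (set q1)" 
        using deg2_nbrs[of E z "hd q2" "last q2"] n(1-3) by metis
      then show ?thesis using n(4,5) 3(4,5) by auto
    qed
  qed
  then obtain q where q: "walk E u q v" "q ~= []" "distinct q" "set q \<inter> ?S = {}" by blast
  let ?R = "u # q @ [v]" and ?T = "{w1, w2} \<union> set (u # q @ [v])"
  have hq: "E u (hd q)" "hd q \<in> set q" "E v (last q)" "last q \<in> set q"
    using q(1,2) walk_split_last[OF q(1)] sym by (cases q; auto)+
  have nb: "consec ?R r r' | r' = w1 | r' = w2" if r: "r \<in> set ?R" "E r r'" for r r'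
  proof -
    consider "r = u" | "r = v" | "r \<in> set q" using r(1) by auto
    then show ?thesis
    proof cases
      case 1
      then have "r' = w1 | r' = w2 | r' = hd q" using un[OF hq(1)] hq(2) q(4) r(2) by blast
      then show ?thesis using consec_hd[OF q(2)] 1 by blast
    next
      case 2
      then have "r' = w1 | r' = w2 | r' = last q" using vn[OF hq(3)] hq(4) q(4) r(2) by blast
      then show ?thesis using consec_last[OF q(2)] 2 by blast
    next
      case 3
      have "r ~= u" "r ~= v" using 3 q(4) by auto
      then have "deg2 E r" using d2[OF walk_conn[OF q(1) 3]] by blast
      then show ?thesis using inner_nbrs[OF q(1,3) _ _ disjI1[OF sq(1)] 3 _ r(2)] q(4) by blast
    qed
  qed
  have comp: "{y. E^** u y} = ?T"
  proof (intro equalityI subsetI)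
    fix y assume "y \<in> {y. E^** u y}"
    then have "E^** u y" by simp
    then show "y \<in> ?T"
    proof (rule closed_conn)
      fix a b assume ab: "a \<in> ?T" "E a b"
      show "b \<in> ?T"
      proof (cases "a \<in> set ?R")
        case True
        then show ?thesis using nb[OF True ab(2)] consec_set[of ?R a b] by blast
      next
        case False
        then have "b = u | b = v" using nw ab by blast
        then show ?thesis by auto
      qed
    qed simp
  next
    fix y assume "y \<in> ?T"
    then show "y \<in> {y. E^** u y}" using cu cv walk_conn[OF q(1)] by auto
  qed
  have cL: "card (L r) = 2" if "r \<in> ?T" for r using that L comp by blast
  obtain a a' where a: "L u = {a, a'}" "a ~= a'" using cL[of u] by (auto simp: card_2_iff)
  obtain d d' where d: "L v = {d, d'}" "d ~= d'" using cL[of v] by (auto simp: card_2_iff)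
  have "odd (length q)" using parity[OF q(1)] bip[OF sq(3)] bip[OF sq(4)] by auto
  then have "thin (kp L q)" using kp_thin[of q L] cL unfolding thin_def by simp
  moreover have "thin (kill1 (L w1))" "!!b. ~ kill1 (L w1) b b" "thin (kill1 (L w2))" "!!b. ~ kill1 (L w2) b b"
    using thin_kill1 cL by blast+
  ultimately obtain b1 b2 where b: "b1 \<in> {a, a'}" "b2 \<in> {d, d'}" "~ kill1 (L w1) b1 b2" "~ kill1 (L w2) b1 b2" "~ kp L q b1 b2"
    using thin3_survivor[of "kill1 (L w1)" "kill1 (L w2)" "kp L q" a a' d d'] a(2) d(2) by blast
  obtain c1 where c1: "c1 \<in> L w1" "c1 ~= b1" "c1 ~= b2" using b(3) unfolding kill1_def by blast
  obtain c2 where c2: "c2 \<in> L w2" "c2 ~= b1" "c2 ~= b2" using b(4) unfolding kill1_def by blast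
  obtain f where f: "\<forall>r\<in>set q. f r \<in> L r"
    "!!c x y. c x = b1 ==> c y = b2 ==> \<forall>z\<in>set q. c z = f z ==> successively (%r t. c r ~= c t) (x # q @ [y])"
    using kp_col[OF q(3) b(5)] by blast
  define c where "c = f(u := b1, v := b2, w1 := c1, w2 := c2)"
  have cq: "\<forall>r\<in>set q. c r = f r" using q(4) by (auto simp: c_def)
  have cv: "c u = b1" "c v = b2" "c w1 = c1" "c w2 = c2" using ds by (auto simp: c_def)
  have cs: "successively (%r t. c r ~= c t) ?R" by (rule f(2)[OF cv(1,2) cq])
  have "col ?T E L c"
    unfolding col_def
  proof (intro conjI ballI impI)
    fix r assume r: "r \<in> ?T"
    then consider "r \<in> set q" | "r = u" | "r = v" | "r = w1" | "r = w2" by auto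
    then show "c r \<in> L r" using f(1) cq cv a d b c1 c2 by cases auto
    fix r' assume r': "r' \<in> ?T" "E r r'"
    show "c r ~= c r'"
    proof (cases "r \<in> set ?R & r' \<in> set ?R & r' ~= w1 & r' ~= w2")
      case True
      then have "consec ?R r r'" using nb[of r r'] r'(2) by blast
      then show ?thesis by (rule consec_col[OF cs])
    next
      case False
      then have w: "r = w1 | r = w2 | r' = w1 | r' = w2" using r r' by blast
      then have "(r = w1 | r = w2) & (r' = u | r' = v) | (r' = w1 | r' = w2) & (r = u | r = v)"
        using nw[of r'] nw[of r] r'(2) sym[OF r'(2)] by blast
      then show ?thesis using cv c1 c2 by auto
    qed
  qed
  then show ?thesis unfolding comp by blast
qed

text \<open>Two lists of size 2 from three colors meet; \<open>u\<close> and \<open>v\<close> take a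
  common color, and every other vertex has a color different from it.\<close>

lemma star_component_col:
  assumes u: "!!y. E u y ==> E y v & deg2 E y" "!!y. E v y ==> E y u" and w: "E u w" and uv: "u ~= v"
    and L: "!!y. E^** u y ==> L y \<subseteq> {1..3} & card (L y) = 2"
  shows "\<exists>c. col {y. E^** u y} E L c"
proof -
  have nw: "r = u | r = v" if "E u y" "E y r" for y r
    using deg2_nbrs[of E y u v r] u(1)[OF that(1)] sym that uv by blast
  have "y \<in> {u, v} \<union> {y. E u y}" if "E^** u y" for y
  proof (rule closed_conn[OF that])
    fix a b assume "a \<in> {u, v} \<union> {y. E u y}" "E a b"
    then show "b \<in> {u, v} \<union> {y. E u y}" using nw[of a b] u(2)[of b] sym[of b u] by blast
  qed simp
  then have comp: "{y. E^** u y} \<subseteq> {u, v} \<union> {y. E u y}" by blast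
  have cv: "E^** u v" using w u(1)[OF w] by (meson r_into_rtranclp rtranclp.rtrancl_into_rtrancl)
  have "L u \<inter> L v ~= {}"
  proof
    assume "L u \<inter> L v = {}"
    then have "card (L u \<union> L v) = 4" using L[of u] L[OF cv] by (subst card_Un_disjoint) (auto intro: finite_subset)
    moreover have "card (L u \<union> L v) \<le> card {1..3::nat}" using L[of u] L[OF cv] by (intro card_mono) auto
    ultimately show False by simp
  qed
  then obtain a where a: "a \<in> L u" "a \<in> L v" by blast
  define g where "g y = (SOME b. b \<in> L y & b ~= a)" for y
  have g: "g y \<in> L y & g y ~= a" if "E^** u y" for y
  proof -
    have "\<exists>b. b \<in> L y & b ~= a" using L[OF that] by (auto simp: card_2_iff)
    then show ?thesis unfolding g_def by (rule someI_ex)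
  qed
  define c where "c y = (if y = u | y = v then a else g y)" for y
  have "col {y. E^** u y} E L c"
    unfolding col_def
  proof (intro conjI ballI impI)
    fix r assume r: "r \<in> {y. E^** u y}"
    then show "c r \<in> L r" using a g by (auto simp: c_def)
    fix r' assume r': "r' \<in> {y. E^** u y}" "E r r'"
    have x: "~ E u u" "~ E u v" "~ E v u" "~ E v v" using irrefl bip u(1)[OF w] w by blast+
    have "(r = u | r = v) ~= (r' = u | r' = v)"
      using r r' comp nw[of r r'] x by blast
    then show "c r ~= c r'" using g r r' by (auto simp: c_def)
  qed
  then show ?thesis by blast
qed

lemma col_components:
  assumes "!!x. x \<in> V ==> \<exists>c. col {y. E^** x y} E L c"
  shows "\<exists>c. col V E L c"
proof -
  define g where "g U = (SOME c. col U E L c)" for U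
  have g: "col {y. E^** x y} E L (g {y. E^** x y})" if "x \<in> V" for x
    unfolding g_def by (rule someI_ex[OF assms[OF that]])
  have "col V E L (%x. g {y. E^** x y} x)"
    unfolding col_def
  proof (intro conjI ballI impI)
    fix x assume x: "x \<in> V"
    show "g {y. E^** x y} x \<in> L x" using colD(1)[OF g[OF x]] by simp
    fix x' assume "E x x'"
    then have c: "E^** x x'" by blast
    then have "{y. E^** x' y} = {y. E^** x y}" using conn_sym[OF c] by (auto intro: rtranclp_trans)
    then show "g {y. E^** x y} x ~= g {y. E^** x' y} x'" using colD(2)[OF g[OF x], of x x'] c \<open>E x x'\<close> by simp
  qed
  then show ?thesis by blast
qed

text \<open>The alternative that is restricted to k = 3 covers the complete bipartite graphs with a
  side of two vertices; the one with three vertices on the other side also falls under the last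
  alternative, which holds for every k.\<close>

definition component_ok :: "nat => 'a => bool" where
  "component_ok k x <-> (\<forall>y. E^** x y --> deg2 E y) |
    (\<exists>u v w1 w2. E^** x u & u ~= v & w1 ~= w2 & E u w1 & E w1 v & E u w2 & E w2 v & 
      (k = 3 & (\<forall>y. E u y --> E y v & deg2 E y) & (\<forall>y. E v y --> E y u) |
       deg3 E u & deg3 E v & (\<forall>y. E^** x y --> y = u | y = v | deg2 E y)))"

text \<open>Choosability for k implies it for 3 colors, so \<open>component_structure\<close>
  applies. For k > 3 a fourth common neighbor is excluded by \<open>K24_bad\<close>; conversely,
  components are colored independently.\<close>

theorem fch_iff_components:
  assumes k: "3 \<le> k"
  shows "fch k (%_. 2) V E <-> (\<forall>x y. E x y --> component_ok k x)"
proof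
  assume f: "fch k (%_. 2) V E"
  have "fch 3 (%_. 2) V E" using bad_mono[OF _ order_refl k] f by blast
  then interpret choosable_core V E s by unfold_locales
  show "\<forall>x y. E x y --> component_ok k x"
  proof (intro allI impI)
    fix x y assume xy: "E x y"
    show "component_ok k x"
    proof (cases "\<forall>y. E^** x y --> deg2 E y")
      case True
      then show ?thesis unfolding component_ok_def by (rule disjI1)
    next
      case False
      then obtain z where z: "E^** x z" "~ deg2 E z" by blast
      have "\<exists>z'. E z z'" using z(1) xy sym by (cases rule: rtranclp.cases) blast+
      then obtain z' where "E z z'" by blast
      from component_structure[OF this z(2)] obtain u v w1 w2 where
        u: "E^** z u" "sq u v w1 w2" "deg2 E w1" "deg2 E w2"
        and c: "(\<forall>y. E u y --> E y v & deg2 E y) & (\<forall>y. E v y --> E y u) |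
          deg3 E u & deg3 E v & (\<forall>y. E^** z y --> y = u | y = v | deg2 E y)" by blast
      have xu: "E^** x u" using z(1) u(1) by (rule rtranclp_trans)
      have zy: "E^** z y" if "E^** x y" for y using conn_sym[OF z(1)] that by (rule rtranclp_trans)
      have "k = 3 & (\<forall>y. E u y --> E y v & deg2 E y) & (\<forall>y. E v y --> E y u) |
         deg3 E u & deg3 E v & (\<forall>y. E^** x y --> y = u | y = v | deg2 E y)"
      proof (cases "k = 3")
        case True
        then show ?thesis using c zy by blast
      next
        case k4: False
        from c show ?thesis
        proof
          assume s: "(\<forall>y. E u y --> E y v & deg2 E y) & (\<forall>y. E v y --> E y u)"
          have e: "E u w1" "E u w2" "u ~= v" "w1 ~= w2" using u(2) by (auto simp: sq_def)
          have nw: "r = u | r = v" if "E u y" "E y r" for y r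
            using deg2_nbrs[of E y u v r] s sym that e(3) by blast
          have cl: "y = u | y = v | E u y" if "E^** u y" for y
            using closed_conn[OF that, of "{u, v} \<union> {y. E u y}"] nw s sym by blast
          \<comment> \<open>Otherwise the component would be a 4-cycle, but it contains the vertex
            \<open>z\<close>.\<close>
          have "~ deg2 E u"
          proof
            assume "deg2 E u"
            moreover from this have "deg2 E v" using s e(1,2,4) sym unfolding deg2_def by metis
            ultimately have "deg2 E y" if "E^** u y" for y using cl[OF that] s by blast
            then show False using z(2) conn_sym[OF u(1)] by blast
          qed
          then obtain w3 where w3: "E u w3" "w3 ~= w1" "w3 ~= w2" using e deg2I[of w1 w2 E u] by blast
          have w4: "w = w1 | w = w2 | w = w3" if w: "E u w" for w
          proof (rule ccontr)
            assume n: "~ ?thesis"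
            have ir: "u ~= y" "v ~= y" if "E u y" for y using that s irrefl by blast+
            have ev: "E w1 v" "E w2 v" "E w3 v" "E w v" using s e w3(1) w by blast+
            have "distinct [u, v, w1, w2, w3, w]" using e w3 n ir[OF e(1)] ir[OF e(2)] ir[OF w3(1)] ir[OF w] by auto
            moreover have "{u, v, w1, w2, w3, w} \<subseteq> V" using e w3(1) w ev ed by blast
            ultimately have "~ fch k (%_. 2) V E"
              using K24_bad[OF e(1) ev(1) e(2) ev(2) w3(1) ev(3) w ev(4)] k k4 by simp
            then show False using f by blast
          qed
          have "deg3 E u" unfolding deg3_def
            by (rule exI[of _ w1], rule exI[of _ w2], rule exI[of _ w3]) (use e w3 w4 in auto)
          moreover have "deg3 E v"
          proof -
            have "E v y <-> E u y" for y using s sym by blast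
            then show ?thesis using \<open>deg3 E u\<close> unfolding deg3_def by simp
          qed
          moreover have "y = u | y = v | deg2 E y" if "E^** x y" for y
            using cl[of y] s conn_sym[OF xu] that by (meson rtranclp_trans)
          ultimately show ?thesis by blast
        qed (use zy in blast)
      qed
      then show ?thesis using xu u(2) unfolding component_ok_def sq_def by blast
    qed
  qed
next
  assume ok: "\<forall>x y. E x y --> component_ok k x"
  show "fch k (%_. 2) V E"
    unfolding fch_def
  proof (intro allI impI col_components)
    fix L x assume "lists_on k (%_. 2) V L" and x: "x \<in> V"
    then have L: "L y \<subseteq> {1..k} & card (L y) = 2" if "y \<in> V" for y using that unfolding lists_on_def by blast
    show "\<exists>c. col {y. E^** x y} E L c"
    proof (cases "\<exists>x'. E x x'")
      case False
      then have "E^** x y <-> y = x" for y by (metis converse_rtranclpE rtranclp.rtrancl_refl)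
      then have s: "{y. E^** x y} = {x}" by simp
      obtain a where "a \<in> L x" using L[OF x] by fastforce
      then show ?thesis unfolding s col_def using irrefl by (intro exI[of _ "%_. a"]) simp
    next
      case True
      then obtain x' where xx: "E x x'" by blast
      have LV: "L y \<subseteq> {1..k} & card (L y) = 2" if "E^** x y" for y
      proof -
        have "y \<in> V" by (rule closed_conn[OF that x]) (use ed in blast)
        then show ?thesis by (rule L)
      qed
      have "component_ok k x" using ok xx by blast
      then consider "!!y. E^** x y ==> deg2 E y" | u v w1 w2 where "E^** x u" "u ~= v" "w1 ~= w2" "E u w1" "E w1 v" "E u w2" "E w2 v"
        "k = 3 & (\<forall>y. E u y --> E y v & deg2 E y) & (\<forall>y. E v y --> E y u) |
         deg3 E u & deg3 E v & (\<forall>y. E^** x y --> y = u | y = v | deg2 E y)"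
        unfolding component_ok_def by blast
      then show ?thesis
      proof cases
        case 1
        show ?thesis using cycle_component_col[OF xx 1] LV by blast
      next
        case 2
        have xc: "E^** u y <-> E^** x y" for y using 2(1) conn_sym[OF 2(1)] by (meson rtranclp_trans)
        from 2(8) have "\<exists>c. col {y. E^** u y} E L c"
        proof
          assume "k = 3 & (\<forall>y. E u y --> E y v & deg2 E y) & (\<forall>y. E v y --> E y u)"
          then show ?thesis using star_component_col[of u v w1 L] 2 LV xc by blast
        next
          assume "deg3 E u & deg3 E v & (\<forall>y. E^** x y --> y = u | y = v | deg2 E y)"
          then show ?thesis using theta_component_col[OF 2(2-7), of L] LV xc by blast
        qed
        then show ?thesis unfolding xc .
      qed
    qed
  qed
qed

end

section \<open>Lists of size 2 in polynomial time\<close>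

definition pos :: "nat => nat => nat => nat" where "pos n x y = Suc n + (y + n * x)"

text \<open>The number of vertices is recovered from a code as the number of its leading
  ones.\<close>

definition nv :: "bool list => nat => bool" where
  "nv X n <-> (\<forall>i<n. bt X i) & ~ bt X n"

lemma bt_gcode:
  "i < n ==> bt (gcode n E) i" "~ bt (gcode n E) n"
  "x < n ==> y < n ==> bt (gcode n E) (pos n x y) <-> E x y" "nv (gcode n E) m <-> m = n"
proof -
  show 1: "bt (gcode n E) i" if "i < n" for i using that gcode_prefix[of i n E] by (simp add: bt_def length_gcode)
  show 2: "~ bt (gcode n E) n" using gcode_prefix[of n n E] by (simp add: bt_def)
  show "bt (gcode n E) (pos n x y) <-> E x y" if "x < n" "y < n"
    using gcode_edge[OF that, of E] by (simp add: bt_def pos_def)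
  show "nv (gcode n E) m <-> m = n" unfolding nv_def using 1 2 by (metis linorder_neqE_nat)
qed

lemma bt_ext: "length X = length Y ==> (!!j. j < length X ==> bt X j <-> bt Y j) ==> X = Y"
  by (rule nth_equalityI) (auto simp: bt_def)

lemma iterate_fixpoint:
  fixes f :: "'x => 'x" and \<mu> :: "'x => nat"
  assumes "!!i. f ((f ^^ i) x) ~= (f ^^ i) x ==> \<mu> ((f ^^ i) x) < \<mu> (f ((f ^^ i) x))" "!!i. \<mu> ((f ^^ i) x) \<le> m"
  shows "f ((f ^^ m) x) = (f ^^ m) x"
proof (rule ccontr)
  assume n: "f ((f ^^ m) x) ~= (f ^^ m) x"
  have st: "(f ^^ (i + d)) x = (f ^^ i) x" if "f ((f ^^ i) x) = (f ^^ i) x" for i d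
    by (induction d) (simp_all add: that)
  have ni: "f ((f ^^ i) x) ~= (f ^^ i) x" if "i \<le> m" for i
  proof
    assume e: "f ((f ^^ i) x) = (f ^^ i) x"
    have "(f ^^ m) x = (f ^^ i) x" using st[OF e, of "m - i"] that by simp
    then show False using n e by simp
  qed
  have "i \<le> Suc m ==> i \<le> \<mu> ((f ^^ i) x)" for i
  proof (induction i)
    case (Suc i)
    then show ?case using assms(1)[OF ni[of i]] by simp
  qed simp
  from this[of "Suc m"] assms(2)[of "Suc m"] show False by simp
qed

lemma length_iter:
  fixes f :: "bool list => bool list"
  shows "(!!Y. length (f Y) = length Y) ==> length ((f ^^ i) X) = length X"
  by (induction i) simp_all

text \<open>Bits change in one direction only, so every round that changes something uses up a bit,
  and as many rounds as bits suffice.\<close>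

lemma map_iter_fixpoint:
  fixes P :: "bool list => nat => bool"
  defines "f \<equiv> %X. map (P X) [0..<length X]"
  assumes mono: "(\<forall>X j. P X j --> bt X j) | (\<forall>X j. bt X j --> P X j)"
  shows "f ((f ^^ length X) X) = (f ^^ length X) X"
proof -
  define b where "b <-> (\<forall>X j. bt X j --> P X j)"
  define \<mu> where "\<mu> Y = card {j. j < length Y & bt Y j = b}" for Y
  have len: "length (f Y) = length Y" for Y by (simp add: f_def)
  have fb: "bt (f Y) j <-> j < length Y & P Y j" for Y j by (simp add: f_def bt_map)
  have keep: "bt (f Y) j = b" if "j < length Y" "bt Y j = b" for Y j
    using mono that unfolding fb b_def by blast
  have "\<mu> Y < \<mu> (f Y)" if ne: "f Y ~= Y" for Y
  proof -
    obtain j where j: "j < length Y" "bt (f Y) j ~= bt Y j" using ne bt_ext[of "f Y" Y] len by metis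
    then have "bt Y j ~= b" "bt (f Y) j = b" using keep[of j Y] by blast+
    then have "{j. j < length Y & bt Y j = b} \<subset> {j. j < length (f Y) & bt (f Y) j = b}"
      using keep j(1) len by auto
    then show ?thesis unfolding \<mu>_def by (intro psubset_card_mono) auto
  qed
  moreover have "\<mu> ((f ^^ i) X) \<le> length X" for i
  proof -
    have "length ((f ^^ i) X) = length X" by (rule length_iter[OF len])
    then have "\<mu> ((f ^^ i) X) \<le> card {..<length X}" unfolding \<mu>_def by (intro card_mono) auto
    then show ?thesis by simp
  qed
  ultimately show ?thesis by (rule iterate_fixpoint[where \<mu> = \<mu>])
qed

section \<open>Removing the vertices of degree 1\<close>

definition prune :: "('v => 'v => bool) => 'v => 'v => bool" where
  "prune E x y <-> E x y & (\<exists>z. z ~= y & E x z) & (\<exists>z. z ~= x & E y z)"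

text \<open>A vertex of degree 1 can be colored last, since its list contains a color other than
  that of its neighbor.\<close>

lemma prune_col:
  fixes E :: "nat => nat => bool" and L :: "nat => nat set"
  assumes E: "!!x y. E x y ==> E y x" "!!x. ~ E x x" and L: "!!v a. v \<in> V ==> \<exists>b\<in>L v. b ~= a"
  shows "(\<exists>c. col V (prune E) L c) <-> (\<exists>c. col V E L c)"
proof
  assume "\<exists>c. col V E L c"
  then show "\<exists>c. col V (prune E) L c" unfolding col_def prune_def by blast
next
  assume "\<exists>c. col V (prune E) L c"
  then obtain c where c: "col V (prune E) L c" ..
  define lf where "lf v y <-> E v y & (\<forall>z. E v z --> z = y)" for v y
  \<comment> \<open>All such vertices lose their edges at once; if both ends of an edge have degree
    1, only the larger one is recolored.\<close>
  define up where "up v y <-> lf v y & (lf y v --> y < v)" for v y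
  define c' where "c' v = (if \<exists>y. up v y then SOME b. b \<in> L v & b ~= c (THE y. up v y) else c v)" for v
  have c1: "c' v \<in> L v & c' v ~= c y" if "v \<in> V" "up v y" for v y
  proof -
    have "(THE y. up v y) = y" using that(2) by (intro the_equality) (auto simp: up_def lf_def)
    then have e: "c' v = (SOME b. b \<in> L v & b ~= c y)" using that(2) unfolding c'_def by auto
    have "\<exists>b. b \<in> L v & b ~= c y" using L[OF that(1), of "c y"] by blast
    then show ?thesis unfolding e by (rule someI_ex)
  qed
  have c2: "c' v = c v" if "~ (\<exists>y. up v y)" for v using that by (simp add: c'_def)
  have lfE: "c' v ~= c' y" if v: "v \<in> V" "y \<in> V" "lf v y" for v y
  proof -
    have "v ~= y" using v(3) E(2) by (auto simp: lf_def)
    have "lf y v | up v y" "y < v ==> up v y" "lf y v ==> v < y ==> up y v" using v(3) by (auto simp: up_def)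
    then consider "up v y" "~ lf y v" | "up v y" "lf y v" | "up y v" "lf v y"
      using \<open>v ~= y\<close> v(3) by (metis linorder_neqE_nat)
    then show ?thesis
    proof cases
      case 1
      have "~ up y z" for z
      proof
        assume "up y z"
        then have "lf y z" by (simp add: up_def)
        moreover from this have "v = z" using v(3) E(1) unfolding lf_def by metis
        ultimately show False using 1(2) by simp
      qed
      then have "c' y = c y" using c2 by blast
      then show ?thesis using c1[OF v(1) 1(1)] by simp
    next
      case 2
      have "~ up y z" for z using 2 unfolding up_def lf_def by (metis less_asym)
      then have "c' y = c y" using c2 by blast
      then show ?thesis using c1[OF v(1) 2(1)] by simp
    next
      case 3
      have "~ up v z" for z using 3 unfolding up_def lf_def by (metis less_asym)
      then have "c' v = c v" using c2 by blast
      then show ?thesis using c1[OF v(2) 3(1)] by simp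
    qed
  qed
  have "col V E L c'"
    unfolding col_def
  proof (intro conjI ballI impI)
    fix v assume v: "v \<in> V"
    show "c' v \<in> L v"
    proof (cases "\<exists>y. up v y")
      case True
      then show ?thesis using c1[OF v] by blast
    next
      case False
      then show ?thesis using c2 colD(1)[OF c v] by simp
    qed
    fix y assume y: "y \<in> V" "E v y"
    show "c' v ~= c' y"
    proof (cases "prune E v y")
      case True
      then have "~ up v z" "~ up y z" for z unfolding prune_def up_def lf_def using E(1) by metis+
      then show ?thesis using c2[of v] c2[of y] colD(2)[OF c v y(1) True] by auto
    next
      case False
      then have "lf v y | lf y v" using y(2) E(1) unfolding prune_def lf_def by blast
      then show ?thesis using lfE v y(1) by metis
    qed
  qed
  then show "\<exists>c. col V E L c" by blast
qed

definition simple :: "nat => (nat => nat => bool) => bool" where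
  "simple n E <-> (\<forall>x y. E x y --> x < n & y < n & E y x & x ~= y)"

definition bipart :: "(nat => nat => bool) => bool" where
  "bipart E <-> (\<exists>s. \<forall>x y. E x y --> s x ~= (s y :: bool))"

lemma simple_prune: "simple n E ==> simple n (prune E)"
  unfolding simple_def prune_def by blast

text \<open>Bipartiteness is a coloring from constant lists of size 2, so that
  \<open>prune_col\<close> shows its invariance as well.\<close>

lemma bipart_col:
  assumes "simple n E" shows "bipart E <-> (\<exists>c. col {..<n} E (%_. {0, 1}) c)"
proof
  assume "bipart E"
  then obtain s where s: "!!x y. E x y ==> s x ~= (s y :: bool)" unfolding bipart_def by blast
  have "col {..<n} E (%_. {0, 1}) (%x. of_bool (s x))" using s by (auto simp: col_def)
  then show "\<exists>c. col {..<n} E (%_. {0, 1}) c" by blast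
next
  assume "\<exists>c. col {..<n} E (%_. {0, 1}) c"
  then obtain c where c: "col {..<n} E (%_. {0, 1}) c" by blast
  have "(c x = 0) ~= (c y = 0)" if xy: "E x y" for x y
  proof -
    have "x \<in> {..<n}" "y \<in> {..<n}" using assms xy unfolding simple_def by blast+
    from colD(1)[OF c this(1)] colD(1)[OF c this(2)] colD(2)[OF c this xy] show ?thesis by auto
  qed
  then show "bipart E" unfolding bipart_def by (intro exI[of _ "%x. c x = 0"]) blast
qed

lemma prune_invariant:
  assumes s: "simple n E"
  shows "simple n ((prune ^^ i) E) & (bipart ((prune ^^ i) E) <-> bipart E) &
    (fch k (%_. 2) {..<n} ((prune ^^ i) E) <-> fch k (%_. 2) {..<n} E)"
proof (induction i)
  case (Suc i)
  let ?E = "(prune ^^ i) E"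
  have si: "simple n ?E" using Suc by blast
  have E: "?E x y ==> ?E y x" "~ ?E x x" for x y using si unfolding simple_def by blast+
  have "bipart (prune ?E) <-> bipart ?E"
    unfolding bipart_col[OF si] bipart_col[OF simple_prune[OF si]]
    by (rule prune_col[OF E]) auto
  moreover have "fch k (%_. 2) {..<n} (prune ?E) <-> fch k (%_. 2) {..<n} ?E"
  proof -
    have "(\<exists>c. col {..<n} (prune ?E) L c) <-> (\<exists>c. col {..<n} ?E L c)" if L: "lists_on k (%_. 2) {..<n} L" for L
    proof (rule prune_col[OF E])
      fix v and a :: nat assume "v \<in> {..<n}"
      then have "card (L v) = 2" using L unfolding lists_on_def by blast
      then show "\<exists>b\<in>L v. b ~= a" by (auto simp: card_2_iff)
    qed
    then show ?thesis unfolding fch_def by blast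
  qed
  ultimately show ?case using Suc simple_prune[OF si] by simp
qed (simp add: s)

definition prune_bit :: "bool list => nat => bool" where
  "prune_bit X j <-> bt X j & ~ (\<exists>n<length X. nv X n & (\<exists>x<n. \<exists>y<n. j = pos n x y &
     ~ ((\<exists>z<n. z ~= y & bt X (pos n x z)) & (\<exists>z<n. z ~= x & bt X (pos n y z)))))"

definition "prune_code X = map (prune_bit X) [0..<length X]"

lemma prune_code_gcode:
  assumes s: "simple n E" shows "prune_code (gcode n E) = gcode n (prune E)"
proof (rule bt_ext)
  show "length (prune_code (gcode n E)) = length (gcode n (prune E))" by (simp add: prune_code_def length_gcode)
  fix j assume "j < length (prune_code (gcode n E))"
  then have j: "j < Suc n + n * n" by (simp add: prune_code_def length_gcode)
  have nl: "n < length (gcode n E)" by (simp add: length_gcode)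
  have b: "bt (prune_code (gcode n E)) j <-> bt (gcode n E) j & ~ (\<exists>x<n. \<exists>y<n. j = pos n x y &
     ~ ((\<exists>z<n. z ~= y & E x z) & (\<exists>z<n. z ~= x & E y z)))"
  proof -
    let ?P = "%m. \<exists>x<m. \<exists>y<m. j = pos m x y & ~ ((\<exists>z<m. z ~= y & bt (gcode n E) (pos m x z)) &
      (\<exists>z<m. z ~= x & bt (gcode n E) (pos m y z)))"
    have "bt (prune_code (gcode n E)) j <-> bt (gcode n E) j & ~ (\<exists>m<length (gcode n E). m = n & ?P m)"
      using j unfolding prune_code_def bt_map prune_bit_def bt_gcode(4) by (simp add: length_gcode)
    also have "(\<exists>m<length (gcode n E). m = n & ?P m) <-> ?P n" using nl by blast
    also have "?P n <-> (\<exists>x<n. \<exists>y<n. j = pos n x y & ~ ((\<exists>z<n. z ~= y & E x z) & (\<exists>z<n. z ~= x & E y z)))"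
      by (simp only: bt_gcode(3) cong: conj_cong)
    finally show ?thesis .
  qed
  show "bt (prune_code (gcode n E)) j <-> bt (gcode n (prune E)) j"
  proof (cases "j \<le> n")
    case True
    have "bt (gcode n F) j <-> j < n" for F using gcode_prefix[OF True, of F] True by (simp add: bt_def length_gcode)
    moreover have "j ~= pos n x y" for x y using True by (simp add: pos_def)
    ultimately show ?thesis using b by blast
  next
    case False
    then obtain i where i: "j = Suc n + i" by (metis less_eqE not_less_eq_eq)
    then have "i < n * n" using j by simp
    then have "n > 0" by (cases n) auto
    define x y where "x = i div n" and "y = i mod n"
    have xy: "x < n" "y < n" "j = pos n x y"
      unfolding x_def y_def pos_def i using less_mult_imp_div_less[OF \<open>i < n * n\<close>] \<open>n > 0\<close> by simp_all
    have inj: "x' = x & y' = y" if "x' < n" "y' < n" "pos n x y = pos n x' y'" for x' y'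
      using mixed_radix[of y n y' x x'] that xy(2) by (simp add: pos_def)
    have "bt (prune_code (gcode n E)) j <-> E x y & (\<exists>z<n. z ~= y & E x z) & (\<exists>z<n. z ~= x & E y z)"
    proof -
      have q: "(\<exists>x'<n. \<exists>y'<n. pos n x y = pos n x' y' & ~ Q x' y') <-> ~ Q x y" for Q
        using inj xy(1,2) by metis
      show ?thesis unfolding b unfolding xy(3) bt_gcode(3)[OF xy(1,2)]
        unfolding q[of "%x y. (\<exists>z<n. z ~= y & E x z) & (\<exists>z<n. z ~= x & E y z)"] by blast
    qed
    also have "\<dots> <-> prune E x y" using s unfolding prune_def simple_def by blast
    finally show ?thesis unfolding xy(3) bt_gcode(3)[OF xy(1,2)] .
  qed
qed

lemma prune_code_iter:
  assumes "simple n E"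
  shows "(prune_code ^^ i) (gcode n E) = gcode n ((prune ^^ i) E)"
  by (induction i) (simp_all add: prune_code_gcode prune_invariant[OF assms])

text \<open>Even positions hold the code of a graph, odd positions the relation of being joined by a walk
  of even length.\<close>

definition nv2 :: "bool list => nat => bool" where
  "nv2 Y n <-> 2 * n < length Y & (\<forall>i<n. bt Y (2 * i)) & ~ bt Y (2 * n)"

abbreviation "hb Y n x y \<equiv> bt Y (2 * pos n x y)"
abbreviation "rb Y n x y \<equiv> bt Y (Suc (2 * pos n x y))"

text \<open>The relation at the odd positions starts as the identity on the vertices: the walks of
  length 0.\<close>

definition "double_code X = map (%j. \<exists>i<length X. j = 2 * i & bt X i |
  j = Suc (2 * i) & (\<exists>n<length X. nv X n & (\<exists>x<n. i = pos n x x))) [0..<2 * length X]"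

definition walk_bit :: "bool list => nat => bool" where
  "walk_bit Y j <-> bt Y j | (\<exists>n<length Y. nv2 Y n & (\<exists>x<n. \<exists>y<n. j = Suc (2 * pos n x y) &
     (\<exists>z<n. rb Y n x z & (\<exists>w<n. hb Y n z w & hb Y n w y))))"

definition "walk_code Y = map (walk_bit Y) [0..<length Y]"

lemma double_code_even: "bt (double_code X) (2 * i) <-> bt X i"
  unfolding double_code_def bt_map by (auto simp: bt_def) presburger

lemma double_code_odd: "bt (double_code (gcode n E)) (Suc (2 * i)) <-> i < Suc n + n * n & (\<exists>x<n. i = pos n x x)"
proof -
  have "bt (double_code (gcode n E)) (Suc (2 * i)) <-> i < length (gcode n E) & (\<exists>m<length (gcode n E). m = n & (\<exists>x<m. i = pos m x x))"
    unfolding double_code_def bt_map bt_gcode(4) by (auto; presburger)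
  then show ?thesis by (auto simp: length_gcode)
qed

lemma walk_code_even: "bt (walk_code Y) (2 * i) <-> bt Y (2 * i)"
proof -
  have "2 * i ~= Suc (2 * j)" for j by presburger
  then have "walk_bit Y (2 * i) <-> bt Y (2 * i)" by (auto simp: walk_bit_def)
  then show ?thesis unfolding walk_code_def bt_map by (auto simp: bt_def)
qed

lemma walk_code_iter_even: "bt ((walk_code ^^ i) Y) (2 * j) <-> bt Y (2 * j)"
  by (induction i) (simp_all add: walk_code_even)

lemma walk_code_iter_length: "length ((walk_code ^^ i) Y) = length Y"
  by (induction i) (simp_all add: walk_code_def)

section \<open>Connectivity and bipartiteness by walks of even length\<close>

definition even_walk :: "(nat => nat => bool) => nat => nat => bool" where
  "even_walk E = (%x y. \<exists>w. E x w & E w y)^**"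

lemma even_walk_trans: "even_walk E x y ==> even_walk E y z ==> even_walk E x z"
  unfolding even_walk_def by (rule rtranclp_trans)

lemma even_walk_step: "even_walk E x y ==> E y w ==> E w z ==> even_walk E x z"
  unfolding even_walk_def by (erule rtranclp.rtrancl_into_rtrancl) blast

lemma even_walk_refl: "even_walk E x x"
  by (simp add: even_walk_def)

text \<open>The graph bits never change and the relation bits are only switched on, so the iteration
  ends in a fixed point, which is the closure under steps along two edges.\<close>

lemma final_code:
  fixes E n
  defines "Y0 \<equiv> double_code (gcode n E)"
  defines "Y \<equiv> (walk_code ^^ length Y0) Y0"
  assumes s: "simple n E"
  shows "nv2 Y m <-> m = n" "n < length Y" "x < n ==> y < n ==> hb Y n x y <-> E x y"
    "x < n ==> y < n ==> rb Y n x y <-> even_walk E x y"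
proof -
  have l0: "length Y0 = 2 * (Suc n + n * n)" by (simp add: Y0_def double_code_def length_gcode)
  have ev: "bt ((walk_code ^^ i) Y0) (2 * j) <-> bt (gcode n E) j" for i j
    unfolding walk_code_iter_even unfolding Y0_def double_code_even ..
  have nvi: "nv2 ((walk_code ^^ i) Y0) m <-> m = n" for i m
    unfolding nv2_def ev walk_code_iter_length l0 using bt_gcode(4)[of n E m] unfolding nv_def by auto
  have He: "hb ((walk_code ^^ i) Y0) n x y <-> E x y" if "x < n" "y < n" for i x y
    unfolding ev by (rule bt_gcode(3)[OF that])
  show "nv2 Y m <-> m = n" "n < length Y" "x < n ==> y < n ==> hb Y n x y <-> E x y"
    unfolding Y_def by (rule nvi, simp only: walk_code_iter_length l0, simp, rule He)
  have nl: "n < length ((walk_code ^^ i) Y0)" for i by (simp add: walk_code_iter_length l0)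
  have inj: "x = x' & y = y'" if "pos n x y = pos n x' y'" "x < n" "y < n" "x' < n" "y' < n" for x y x' y'
    using mixed_radix[of y n y' x x'] that by (simp add: pos_def)
  have step: "rb ((walk_code ^^ Suc i) Y0) n x y <-> rb ((walk_code ^^ i) Y0) n x y |
      (\<exists>z<n. rb ((walk_code ^^ i) Y0) n x z & (\<exists>w<n. E z w & E w y))" if xy: "x < n" "y < n" for i x y
  proof -
    let ?Z = "(walk_code ^^ i) Y0"
    have "pos n x y < Suc n + n * n" using mixed_radix_less[OF xy(2,1)] by (simp add: pos_def)
    then have lt: "Suc (2 * pos n x y) < length ?Z" unfolding walk_code_iter_length l0 by simp
    have "rb ((walk_code ^^ Suc i) Y0) n x y <-> walk_bit ?Z (Suc (2 * pos n x y))"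
      using lt by (simp add: walk_code_def bt_map)
    also have "\<dots> <-> rb ?Z n x y | (\<exists>x'<n. \<exists>y'<n. pos n x y = pos n x' y' &
       (\<exists>z<n. rb ?Z n x' z & (\<exists>w<n. hb ?Z n z w & hb ?Z n w y')))"
      unfolding walk_bit_def nvi using nl[of i] by auto
    also have "\<dots> <-> rb ?Z n x y | (\<exists>z<n. rb ?Z n x z & (\<exists>w<n. hb ?Z n z w & hb ?Z n w y))"
      using inj[OF _ xy] xy by blast
    also have "\<dots> <-> rb ?Z n x y | (\<exists>z<n. rb ?Z n x z & (\<exists>w<n. E z w & E w y))"
      using He xy(2) by blast
    finally show ?thesis .
  qed
  have refl: "rb ((walk_code ^^ i) Y0) n x x" if x: "x < n" for i x
  proof (induction i)
    case 0
    have "pos n x x < Suc n + n * n" using mixed_radix_less[OF x x] by (simp add: pos_def)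
    then show ?case using x by (auto simp: Y0_def double_code_odd)
  next
    case (Suc i)
    then show ?case unfolding step[OF x x] by blast
  qed
  have sound: "rb ((walk_code ^^ i) Y0) n x y ==> even_walk E x y" if xy: "x < n" "y < n" for i x y
    using xy(2)
  proof (induction i arbitrary: y)
    case 0
    then obtain x' where "x' < n" "pos n x y = pos n x' x'" by (auto simp: Y0_def double_code_odd)
    then have "x = y" using inj[of x y x' x'] xy(1) 0 by auto
    then show ?case by (simp add: even_walk_def)
  next
    case (Suc i)
    then consider "rb ((walk_code ^^ i) Y0) n x y" | z w where "z < n" "rb ((walk_code ^^ i) Y0) n x z" "E z w" "E w y"
      using step[OF xy(1) Suc.prems(2), of i] by blast
    then show ?case
    proof cases
      case 2
      then have "even_walk E x z" using Suc.IH by blast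
      then show ?thesis using even_walk_step 2(3,4) by blast
    qed (use Suc in blast)
  qed
  have fx: "walk_code Y = Y" unfolding Y_def walk_code_def[abs_def]
    by (rule map_iter_fixpoint) (auto simp: walk_bit_def)
  have close: "rb Y n x y" if "x < n" "z < n" "y < n" "rb Y n x z" "E z w" "E w y" for x z y w
  proof -
    have "w < n" using that(5) s unfolding simple_def by blast
    then have "rb ((walk_code ^^ Suc (length Y0)) Y0) n x y" unfolding step[OF that(1,3)] using that unfolding Y_def by blast
    then show ?thesis using fx unfolding Y_def by simp
  qed
  show "rb Y n x y <-> even_walk E x y" if xy: "x < n" "y < n"
  proof
    show "rb Y n x y ==> even_walk E x y" using sound[OF xy] unfolding Y_def .
    assume "even_walk E x y"
    then have "y < n & rb Y n x y" unfolding even_walk_def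
    proof (induction rule: rtranclp_induct)
      case base
      then show ?case using refl[OF xy(1)] xy(1) unfolding Y_def by blast
    next
      case (step y z)
      then obtain w where "E y w" "E w z" by blast
      moreover from this have "z < n" using s unfolding simple_def by blast
      ultimately show ?case using close[OF xy(1), of y z w] step.IH by blast
    qed
    then show "rb Y n x y" by blast
  qed
qed

lemma even_walk_sym: assumes "simple n E" "even_walk E x y" shows "even_walk E y x"
proof -
  have "symp (%x y. \<exists>w. E x w & E w y)" using assms(1) unfolding simple_def by (intro sympI) blast
  then have "symp (even_walk E)" unfolding even_walk_def by (rule symp_rtranclp)
  then show ?thesis using assms(2) by (rule sympD)
qed

text \<open>A walk of odd length is an edge followed by a walk of even length; thus one computed
  relation serves for parity and for connectivity.\<close>

lemma conn_iff_even_walk: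
  assumes "simple n E"
  shows "E^** x y <-> even_walk E x y | (\<exists>z. E x z & even_walk E z y)"
proof
  assume "E^** x y"
  then show "even_walk E x y | (\<exists>z. E x z & even_walk E z y)"
  proof (induction rule: converse_rtranclp_induct)
    case base
    show ?case using even_walk_refl by blast
  next
    case (step x x')
    from step.IH show ?case
    proof
      assume "\<exists>z. E x' z & even_walk E z y"
      then have "even_walk E x y" using step.hyps(1) unfolding even_walk_def by (blast intro: converse_rtranclp_into_rtranclp)
      then show ?thesis ..
    qed (use step.hyps(1) in blast)
  qed
next
  have "E^** x y" if "even_walk E x y" for x y
    using that unfolding even_walk_def
    by (induction rule: rtranclp_induct) (auto intro: rtranclp.rtrancl_into_rtrancl)
  then show "even_walk E x y | (\<exists>z. E x z & even_walk E z y) ==> E^** x y"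
    by (auto intro: converse_rtranclp_into_rtranclp)
qed

text \<open>The side of a vertex is the parity of its walks from a representative of its component;
  an edge within a side would close up to a walk of even length between its ends.\<close>

lemma bipart_iff_even_walk:
  assumes s: "simple n E"
  shows "bipart E <-> (\<forall>x y. E x y --> ~ even_walk E x y)"
proof
  assume "bipart E"
  then obtain s where s: "!!x y. E x y ==> s x ~= (s y :: bool)" unfolding bipart_def by blast
  have "s x = s y" if "even_walk E x y" for x y
    using that unfolding even_walk_def
  proof (induction rule: rtranclp_induct)
    case (step y z)
    then show ?case using s by blast
  qed simp
  then show "\<forall>x y. E x y --> ~ even_walk E x y" using s by blast
next
  assume no: "\<forall>x y. E x y --> ~ even_walk E x y"
  have sym: "E y x" if "E x y" for x y using s that unfolding simple_def by blast
  \<comment> \<open>The predicate \<open>E^** x\<close> is the same for all vertices of a component,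
    so the choice operator returns the same representative for them.\<close>
  define r where "r x = (SOME z. E^** x z)" for x
  have r: "E^** x (r x)" for x unfolding r_def by (rule someI[of _ x]) simp
  have cs: "E^** y x" if "E^** x y" for x y using that sym by (metis sympD sympI symp_rtranclp)
  have rr: "r x = r y" if e: "E x y" for x y
  proof -
    have "E^** x z <-> E^** y z" for z using e sym by (meson converse_rtranclp_into_rtranclp)
    then have "E^** x = E^** y" by blast
    then show ?thesis unfolding r_def by simp
  qed
  have "even_walk E (r x) x ~= even_walk E (r y) y" if e: "E x y" for x y
  proof
    assume eq: "even_walk E (r x) x = even_walk E (r y) y"
    show False
    proof (cases "even_walk E (r x) x")
      case True
      then have "even_walk E (r x) y" using eq rr[OF e] by simp
      then have "even_walk E x y" using even_walk_sym[OF s True] even_walk_trans by blast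
      then show False using no e by blast
    next
      case False
      then obtain z where z: "E (r x) z" "even_walk E z x" using conn_iff_even_walk[OF s] cs[OF r] by blast
      define a where "a = r x"
      have az: "E a z" using z(1) by (simp add: a_def)
      from z(2)[unfolded even_walk_def] have "E x y' ==> even_walk E a y'" for y'
      proof (induction arbitrary: y' rule: rtranclp_induct)
        case base
        show ?case using even_walk_step[OF even_walk_refl az base] .
      next
        case (step u v)
        then obtain w where "E u w" "E w v" by blast
        then show ?case using even_walk_step[OF step.IH _ step.prems] by blast
      qed
      then show False using e False eq rr[OF e] unfolding a_def by simp
    qed
  qed
  then show "bipart E" unfolding bipart_def by (intro exI[of _ "%x. even_walk E (r x) x"]) blast
qed

section \<open>The decision procedure on codes\<close>

definition component_ok_on :: "nat => (nat => nat => bool) => (nat => nat => bool) => nat => nat => bool" where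
  "component_ok_on n E R k x <->
    (let d2 = %x. \<exists>y1<n. \<exists>y2<n. y1 ~= y2 & (\<forall>y<n. E x y <-> y = y1 | y = y2);
         d3 = %x. \<exists>y1<n. \<exists>y2<n. \<exists>y3<n. y1 ~= y2 & y1 ~= y3 & y2 ~= y3 & (\<forall>y<n. E x y <-> y = y1 | y = y2 | y = y3);
         C = %x y. R x y | (\<exists>z<n. E x z & R z y)
     in (\<forall>y<n. C x y --> d2 y) |
       (\<exists>u<n. \<exists>v<n. \<exists>w1<n. \<exists>w2<n. C x u & u ~= v & w1 ~= w2 & E u w1 & E w1 v & E u w2 & E w2 v &
         (k = 3 & (\<forall>y<n. E u y --> E y v & d2 y) & (\<forall>y<n. E v y --> E y u) |
          d3 u & d3 v & (\<forall>y<n. C x y --> y = u | y = v | d2 y))))"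

lemma component_ok_on_cong:
  assumes "!!x y. x < n ==> y < n ==> E x y <-> E' x y" "!!x y. x < n ==> y < n ==> R x y <-> R' x y" "x < n"
  shows "component_ok_on n E R k x <-> component_ok_on n E' R' k x"
  unfolding component_ok_on_def Let_def using assms(3) by (simp only: assms(1,2) cong: conj_cong imp_cong)

lemma component_ok_on_iff:
  assumes g: "core_graph {..<n} E s" and si: "simple n E" and x: "x < n"
  shows "component_ok_on n E (even_walk E) k x <-> core_graph.component_ok E k x"
proof -
  have E: "x < n & y < n" if "E x y" for x y using si that unfolding simple_def by blast
  have d2: "(\<exists>y1<n. \<exists>y2<n. y1 ~= y2 & (\<forall>y<n. E x y <-> y = y1 | y = y2)) <-> deg2 E x" for x
    unfolding deg2_def using E by metis
  have d3: "(\<exists>y1<n. \<exists>y2<n. \<exists>y3<n. y1 ~= y2 & y1 ~= y3 & y2 ~= y3 & (\<forall>y<n. E x y <-> y = y1 | y = y2 | y = y3)) <-> deg3 E x" for x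
  proof
    assume "\<exists>y1<n. \<exists>y2<n. \<exists>y3<n. y1 ~= y2 & y1 ~= y3 & y2 ~= y3 & (\<forall>y<n. E x y <-> y = y1 | y = y2 | y = y3)"
    then obtain y1 y2 y3 where y: "y1 < n" "y2 < n" "y3 < n" "y1 ~= y2" "y1 ~= y3" "y2 ~= y3"
      "\<forall>y<n. E x y <-> y = y1 | y = y2 | y = y3" by blast
    then have "\<forall>y. E x y <-> y = y1 | y = y2 | y = y3" using E by blast
    then show "deg3 E x" unfolding deg3_def using y(4-6) by blast
  next
    assume "deg3 E x"
    then obtain y1 y2 y3 where y: "y1 ~= y2" "y1 ~= y3" "y2 ~= y3" "\<forall>y. E x y <-> y = y1 | y = y2 | y = y3"
      unfolding deg3_def by blast
    then have "y1 < n" "y2 < n" "y3 < n" using E by blast+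
    then show "\<exists>y1<n. \<exists>y2<n. \<exists>y3<n. y1 ~= y2 & y1 ~= y3 & y2 ~= y3 & (\<forall>y<n. E x y <-> y = y1 | y = y2 | y = y3)"
      using y by blast
  qed
  have C: "even_walk E x y | (\<exists>z<n. E x z & even_walk E z y) <-> E^** x y" for x y
    unfolding conn_iff_even_walk[OF si] using E by blast
  have Cn: "y < n" if "E^** x y" for y using that x E by (cases rule: rtranclp.cases) blast+
  have A: "(\<forall>y<n. E^** x y --> P y) <-> (\<forall>y. E^** x y --> P y)" for P using Cn by blast
  have B: "(\<forall>y<n. E u y --> P y) <-> (\<forall>y. E u y --> P y)" for u P using E by blast
  have D: "(\<exists>u<n. \<exists>v<n. \<exists>w1<n. \<exists>w2<n. Q0 u & u ~= v & w1 ~= w2 & E u w1 & E w1 v & E u w2 & E w2 v & Q u v) <->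
      (\<exists>u v w1 w2. Q0 u & u ~= v & w1 ~= w2 & E u w1 & E w1 v & E u w2 & E w2 v & Q u v)" for Q0 Q
    using E by meson
  show ?thesis
    unfolding component_ok_on_def Let_def d2 d3 C core_graph.component_ok_def[OF g] A B
    by (rule arg_cong2[of _ _ _ _ "(|)", OF refl D])
qed

definition accept :: "nat => bool list => bool" where
  "accept k Y <-> (\<exists>n<length Y. nv2 Y n & (\<forall>x<n. \<forall>y<n. hb Y n x y --> ~ rb Y n x y &
     component_ok_on n (hb Y n) (rb Y n) k x))"

definition valid :: "bool list => bool" where
  "valid X <-> (\<exists>n<length X. length X = Suc n + n * n & nv X n &
     (\<forall>x<n. \<forall>y<n. bt X (pos n x y) --> bt X (pos n y x) & x ~= y))"

text \<open>A string without a zero encodes no graph.\<close>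

definition "mark X = map (%j. valid X --> bt X j) [0..<length X]"

definition "prune_all X = (prune_code ^^ length X) X"
definition "walk_all X = (walk_code ^^ length X) X"

text \<open>Pruning has reached a fixed point, and a fixed point has no vertex of degree 1, which is
  the condition of \<open>core_graph\<close>. Pruning preserves bipartiteness and choosability, so
  testing its result is enough.\<close>

lemma accept_valid:
  assumes s: "simple n E" and k: "3 \<le> k"
  shows "accept k (walk_all (double_code (prune_all (gcode n E)))) <-> bipart E & fch k (%_. 2) {..<n} E"
proof -
  define H where "H = (prune ^^ length (gcode n E)) E"
  have p: "prune_all (gcode n E) = gcode n H" unfolding prune_all_def prune_code_iter[OF s] H_def ..
  have H: "simple n H" "bipart H <-> bipart E" "fch k (%_. 2) {..<n} H <-> fch k (%_. 2) {..<n} E"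
    using prune_invariant[OF s] unfolding H_def by blast+
  have "prune_code (prune_all (gcode n E)) = prune_all (gcode n E)"
    unfolding prune_all_def prune_code_def[abs_def] by (rule map_iter_fixpoint) (simp add: prune_bit_def)
  then have "gcode n (prune H) = gcode n H" unfolding p prune_code_gcode[OF H(1)] .
  then have fx: "prune H x y <-> H x y" if "x < n" "y < n" for x y using gcode_inj(2) that by blast
  define Y where "Y = walk_all (double_code (gcode n H))"
  have Y: "(walk_code ^^ length (double_code (gcode n H))) (double_code (gcode n H)) = Y"
    by (simp add: Y_def walk_all_def)
  note f = final_code[OF H(1), unfolded Y]
  have "accept k Y <-> (\<forall>x<n. \<forall>y<n. H x y --> ~ even_walk H x y & component_ok_on n H (even_walk H) k x)"
  proof -
    have "accept k Y <-> (\<forall>x<n. \<forall>y<n. hb Y n x y --> ~ rb Y n x y & component_ok_on n (hb Y n) (rb Y n) k x)"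
      unfolding accept_def f(1) using f(2) by blast
    then show ?thesis using component_ok_on_cong[of n "hb Y n" H "rb Y n" "even_walk H"] f(3,4) by simp
  qed
  also have "\<dots> <-> bipart H & (\<forall>x<n. \<forall>y<n. H x y --> component_ok_on n H (even_walk H) k x)"
    unfolding bipart_iff_even_walk[OF H(1)] using H(1) unfolding simple_def by blast
  also have "\<dots> <-> bipart H & fch k (%_. 2) {..<n} H"
  proof (rule conj_cong[OF refl])
    assume "bipart H"
    then obtain s where s: "!!x y. H x y ==> s x ~= (s y :: bool)" unfolding bipart_def by blast
    have g: "core_graph {..<n} H s"
    proof
      show "x \<in> {..<n} & y \<in> {..<n} & H y x" if "H x y" for x y using that H(1) unfolding simple_def by blast
      show "\<exists>z. z ~= y & H x z" if "H x y" for x y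
      proof -
        have "prune H x y" using fx[of x y] that H(1) unfolding simple_def by blast
        then show ?thesis unfolding prune_def by blast
      qed
    qed (use s in auto)
    show "(\<forall>x<n. \<forall>y<n. H x y --> component_ok_on n H (even_walk H) k x) <-> fch k (%_. 2) {..<n} H"
      unfolding core_graph.fch_iff_components[OF g k] using component_ok_on_iff[OF g H(1)] H(1)
      unfolding simple_def by blast
  qed
  finally show ?thesis unfolding p Y_def H .
qed

text \<open>Without a zero there is no end of the unary prefix, so no number of vertices is ever
  recognized, and none of the rounds can create a zero at an even position.\<close>

lemma accept_invalid:
  assumes "!!j. bt Z j <-> j < length Z"
  shows "~ accept k (walk_all (double_code (prune_all Z)))"
proof -
  have "prune_bit Z j <-> bt Z j" for j using assms by (auto simp: prune_bit_def nv_def)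
  then have "prune_code Z = Z" unfolding prune_code_def by (intro nth_equalityI) (use assms in "auto simp: bt_def")
  then have "(prune_code ^^ i) Z = Z" for i by (induction i) simp_all
  then have p: "prune_all Z = Z" by (simp add: prune_all_def)
  have "~ nv2 (walk_all (double_code Z)) n" for n
  proof
    assume "nv2 (walk_all (double_code Z)) n"
    then have "2 * n < length (double_code Z)" "~ bt (double_code Z) (2 * n)"
      unfolding nv2_def walk_all_def walk_code_iter_even walk_code_iter_length by blast+
    then show False using assms unfolding double_code_even by (simp add: double_code_def)
  qed
  then show ?thesis unfolding p accept_def by blast
qed

lemma bipartite_CH_algorithm:
  assumes k: "3 \<le> k"
  shows "X \<in> bipartite_CH 2 k <-> accept k (walk_all (double_code (prune_all (mark X))))"
proof (cases "valid X")
  case True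
  then obtain n where n: "length X = Suc n + n * n" "nv X n"
    "!!x y. x < n ==> y < n ==> bt X (pos n x y) ==> bt X (pos n y x) & x ~= y"
    unfolding valid_def by blast
  define E where "E i j <-> i < n & j < n & bt X (Suc n + (j + n * i))" for i j
  have X: "X = gcode n E" unfolding E_def by (rule gcode_bt) (use n in "auto simp: nv_def")
  have s: "simple n E" using n(3) unfolding simple_def E_def pos_def by blast
  have "mark X = X" by (rule nth_equalityI) (auto simp: mark_def True bt_def)
  then have "accept k (walk_all (double_code (prune_all (mark X)))) <-> bipart E & fch k (%_. 2) {..<n} E"
    using accept_valid[OF s k] X by simp
  also have "\<dots> <-> X \<in> bipartite_CH 2 k"
    unfolding X using gcode_bipartite_CH[of E n 2 k] s unfolding simple_def bipart_def by blast
  finally show ?thesis by blast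
next
  case False
  have "X ~: bipartite_CH 2 k"
  proof
    assume "X \<in> bipartite_CH 2 k"
    then obtain n E where X: "X = gcode n E" and E: "!!x y. E x y ==> x < n & y < n & E y x"
      "!!x. ~ E x x" unfolding bipartite_CH_iff by blast
    have "bt X (pos n x y) --> bt X (pos n y x) & x ~= y" if "x < n" "y < n" for x y
      unfolding X bt_gcode(3)[OF that] bt_gcode(3)[OF that(2,1)] using E by blast
    moreover have "nv X n" unfolding X bt_gcode(4) ..
    ultimately have "valid X" unfolding valid_def by (intro exI[of _ n]) (simp add: X length_gcode)
    then show False using False by blast
  qed
  moreover have "~ accept k (walk_all (double_code (prune_all (mark X))))"
    by (rule accept_invalid) (use False in "auto simp: mark_def bt_map")
  ultimately show ?thesis by blast
qed

lemma ptrans_mark: "ptrans mark"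
  unfolding mark_def[abs_def] valid_def nv_def pos_def bt_def by (intro ptrans_map pb_intros pt_intros)

lemma ptrans_prune_all: "ptrans prune_all"
  unfolding prune_all_def[abs_def] prune_code_def[abs_def]
  by (rule ptrans_map_iter[OF pt_len]) (unfold prune_bit_def nv_def pos_def bt_def, intro pb_intros pt_intros)

lemma ptrans_double_code: "ptrans double_code"
  unfolding double_code_def[abs_def] nv_def pos_def bt_def by (intro ptrans_map pb_intros pt_intros)

lemma ptrans_walk_all: "ptrans walk_all"
  unfolding walk_all_def[abs_def] walk_code_def[abs_def]
  by (rule ptrans_map_iter[OF pt_len]) (unfold walk_bit_def nv2_def pos_def bt_def, intro pb_intros pt_intros)

lemma pb_accept: "pb (%X e. accept k X)"
  unfolding accept_def component_ok_on_def Let_def nv2_def pos_def bt_def by (intro pb_intros pt_intros)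

theorem two_lists_in_P:
  assumes k: "3 \<le> k"
  shows "bipartite_CH 2 k \<in> class_P"
proof -
  have "ptrans (%X. walk_all (double_code (prune_all (mark X))))"
    by (rule ptrans_comp[OF ptrans_comp[OF ptrans_comp[OF ptrans_mark ptrans_prune_all] ptrans_double_code] ptrans_walk_all])
  from class_P_ptrans[where P = "accept k", OF this pb_accept]
  have "{X. accept k (walk_all (double_code (prune_all (mark X))))} \<in> class_P" .
  moreover have "{X. accept k (walk_all (double_code (prune_all (mark X))))} = bipartite_CH 2 k"
    using bipartite_CH_algorithm[OF k] by (intro set_eqI) (simp only: mem_Collect_eq)
  ultimately show ?thesis by (simp only:)
qed

theorem proposition4p3:
  fixes l k :: nat
  assumes "1 \<le> l" and "l \<le> k"
  shows "(2 \<le> k \<and> k < 2 * l - 1 \<longrightarrow>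
            (\<forall>G :: 'a pair_pre_digraph. pair_graph G \<longrightarrow> bipartite G \<longrightarrow> choosable l k G))
       \<and> (l = 2 \<and> k \<ge> 3 \<longrightarrow> bipartite_CH l k \<in> class_P)
       \<and> (l \<ge> 3 \<and> k \<ge> 2 * l - 1 \<longrightarrow> complete_for class_Pi2 (bipartite_CH l k))
       \<and> complete_for class_Pi2 (bipartite_CH 3 5)"
proof -
  have "complete_for class_Pi2 (bipartite_CH l' k')" if "3 \<le> l'" "2 * l' - 1 \<le> k'" for l' k'
    unfolding complete_for_def using in_Pi2 Pi2_hard[OF that] by blast
  from this this[of 3 5] show ?thesis using small_palette_choosable two_lists_in_P by auto
qed

end
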